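(* Let $d\ge 2$ and suppose $V\in L^p_{\mathrm{rad}}(\mathbb B^d;\mathbb R)$ with $d/2<p<\infty$. Then the eigenvalues $(\lambda_n[V])_{n\in\mathbb N_0}$ of $\Lambda_V$ satisfy, for a certain integer $k_0\ge0$ that may depend only on $d$, $p$, and the $L^p$ norm of $V$: $$\sup_{k\ge0}\,(k+1)^{p-1}\sum_{m=0}^k\left|\binom km\Delta^{k-m}\upsilon_{m+k_0}[V]\right|^p<\infty ,$$ where $\upsilon_n[V]:=\lambda_n[V]-n$.
   Context: $\mathbb B^d=\{x\in\mathbb R^d:|x|<1\}$, $\mathbb S^{d-1}=\partial\mathbb B^d$, $\mathbb N_0=\{0,1,2,\dots\}$; $L^p_{\mathrm{rad}}(\mathbb B^d;\mathbb R)$ denotes real-valued radial functions in $L^p(\mathbb B^d)$. For a sequence $(\mu_n)_{n\in\mathbb N_0}$ of complex numbers and $k\in\mathbb N_0$, $$\Delta^k\mu_n:=\sum_{m=0}^k(-1)^m\binom km\mu_{n+k-m}.$$ Definition of $\lambda_k[V]$, $k\in\mathbb N_0$, for $V=q(|\cdot|)$: consider solutions $b_k$ on $(0,1]$ of $$-\frac1{r^{d-1}}\frac{d}{dr}\Big(r^{d-1}\frac{d b_k}{dr}\Big)+\Big(\frac{k(k+d-2)}{r^2}+q(r)\Big)b_k=0,\qquad b_k(1)=1,$$ such that $b_k(|x|)Y_k(x/|x|)\in L^2(\mathbb B^d,|x|^{-2}dx)$ for every spherical harmonic $Y_k$ of degree $k$. If there is exactly one such solution, $\lambda_k[V]:=\partial_rb_k(1)$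 (this is the case for all sufficiently large $k$); otherwise $\lambda_k[V]:=k$. When $0$ is not a Dirichlet eigenvalue of $-\Delta+V$ on $\mathbb B^d$, so that the Dirichlet-to-Neumann map $\Lambda_V$ ($\Lambda_Vf=\partial_\nu u|_{\mathbb S^{d-1}}$ with $-\Delta u+Vu=0$, $u|_{\mathbb S^{d-1}}=f$) is well defined, $\lambda_k[V]$ is the eigenvalue of $\Lambda_V$ on the spherical harmonics of degree $k$ (if both prescriptions apply and differ, which can concern only $d=2$, $k=0$, the latter is used). "Eigenvalues of $\Lambda_V$" means this sequence $(\lambda_k[V])$ even when $\Lambda_V$ is not well defined. *)

theory Defs
  imports "HOL-Analysis.Analysis"
begin

text \<open>
  The space \<open>\<real>\<^sup>d\<close> is a type \<open>'a :: euclidean_space\<close> with \<open>d = DIM('a)\<close>. Elements of \<open>L\<^sup>p\<close>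
  spaces are represented by functions, and no definition depends on their values on null sets.
\<close>

abbreviation ball_measure :: "'a::euclidean_space measure" where
  "ball_measure \<equiv> lebesgue_on (ball 0 1)"

definition Lp_space :: "'b measure \<Rightarrow> real \<Rightarrow> ('b \<Rightarrow> 'c::euclidean_space) set" where
  "Lp_space M p = {f \<in> borel_measurable M. integrable M (\<lambda>x. norm (f x) powr p)}"

definition Lp_norm :: "'b measure \<Rightarrow> real \<Rightarrow> ('b \<Rightarrow> 'c::euclidean_space) \<Rightarrow> real" where
  "Lp_norm M p f = (\<integral>x. norm (f x) powr p \<partial>M) powr (1 / p)"

definition radial_profile :: "('a::euclidean_space \<Rightarrow> real) \<Rightarrow> (real \<Rightarrow> real) \<Rightarrow> bool" where
  "radial_profile V q \<longleftrightarrow> (AE x in ball_measure. V x = q (norm x))"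

definition Lp_rad :: "real \<Rightarrow> ('a::euclidean_space \<Rightarrow> real) set" where
  "Lp_rad p = {V \<in> Lp_space ball_measure p. \<exists>q. radial_profile V q}"

text \<open>For a radial \<open>V\<close>, the function \<open>q\<close> with \<open>V = q(|\<cdot>|)\<close>; it is unique up to null sets
  of \<open>(0,1)\<close>, which do not affect the integrals below.\<close>

definition profile :: "('a::euclidean_space \<Rightarrow> real) \<Rightarrow> real \<Rightarrow> real" where
  "profile V = (SOME q. radial_profile V q)"


subsection \<open>Spherical harmonics\<close>

definition laplacian :: "('a::euclidean_space \<Rightarrow> real) \<Rightarrow> 'a \<Rightarrow> real" where
  "laplacian f x = (\<Sum>i\<in>Basis. (deriv ^^ 2) (\<lambda>t. f (x + t *\<^sub>R i)) 0)"

text \<open>The values of \<open>Y\<close> off the unit sphere are irrelevant.\<close>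

definition spherical_harmonic :: "nat \<Rightarrow> ('a::euclidean_space \<Rightarrow> real) \<Rightarrow> bool" where
  "spherical_harmonic k Y \<longleftrightarrow>
     (\<exists>P. real_polynomial_function P \<and> (\<forall>c x. P (c *\<^sub>R x) = c ^ k * P x) \<and>
          (\<forall>x. laplacian P x = 0) \<and> (\<forall>x\<in>sphere 0 1. Y x = P x))"


subsection \<open>The radial equation\<close>

text \<open>
  As \<open>q\<close> is merely locally integrable on \<open>(0,1]\<close>, solutions are taken in the sense of
  Caratheodory: \<open>b\<close> is differentiable and \<open>r\<^sup>d\<^sup>-\<^sup>1 b'\<close> is locally absolutely continuous on
  \<open>(0,1]\<close>, with almost everywhere derivative \<open>r\<^sup>d\<^sup>-\<^sup>1 (k (k + d - 2) / r\<^sup>2 + q) b\<close>. This is the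
  equation integrated over \<open>[r,1]\<close>.
\<close>

definition radial_solution :: "nat \<Rightarrow> (real \<Rightarrow> real) \<Rightarrow> nat \<Rightarrow> (real \<Rightarrow> real) \<Rightarrow> bool" where
  "radial_solution d q k b \<longleftrightarrow>
     (\<exists>b'. \<forall>r\<in>{0<..1}.
        (b has_real_derivative b' r) (at r within {0<..1}) \<and>
        set_integrable lebesgue {r..1}
          (\<lambda>t. t ^ (d - 1) * (real k * (real k + real d - 2) / t\<^sup>2 + q t) * b t) \<and>
        b' 1 - r ^ (d - 1) * b' r =
          set_lebesgue_integral lebesgue {r..1}
            (\<lambda>t. t ^ (d - 1) * (real k * (real k + real d - 2) / t\<^sup>2 + q t) * b t))"

text \<open>The restriction to extensional functions makes equality of solutions the same as equality
  on \<open>(0,1]\<close>. The measure is \<open>|x|\<^sup>-\<^sup>2 dx\<close> on the ball.\<close>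

definition admissible_solution :: "('a::euclidean_space \<Rightarrow> real) \<Rightarrow> nat \<Rightarrow> (real \<Rightarrow> real) \<Rightarrow> bool" where
  "admissible_solution V k b \<longleftrightarrow>
     b \<in> extensional {0<..1} \<and> radial_solution DIM('a) (profile V) k b \<and> b 1 = 1 \<and>
     (\<forall>Y::'a \<Rightarrow> real. spherical_harmonic k Y \<longrightarrow>
        (\<lambda>x::'a. b (norm x) * Y (x /\<^sub>R norm x))
          \<in> Lp_space (density ball_measure (\<lambda>x. ennreal (1 / (norm x)\<^sup>2))) 2)"

definition radial_eigenvalue :: "('a::euclidean_space \<Rightarrow> real) \<Rightarrow> nat \<Rightarrow> real" where
  "radial_eigenvalue V k =
     (if \<exists>!b. admissible_solution V k b
      then vector_derivative (THE b. admissible_solution V k b) (at 1 within {0<..1})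
      else real k)"


subsection \<open>The Dirichlet-to-Neumann map\<close>

definition C1_function :: "('a::euclidean_space \<Rightarrow> real) \<Rightarrow> ('a \<Rightarrow> 'a) \<Rightarrow> bool" where
  "C1_function \<phi> \<Phi> \<longleftrightarrow> (\<forall>x. GDERIV \<phi> x :> \<Phi> x) \<and> continuous_on UNIV \<Phi>"

definition C1_compact_support :: "('a::euclidean_space \<Rightarrow> real) \<Rightarrow> ('a \<Rightarrow> 'a) \<Rightarrow> bool" where
  "C1_compact_support \<phi> \<Phi> \<longleftrightarrow> C1_function \<phi> \<Phi> \<and> closure {x. \<phi> x \<noteq> 0} \<subseteq> ball 0 1"

text \<open>\<open>u\<close> belongs to \<open>H\<^sup>1\<close> of the unit ball and \<open>G\<close> is its weak gradient.\<close>

definition H1_function :: "('a::euclidean_space \<Rightarrow> real) \<Rightarrow> ('a \<Rightarrow> 'a) \<Rightarrow> bool" where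
  "H1_function u G \<longleftrightarrow>
     u \<in> Lp_space ball_measure 2 \<and> G \<in> Lp_space ball_measure 2 \<and>
     (\<forall>\<phi> \<Phi>. C1_compact_support \<phi> \<Phi> \<longrightarrow>
        (\<forall>i\<in>Basis. (\<integral>x. u x * (\<Phi> x \<bullet> i) \<partial>ball_measure) = - (\<integral>x. (G x \<bullet> i) * \<phi> x \<partial>ball_measure)))"

text \<open>Surface measure on the unit sphere, via \<open>\<sigma>(A) = d \<cdot> |{r \<omega>. 0 < r < 1, \<omega> \<in> A}|\<close>.\<close>

definition sphere_measure :: "'a::euclidean_space measure" where
  "sphere_measure =
     scale_measure (of_nat DIM('a))
       (distr (lebesgue_on (ball 0 1 - {0})) (restrict_space borel (sphere 0 1)) (\<lambda>x. x /\<^sub>R norm x))"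

text \<open>The trace of \<open>u \<in> H\<^sup>1\<close> on the sphere is the limit in \<open>L\<^sup>2\<close> of the restrictions of smooth
  functions converging to \<open>u\<close> in \<open>H\<^sup>1\<close>.\<close>

definition has_trace :: "('a::euclidean_space \<Rightarrow> real) \<Rightarrow> ('a \<Rightarrow> 'a) \<Rightarrow> ('a \<Rightarrow> real) \<Rightarrow> bool" where
  "has_trace u G f \<longleftrightarrow>
     f \<in> Lp_space sphere_measure 2 \<and>
     (\<exists>\<phi> \<Phi>. (\<forall>n::nat. C1_function (\<phi> n) (\<Phi> n)) \<and>
        (\<lambda>n. Lp_norm ball_measure 2 (\<lambda>x. \<phi> n x - u x)) \<longlonglongrightarrow> 0 \<and>
        (\<lambda>n. Lp_norm ball_measure 2 (\<lambda>x. \<Phi> n x - G x)) \<longlonglongrightarrow> 0 \<and>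
        (\<lambda>n. Lp_norm sphere_measure 2 (\<lambda>x. \<phi> n x - f x)) \<longlonglongrightarrow> 0)"

text \<open>Weak solutions in \<open>H\<^sup>1\<close> of \<open>-\<Delta>u + Vu = 0\<close>. The integrability of \<open>Vu\<close> is automatic for
  \<open>V \<in> L\<^sup>p\<close> with \<open>p > d/2\<close>, by Sobolev embedding.\<close>

definition weak_solution :: "('a::euclidean_space \<Rightarrow> real) \<Rightarrow> ('a \<Rightarrow> real) \<Rightarrow> ('a \<Rightarrow> 'a) \<Rightarrow> bool" where
  "weak_solution V u G \<longleftrightarrow>
     H1_function u G \<and> integrable ball_measure (\<lambda>x. V x * u x) \<and>
     (\<forall>\<phi> \<Phi>. C1_compact_support \<phi> \<Phi> \<longrightarrow>
        (\<integral>x. G x \<bullet> \<Phi> x + V x * u x * \<phi> x \<partial>ball_measure) = 0)"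

text \<open>The space \<open>H\<^sup>1\<^sub>0\<close> consists of the functions in \<open>H\<^sup>1\<close> of zero trace.\<close>

definition zero_Dirichlet_eigenvalue :: "('a::euclidean_space \<Rightarrow> real) \<Rightarrow> bool" where
  "zero_Dirichlet_eigenvalue V \<longleftrightarrow>
     (\<exists>u G. weak_solution V u G \<and> has_trace u G (\<lambda>_. 0) \<and> \<not> (AE x in ball_measure. u x = 0))"

text \<open>
  The normal derivative of a weak solution is understood through Green's formula. In general
  it is in \<open>H\<^sup>-\<^sup>1\<^sup>/\<^sup>2\<close>; the relation below is the graph of \<open>\<Lambda>\<^sub>V\<close> (for \<open>0\<close> not a Dirichlet
  eigenvalue) restricted to those \<open>f\<close> for which it is in \<open>L\<^sup>2\<close>, which is the case for
  eigenfunctions.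
\<close>

definition DN_map :: "('a::euclidean_space \<Rightarrow> real) \<Rightarrow> ('a \<Rightarrow> real) \<Rightarrow> ('a \<Rightarrow> real) \<Rightarrow> bool" where
  "DN_map V f g \<longleftrightarrow>
     g \<in> Lp_space sphere_measure 2 \<and>
     (\<exists>u G. weak_solution V u G \<and> has_trace u G f \<and>
        (\<forall>\<phi> \<Phi>. C1_function \<phi> \<Phi> \<longrightarrow>
           (\<integral>x. G x \<bullet> \<Phi> x + V x * u x * \<phi> x \<partial>ball_measure) = (\<integral>x. g x * \<phi> x \<partial>sphere_measure)))"

text \<open>
  If \<open>\<Lambda>\<^sub>V\<close> is well defined, its eigenvalue takes precedence; it can differ from
  \<open>radial_eigenvalue V k\<close> only for \<open>d = 2\<close>, \<open>k = 0\<close>, where no admissible solution exists.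
\<close>

definition DN_eigenvalue :: "('a::euclidean_space \<Rightarrow> real) \<Rightarrow> nat \<Rightarrow> real" where
  "DN_eigenvalue V k =
     (if zero_Dirichlet_eigenvalue V then radial_eigenvalue V k
      else (THE l. \<forall>Y. spherical_harmonic k Y \<longrightarrow> DN_map V Y (\<lambda>x. l * Y x)))"


definition fdiff :: "nat \<Rightarrow> (nat \<Rightarrow> 'b::comm_ring_1) \<Rightarrow> nat \<Rightarrow> 'b" where
  "fdiff k \<mu> n = (\<Sum>m\<le>k. (-1) ^ m * of_nat (k choose m) * \<mu> (n + k - m))"

end

theory Submission
  imports Defs
begin

text \<open>
  Put \<open>N = 2 k + d - 2\<close> and \<open>w t = t q(t)\<close>, where \<open>V = q(|\<cdot>|)\<close>. Since \<open>p > d/2\<close>, Young's inequality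
  makes \<open>w\<close> integrable on \<open>(0,1)\<close>, with a bound \<open>L\<close> of \<open>\<integral>|w|\<close> that depends only on \<open>d\<close>, \<open>p\<close> and the \<open>L\<^sup>p\<close> norm of \<open>V\<close>
  (\<open>radial_reduction\<close>). The solution of the radial equation of degree \<open>k\<close> that is regular at the
  origin is \<open>r\<^sup>k c(r)\<close>, where \<open>(r\<^sup>N\<^sup>+\<^sup>1 c')' = r\<^sup>N w c\<close> and \<open>c(0) = 1\<close>. Hence \<open>c\<close> is the sum of a Neumann series,
  which converges for \<open>N > L\<close>, and the eigenvalue is \<open>k + c'(1) / c(1)\<close>, with \<open>c'(1) = \<integral>t\<^sup>N w c\<close>.
  Therefore

  \<open>\<lambda>\<^sub>k - k = \<integral>t\<^sup>N w(t) dt + \<integral>t\<^sup>N w(t) (c(t) / c(1) - 1) dt\<close>.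

  For \<open>k = n + k\<^sub>0\<close> the substitution \<open>s = t\<^sup>2\<close> turns the first integral into the \<open>n\<close>-th moment
  \<open>\<integral>s\<^sup>n h(s) ds\<close> of a function \<open>h\<close> in \<open>L\<^sup>p(0,1)\<close>. Its differences, multiplied by binomial coefficients, are up to sign the
  integrals of \<open>h\<close> against the Bernstein polynomials. These are nonnegative, add up to \<open>1\<close> and have integral
  \<open>1/(k+1)\<close> each, so Jensen's inequality gives Hausdorff's bound (\<open>Hausdorff_moment_bound\<close>).

  The second integral is not a moment sequence, because \<open>c\<close> depends on the degree. It is controlled by
  comparing all differences at once: \<open>dominated \<mu> M\<close> says that every iterated difference of \<open>\<mu>\<close> is bounded by
  that of \<open>M\<close>. By the Leibniz rule for differences this relation is preserved by products, and also by
  sums, limits and integrals. Every factor in the Neumann series is dominated by an explicit completely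
  monotone sequence, hence so are the series, its reciprocal, and finally the second integral, by
  \<open>L\<^sup>2/(n+1)\<close> (\<open>flux_ratio\<close>). The differences of \<open>1/(n+1)\<close>, multiplied by binomial coefficients,
  equal \<open>\<plusminus>1/(k+1)\<close>, so the second integral contributes at most a constant to the supremum
  (\<open>Hausdorff_bound_perturbed\<close>).

  What remains is to see that \<open>k + c'(1)/c(1)\<close> is the eigenvalue, in both prescriptions. For a homogeneous harmonic
  polynomial \<open>P\<close> of degree \<open>k \<ge> 3\<close> the function \<open>u(x) = c(|x|) P(x)\<close> is \<open>C\<^sup>1\<close> and satisfies Green's formula
  (\<open>harmonic_Green\<close>), so it solves the boundary value problem. If \<open>0\<close> is not a Dirichlet eigenvalue, weak solutions
  with equal traces have equal normal derivatives (\<open>DN_map_unique_pairing\<close>), which settles this case. Otherwise the admissible solution has to be shown unique: two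
  independent solutions have a nonzero constant Wronskian (with weight \<open>r\<^sup>d\<^sup>-\<^sup>1\<close>), which forces the other one to grow like \<open>r\<^sup>k\<^sup>-\<^sup>N\<close> and so
  not to be square integrable (\<open>square_integrable_solution_unique\<close>).
\<close>


section \<open>Iterated differences and domination\<close>

text \<open>The sign is such that the completely monotone sequences are those with all iterates nonnegative.\<close>

definition bdiff :: "(nat \<Rightarrow> real) \<Rightarrow> nat \<Rightarrow> real" where
  "bdiff \<mu> n = \<mu> n - \<mu> (Suc n)"

text \<open>Truncation to differences of order at most \<open>J\<close>, which makes inductions on the order possible.\<close>

definition dominated_upto :: "nat \<Rightarrow> (nat \<Rightarrow> real) \<Rightarrow> (nat \<Rightarrow> real) \<Rightarrow> bool" where
  "dominated_upto J \<mu> M \<longleftrightarrow> (\<forall>j\<le>J. \<forall>n. \<bar>(bdiff ^^ j) \<mu> n\<bar> \<le> (bdiff ^^ j) M n)"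

text \<open>
  A discrete analogue of Cauchy's method of majorants: \<open>M\<close> controls \<open>\<mu>\<close> together with all its
  differences, and so the majorant of a product, a series or an integral can be computed from the
  majorants of its parts.
\<close>

definition dominated :: "(nat \<Rightarrow> real) \<Rightarrow> (nat \<Rightarrow> real) \<Rightarrow> bool" where
  "dominated \<mu> M \<longleftrightarrow> (\<forall>j n. \<bar>(bdiff ^^ j) \<mu> n\<bar> \<le> (bdiff ^^ j) M n)"

abbreviation completely_monotone :: "(nat \<Rightarrow> real) \<Rightarrow> bool" where
  "completely_monotone \<mu> \<equiv> dominated \<mu> \<mu>"

lemma dominated_iff_upto: "dominated \<mu> M \<longleftrightarrow> (\<forall>J. dominated_upto J \<mu> M)"
  by (auto simp: dominated_def dominated_upto_def)

lemma completely_monotone_iff: "completely_monotone \<mu> \<longleftrightarrow> (\<forall>j n. 0 \<le> (bdiff ^^ j) \<mu> n)"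
  by (auto simp: dominated_def)

lemma bdiff_pow_Suc: "(bdiff ^^ Suc j) \<mu> n = (bdiff ^^ j) \<mu> n - (bdiff ^^ j) \<mu> (Suc n)"
  by (simp add: bdiff_def)

lemma bdiff_pow_Suc': "(bdiff ^^ Suc j) \<mu> n = (bdiff ^^ j) (bdiff \<mu>) n"
  by (metis comp_apply funpow_Suc_right)

lemma bdiff_pow_add: "(bdiff ^^ j) (\<lambda>n. \<mu> n + \<nu> n) n = (bdiff ^^ j) \<mu> n + (bdiff ^^ j) \<nu> n"
  by (induction j arbitrary: n) (simp_all add: bdiff_def)

lemma bdiff_pow_cmult: "(bdiff ^^ j) (\<lambda>n. c * \<mu> n) n = c * (bdiff ^^ j) \<mu> n"
  by (induction j arbitrary: n) (simp_all add: bdiff_def algebra_simps)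

lemma bdiff_pow_diff: "(bdiff ^^ j) (\<lambda>n. \<mu> n - \<nu> n) n = (bdiff ^^ j) \<mu> n - (bdiff ^^ j) \<nu> n"
  by (induction j arbitrary: n) (simp_all add: bdiff_def)

lemma bdiff_pow_zero: "(bdiff ^^ j) (\<lambda>n. 0) n = 0"
  by (induction j arbitrary: n) (simp_all add: bdiff_def)

lemma bdiff_pow_shift: "(bdiff ^^ j) (\<lambda>n. \<mu> (Suc n)) n = (bdiff ^^ j) \<mu> (Suc n)"
  by (induction j arbitrary: n) (simp_all add: bdiff_def)

lemma bdiff_pow_tendsto:
  assumes "\<And>n. ((\<lambda>i. \<mu> i n) \<longlongrightarrow> \<nu> n) F"
  shows "((\<lambda>i. (bdiff ^^ j) (\<mu> i) n) \<longlongrightarrow> (bdiff ^^ j) \<nu> n) F"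
  by (induction j arbitrary: n) (auto simp: bdiff_def intro!: tendsto_diff assms)

lemma bdiff_pow_deriv:
  assumes "\<And>n. ((\<lambda>s. F s n) has_real_derivative F' n) (at s within S)"
  shows "((\<lambda>s. (bdiff ^^ j) (F s) n) has_real_derivative (bdiff ^^ j) F' n) (at s within S)"
  by (induction j arbitrary: n) (auto simp: bdiff_def intro!: DERIV_diff assms)

text \<open>
  Differences are finite linear combinations, so they commute with the integral; only integrability
  has to be carried along.
\<close>

lemma bdiff_pow_integral:
  assumes "\<And>n. integrable M (\<lambda>t. F t n)"
  shows "integrable M (\<lambda>t. (bdiff ^^ j) (F t) n)"
    and "(bdiff ^^ j) (\<lambda>n. \<integral>t. F t n \<partial>M) n = (\<integral>t. (bdiff ^^ j) (F t) n \<partial>M)"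
proof (induction j arbitrary: n)
  case (Suc j)
  {
    case 1
    show ?case unfolding bdiff_pow_Suc by (intro Bochner_Integration.integrable_diff Suc.IH)
  next
    case 2
    show ?case unfolding bdiff_pow_Suc
      by (subst Bochner_Integration.integral_diff) (use Suc.IH in auto)
  }
qed (use assms in auto)

lemma dominated_upto_bdiff:
  "dominated_upto (Suc J) \<mu> M \<Longrightarrow> dominated_upto J (bdiff \<mu>) (bdiff M)"
  unfolding dominated_upto_def by (metis Suc_le_mono bdiff_pow_Suc')

lemma dominated_upto_shift:
  "dominated_upto J \<mu> M \<Longrightarrow> dominated_upto J (\<lambda>n. \<mu> (Suc n)) (\<lambda>n. M (Suc n))"
  unfolding dominated_upto_def by (simp add: bdiff_pow_shift)

lemma dominated_upto_mono: "dominated_upto J \<mu> M \<Longrightarrow> I \<le> J \<Longrightarrow> dominated_upto I \<mu> M"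
  unfolding dominated_upto_def by auto

lemma dominated_upto_Suc:
  assumes "\<And>n. \<bar>\<mu> n\<bar> \<le> M n" "dominated_upto J (bdiff \<mu>) (bdiff M)"
  shows "dominated_upto (Suc J) \<mu> M"
  unfolding dominated_upto_def
proof (intro allI impI)
  fix j n assume "j \<le> Suc J"
  then show "\<bar>(bdiff ^^ j) \<mu> n\<bar> \<le> (bdiff ^^ j) M n"
    using assms by (cases j) (auto simp: dominated_upto_def bdiff_pow_Suc' simp del: funpow.simps)
qed

lemma dominated_upto_add:
  assumes "dominated_upto J \<mu> M" "dominated_upto J \<nu> N"
  shows "dominated_upto J (\<lambda>n. \<mu> n + \<nu> n) (\<lambda>n. M n + N n)"
  using assms unfolding dominated_upto_def bdiff_pow_add by (meson abs_triangle_ineq add_mono order_trans)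

text \<open>
  The Leibniz rule \<open>bdiff (a b) = bdiff a \<cdot> b + a(\<cdot>+1) \<cdot> bdiff b\<close> reduces order \<open>J + 1\<close> of a product to
  order \<open>J\<close> of two products. The same rule holds for the majorants, where all terms are nonnegative, so
  nothing is lost.
\<close>

lemma dominated_upto_mult:
  assumes "dominated_upto J \<mu> M" "dominated_upto J \<nu> N"
  shows "dominated_upto J (\<lambda>n. \<mu> n * \<nu> n) (\<lambda>n. M n * N n)"
  using assms
proof (induction J arbitrary: \<mu> M \<nu> N)
  case 0
  then show ?case
    by (auto simp: dominated_upto_def abs_mult intro!: mult_mono intro: order_trans[OF abs_ge_zero])
next
  case (Suc J)
  have *: "bdiff (\<lambda>n. a n * b n) = (\<lambda>n. bdiff a n * b n + a (Suc n) * bdiff b n)" for a b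
    by (auto simp: bdiff_def algebra_simps)
  show ?case
  proof (rule dominated_upto_Suc)
    have "\<bar>\<mu> n\<bar> \<le> M n" "\<bar>\<nu> n\<bar> \<le> N n" for n
      using Suc.prems unfolding dominated_upto_def by (force dest: spec[of _ "0::nat"])+
    then show "\<bar>\<mu> n * \<nu> n\<bar> \<le> M n * N n" for n
      by (auto simp: abs_mult intro!: mult_mono intro: order_trans[OF abs_ge_zero])
    show "dominated_upto J (bdiff (\<lambda>n. \<mu> n * \<nu> n)) (bdiff (\<lambda>n. M n * N n))"
      unfolding * using Suc.prems
      by (intro dominated_upto_add Suc.IH dominated_upto_bdiff dominated_upto_shift)
         (auto intro: dominated_upto_mono)
  qed
qed

lemma dominated_add: "dominated \<mu> M \<Longrightarrow> dominated \<nu> N \<Longrightarrow> dominated (\<lambda>n. \<mu> n + \<nu> n) (\<lambda>n. M n + N n)"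
  by (simp add: dominated_iff_upto dominated_upto_add)

lemma dominated_mult: "dominated \<mu> M \<Longrightarrow> dominated \<nu> N \<Longrightarrow> dominated (\<lambda>n. \<mu> n * \<nu> n) (\<lambda>n. M n * N n)"
  by (simp add: dominated_iff_upto dominated_upto_mult)

lemma dominated_cmult: "dominated \<mu> M \<Longrightarrow> \<bar>c\<bar> \<le> C \<Longrightarrow> dominated (\<lambda>n. c * \<mu> n) (\<lambda>n. C * M n)"
  unfolding dominated_def bdiff_pow_cmult abs_mult
  by (meson abs_ge_zero mult_mono order_trans)

lemma dominated_trans: "dominated \<mu> M \<Longrightarrow> dominated M N \<Longrightarrow> dominated \<mu> N"
  unfolding dominated_def by (meson abs_le_D1 order_trans)

lemma dominated_le: "dominated \<mu> M \<Longrightarrow> \<bar>\<mu> n\<bar> \<le> M n"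
  unfolding dominated_def by (metis funpow_0)

lemma dominated_self: "dominated \<mu> M \<Longrightarrow> completely_monotone M"
  unfolding completely_monotone_iff dominated_def by (meson abs_ge_zero order_trans)

text \<open>A difference involves finitely many entries, so the inequalities pass to pointwise limits.\<close>

lemma dominated_tendsto:
  assumes "\<And>i::nat. dominated (\<mu> i) (M i)" "\<And>n. (\<lambda>i. \<mu> i n) \<longlonglongrightarrow> \<nu> n" "\<And>n. (\<lambda>i. M i n) \<longlonglongrightarrow> N n"
  shows "dominated \<nu> N"
  unfolding dominated_def
proof (intro allI)
  fix j n
  show "\<bar>(bdiff ^^ j) \<nu> n\<bar> \<le> (bdiff ^^ j) N n"
    using assms unfolding dominated_def
    by (intro LIMSEQ_le[OF tendsto_rabs[OF bdiff_pow_tendsto] bdiff_pow_tendsto, of \<mu> \<nu> M N]) auto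
qed

lemma completely_monotone_const: "c \<ge> 0 \<Longrightarrow> completely_monotone (\<lambda>n. c)"
  unfolding completely_monotone_iff
proof (intro allI)
  have const: "bdiff (\<lambda>n. c) = (\<lambda>n. 0)" by (auto simp: bdiff_def)
  fix j n assume "c \<ge> 0" then show "0 \<le> (bdiff ^^ j) (\<lambda>n. c) n"
    by (cases j) (simp_all add: bdiff_pow_Suc' const bdiff_pow_zero del: funpow.simps)
qed

lemma dominated_sum:
  assumes "\<And>i. i < m \<Longrightarrow> dominated (\<mu> i) (M i)"
  shows "dominated (\<lambda>n. \<Sum>i<m. \<mu> i n) (\<lambda>n. \<Sum>i<(m::nat). M i n)"
  using assms
proof (induction m)
  case 0 then show ?case using completely_monotone_const[of 0] by simp
next
  case (Suc m) then show ?case by (auto intro!: dominated_add)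
qed

lemma dominated_power:
  assumes "dominated \<mu> M" shows "dominated (\<lambda>n. \<mu> n ^ i) (\<lambda>n. M n ^ i)"
  by (induction i) (use completely_monotone_const[of 1] in \<open>auto intro!: dominated_mult assms\<close>)

lemma dominated_suminf:
  assumes "\<And>i. dominated (\<mu> i) (M i)" "\<And>n. (\<lambda>i. M i n) sums N n"
  shows "dominated (\<lambda>n. \<Sum>i. \<mu> i n) N"
proof (rule dominated_tendsto)
  show "dominated (\<lambda>n. \<Sum>i<m. \<mu> i n) (\<lambda>n. \<Sum>i<m. M i n)" for m
    by (intro dominated_sum assms)
  show "(\<lambda>m. \<Sum>i<m. M i n) \<longlonglongrightarrow> N n" for n using assms(2) by (simp add: sums_def)
  have "summable (\<lambda>i. \<mu> i n)" for n
    by (rule summable_comparison_test[of _ "\<lambda>i. M i n"])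
       (use assms dominated_le in \<open>auto simp: summable_def\<close>)
  then show "(\<lambda>m. \<Sum>i<m. \<mu> i n) \<longlonglongrightarrow> (\<Sum>i. \<mu> i n)" for n by (rule summable_LIMSEQ)
qed

lemma dominated_integral:
  assumes "\<And>n. integrable M (\<lambda>t. F t n)" "\<And>n. integrable M (\<lambda>t. G t n)"
    and "\<And>t. t \<in> space M \<Longrightarrow> dominated (F t) (G t)"
  shows "dominated (\<lambda>n. \<integral>t. F t n \<partial>M) (\<lambda>n. \<integral>t. G t n \<partial>M)"
  unfolding dominated_def bdiff_pow_integral(2)[OF assms(1)] bdiff_pow_integral(2)[OF assms(2)]
proof (intro allI)
  fix j n
  have "\<bar>\<integral>t. (bdiff ^^ j) (F t) n \<partial>M\<bar> \<le> (\<integral>t. \<bar>(bdiff ^^ j) (F t) n\<bar> \<partial>M)"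
    by simp
  also have "\<dots> \<le> (\<integral>t. (bdiff ^^ j) (G t) n \<partial>M)"
    using assms(3) by (intro integral_mono bdiff_pow_integral assms integrable_abs) (auto simp: dominated_def)
  finally show "\<bar>\<integral>t. (bdiff ^^ j) (F t) n \<partial>M\<bar> \<le> (\<integral>t. (bdiff ^^ j) (G t) n \<partial>M)" .
qed

text \<open>
  The sequence \<open>\<mu>\<^sub>n = 1/(2n+b)\<close> satisfies \<open>bdiff \<mu> n = 2 \<mu>\<^sub>n \<mu>\<^sub>n\<^sub>+\<^sub>1\<close>, a product of sequences of the same kind; an
  induction on the order concludes.
\<close>

lemma completely_monotone_inverse:
  assumes "b > 0" shows "completely_monotone (\<lambda>n. 1 / (2 * real n + b))"
proof -
  let ?\<mu> = "\<lambda>n. 1 / (2 * real n + b)"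
  have pos: "2 * real n + b > 0" for n using assms by (simp add: add_nonneg_pos)
  have "bdiff ?\<mu> n = 2 * (?\<mu> n * ?\<mu> (Suc n))" for n
    using pos[of n] pos[of "Suc n"] by (simp add: bdiff_def field_simps)
  then have *: "bdiff ?\<mu> = (\<lambda>n. 2 * (?\<mu> n * ?\<mu> (Suc n)))" by auto
  have "dominated_upto J ?\<mu> ?\<mu>" for J
  proof (induction J)
    case 0 show ?case using pos by (auto simp: dominated_upto_def less_imp_le)
  next
    case (Suc J)
    show ?case
    proof (rule dominated_upto_Suc)
      show "\<bar>?\<mu> n\<bar> \<le> ?\<mu> n" for n using pos[of n] by simp
      show "dominated_upto J (bdiff ?\<mu>) (bdiff ?\<mu>)"
        unfolding *
        by (intro dominated_upto_mult[OF _ dominated_upto_mult[OF Suc dominated_upto_shift[OF Suc]]])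
           (use completely_monotone_const[of 2] in \<open>simp add: dominated_iff_upto\<close>)
    qed
  qed
  then show ?thesis by (simp add: dominated_iff_upto)
qed

lemma bdiff_pow_power: "(bdiff ^^ j) (\<lambda>n. c * s ^ n) n = c * ((1 - s) ^ j * s ^ n)"
  by (induction j arbitrary: n) (simp_all add: bdiff_def algebra_simps)

lemma completely_monotone_power:
  assumes "0 \<le> s" "s \<le> 1" shows "completely_monotone (\<lambda>n. s ^ (2 * n + a))"
proof -
  have "(\<lambda>n. s ^ (2 * n + a)) = (\<lambda>n. s ^ a * (s\<^sup>2) ^ n)"
    by (simp add: power_add power_mult[symmetric] mult.commute)
  then show ?thesis
    using assms by (auto simp: completely_monotone_iff bdiff_pow_power power_le_one)
qed

text \<open>
  As a function of \<open>s\<close> the \<open>j\<close>-th difference vanishes at \<open>s = 1\<close>. Its derivative is minus the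
  \<open>j\<close>-th difference of \<open>(1 + b/(2n+a-b)) s\<^sup>2\<^sup>n\<^sup>+\<^sup>a\<^sup>-\<^sup>1\<close>, a product of completely monotone sequences, so it decreases to
  \<open>0\<close> on \<open>[0,1]\<close>. For \<open>b = 0\<close> the sequence is the kernel of the integral equation of the regular solution;
  \<open>b > 0\<close> occurs when a power is multiplied by the majorant of the Neumann series.
\<close>

lemma completely_monotone_one_minus_power:
  assumes s: "0 \<le> s" "s \<le> 1" and b: "0 \<le> b" "b < real a"
  shows "completely_monotone (\<lambda>n. (1 - s ^ (2 * n + a)) / (2 * real n + real a - b))"
  unfolding completely_monotone_iff
proof (intro allI)
  fix j n
  define F where "F s n = (1 - s ^ (2 * n + a)) / (2 * real n + real a - b)" for s n
  define F' where "F' s n = (1 + b * (1 / (2 * real n + (real a - b)))) * s ^ (2 * n + (a - 1))" for s n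
  have a: "a \<ge> 1" using b by linarith
  have der: "((\<lambda>s. F s n) has_real_derivative - 1 * F' t n) (at t)" for t n
  proof -
    have D: "2 * real n + real a - b > 0" using b by (simp add: add_nonneg_pos)
    then have "F' t n = real (2 * n + a) * t ^ (2 * n + a - 1) / (2 * real n + real a - b)"
      unfolding F'_def using a by (simp add: field_simps)
    then show ?thesis
      unfolding F_def using D by (auto intro!: derivative_eq_intros)
  qed
  have mono: "(bdiff ^^ j) (F' t) n \<ge> 0" if "0 \<le> t" "t \<le> 1" for t
  proof -
    have "completely_monotone (F' t)"
      unfolding F'_def[abs_def] using that b
      by (intro dominated_mult dominated_add dominated_cmult completely_monotone_inverse
          completely_monotone_const completely_monotone_power) auto
    then show ?thesis by (simp add: completely_monotone_iff)
  qed
  have "(bdiff ^^ j) (F 1) n \<le> (bdiff ^^ j) (F s) n"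
  proof (rule DERIV_nonpos_imp_nonincreasing[OF s(2)])
    fix t assume t: "s \<le> t" "t \<le> 1"
    show "\<exists>y. ((\<lambda>s. (bdiff ^^ j) (F s) n) has_real_derivative y) (at t) \<and> y \<le> 0"
    proof (intro exI conjI)
      show "((\<lambda>s. (bdiff ^^ j) (F s) n) has_real_derivative (bdiff ^^ j) (\<lambda>n. - 1 * F' t n) n) (at t)"
        by (rule bdiff_pow_deriv, rule der)
      show "(bdiff ^^ j) (\<lambda>n. - 1 * F' t n) n \<le> 0"
        unfolding bdiff_pow_cmult using mono[of t] t s by simp
    qed
  qed
  moreover have "(bdiff ^^ j) (F 1) n = 0" by (simp add: F_def[abs_def] bdiff_pow_zero)
  ultimately show "0 \<le> (bdiff ^^ j) (\<lambda>n. (1 - s ^ (2 * n + a)) / (2 * real n + real a - b)) n"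
    by (simp add: F_def[abs_def])
qed

text \<open>These are the values \<open>\<integral>(1-s)\<^sup>j s\<^sup>m ds\<close> of the Beta function.\<close>

lemma bdiff_pow_moments_lebesgue:
  "(bdiff ^^ j) (\<lambda>n. 1 / (real n + 1)) m = fact j * fact m / fact (m + j + 1)"
proof (induction j arbitrary: m)
  case 0
  have "fact (m + 0 + 1) = (real m + 1) * fact m" by (simp add: algebra_simps)
  then show ?case by simp
next
  case (Suc j)
  have "(fact j * fact m / fact (m + j + 1) - fact j * fact (Suc m) / fact (Suc m + j + 1) :: real)
      = fact (Suc j) * fact m / fact (m + Suc j + 1)"
  proof -
    have *: "fact (m + j + 1) > (0::real)" by simp
    have "fact (Suc m + j + 1) = (real m + real j + 2) * fact (m + j + 1)"
      "fact (m + Suc j + 1) = (real m + real j + 2) * fact (m + j + 1)"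
      by (simp_all add: fact_Suc algebra_simps)
    with * show ?thesis
      by (simp only: fact_Suc) (simp add: divide_simps, simp add: algebra_simps)
  qed
  then show ?case unfolding bdiff_pow_Suc Suc .
qed

text \<open>
  All Bernstein polynomials of the same degree have the same integral. This is what makes \<open>C/(n+1)\<close>
  the right majorant for a remainder.
\<close>

lemma binomial_bdiff_moments_lebesgue:
  assumes "m \<le> k"
  shows "real (k choose m) * (bdiff ^^ (k - m)) (\<lambda>n. 1 / (real n + 1)) m = 1 / (real k + 1)"
proof -
  have "real (k choose m) = fact k / (fact m * fact (k - m))" using assms by (rule binomial_fact)
  moreover have "m + (k - m) + 1 = Suc k" using assms by simp
  moreover have "fact (Suc k) = (real k + 1) * fact k" by (simp add: algebra_simps)
  ultimately show ?thesis unfolding bdiff_pow_moments_lebesgue by simp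
qed

lemma fdiff_eq_bdiff: "fdiff k \<mu> n = (-1) ^ k * (bdiff ^^ k) \<mu> n" for \<mu> :: "nat \<Rightarrow> real"
proof -
  have "(bdiff ^^ k) \<mu> n = (\<Sum>i\<le>k. (-1) ^ i * real (k choose i) * \<mu> (n + i))"
  proof (induction k arbitrary: n)
    case (Suc k)
    have "(\<Sum>i\<le>Suc k. (-1) ^ i * real (Suc k choose i) * \<mu> (n + i))
        = \<mu> n + (\<Sum>i\<le>k. (-1) ^ Suc i * real (k choose Suc i) * \<mu> (n + Suc i))
              + (\<Sum>i\<le>k. (-1) ^ Suc i * real (k choose i) * \<mu> (n + Suc i))"
      by (subst sum.atMost_Suc_shift) (simp add: sum.distrib[symmetric] algebra_simps)
    also have "\<mu> n + (\<Sum>i\<le>k. (-1) ^ Suc i * real (k choose Suc i) * \<mu> (n + Suc i))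
       = (\<Sum>i\<le>Suc k. (-1) ^ i * real (k choose i) * \<mu> (n + i))"
      by (subst sum.atMost_Suc_shift) simp
    also have "\<dots> = (\<Sum>i\<le>k. (-1) ^ i * real (k choose i) * \<mu> (n + i))" by simp
    finally show ?case
      unfolding bdiff_pow_Suc Suc by (simp add: sum_subtractf[symmetric] sum_negf algebra_simps)
  qed simp
  also have "\<dots> = (\<Sum>i\<le>k. (-1) ^ (k - i) * real (k choose (k - i)) * \<mu> (n + (k - i)))"
    by (rule sum.nat_diff_reindex[of _ "Suc k", unfolded lessThan_Suc_atMost, simplified, symmetric])
  also have "\<dots> = (\<Sum>i\<le>k. (-1) ^ k * ((-1) ^ i * real (k choose i) * \<mu> (n + k - i)))"
  proof (rule sum.cong[OF refl])
    fix i assume "i \<in> {..k}"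
    then have i: "i \<le> k" by simp
    have "(-1) ^ (k - i) = (-1 :: real) ^ k * (-1) ^ i"
      using i by (metis (no_types, opaque_lifting) le_add_diff_inverse2 minus_one_power_iff mult.right_neutral mult_minus1_right power_add even_add mult_minus_left)
    then show "(-1) ^ (k - i) * real (k choose (k - i)) * \<mu> (n + (k - i))
       = (-1) ^ k * ((-1) ^ i * real (k choose i) * \<mu> (n + k - i))"
      using i by (simp add: binomial_symmetric[symmetric])
  qed
  finally have "(bdiff ^^ k) \<mu> n = (-1) ^ k * fdiff k \<mu> n"
    by (simp add: fdiff_def sum_distrib_left)
  then show ?thesis by (simp add: mult.assoc[symmetric] power_mult_distrib[symmetric])
qed


section \<open>Hausdorff's moment inequality and its perturbation\<close>

text \<open>
  Jensen's inequality for the measure \<open>B M\<close> of total mass \<open>Z\<close>. It follows by integrating the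
  tangent line inequality for \<open>y\<^sup>p\<close> at the mean \<open>m\<close> of \<open>|h|\<close>, here in the form of Young's inequality.
\<close>

lemma weighted_Jensen_powr:
  fixes B h :: "'b \<Rightarrow> real"
  assumes p: "p > 1" and B: "\<And>t. t \<in> space M \<Longrightarrow> B t \<ge> 0"
    and int: "integrable M B" "integrable M (\<lambda>t. B t * h t)" "integrable M (\<lambda>t. B t * \<bar>h t\<bar> powr p)"
    and Z: "(\<integral>t. B t \<partial>M) = Z" "Z > 0"
  shows "\<bar>\<integral>t. B t * h t \<partial>M\<bar> powr p \<le> Z powr (p - 1) * (\<integral>t. B t * \<bar>h t\<bar> powr p \<partial>M)"
proof -
  define X where "X = (\<integral>t. \<bar>B t * h t\<bar> \<partial>M)"
  define Y where "Y = (\<integral>t. B t * \<bar>h t\<bar> powr p \<partial>M)"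
  have le: "\<bar>\<integral>t. B t * h t \<partial>M\<bar> \<le> X" unfolding X_def by (rule integral_abs_bound)
  have Y0: "Y \<ge> 0" unfolding Y_def using B by (intro Bochner_Integration.integral_nonneg) auto
  show ?thesis
  proof (cases "X > 0")
    case False
    then have "\<bar>\<integral>t. B t * h t \<partial>M\<bar> = 0" using le by linarith
    then show ?thesis using Y0 p Z unfolding Y_def by simp
  next
    case True
    \<comment> \<open>The mean of \<open>|h|\<close> for the weight \<open>B\<close>; Young's inequality is an equality at \<open>y = m\<close>.\<close>
    define m where "m = X / Z"
    have m: "m > 0" using True Z by (simp add: m_def)
    define q where "q = p / (p - 1)"
    have q: "q > 1" "1 / p + 1 / q = 1" using p by (auto simp: q_def field_simps)
    have young: "y \<le> m powr (1 - p) / p * y powr p + m / q" if "y \<ge> 0" for y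
    proof -
      have "y / m * 1 \<le> (y / m) powr p / p + 1 powr q / q"
        using that m p q by (intro Youngs_inequality) auto
      then have "y \<le> m * ((y / m) powr p / p + 1 / q)"
        using m by (simp add: field_simps)
      also have "m * (y / m) powr p = m powr (1 - p) * y powr p"
        using m that by (simp add: powr_divide powr_diff)
      then have "m * ((y / m) powr p / p + 1 / q) = m powr (1 - p) / p * y powr p + m / q"
        by (simp add: field_simps)
      finally show ?thesis .
    qed
    have "X \<le> (\<integral>t. m powr (1 - p) / p * (B t * \<bar>h t\<bar> powr p) + m / q * B t \<partial>M)"
      unfolding X_def
    proof (rule integral_mono)
      fix t assume t: "t \<in> space M"
      have "\<bar>B t * h t\<bar> = B t * \<bar>h t\<bar>" using B[OF t] by (simp add: abs_mult)
      also have "\<dots> \<le> B t * (m powr (1 - p) / p * \<bar>h t\<bar> powr p + m / q)"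
        by (intro mult_left_mono young B t) auto
      finally show "\<bar>B t * h t\<bar> \<le> m powr (1 - p) / p * (B t * \<bar>h t\<bar> powr p) + m / q * B t"
        by (simp add: algebra_simps)
    qed (use int in auto)
    also have "\<dots> = m powr (1 - p) / p * Y + m / q * Z"
      using int by (simp add: Y_def Z)
    also have "m / q * Z = X * (1 - 1 / p)"
    proof -
      have "1 / q = 1 - 1 / p" using q by simp
      then show ?thesis using Z q(1) by (simp add: m_def flip: \<open>1 / q = 1 - 1 / p\<close>)
    qed
    finally have "X / p \<le> m powr (1 - p) / p * Y" by (simp add: algebra_simps)
    then have "X \<le> m powr (1 - p) * Y" using p by (simp add: field_simps)
    then have "X * m powr (p - 1) \<le> Y"
      using m by (simp add: powr_diff field_simps)
    then have "X powr p / Z powr (p - 1) \<le> Y"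
      using True Z by (simp add: m_def powr_divide powr_diff field_simps)
    then have "X powr p \<le> Z powr (p - 1) * Y" using Z by (simp add: field_simps)
    moreover have "\<bar>\<integral>t. B t * h t \<partial>M\<bar> powr p \<le> X powr p"
      using le p by (intro powr_mono2) auto
    ultimately show ?thesis by (simp add: Y_def)
  qed
qed

text \<open>
  Hausdorff's necessary condition for a moment sequence of an \<open>L\<^sup>p\<close> density on \<open>[0,1]\<close>. The variable
  \<open>T\<close> on a measure space is uniformly distributed by the condition on its moments; this form spares the substitution
  \<open>s = t\<^sup>2\<close> in the integrals to which it is applied.
\<close>

lemma Hausdorff_moment_bound:
  fixes T h :: "'b \<Rightarrow> real"
  assumes p: "p > 1"
    and T: "T \<in> borel_measurable M" "\<And>t. t \<in> space M \<Longrightarrow> 0 \<le> T t \<and> T t \<le> 1"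
    and fin: "finite_measure M" and uniform: "\<And>n. (\<integral>t. T t ^ n \<partial>M) = 1 / (real n + 1)"
    and h: "integrable M h" "integrable M (\<lambda>t. \<bar>h t\<bar> powr p)"
  shows "real (k + 1) powr (p - 1) *
      (\<Sum>m\<le>k. \<bar>real (k choose m) * (bdiff ^^ (k - m)) (\<lambda>n. \<integral>t. T t ^ n * h t \<partial>M) m\<bar> powr p)
    \<le> (\<integral>t. \<bar>h t\<bar> powr p \<partial>M)"
proof -
  interpret finite_measure M by fact
  note T(1)[measurable]
  have bounded: "integrable M (\<lambda>t. f t * g t)"
    if "integrable M g" "f \<in> borel_measurable M" "\<And>t. t \<in> space M \<Longrightarrow> \<bar>f t\<bar> \<le> C" for f g :: "'b \<Rightarrow> real" and C
  proof (rule Bochner_Integration.integrable_bound)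
    show "integrable M (\<lambda>t. C * g t)" using that by simp
    show "AE t in M. norm (f t * g t) \<le> norm (C * g t)"
    proof (rule AE_I2)
      fix t assume "t \<in> space M"
      then have "\<bar>f t\<bar> \<le> \<bar>C\<bar>" using that(3)[of t] by simp
      then show "norm (f t * g t) \<le> norm (C * g t)" by (simp add: abs_mult mult_right_mono)
    qed
    show "(\<lambda>t. f t * g t) \<in> borel_measurable M"
      using that borel_measurable_integrable[OF that(1)] by measurable
  qed
  have Tn: "\<bar>T t ^ n\<bar> \<le> 1" if "t \<in> space M" for t n
    using T(2)[OF that] by (simp add: power_le_one)
  have int_T: "integrable M (\<lambda>t. T t ^ n * g t)" if "integrable M g" for n g
    by (rule bounded[OF that, of _ 1]) (use Tn in auto)
  have bdiff_T: "(bdiff ^^ j) (\<lambda>n. \<integral>t. T t ^ n * g t \<partial>M) m = (\<integral>t. (1 - T t) ^ j * T t ^ m * g t \<partial>M)"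
    if "integrable M g" for g j m
  proof -
    have "(bdiff ^^ j) (\<lambda>n. \<integral>t. T t ^ n * g t \<partial>M) m = (\<integral>t. (bdiff ^^ j) (\<lambda>n. T t ^ n * g t) m \<partial>M)"
      by (rule bdiff_pow_integral(2)[OF int_T[OF that]])
    also have "\<dots> = (\<integral>t. (1 - T t) ^ j * T t ^ m * g t \<partial>M)"
      using bdiff_pow_power[of j "g t" "T t" m for t] by (simp add: mult_ac)
    finally show ?thesis .
  qed
  \<comment> \<open>The Bernstein polynomials, a partition of unity with equal integrals.\<close>
  define B where "B m t = real (k choose m) * ((1 - T t) ^ (k - m) * T t ^ m)" for m t
  have B0: "B m t \<ge> 0" if "t \<in> space M" for m t using T(2)[OF that] by (simp add: B_def)
  have B1: "(\<Sum>m\<le>k. B m t) = 1" for t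
    using binomial_ring[of "T t" "1 - T t" k] by (simp add: B_def mult_ac)
  have B_le: "\<bar>B m t\<bar> \<le> 1" if "t \<in> space M" "m \<le> k" for m t
    using B0[OF that(1)] B1[of t] member_le_sum[of m "{..k}" "\<lambda>m. B m t"] that by auto
  have B_meas[measurable]: "B m \<in> borel_measurable M" for m unfolding B_def by measurable
  have int_B: "integrable M (\<lambda>t. B m t * g t)" if "integrable M g" "m \<le> k" for m g
    by (rule bounded[OF that(1), of _ 1]) (use B_le that in auto)
  have ZB: "(\<integral>t. B m t \<partial>M) = 1 / (real k + 1)" if "m \<le> k" for m
    using binomial_bdiff_moments_lebesgue[OF that] bdiff_T[of "\<lambda>_. 1" "k - m" m]
    by (simp add: B_def uniform[symmetric])
  have each: "\<bar>real (k choose m) * (bdiff ^^ (k - m)) (\<lambda>n. \<integral>t. T t ^ n * h t \<partial>M) m\<bar> powr p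
      \<le> (1 / (real k + 1)) powr (p - 1) * (\<integral>t. B m t * \<bar>h t\<bar> powr p \<partial>M)" if "m \<le> k" for m
  proof -
    have "real (k choose m) * (bdiff ^^ (k - m)) (\<lambda>n. \<integral>t. T t ^ n * h t \<partial>M) m = (\<integral>t. B m t * h t \<partial>M)"
      unfolding bdiff_T[OF h(1)] B_def by (simp add: mult.assoc)
    then show ?thesis
      using weighted_Jensen_powr[OF p B0 _ int_B[OF h(1) that] int_B[OF h(2) that] ZB[OF that]]
        int_B[of "\<lambda>_. 1", OF _ that] by simp
  qed
  have "(\<Sum>m\<le>k. \<bar>real (k choose m) * (bdiff ^^ (k - m)) (\<lambda>n. \<integral>t. T t ^ n * h t \<partial>M) m\<bar> powr p)
      \<le> (\<Sum>m\<le>k. (1 / (real k + 1)) powr (p - 1) * (\<integral>t. B m t * \<bar>h t\<bar> powr p \<partial>M))"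
    by (intro sum_mono each) simp
  also have "\<dots> = (1 / (real k + 1)) powr (p - 1) * (\<integral>t. (\<Sum>m\<le>k. B m t * \<bar>h t\<bar> powr p) \<partial>M)"
    by (subst Bochner_Integration.integral_sum) (auto intro!: int_B h simp: sum_distrib_left)
  also have "\<dots> = (1 / (real k + 1)) powr (p - 1) * (\<integral>t. \<bar>h t\<bar> powr p \<partial>M)"
    by (simp add: sum_distrib_right[symmetric] B1)
  finally show ?thesis
    by (simp add: powr_divide field_simps)
qed

lemma dominated_binomial_bound:
  assumes "dominated \<mu> (\<lambda>n. C * (1 / (real n + 1)))" "m \<le> k"
  shows "\<bar>real (k choose m) * (bdiff ^^ (k - m)) \<mu> m\<bar> \<le> C / (real k + 1)"
proof -
  have "\<bar>real (k choose m) * (bdiff ^^ (k - m)) \<mu> m\<bar> = real (k choose m) * \<bar>(bdiff ^^ (k - m)) \<mu> m\<bar>"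
    by (simp add: abs_mult)
  also have "\<dots> \<le> real (k choose m) * (C * (bdiff ^^ (k - m)) (\<lambda>n. 1 / (real n + 1)) m)"
    using assms unfolding dominated_def bdiff_pow_cmult by (intro mult_left_mono) auto
  also have "\<dots> = C * (real (k choose m) * (bdiff ^^ (k - m)) (\<lambda>n. 1 / (real n + 1)) m)" by simp
  also have "\<dots> = C / (real k + 1)" unfolding binomial_bdiff_moments_lebesgue[OF assms(2)] by simp
  finally show ?thesis .
qed

lemma powr_add_le:
  fixes a b :: real assumes "a \<ge> 0" "b \<ge> 0" "p \<ge> 0"
  shows "(a + b) powr p \<le> 2 powr p * (a powr p + b powr p)"
proof -
  have "(a + b) powr p \<le> (2 * max a b) powr p" using assms by (intro powr_mono2) auto
  also have "\<dots> = 2 powr p * max a b powr p" using assms by (simp add: powr_mult)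
  also have "max a b powr p \<le> a powr p + b powr p" by (simp add: max_def)
  finally show ?thesis by simp
qed

text \<open>
  A remainder that is dominated by \<open>C/(n+1)\<close> contributes at most
  \<open>(k+1)\<^sup>p\<^sup>-\<^sup>1 (k+1) (C/(k+1))\<^sup>p = C\<^sup>p\<close>, independently of \<open>k\<close>.
\<close>

lemma Hausdorff_bound_perturbed:
  fixes T h :: "'b \<Rightarrow> real"
  assumes p: "p > 1"
    and T: "T \<in> borel_measurable M" "\<And>t. t \<in> space M \<Longrightarrow> 0 \<le> T t \<and> T t \<le> 1"
    and fin: "finite_measure M" and uniform: "\<And>n. (\<integral>t. T t ^ n \<partial>M) = 1 / (real n + 1)"
    and h: "integrable M h" "integrable M (\<lambda>t. \<bar>h t\<bar> powr p)"
    and C: "dominated \<nu> (\<lambda>n. C * (1 / (real n + 1)))"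
    and \<mu>: "\<And>n. \<mu> n = (\<integral>t. T t ^ n * h t \<partial>M) + \<nu> n"
  shows "real (k + 1) powr (p - 1) * (\<Sum>m\<le>k. \<bar>real (k choose m) * fdiff (k - m) \<mu> m\<bar> powr p)
     \<le> 2 powr p * ((\<integral>t. \<bar>h t\<bar> powr p \<partial>M) + C powr p)"
proof -
  let ?f = "\<lambda>n. \<integral>t. T t ^ n * h t \<partial>M"
  let ?A = "\<lambda>m. \<bar>real (k choose m) * (bdiff ^^ (k - m)) ?f m\<bar>"
  have C0: "C \<ge> 0" using dominated_binomial_bound[OF C, of 0 0] by simp
  have "\<bar>real (k choose m) * fdiff (k - m) \<mu> m\<bar> powr p \<le> 2 powr p * (?A m powr p + (C / (real k + 1)) powr p)"
    if "m \<le> k" for m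
  proof -
    have "\<bar>real (k choose m) * fdiff (k - m) \<mu> m\<bar> = \<bar>real (k choose m) * (bdiff ^^ (k - m)) \<mu> m\<bar>"
      by (simp add: fdiff_eq_bdiff abs_mult)
    also have "\<dots> = \<bar>real (k choose m) * (bdiff ^^ (k - m)) (\<lambda>n. ?f n + \<nu> n) m\<bar>"
      using \<mu> by presburger
    also have "\<dots> \<le> ?A m + \<bar>real (k choose m) * (bdiff ^^ (k - m)) \<nu> m\<bar>"
      unfolding bdiff_pow_add distrib_left by (rule abs_triangle_ineq)
    also have "\<dots> \<le> ?A m + C / (real k + 1)"
      using dominated_binomial_bound[OF C that] by simp
    finally have "\<bar>real (k choose m) * fdiff (k - m) \<mu> m\<bar> powr p \<le> (?A m + C / (real k + 1)) powr p"
      using p by (intro powr_mono2) auto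
    also have "\<dots> \<le> 2 powr p * (?A m powr p + (C / (real k + 1)) powr p)"
      using p C0 by (intro powr_add_le) auto
    finally show ?thesis .
  qed
  then have "(\<Sum>m\<le>k. \<bar>real (k choose m) * fdiff (k - m) \<mu> m\<bar> powr p)
     \<le> (\<Sum>m\<le>k. 2 powr p * (?A m powr p + (C / (real k + 1)) powr p))"
    by (intro sum_mono) simp
  also have "\<dots> = 2 powr p * ((\<Sum>m\<le>k. ?A m powr p) + (real k + 1) * (C / (real k + 1)) powr p)"
    by (simp add: sum_distrib_left[symmetric] sum.distrib algebra_simps)
  finally have "real (k + 1) powr (p - 1) * (\<Sum>m\<le>k. \<bar>real (k choose m) * fdiff (k - m) \<mu> m\<bar> powr p)
     \<le> real (k + 1) powr (p - 1) * (2 powr p * ((\<Sum>m\<le>k. ?A m powr p) + (real k + 1) * (C / (real k + 1)) powr p))"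
    by (rule mult_left_mono) simp
  also have "\<dots> = 2 powr p * (real (k + 1) powr (p - 1) * (\<Sum>m\<le>k. ?A m powr p)
      + real (k + 1) powr (p - 1) * ((real k + 1) * (C / (real k + 1)) powr p))"
    by (simp add: algebra_simps)
  also have "real (k + 1) powr (p - 1) * ((real k + 1) * (C / (real k + 1)) powr p) = C powr p"
    using C0 by (simp add: powr_divide powr_diff add.commute[of 1])
  also have "2 powr p * (real (k + 1) powr (p - 1) * (\<Sum>m\<le>k. ?A m powr p) + C powr p)
      \<le> 2 powr p * ((\<integral>t. \<bar>h t\<bar> powr p \<partial>M) + C powr p)"
    using Hausdorff_moment_bound[OF p T fin uniform h, of k] by simp
  finally show ?thesis .
qed


section \<open>Integration by parts for indefinite Lebesgue integrals\<close>

lemma isCont_indefinite_integral: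
  fixes f :: "real \<Rightarrow> real"
  assumes f: "integrable lborel f"
  shows "isCont (\<lambda>s. \<integral>t. indicator {..<s} t * f t \<partial>lborel) r"
  unfolding continuous_at_sequentially
proof (intro allI impI)
  fix x :: "nat \<Rightarrow> real" assume x: "x \<longlonglongrightarrow> r"
  note borel_measurable_integrable[OF f, measurable]
  show "((\<lambda>s. \<integral>t. indicator {..<s} t * f t \<partial>lborel) \<circ> x) \<longlonglongrightarrow> (\<integral>t. indicator {..<r} t * f t \<partial>lborel)"
    unfolding o_def
  proof (rule integral_dominated_convergence[where w = "\<lambda>t. \<bar>f t\<bar>"])
    show "AE t in lborel. (\<lambda>i. indicator {..<x i} t * f t) \<longlonglongrightarrow> indicator {..<r} t * f t"
      using AE_lborel_singleton[of r]
    proof eventually_elim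
      fix t assume t: "t \<noteq> r"
      have "eventually (\<lambda>i. indicator {..<x i} t = (indicator {..<r} t :: real)) sequentially"
      proof (cases "t < r")
        case True
        then show ?thesis using order_tendstoD(1)[OF x, of t] by (auto elim: eventually_mono)
      next
        case False
        then show ?thesis using order_tendstoD(2)[OF x, of t] t by (auto elim!: eventually_mono)
      qed
      then show "(\<lambda>i. indicator {..<x i} t * f t) \<longlonglongrightarrow> indicator {..<r} t * f t"
        by (intro tendsto_eventually) (auto elim: eventually_mono)
    qed
  qed (use f in \<open>auto simp: indicator_def\<close>)
qed

text \<open>
  Formally the derivative is \<open>\<phi>' G + \<phi> g - \<phi> g\<close>, where \<open>G\<close> is the indefinite integral of \<open>g\<close>: the terms with \<open>g\<close>
  cancel. So the combination is differentiable everywhere, although \<open>G\<close> itself need not be when \<open>g\<close> is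
  merely integrable.
\<close>

lemma has_derivative_weighted_indefinite_integral:
  fixes g \<phi> \<phi>' :: "real \<Rightarrow> real"
  assumes g: "integrable lborel g" "integrable lborel (\<lambda>t. \<phi> t * g t)"
    and \<phi>: "\<And>t. 0 < t \<Longrightarrow> t < R \<Longrightarrow> (\<phi> has_real_derivative \<phi>' t) (at t)" "continuous_on {0<..<R} \<phi>'"
    and r: "0 < r" "r < R"
  shows "((\<lambda>s. \<phi> s * (\<integral>t. indicator {..<s} t * g t \<partial>lborel) - (\<integral>t. indicator {..<s} t * (\<phi> t * g t) \<partial>lborel))
           has_real_derivative \<phi>' r * (\<integral>t. indicator {..<r} t * g t \<partial>lborel)) (at r)"
proof -
  note borel_measurable_integrable[OF g(1), measurable] borel_measurable_integrable[OF g(2), measurable]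
  have int: "integrable lborel (\<lambda>t. indicator {..<s} t * f t)" if "integrable lborel f" for s and f :: "real \<Rightarrow> real"
    using integrable_mult_indicator[OF _ that, of "{..<s}"] by simp
  define G where "G s = (\<integral>t. indicator {..<s} t * g t \<partial>lborel)" for s
  define J where "J s = (\<integral>t. indicator {..<s} t * (\<phi> t * g t) \<partial>lborel)" for s
  define A where "A s = (\<integral>t. indicator {..<s} t * \<bar>g t\<bar> \<partial>lborel)" for s
  \<comment> \<open>The error of the linear approximation; it is \<open>o(s - r)\<close> by the Lipschitz bound on \<open>\<phi>\<close> near \<open>r\<close> and the continuity of \<open>A\<close>.\<close>
  define E where "E s = (\<integral>t. (indicator {..<s} t - indicator {..<r} t) * ((\<phi> s - \<phi> t) * g t) \<partial>lborel)" for s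
  have "compact (\<phi>' ` {r/2..(r+R)/2})"
    using r by (intro compact_continuous_image continuous_on_subset[OF \<phi>(2)]) auto
  then have "bounded (\<phi>' ` {r/2..(r+R)/2})" by (rule compact_imp_bounded)
  then obtain K where "\<forall>y\<in>\<phi>' ` {r/2..(r+R)/2}. norm y \<le> K" unfolding bounded_iff by blast
  then have K: "\<bar>\<phi>' t\<bar> \<le> K" if "t \<in> {r/2..(r+R)/2}" for t using that by (metis imageI real_norm_def)
  have lip: "\<bar>\<phi> s - \<phi> t\<bar> \<le> K * \<bar>s - t\<bar>" if "s \<in> {r/2..(r+R)/2}" "t \<in> {r/2..(r+R)/2}" for s t
  proof -
    have "norm (\<phi> s - \<phi> t) \<le> K * norm (s - t)"
      by (rule field_differentiable_bound[of "{r/2..(r+R)/2}" \<phi> \<phi>'])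
         (use that r K \<phi>(1) in \<open>auto intro: has_field_derivative_at_within\<close>)
    then show ?thesis by simp
  qed
  have E_eq: "\<phi> s * G s - J s - (\<phi> r * G r - J r) = (\<phi> s - \<phi> r) * G r + E s" for s
  proof -
    have "E s = (\<integral>t. \<phi> s * (indicator {..<s} t * g t) - \<phi> s * (indicator {..<r} t * g t)
       - (indicator {..<s} t * (\<phi> t * g t)) + (indicator {..<r} t * (\<phi> t * g t)) \<partial>lborel)"
      unfolding E_def by (rule arg_cong[where f="integral\<^sup>L lborel"]) (auto simp: algebra_simps)
    also have "\<dots> = \<phi> s * G s - \<phi> s * G r - J s + J r"
      unfolding G_def J_def using int[OF g(1)] int[OF g(2)] by simp
    finally show ?thesis by (simp add: algebra_simps)
  qed
  have E_le: "\<bar>E s\<bar> \<le> K * \<bar>s - r\<bar> * \<bar>A s - A r\<bar>" if s: "s \<in> {r/2..(r+R)/2}" for s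
  proof -
    have K0: "K \<ge> 0" using K[of r] r by auto
    have "\<bar>E s\<bar> \<le> (\<integral>t. \<bar>(indicator {..<s} t - indicator {..<r} t) * ((\<phi> s - \<phi> t) * g t)\<bar> \<partial>lborel)"
      unfolding E_def by (rule integral_abs_bound)
    also have "\<dots> \<le> (\<integral>t. K * \<bar>s - r\<bar> * (\<bar>indicator {..<s} t - indicator {..<r} t\<bar> * \<bar>g t\<bar>) \<partial>lborel)"
    proof (rule integral_mono)
      have "integrable lborel (\<lambda>t. (indicator {..<s} t - indicator {..<r} t) * ((\<phi> s - \<phi> t) * g t))"
      proof -
        have "integrable lborel (\<lambda>t. \<phi> s * (indicator {..<s} t * g t) - \<phi> s * (indicator {..<r} t * g t)
          - (indicator {..<s} t * (\<phi> t * g t)) + (indicator {..<r} t * (\<phi> t * g t)))"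
          using int[OF g(1)] int[OF g(2)] by simp
        then show ?thesis by (simp add: algebra_simps)
      qed
      then show "integrable lborel (\<lambda>t. \<bar>(indicator {..<s} t - indicator {..<r} t) * ((\<phi> s - \<phi> t) * g t)\<bar>)"
        by (rule integrable_abs)
      have "integrable lborel (\<lambda>t. \<bar>indicator {..<s} t * g t - indicator {..<r} t * g t\<bar>)"
        using int[OF g(1)] by simp
      then show "integrable lborel (\<lambda>t. K * \<bar>s - r\<bar> * (\<bar>indicator {..<s} t - indicator {..<r} t\<bar> * \<bar>g t\<bar>))"
        by (simp add: left_diff_distrib abs_mult[symmetric] del: abs_mult)
      fix t
      show "\<bar>(indicator {..<s} t - indicator {..<r} t) * ((\<phi> s - \<phi> t) * g t)\<bar>
         \<le> K * \<bar>s - r\<bar> * (\<bar>indicator {..<s} t - indicator {..<r} t\<bar> * \<bar>g t\<bar>)"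
      proof (cases "indicator {..<s} t = (indicator {..<r} t :: real)")
        case False
        then have t: "t \<in> {r/2..(r+R)/2}" "\<bar>s - t\<bar> \<le> \<bar>s - r\<bar>"
          using s r by (auto simp: indicator_def of_bool_def split: if_splits)
        have "\<bar>\<phi> s - \<phi> t\<bar> \<le> K * \<bar>s - r\<bar>"
          using lip[OF s t(1)] mult_left_mono[OF t(2) K0] by linarith
        then have "\<bar>indicator {..<s} t - indicator {..<r} t\<bar> * \<bar>g t\<bar> * \<bar>\<phi> s - \<phi> t\<bar>
           \<le> \<bar>indicator {..<s} t - indicator {..<r} t\<bar> * \<bar>g t\<bar> * (K * \<bar>s - r\<bar>)"
          by (intro mult_left_mono) auto
        then show ?thesis by (simp add: abs_mult mult_ac)
      qed simp
    qed
    also have "\<dots> = K * \<bar>s - r\<bar> * (\<integral>t. \<bar>indicator {..<s} t - indicator {..<r} t\<bar> * \<bar>g t\<bar> \<partial>lborel)"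
      by simp
    also have "(\<integral>t. \<bar>indicator {..<s} t - indicator {..<r} t\<bar> * \<bar>g t\<bar> \<partial>lborel) = \<bar>A s - A r\<bar>"
    proof (cases "s \<le> r")
      case True
      have "(\<integral>t. \<bar>indicator {..<s} t - indicator {..<r} t\<bar> * \<bar>g t\<bar> \<partial>lborel)
        = (\<integral>t. indicator {..<r} t * \<bar>g t\<bar> - indicator {..<s} t * \<bar>g t\<bar> \<partial>lborel)"
        using True by (intro Bochner_Integration.integral_cong) (auto simp: indicator_def)
      also have "\<dots> = A r - A s" unfolding A_def
        using int[OF integrable_abs[OF g(1)]] by simp
      moreover have "A r - A s \<ge> 0"
        unfolding calculation[symmetric] by (intro Bochner_Integration.integral_nonneg) auto
      ultimately show ?thesis by simp
    next
      case False
      have "(\<integral>t. \<bar>indicator {..<s} t - indicator {..<r} t\<bar> * \<bar>g t\<bar> \<partial>lborel)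
        = (\<integral>t. indicator {..<s} t * \<bar>g t\<bar> - indicator {..<r} t * \<bar>g t\<bar> \<partial>lborel)"
        using False by (intro Bochner_Integration.integral_cong) (auto simp: indicator_def)
      also have "\<dots> = A s - A r" unfolding A_def
        using int[OF integrable_abs[OF g(1)]] by simp
      moreover have "A s - A r \<ge> 0"
        unfolding calculation[symmetric] by (intro Bochner_Integration.integral_nonneg) auto
      ultimately show ?thesis by simp
    qed
    finally show ?thesis .
  qed
  have ev: "\<forall>\<^sub>F s in at r. s \<in> {r/2..(r+R)/2} \<and> s \<noteq> r"
  proof -
    have "\<forall>\<^sub>F s in at r. s \<in> {r/2<..<(r+R)/2}" using r by (intro eventually_at_in_open') auto
    with eventually_neq_at_within[of r r UNIV] show ?thesis
      by eventually_elim auto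
  qed
  have "((\<lambda>s. E s / (s - r)) \<longlongrightarrow> 0) (at r)"
  proof (rule Lim_null_comparison)
    show "\<forall>\<^sub>F s in at r. norm (E s / (s - r)) \<le> K * \<bar>A s - A r\<bar>"
      using ev
    proof eventually_elim
      fix s assume s: "s \<in> {r/2..(r+R)/2} \<and> s \<noteq> r"
      then show "norm (E s / (s - r)) \<le> K * \<bar>A s - A r\<bar>"
        using E_le[of s] by (simp add: field_simps)
    qed
    have "isCont A r" unfolding A_def by (intro isCont_indefinite_integral integrable_abs g)
    then have "((\<lambda>s. K * \<bar>A s - A r\<bar>) \<longlongrightarrow> K * \<bar>A r - A r\<bar>) (at r)"
      by (intro tendsto_intros) (simp add: isCont_def)
    then show "((\<lambda>s. K * \<bar>A s - A r\<bar>) \<longlongrightarrow> 0) (at r)" by simp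
  qed
  moreover have "((\<lambda>s. (\<phi> s - \<phi> r) / (s - r)) \<longlongrightarrow> \<phi>' r) (at r)"
    using \<phi>(1)[OF r] by (simp add: has_field_derivative_iff)
  ultimately have "((\<lambda>s. (\<phi> s - \<phi> r) / (s - r) * G r + E s / (s - r)) \<longlongrightarrow> \<phi>' r * G r + 0) (at r)"
    by (intro tendsto_intros)
  then have "((\<lambda>s. ((\<phi> s * G s - J s) - (\<phi> r * G r - J r)) / (s - r)) \<longlongrightarrow> \<phi>' r * G r) (at r)"
    unfolding E_eq by (simp add: add_divide_distrib)
  then show ?thesis
    unfolding has_field_derivative_iff G_def J_def .
qed

text \<open>
  Here \<open>G\<close> is only absolutely continuous. The fundamental theorem of calculus applies nevertheless to
  the differentiable function \<open>\<phi> G - \<integral>\<phi> g\<close> of the preceding lemma, whose derivative is continuous.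
\<close>

lemma weighted_integration_by_parts:
  fixes g \<phi> \<phi>' :: "real \<Rightarrow> real"
  assumes g: "integrable lborel g" "integrable lborel (\<lambda>t. \<phi> t * g t)"
    and \<phi>: "\<And>t. 0 < t \<Longrightarrow> t < R \<Longrightarrow> (\<phi> has_real_derivative \<phi>' t) (at t)" "continuous_on {0<..<R} \<phi>'"
    and G: "\<And>s. G s = (\<integral>t. indicator {..<s} t * g t \<partial>lborel)"
    and r: "0 < r" "r \<le> s" "s < R"
  shows "has_bochner_integral lborel (\<lambda>t. indicator {r..s} t * (\<phi> t * g t + \<phi>' t * G t)) (\<phi> s * G s - \<phi> r * G r)"
proof -
  define J where "J s = (\<integral>t. indicator {..<s} t * (\<phi> t * g t) \<partial>lborel)" for s
  note borel_measurable_integrable[OF g(1), measurable] borel_measurable_integrable[OF g(2), measurable]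
  have int: "integrable lborel (\<lambda>t. indicator {..<s} t * f t)" if "integrable lborel f" for s and f :: "real \<Rightarrow> real"
    using integrable_mult_indicator[OF _ that, of "{..<s}"] by simp
  have G_cont: "isCont G t" for t
    using isCont_indefinite_integral[OF g(1)] by (simp add: G[abs_def])
  have "has_bochner_integral lborel (\<lambda>t. (\<phi>' t * G t) * indicator {r..s} t) ((\<phi> s * G s - J s) - (\<phi> r * G r - J r))"
  proof (rule has_bochner_integral_FTC_Icc_real[OF r(2)])
    fix t assume t: "r \<le> t" "t \<le> s"
    then have t0: "0 < t" "t < R" using r by simp_all
    show "((\<lambda>s. \<phi> s * G s - J s) has_real_derivative \<phi>' t * G t) (at t)"
      unfolding G J_def by (rule has_derivative_weighted_indefinite_integral[OF g \<phi> t0])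
    have "isCont \<phi>' t" using \<phi>(2) t0 by (simp add: continuous_on_eq_continuous_at)
    then show "isCont (\<lambda>t. \<phi>' t * G t) t" by (intro continuous_intros G_cont)
  qed
  moreover have "has_bochner_integral lborel (\<lambda>t. indicator {r..s} t * (\<phi> t * g t)) (J s - J r)"
  proof -
    have "has_bochner_integral lborel (\<lambda>t. indicator {..<s} t * (\<phi> t * g t) - indicator {..<r} t * (\<phi> t * g t)) (J s - J r)"
      unfolding J_def by (intro has_bochner_integral_diff has_bochner_integral_integrable int g)
    then show ?thesis
    proof (rule has_bochner_integral_cong_AE[THEN iffD1, rotated -1])
      show "AE t in lborel. indicator {..<s} t * (\<phi> t * g t) - indicator {..<r} t * (\<phi> t * g t) = indicator {r..s} t * (\<phi> t * g t)"
        using AE_lborel_singleton[of s] by eventually_elim (use r in \<open>auto simp: indicator_def\<close>)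
    qed measurable
  qed
  ultimately have "has_bochner_integral lborel (\<lambda>t. (\<phi>' t * G t) * indicator {r..s} t + indicator {r..s} t * (\<phi> t * g t))
      (((\<phi> s * G s - J s) - (\<phi> r * G r - J r)) + (J s - J r))"
    by (rule has_bochner_integral_add)
  then show ?thesis by (simp add: algebra_simps)
qed


section \<open>The regular radial solution as a function of the degree\<close>

text \<open>If \<open>M\<close> is the sum of two completely monotone sequences, then it dominates each of them.\<close>

lemma dominated_of_diff:
  assumes "completely_monotone \<nu>" "completely_monotone (\<lambda>n. M n - \<nu> n)"
  shows "dominated \<nu> M"
  using assms unfolding completely_monotone_iff bdiff_pow_diff
  by (auto simp: dominated_def)

lemma dominated_kernel:
  assumes s: "0 \<le> s" "s \<le> 1" and a: "a > 0"
  shows "dominated (\<lambda>n. (1 - s ^ (2 * n + a)) / real (2 * n + a)) (\<lambda>n. 1 / real (2 * n + a))"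
proof (rule dominated_of_diff)
  show "completely_monotone (\<lambda>n. (1 - s ^ (2 * n + a)) / real (2 * n + a))"
    using completely_monotone_one_minus_power[OF s, of 0 a] a by simp
  have "completely_monotone (\<lambda>n. s ^ (2 * n + a) * (1 / (2 * real n + real a)))"
    using a by (intro dominated_mult completely_monotone_power completely_monotone_inverse s) simp
  then show "completely_monotone (\<lambda>n. 1 / real (2 * n + a) - (1 - s ^ (2 * n + a)) / real (2 * n + a))"
    by (simp add: diff_divide_distrib)
qed

lemma dominated_power_mult_inverse:
  assumes s: "0 \<le> s" "s \<le> 1" and b: "0 \<le> b" "b < real a"
  shows "dominated (\<lambda>n. s ^ (2 * n + a) * (1 / (2 * real n + real a - b))) (\<lambda>n. 1 / (2 * real n + real a - b))"
proof (rule dominated_of_diff)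
  show "completely_monotone (\<lambda>n. s ^ (2 * n + a) * (1 / (2 * real n + real a - b)))"
    using b completely_monotone_inverse[of "real a - b"]
    by (intro dominated_mult completely_monotone_power s) (simp add: algebra_simps)
  show "completely_monotone (\<lambda>n. 1 / (2 * real n + real a - b) - s ^ (2 * n + a) * (1 / (2 * real n + real a - b)))"
    using completely_monotone_one_minus_power[OF s b] by (simp add: diff_divide_distrib)
qed

lemma dominated_inverse_mono:
  assumes "0 < b" "b \<le> c"
  shows "dominated (\<lambda>n. 1 / (2 * real n + c)) (\<lambda>n. 1 / (2 * real n + b))"
proof (rule dominated_of_diff)
  show "completely_monotone (\<lambda>n. 1 / (2 * real n + c))" using assms by (intro completely_monotone_inverse) simp
  have "completely_monotone (\<lambda>n. (c - b) * ((1 / (2 * real n + b)) * (1 / (2 * real n + c))))"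
    using assms by (intro dominated_cmult dominated_mult completely_monotone_inverse) auto
  moreover have "(c - b) * ((1 / (2 * real n + b)) * (1 / (2 * real n + c))) = 1 / (2 * real n + b) - 1 / (2 * real n + c)" for n
  proof -
    have "2 * real n + b > 0" "2 * real n + c > 0" using assms by (auto intro: add_nonneg_pos)
    then show ?thesis by (simp add: field_simps)
  qed
  ultimately show "completely_monotone (\<lambda>n. 1 / (2 * real n + b) - 1 / (2 * real n + c))" by simp
qed

text \<open>
  The only properties of a radial potential \<open>V = q(|\<cdot>|)\<close> that the analysis of the regular
  solution uses are those of \<open>w t = t q(t)\<close>.
\<close>

locale radial_potential =
  fixes w :: "real \<Rightarrow> real" and L :: real
  assumes w_integrable: "integrable lborel w"
    and w_support: "\<And>t. t \<notin> {0<..<1} \<Longrightarrow> w t = 0"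
    and w_bound: "(\<integral>t. \<bar>w t\<bar> \<partial>lborel) \<le> L"
begin

lemma w_measurable [measurable]: "w \<in> borel_measurable borel"
  using borel_measurable_integrable[OF w_integrable] by simp

lemma L_nonneg: "L \<ge> 0"
  using w_bound Bochner_Integration.integral_nonneg[of lborel "\<lambda>t. \<bar>w t\<bar>"] by (meson abs_ge_zero order_trans)

text \<open>The value of \<open>t\<^sup>N \<integral>\<^sub>t\<^sup>r s\<^sup>-\<^sup>N\<^sup>-\<^sup>1 ds\<close>. It results from integrating \<open>(r\<^sup>N\<^sup>+\<^sup>1 c')' = r\<^sup>N w c\<close> twice.\<close>

definition kern :: "nat \<Rightarrow> real \<Rightarrow> real \<Rightarrow> real" where
  "kern N r t = (if 0 < t \<and> t < r then (1 - (t / r) ^ N) / real N else 0)"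

primrec jost_term :: "nat \<Rightarrow> nat \<Rightarrow> real \<Rightarrow> real" where
  "jost_term N 0 = (\<lambda>r. 1)"
| "jost_term N (Suc j) = (\<lambda>r. \<integral>t. kern N r t * (w t * jost_term N j t) \<partial>lborel)"

text \<open>
  The solution \<open>c\<close> of \<open>c(r) = 1 + \<integral>kern N r t w(t) c(t) dt\<close>. In the variable \<open>x = - ln r\<close> the function
  \<open>e\<^sup>-\<^sup>N\<^sup>x\<^sup>/\<^sup>2 c\<close> is the Jost solution of a Schroedinger equation on the half-line, whence the name.
\<close>

definition jost :: "nat \<Rightarrow> real \<Rightarrow> real" where
  "jost N r = (\<Sum>j. jost_term N j r)"

text \<open>This is \<open>r\<^sup>N\<^sup>+\<^sup>1 c'(r)\<close>; see \<open>jost_deriv\<close> below.\<close>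

definition flux :: "nat \<Rightarrow> real \<Rightarrow> real" where
  "flux N r = (\<integral>t. indicator {..<r} t * (t ^ N * w t * jost N t) \<partial>lborel)"

lemma kern_measurable [measurable]: "(\<lambda>(r, t). kern N r t) \<in> borel_measurable (borel \<Otimes>\<^sub>M borel)"
  unfolding kern_def by measurable

lemma kern_measurable2 [measurable]: "kern N r \<in> borel_measurable borel"
  unfolding kern_def by measurable

lemma kern_bound: "\<bar>kern N r t\<bar> \<le> 1 / real N"
proof (cases "0 < t \<and> t < r")
  case True
  then have "0 \<le> (t / r) ^ N" "(t / r) ^ N \<le> 1" by (auto intro!: power_le_one)
  then show ?thesis using True by (simp add: kern_def divide_right_mono)
qed (auto simp: kern_def)

lemma jost_term_measurable [measurable]: "jost_term N j \<in> borel_measurable borel"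
proof (induction j)
  case (Suc j)
  note Suc[measurable]
  show ?case by simp
qed simp

lemma w_mult_integrable:
  assumes f[measurable]: "f \<in> borel_measurable borel" and b: "\<And>t. 0 < t \<Longrightarrow> t < 1 \<Longrightarrow> \<bar>f t\<bar> \<le> C"
  shows "integrable lborel (\<lambda>t. f t * w t)"
proof (rule Bochner_Integration.integrable_bound)
  show "integrable lborel (\<lambda>t. C * \<bar>w t\<bar>)" using w_integrable by simp
  show "AE t in lborel. norm (f t * w t) \<le> norm (C * \<bar>w t\<bar>)"
  proof (rule AE_I2)
    fix t :: real
    show "norm (f t * w t) \<le> norm (C * \<bar>w t\<bar>)"
    proof (cases "t \<in> {0<..<1}")
      case True
      then have "\<bar>f t\<bar> \<le> \<bar>C\<bar>" using b[of t] by auto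
      then show ?thesis by (simp add: abs_mult mult_right_mono)
    qed (simp add: w_support)
  qed
qed simp

text \<open>
  Each iteration integrates a product of the kernel, which is dominated by \<open>1/N\<close>, with the previous
  term, against \<open>|w|\<close>. So domination passes through the recursion with the factor \<open>L/N\<close>.
\<close>

lemma jost_term_dominated:
  assumes a: "a > 0"
  shows "dominated (\<lambda>n. jost_term (2 * n + a) j r) (\<lambda>n. (L / real (2 * n + a)) ^ j)"
proof (induction j arbitrary: r)
  case 0
  show ?case using completely_monotone_const[of 1] by simp
next
  case (Suc j)
  let ?N = "\<lambda>n. 2 * n + a"
  have bd: "\<bar>jost_term (?N n) j t\<bar> \<le> (L / real (?N n)) ^ j" for n t
    using dominated_le[OF Suc, of n] by simp
  have "dominated (\<lambda>n. \<integral>t. kern (?N n) r t * (w t * jost_term (?N n) j t) \<partial>lborel)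
      (\<lambda>n. \<integral>t. 1 / real (?N n) * (\<bar>w t\<bar> * (L / real (?N n)) ^ j) \<partial>lborel)"
  proof (rule dominated_integral)
    fix n
    have "integrable lborel (\<lambda>t. (kern (?N n) r t * jost_term (?N n) j t) * w t)"
    proof (rule w_mult_integrable)
      show "\<bar>kern (?N n) r t * jost_term (?N n) j t\<bar> \<le> 1 / real (?N n) * (L / real (?N n)) ^ j" for t
        unfolding abs_mult by (intro mult_mono kern_bound bd) auto
    qed simp
    then show "integrable lborel (\<lambda>t. kern (?N n) r t * (w t * jost_term (?N n) j t))"
      by (simp add: mult_ac)
    show "integrable lborel (\<lambda>t. 1 / real (?N n) * (\<bar>w t\<bar> * (L / real (?N n)) ^ j))"
      using w_integrable by simp
  next
    fix t
    have "dominated (\<lambda>n. kern (?N n) r t) (\<lambda>n. 1 / real (?N n))"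
    proof (cases "0 < t \<and> t < r")
      case True
      then show ?thesis using dominated_kernel[of "t / r" a] a by (simp add: kern_def)
    next
      case False
      then have "(\<lambda>n. kern (?N n) r t) = (\<lambda>n. 0 * (1 / real (?N n)))" by (auto simp: kern_def)
      then show ?thesis
        using dominated_cmult[OF completely_monotone_inverse[of "real a"], of 0 1] a by simp
    qed
    moreover have "dominated (\<lambda>n. w t * jost_term (?N n) j t) (\<lambda>n. \<bar>w t\<bar> * (L / real (?N n)) ^ j)"
      by (intro dominated_cmult Suc) simp
    ultimately show "dominated (\<lambda>n. kern (?N n) r t * (w t * jost_term (?N n) j t))
       (\<lambda>n. 1 / real (?N n) * (\<bar>w t\<bar> * (L / real (?N n)) ^ j))"
      by (rule dominated_mult)
  qed
  moreover have "(\<lambda>n. \<integral>t. 1 / real (?N n) * (\<bar>w t\<bar> * (L / real (?N n)) ^ j) \<partial>lborel)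
      = (\<lambda>n. (\<integral>t. \<bar>w t\<bar> \<partial>lborel) * (1 / real (?N n) * (L / real (?N n)) ^ j))"
    by (auto simp: mult_ac)
  moreover have "dominated (\<lambda>n. (\<integral>t. \<bar>w t\<bar> \<partial>lborel) * (1 / real (?N n) * (L / real (?N n)) ^ j))
      (\<lambda>n. L * (1 / real (?N n) * (L / real (?N n)) ^ j))"
    using w_bound completely_monotone_inverse[of "real a"] a dominated_self[OF Suc]
    by (intro dominated_cmult dominated_mult) auto
  ultimately show ?case
    by (auto simp: mult_ac dest: dominated_trans)
qed

lemma jost_term_bound: "N > 0 \<Longrightarrow> \<bar>jost_term N j r\<bar> \<le> (L / real N) ^ j"
  using dominated_le[OF jost_term_dominated[of N j r], of 0] by simp

lemma geometric_sums:
  assumes "L < real N"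
  shows "(\<lambda>j. (L / real N) ^ Suc j) sums (L / (real N - L))"
proof -
  have "(\<lambda>j. L / real N * (L / real N) ^ j) sums (L / real N * (1 / (1 - L / real N)))"
    using assms L_nonneg by (intro sums_mult geometric_sums) auto
  moreover have "L / real N * (1 / (1 - L / real N)) = L / (real N - L)"
    using assms L_nonneg by (simp add: field_simps)
  ultimately show ?thesis by (simp only: power_Suc)
qed

lemma jost_summable:
  assumes "L < real N"
  shows "summable (\<lambda>j. jost_term N j r)"
proof (rule summable_comparison_test'[of "\<lambda>j. (L / real N) ^ j" 0])
  show "summable (\<lambda>j. (L / real N) ^ j)"
    using assms L_nonneg by (intro summable_geometric) auto
  show "norm (jost_term N j r) \<le> (L / real N) ^ j" for j
    using jost_term_bound[of N j r] assms L_nonneg by simp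
qed

lemma jost_measurable [measurable]: "jost N \<in> borel_measurable borel"
  unfolding jost_def by measurable

lemma jost_dominated:
  assumes "L < real a"
  shows "dominated (\<lambda>n. jost (2 * n + a) r - 1) (\<lambda>n. L / (2 * real n + real a - L))"
proof -
  have a: "a > 0" using assms L_nonneg by linarith
  have "dominated (\<lambda>n. \<Sum>j. jost_term (2 * n + a) (Suc j) r) (\<lambda>n. L / (2 * real n + real a - L))"
  proof (rule dominated_suminf[OF jost_term_dominated[OF a, of "Suc j" for j]])
    show "(\<lambda>i. (L / real (2 * n + a)) ^ Suc i) sums (L / (2 * real n + real a - L))" for n
      using geometric_sums[of "2 * n + a"] assms by simp
  qed
  moreover have "(\<Sum>j. jost_term (2 * n + a) (Suc j) r) = jost (2 * n + a) r - 1" for n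
    using suminf_split_head[OF jost_summable[of "2 * n + a" r]] assms by (simp add: jost_def)
  ultimately show ?thesis by simp
qed

lemma jost_bound: "L < real N \<Longrightarrow> \<bar>jost N r - 1\<bar> \<le> L / (real N - L)"
  using dominated_le[OF jost_dominated[of N r], of 0] by simp

text \<open>
  Expand \<open>1/(1+e)\<close> in powers of \<open>e = c - 1\<close>. The majorant \<open>M = L/(N-L)\<close> of \<open>e\<close> gives the majorant
  \<open>M/(1-M) = L/(N-2L)\<close> of the sum.
\<close>

lemma jost_inverse_dominated:
  assumes "2 * L < real a"
  shows "dominated (\<lambda>n. 1 / jost (2 * n + a) r - 1) (\<lambda>n. L / (2 * real n + real a - 2 * L))"
proof -
  let ?e = "\<lambda>n. jost (2 * n + a) r - 1" and ?M = "\<lambda>n. L / (2 * real n + real a - L)"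
  have La: "L < real a" using assms L_nonneg by linarith
  have M: "0 \<le> ?M n" "?M n < 1" for n
    using assms L_nonneg by (auto simp: field_simps)
  have e: "\<bar>?e n\<bar> < 1" for n
    using dominated_le[OF jost_dominated[OF La, of r], of n] M(2)[of n] by simp
  have e': "(\<lambda>i. (- 1 * ?e n) ^ i) sums (1 / (1 - (- 1 * ?e n)))" for n
    using e[of n] by (intro Series.geometric_sums) simp
  have "dominated (\<lambda>n. \<Sum>i. (- 1 * ?e n) ^ Suc i) (\<lambda>n. L / (2 * real n + real a - 2 * L))"
  proof (rule dominated_suminf)
    show "dominated (\<lambda>n. (- 1 * ?e n) ^ Suc i) (\<lambda>n. ?M n ^ Suc i)" for i
      using dominated_cmult[OF jost_dominated[OF La], of "-1" 1] by (intro dominated_power) simp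
    fix n
    have "(\<lambda>i. ?M n * ?M n ^ i) sums (?M n * (1 / (1 - ?M n)))"
      using M[of n] by (intro sums_mult Series.geometric_sums) (simp only: real_norm_def abs_of_nonneg)
    moreover have "?M n * (1 / (1 - ?M n)) = L / (2 * real n + real a - 2 * L)"
    proof -
      define x where "x = 2 * real n + real a - 2 * L"
      have x: "x > 0" using assms by (simp add: x_def)
      have 1: "2 * real n + real a - L = x + L" by (simp add: x_def)
      have 2: "1 - L / (x + L) = x / (x + L)" using x L_nonneg by (simp add: field_simps)
      show ?thesis unfolding x_def[symmetric] 1 2 using x L_nonneg by simp
    qed
    ultimately show "(\<lambda>i. ?M n ^ Suc i) sums (L / (2 * real n + real a - 2 * L))" by (simp only: power_Suc)
  qed
  moreover have "(\<Sum>i. (- 1 * ?e n) ^ Suc i) = 1 / jost (2 * n + a) r - 1" for n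
    using suminf_split_head[OF sums_summable[OF e'[of n]]] sums_unique[OF e'[of n]] by simp
  ultimately show ?thesis by simp
qed

lemma jost_ratio_dominated:
  assumes "2 * L < real a"
  shows "dominated (\<lambda>n. jost (2 * n + a) t / jost (2 * n + a) r - 1) (\<lambda>n. 2 * L * (1 / (2 * real n + real a - 2 * L)))"
proof -
  have La: "L < real a" using assms L_nonneg by linarith
  let ?e = "\<lambda>n. jost (2 * n + a) t - 1" and ?f = "\<lambda>n. 1 / jost (2 * n + a) r - 1"
  let ?E = "\<lambda>n. L / (2 * real n + real a - L)" and ?F = "\<lambda>n. L / (2 * real n + real a - 2 * L)"
  have "dominated (\<lambda>n. ?e n + ?f n + ?e n * ?f n) (\<lambda>n. ?E n + ?F n + ?E n * ?F n)"
    by (intro dominated_add dominated_mult jost_dominated[OF La] jost_inverse_dominated[OF assms])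
  moreover have "?e n + ?f n + ?e n * ?f n = jost (2 * n + a) t / jost (2 * n + a) r - 1" for n
    by (cases "jost (2 * n + a) r = 0") (simp_all add: algebra_simps diff_divide_distrib)
  moreover have "?E n + ?F n + ?E n * ?F n = 2 * L * (1 / (2 * real n + real a - 2 * L))" for n
  proof -
    define x where "x = 2 * real n + real a - 2 * L"
    have x: "x > 0" using assms by (simp add: x_def)
    have "2 * real n + real a - L = x + L" by (simp add: x_def)
    then show ?thesis unfolding x_def[symmetric] using x L_nonneg
      by (simp add: divide_simps) (simp add: algebra_simps)
  qed
  ultimately show ?thesis by (simp only:)
qed

text \<open>
  The remainder is \<open>\<nu> n = \<integral>t\<^sup>N w(t) (c(t)/c(1) - 1) dt\<close> for \<open>N = 2n+a\<close>. The bracket is dominated by \<open>2L/(N-2L)\<close>, and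
  so is its product with \<open>t\<^sup>N\<close>, since \<open>(1 - t\<^sup>N)/(N-2L)\<close> is completely monotone. Integration against \<open>|w|\<close> gives
  another factor \<open>L\<close>.
\<close>

theorem flux_ratio:
  assumes "2 * L + 2 \<le> real a"
  obtains \<nu> where "dominated \<nu> (\<lambda>n. L\<^sup>2 * (1 / (real n + 1)))"
    and "\<And>n. flux (2 * n + a) 1 / jost (2 * n + a) 1 = (\<integral>t. t ^ (2 * n + a) * w t \<partial>lborel) + \<nu> n"
proof -
  let ?N = "\<lambda>n. 2 * n + a"
  have La: "2 * L < real a" using assms by simp
  define R where "R n t = jost (?N n) t / jost (?N n) 1 - 1" for n t
  define M where "M n = 2 * L * (1 / (2 * real n + real a - 2 * L))" for n
  define \<nu> where "\<nu> n = (\<integral>t. w t * (t ^ (?N n) * R n t) \<partial>lborel)" for n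
  have R: "dominated (\<lambda>n. R n t) M" for t
    unfolding R_def M_def using jost_ratio_dominated[OF La, of t 1] by simp
  have [measurable]: "R n \<in> borel_measurable borel" for n unfolding R_def by measurable
  have pow: "0 \<le> t ^ k" "t ^ k \<le> 1" if "0 < t" "t < 1" for t :: real and k
    using that by (auto intro: power_le_one)
  have int1: "integrable lborel (\<lambda>t. t ^ (?N n) * w t)" for n
    by (rule w_mult_integrable[of _ 1]) (use pow in auto)
  have int2: "integrable lborel (\<lambda>t. (t ^ (?N n) * R n t) * w t)" for n
  proof (rule w_mult_integrable)
    fix t :: real assume t: "0 < t" "t < 1"
    show "\<bar>t ^ (?N n) * R n t\<bar> \<le> 1 * M n"
      unfolding abs_mult using dominated_le[OF R, of n t] pow[OF t] by (intro mult_mono) auto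
  qed simp
  have "dominated \<nu> (\<lambda>n. \<integral>t. \<bar>w t\<bar> * M n \<partial>lborel)"
    unfolding \<nu>_def
  proof (rule dominated_integral)
    show "integrable lborel (\<lambda>t. w t * (t ^ (?N n) * R n t))" for n using int2[of n] by (simp add: mult_ac)
    show "integrable lborel (\<lambda>t. \<bar>w t\<bar> * M n)" for n using w_integrable by simp
    fix t
    have M: "completely_monotone M" by (rule dominated_self[OF R])
    show "dominated (\<lambda>n. w t * (t ^ ?N n * R n t)) (\<lambda>n. \<bar>w t\<bar> * M n)"
    proof (cases "t \<in> {0<..<1}")
      case True
      then have t: "0 \<le> t" "t \<le> 1" by auto
      have "dominated (\<lambda>n. t ^ ?N n * R n t) (\<lambda>n. t ^ ?N n * M n)"
        by (intro dominated_mult R completely_monotone_power t)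
      moreover have "dominated (\<lambda>n. 2 * L * (t ^ ?N n * (1 / (2 * real n + real a - 2 * L)))) M"
        unfolding M_def using L_nonneg La by (intro dominated_cmult dominated_power_mult_inverse t) auto
      ultimately have "dominated (\<lambda>n. t ^ ?N n * R n t) M"
        by (auto simp: M_def mult_ac dest: dominated_trans)
      then show ?thesis by (rule dominated_cmult) (rule order_refl)
    next
      case False
      then show ?thesis using dominated_cmult[OF M, of 0 0] by (simp add: w_support)
    qed
  qed
  moreover have "(\<lambda>n. \<integral>t. \<bar>w t\<bar> * M n \<partial>lborel) = (\<lambda>n. (\<integral>t. \<bar>w t\<bar> \<partial>lborel) * M n)" by simp
  moreover have "dominated (\<lambda>n. (\<integral>t. \<bar>w t\<bar> \<partial>lborel) * M n) (\<lambda>n. L * (2 * L * (1 / (2 * real n + 2))))"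
  proof (rule dominated_trans)
    show "dominated (\<lambda>n. (\<integral>t. \<bar>w t\<bar> \<partial>lborel) * M n) (\<lambda>n. L * M n)"
      using w_bound by (intro dominated_cmult dominated_self[OF R]) auto
    have "dominated (\<lambda>n. 1 / (2 * real n + real a - 2 * L)) (\<lambda>n. 1 / (2 * real n + 2))"
      using dominated_inverse_mono[of 2 "real a - 2 * L"] assms by (simp add: algebra_simps)
    then show "dominated (\<lambda>n. L * M n) (\<lambda>n. L * (2 * L * (1 / (2 * real n + 2))))"
      unfolding M_def using L_nonneg by (intro dominated_cmult) auto
  qed
  moreover have "(\<lambda>n. L * (2 * L * (1 / (2 * real n + 2)))) = (\<lambda>n. L\<^sup>2 * (1 / (real n + 1)))"
  proof
    fix n show "L * (2 * L * (1 / (2 * real n + 2))) = L\<^sup>2 * (1 / (real n + 1))"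
      by (simp add: power2_eq_square divide_simps)
  qed
  ultimately have dom: "dominated \<nu> (\<lambda>n. L\<^sup>2 * (1 / (real n + 1)))"
    by (auto dest: dominated_trans)
  show ?thesis
  proof (rule that[OF dom])
    fix n
    have "flux (?N n) 1 / jost (?N n) 1 = (\<integral>t. indicator {..<1} t * (t ^ ?N n * w t * jost (?N n) t) / jost (?N n) 1 \<partial>lborel)"
      by (simp add: flux_def)
    also have "\<dots> = (\<integral>t. t ^ ?N n * w t + w t * (t ^ ?N n * R n t) \<partial>lborel)"
    proof (rule Bochner_Integration.integral_cong[OF refl])
      fix t
      show "indicator {..<1} t * (t ^ ?N n * w t * jost (?N n) t) / jost (?N n) 1 = t ^ ?N n * w t + w t * (t ^ ?N n * R n t)"
        by (cases "t \<in> {0<..<1}") (simp_all add: w_support R_def algebra_simps)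
    qed
    also have "\<dots> = (\<integral>t. t ^ ?N n * w t \<partial>lborel) + \<nu> n"
      unfolding \<nu>_def using int1[of n] int2[of n] by (simp add: mult_ac)
    finally show "flux (?N n) 1 / jost (?N n) 1 = (\<integral>t. t ^ ?N n * w t \<partial>lborel) + \<nu> n" .
  qed
qed

end


section \<open>The differential equation of the regular solution\<close>

context radial_potential begin

definition jost_bd :: "nat \<Rightarrow> real" where "jost_bd N = 1 + L / (real N - L)"

lemma jost_abs_bound: "L < real N \<Longrightarrow> \<bar>jost N r\<bar> \<le> jost_bd N"
  using jost_bound[of N r] by (simp add: jost_bd_def)

lemma jost_bd_pos: "L < real N \<Longrightarrow> jost_bd N > 0"
  using L_nonneg by (simp add: jost_bd_def add_pos_nonneg)

lemma jost_pos:
  assumes "2 * L < real N" shows "jost N r > 0"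
proof -
  have "L / (real N - L) < 1" using assms L_nonneg by (simp add: field_simps)
  moreover have "\<bar>jost N r - 1\<bar> \<le> L / (real N - L)" using assms L_nonneg by (intro jost_bound) simp
  ultimately show ?thesis by linarith
qed

text \<open>
  Summing the recursion for the terms; the geometric bound on the terms allows the interchange of
  sum and integral.
\<close>

lemma jost_integral_equation:
  assumes N: "L < real N"
  shows "jost N r = 1 + (\<integral>t. kern N r t * (w t * jost N t) \<partial>lborel)"
proof -
  have N0: "N > 0" using N L_nonneg by (cases N) auto
  define f where "f j t = kern N r t * (w t * jost_term N j t)" for j t
  have bd: "\<bar>kern N r t * jost_term N j t\<bar> \<le> 1 / real N * (L / real N) ^ j" for j t
    unfolding abs_mult by (intro mult_mono kern_bound jost_term_bound N0) auto
  have int: "integrable lborel (f j)" for j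
  proof -
    have "integrable lborel (\<lambda>t. (kern N r t * jost_term N j t) * w t)"
      by (rule w_mult_integrable[OF _ bd]) simp
    then show ?thesis by (simp add: f_def[abs_def] mult_ac)
  qed
  have fle: "\<bar>f j t\<bar> \<le> 1 / real N * (L / real N) ^ j * \<bar>w t\<bar>" for j t
    using mult_right_mono[OF bd[of t j], of "\<bar>w t\<bar>"] by (simp add: f_def abs_mult mult_ac)
  have geo: "summable (\<lambda>j. (L / real N) ^ j)"
    using N L_nonneg by (intro summable_geometric) auto
  have s1: "summable (\<lambda>j. norm (f j t))" for t
    by (rule summable_comparison_test'[of "\<lambda>j. 1 / real N * (L / real N) ^ j * \<bar>w t\<bar>" 0])
       (use fle geo in \<open>auto intro!: summable_mult2 summable_mult\<close>)
  have s2: "summable (\<lambda>j. \<integral>t. norm (f j t) \<partial>lborel)"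
  proof (rule summable_comparison_test'[of "\<lambda>j. 1 / real N * (L / real N) ^ j * L" 0])
    show "summable (\<lambda>j. 1 / real N * (L / real N) ^ j * L)" by (intro summable_mult2 summable_mult geo)
    fix j
    have "(\<integral>t. norm (f j t) \<partial>lborel) \<le> (\<integral>t. 1 / real N * (L / real N) ^ j * \<bar>w t\<bar> \<partial>lborel)"
      using fle w_integrable int by (intro integral_mono) auto
    also have "\<dots> = 1 / real N * (L / real N) ^ j * (\<integral>t. \<bar>w t\<bar> \<partial>lborel)" by simp
    also have "\<dots> \<le> 1 / real N * (L / real N) ^ j * L" using L_nonneg by (intro mult_left_mono w_bound) simp
    finally show "norm (\<integral>t. norm (f j t) \<partial>lborel) \<le> 1 / real N * (L / real N) ^ j * L" by simp
  qed
  have "jost N r = 1 + (\<Sum>j. jost_term N (Suc j) r)"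
    using suminf_split_head[OF jost_summable[OF N, of r]] by (simp add: jost_def)
  also have "(\<Sum>j. jost_term N (Suc j) r) = (\<Sum>j. \<integral>t. f j t \<partial>lborel)" by (simp add: f_def)
  also have "\<dots> = (\<integral>t. (\<Sum>j. f j t) \<partial>lborel)"
    by (rule integral_suminf[symmetric]) (use int s1 s2 in auto)
  also have "(\<lambda>t. \<Sum>j. f j t) = (\<lambda>t. kern N r t * (w t * jost N t))"
    using jost_summable[OF N] by (auto simp: f_def jost_def suminf_mult)
  finally show ?thesis .
qed

lemma flux_integrable:
  assumes N: "L < real N" and [measurable]: "\<alpha> \<in> borel_measurable borel" 
    and \<alpha>: "\<And>t. 0 < t \<Longrightarrow> t < 1 \<Longrightarrow> \<bar>\<alpha> t\<bar> \<le> K"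
  shows "integrable lborel (\<lambda>t. \<alpha> t * w t * jost N t)"
proof -
  have "integrable lborel (\<lambda>t. (\<alpha> t * jost N t) * w t)"
  proof (rule w_mult_integrable)
    show "\<bar>\<alpha> t * jost N t\<bar> \<le> K * jost_bd N" if "0 < t" "t < 1" for t
      unfolding abs_mult using \<alpha>[OF that] jost_bd_pos[OF N] 
      by (intro mult_mono jost_abs_bound N) auto
  qed simp
  then show ?thesis by (simp add: mult_ac)
qed

lemma flux_density_integrable:
  assumes N: "L < real N"
  shows "integrable lborel (\<lambda>t. t ^ N * w t * jost N t)"
  by (rule flux_integrable[OF N, of _ 1]) (auto intro: power_le_one)

text \<open>
  The integral equation has the form \<open>c = 1 + \<phi> G - \<integral>\<phi> g\<close> with \<open>\<phi> t = -1/(N t\<^sup>N)\<close> and \<open>g = t\<^sup>N w c\<close>, so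
  \<open>has_derivative_weighted_indefinite_integral\<close> gives its derivative at every point, even though \<open>w\<close> is
  only integrable.
\<close>

lemma jost_deriv:
  assumes N: "L < real N" and r: "r > 0"
  shows "(jost N has_real_derivative flux N r / r ^ Suc N) (at r)"
proof -
  have N0: "N > 0" using N L_nonneg by (cases N) auto
  define \<phi> where "\<phi> t = - (1 / (real N * t ^ N))" for t :: real
  define g where "g t = t ^ N * w t * jost N t" for t
  have g_int: "integrable lborel g" unfolding g_def by (rule flux_density_integrable[OF N])
  have [measurable]: "\<phi> \<in> borel_measurable borel" "g \<in> borel_measurable borel"
    unfolding \<phi>_def g_def by measurable
  have \<phi>g: "\<phi> t * g t = - 1 / real N * w t * jost N t" for t
    by (cases "t \<in> {0<..<1}") (auto simp: \<phi>_def g_def w_support)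
  have \<phi>g_int: "integrable lborel (\<lambda>t. \<phi> t * g t)"
    unfolding \<phi>g by (rule flux_integrable[OF N, of _ "1 / real N"]) auto
  have "((\<lambda>s. \<phi> s * (\<integral>t. indicator {..<s} t * g t \<partial>lborel) - (\<integral>t. indicator {..<s} t * (\<phi> t * g t) \<partial>lborel))
           has_real_derivative (1 / r ^ Suc N) * (\<integral>t. indicator {..<r} t * g t \<partial>lborel)) (at r)"
  proof (rule has_derivative_weighted_indefinite_integral[OF g_int \<phi>g_int _ _ r, of "r + 1"])
    show "(\<phi> has_real_derivative 1 / t ^ Suc N) (at t)" if "0 < t" for t
      unfolding \<phi>_def[abs_def] using that N0
      by (auto intro!: derivative_eq_intros simp: power2_eq_square field_simps simp flip: power_Suc power_add)
  qed (auto intro!: continuous_intros)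
  moreover have "\<phi> s * (\<integral>t. indicator {..<s} t * g t \<partial>lborel) - (\<integral>t. indicator {..<s} t * (\<phi> t * g t) \<partial>lborel)
      = jost N s - 1" for s
  proof -
    have "\<phi> s * (\<integral>t. indicator {..<s} t * g t \<partial>lborel) - (\<integral>t. indicator {..<s} t * (\<phi> t * g t) \<partial>lborel)
      = (\<integral>t. \<phi> s * (indicator {..<s} t * g t) - indicator {..<s} t * (\<phi> t * g t) \<partial>lborel)"
      using integrable_mult_indicator[OF _ g_int, of "{..<s}"] integrable_mult_indicator[OF _ \<phi>g_int, of "{..<s}"]
      by (subst Bochner_Integration.integral_diff) auto
    also have "\<dots> = (\<integral>t. kern N s t * (w t * jost N t) \<partial>lborel)"
    proof (rule Bochner_Integration.integral_cong[OF refl])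
      fix t show "\<phi> s * (indicator {..<s} t * g t) - indicator {..<s} t * (\<phi> t * g t) = kern N s t * (w t * jost N t)"
      proof (cases "t \<in> {0<..<1} \<and> t < s")
        case True
        then show ?thesis using N0
          by (simp add: kern_def \<phi>_def g_def power_divide field_simps)
      next
        case False
        then show ?thesis by (cases "t \<in> {0<..<1}") (auto simp: kern_def g_def w_support)
      qed
    qed
    also have "\<dots> = jost N s - 1" using jost_integral_equation[OF N, of s] by simp
    finally show ?thesis .
  qed
  ultimately have "((\<lambda>s. jost N s - 1) has_real_derivative (1 / r ^ Suc N) * flux N r) (at r)"
    unfolding flux_def g_def by simp
  from DERIV_add[OF this DERIV_const[of 1]] show ?thesis by simp
qed

lemma flux_isCont: "L < real N \<Longrightarrow> isCont (flux N) r"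
  using isCont_indefinite_integral[OF flux_density_integrable, of N r] by (simp add: flux_def[abs_def])

lemma flux_measurable [measurable]: "flux N \<in> borel_measurable borel"
proof -
  have "(\<lambda>r. \<integral>t. (if t < r then t ^ N * w t * jost N t else 0) \<partial>lborel) \<in> borel_measurable borel"
    by measurable
  moreover have "(if t < r then t ^ N * w t * jost N t else 0) = indicator {..<r} t * (t ^ N * w t * jost N t)" for r t
    by simp
  ultimately show ?thesis by (simp only: flux_def[abs_def])
qed

text \<open>The point is the factor \<open>r\<^sup>N\<close>, which compensates the singular powers of \<open>r\<close> by which the flux is divided later.\<close>

lemma flux_bound:
  assumes N: "L < real N" and r: "r > 0"
  shows "\<bar>flux N r\<bar> \<le> r ^ N * (jost_bd N * (\<integral>t. indicator {..<r} t * \<bar>w t\<bar> \<partial>lborel))"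
proof -
  have int: "integrable lborel (\<lambda>t. indicator {..<r} t * (t ^ N * w t * jost N t))"
    using integrable_mult_indicator[OF _ flux_density_integrable[OF N], of "{..<r}"] by simp
  have "integrable lborel (\<lambda>t. indicator {..<r} t * \<bar>w t\<bar>)"
    using integrable_mult_indicator[OF _ integrable_abs[OF w_integrable], of "{..<r}"] by simp
  then have int2: "integrable lborel (\<lambda>t. r ^ N * jost_bd N * (indicator {..<r} t * \<bar>w t\<bar>))" by (rule integrable_mult_right)
  have "\<bar>flux N r\<bar> \<le> (\<integral>t. \<bar>indicator {..<r} t * (t ^ N * w t * jost N t)\<bar> \<partial>lborel)"
    unfolding flux_def by (rule integral_abs_bound)
  also have "\<dots> \<le> (\<integral>t. r ^ N * jost_bd N * (indicator {..<r} t * \<bar>w t\<bar>) \<partial>lborel)"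
  proof (rule integral_mono[OF integrable_abs[OF int] int2])
    fix t
    show "\<bar>indicator {..<r} t * (t ^ N * w t * jost N t)\<bar> \<le> r ^ N * jost_bd N * (indicator {..<r} t * \<bar>w t\<bar>)"
    proof (cases "t \<in> {0<..<1} \<and> t < r")
      case True
      then have "\<bar>t ^ N * jost N t\<bar> \<le> r ^ N * jost_bd N"
        unfolding abs_mult by (intro mult_mono jost_abs_bound N) (auto intro: power_mono)
      from mult_right_mono[OF this, of "\<bar>w t\<bar>"] show ?thesis using True by (simp add: abs_mult mult_ac)
    next
      case False
      then show ?thesis by (cases "t \<in> {0<..<1}") (auto simp: w_support)
    qed
  qed
  also have "\<dots> = r ^ N * jost_bd N * (\<integral>t. indicator {..<r} t * \<bar>w t\<bar> \<partial>lborel)" by simp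
  finally show ?thesis by (simp only: mult.assoc)
qed

lemma w_initial_integral_le: "(\<integral>t. indicator {..<r} t * \<bar>w t\<bar> \<partial>lborel) \<le> L"
proof -
  have "(\<integral>t. indicator {..<r} t * \<bar>w t\<bar> \<partial>lborel) \<le> (\<integral>t. \<bar>w t\<bar> \<partial>lborel)"
    using integrable_mult_indicator[OF _ integrable_abs[OF w_integrable], of "{..<r}"] w_integrable
    by (intro integral_mono) (auto simp: indicator_def)
  then show ?thesis using w_bound by simp
qed

lemma flux_bound_L:
  assumes N: "L < real N" and r: "r > 0"
  shows "\<bar>flux N r\<bar> \<le> r ^ N * (jost_bd N * L)"
proof -
  have "r ^ N * (jost_bd N * (\<integral>t. indicator {..<r} t * \<bar>w t\<bar> \<partial>lborel)) \<le> r ^ N * (jost_bd N * L)"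
    using jost_bd_pos[OF N] r w_initial_integral_le by (intro mult_left_mono) auto
  then show ?thesis using flux_bound[OF N r] by linarith
qed

text \<open>The product rule for \<open>t\<^sup>-\<^sup>k \<alpha> \<cdot> flux\<close> in integrated form.\<close>

lemma flux_integration_by_parts:
  fixes \<alpha> \<alpha>' :: "real \<Rightarrow> real"
  assumes N: "L < real N" and k: "k \<le> N"
    and \<alpha>: "\<And>t. (\<alpha> has_real_derivative \<alpha>' t) (at t)" "continuous_on UNIV \<alpha>'"
    and r: "0 < r" "r \<le> s"
  shows "has_bochner_integral lborel
     (\<lambda>t. indicator {r..s} t * (t ^ (N - k) * w t * jost N t * \<alpha> t + (flux N t / t ^ k * \<alpha>' t - real k * (flux N t / t ^ Suc k) * \<alpha> t)))
     (\<alpha> s / s ^ k * flux N s - \<alpha> r / r ^ k * flux N r)"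
proof -
  have \<alpha>_cont: "continuous_on UNIV \<alpha>" using \<alpha>(1) by (meson DERIV_continuous continuous_at_imp_continuous_on)
  then have [measurable]: "\<alpha> \<in> borel_measurable borel" by (rule borel_measurable_continuous_onI)
  have "compact (\<alpha> ` {0..1})" by (intro compact_continuous_image continuous_on_subset[OF \<alpha>_cont]) auto
  then obtain K where K0: "\<forall>y\<in>\<alpha> ` {0..1}. norm y \<le> K" using compact_imp_bounded bounded_iff by blast
  have K: "\<bar>\<alpha> t\<bar> \<le> K" if "t \<in> {0..1}" for t using K0 that by (metis imageI real_norm_def)
  define \<phi> where "\<phi> t = \<alpha> t / t ^ k" for t
  define \<phi>' where "\<phi>' t = \<alpha>' t / t ^ k - real k * \<alpha> t / t ^ Suc k" for t
  define g where "g t = t ^ N * w t * jost N t" for t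
  have g_int: "integrable lborel g" unfolding g_def by (rule flux_density_integrable[OF N])
  have \<phi>g: "\<phi> t * g t = t ^ (N - k) * \<alpha> t * w t * jost N t" for t
  proof (cases "t \<in> {0<..<1}")
    case True
    then have "t ^ N = t ^ k * t ^ (N - k)" using k by (simp flip: power_add)
    then show ?thesis using True by (simp add: \<phi>_def g_def)
  qed (auto simp: \<phi>_def g_def w_support)
  have \<phi>g_int: "integrable lborel (\<lambda>t. \<phi> t * g t)"
    unfolding \<phi>g
  proof (rule flux_integrable[OF N])
    show "\<bar>t ^ (N - k) * \<alpha> t\<bar> \<le> 1 * K" if "0 < t" "t < 1" for t
      unfolding abs_mult using that by (intro mult_mono K) (auto intro: power_le_one)
  qed simp
  have "has_bochner_integral lborel (\<lambda>t. indicator {r..s} t * (\<phi> t * g t + \<phi>' t * flux N t)) (\<phi> s * flux N s - \<phi> r * flux N r)"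
  proof (rule weighted_integration_by_parts[OF g_int \<phi>g_int _ _ _ r, of "s + 1"])
    show "(\<phi> has_real_derivative \<phi>' t) (at t)" if "0 < t" for t
      unfolding \<phi>_def[abs_def] \<phi>'_def
    proof (rule DERIV_cong[OF DERIV_divide[OF \<alpha>(1) DERIV_power[OF DERIV_ident]]])
      show "t ^ k \<noteq> 0" using that by simp
      show "(\<alpha>' t * t ^ k - \<alpha> t * (real k * (1 * t ^ (k - Suc 0)))) / (t ^ k * t ^ k) = \<alpha>' t / t ^ k - real k * \<alpha> t / t ^ Suc k"
        using that by (cases k) (simp_all add: field_simps)
    qed
    show "continuous_on {0<..<s + 1} \<phi>'"
      unfolding \<phi>'_def by (intro continuous_intros continuous_on_subset[OF \<alpha>(2)] continuous_on_subset[OF \<alpha>_cont]) auto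
    show "flux N s = (\<integral>t. indicator {..<s} t * g t \<partial>lborel)" for s by (simp add: flux_def g_def)
  qed simp
  moreover have "\<phi> t * g t + \<phi>' t * flux N t = t ^ (N - k) * w t * jost N t * \<alpha> t + (flux N t / t ^ k * \<alpha>' t - real k * (flux N t / t ^ Suc k) * \<alpha> t)" for t
    unfolding \<phi>g by (simp add: \<phi>'_def algebra_simps)
  ultimately show ?thesis by (simp add: \<phi>_def)
qed

text \<open>
  Green's formula along one ray: \<open>\<alpha>\<close> will be a test function restricted to the ray. The
  boundary term at the origin vanishes because the flux is \<open>O(r\<^sup>N)\<close> and \<open>k < N\<close>.
\<close>

lemma radial_Green:
  fixes \<alpha> \<alpha>' :: "real \<Rightarrow> real"
  assumes N: "L < real N" and k: "k < N"
    and \<alpha>: "\<And>t. (\<alpha> has_real_derivative \<alpha>' t) (at t)" "continuous_on UNIV \<alpha>'"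
  shows "(\<integral>t. indicator {0<..<1} t * (t ^ (N - k) * w t * jost N t * \<alpha> t + (flux N t / t ^ k * \<alpha>' t - real k * (flux N t / t ^ Suc k) * \<alpha> t)) \<partial>lborel)
     = \<alpha> 1 * flux N 1"
proof -
  have \<alpha>_cont: "continuous_on UNIV \<alpha>" using \<alpha>(1) by (meson DERIV_continuous continuous_at_imp_continuous_on)
  then have [measurable]: "\<alpha> \<in> borel_measurable borel" "\<alpha>' \<in> borel_measurable borel" 
    using \<alpha>(2) by (auto intro: borel_measurable_continuous_onI)
  have "compact (\<alpha> ` {0..1})" "compact (\<alpha>' ` {0..1})"
    by (intro compact_continuous_image continuous_on_subset[OF \<alpha>_cont] continuous_on_subset[OF \<alpha>(2)]; auto)+
  then obtain K K' where K0: "\<forall>y\<in>\<alpha> ` {0..1}. norm y \<le> K" "\<forall>y\<in>\<alpha>' ` {0..1}. norm y \<le> K'"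
    using compact_imp_bounded bounded_iff by meson
  have K: "\<bar>\<alpha> t\<bar> \<le> K" "\<bar>\<alpha>' t\<bar> \<le> K'" if "t \<in> {0..1}" for t using K0 that by (metis imageI real_norm_def)+
  have Kpos: "K \<ge> 0" "K' \<ge> 0" using K[of 0] by auto
  let ?C = "jost_bd N"
  have C: "?C > 0" by (rule jost_bd_pos[OF N])
  define F where "F t = t ^ (N - k) * w t * jost N t * \<alpha> t + (flux N t / t ^ k * \<alpha>' t - real k * (flux N t / t ^ Suc k) * \<alpha> t)" for t
  have [measurable]: "F \<in> borel_measurable borel" unfolding F_def by measurable
  have fluxdiv: "\<bar>flux N t / t ^ j\<bar> \<le> ?C * L" if t: "t \<in> {0<..1}" and j: "j \<le> N" for t j
  proof -
    have "\<bar>flux N t\<bar> \<le> t ^ j * (t ^ (N - j) * (?C * L))"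
      using flux_bound_L[OF N, of t] t j by (simp add: mult.assoc[symmetric] flip: power_add)
    also have "\<dots> \<le> t ^ j * (1 * (?C * L))"
      using t C L_nonneg by (intro mult_left_mono mult_right_mono power_le_one) auto
    finally show ?thesis using t by (simp add: field_simps)
  qed
  have F_bound: "\<bar>F t\<bar> \<le> ?C * K * \<bar>w t\<bar> + (?C * L * K' + real k * (?C * L) * K)" if t: "t \<in> {0<..1}" for t
  proof -
    have "\<bar>t ^ (N - k) * w t * jost N t * \<alpha> t\<bar> \<le> 1 * \<bar>w t\<bar> * ?C * K"
      unfolding abs_mult using t C
      by (intro mult_mono jost_abs_bound N K) (auto intro: power_le_one)
    moreover have "\<bar>flux N t / t ^ k * \<alpha>' t\<bar> \<le> ?C * L * K'"
      unfolding abs_mult using t C k L_nonneg by (intro mult_mono fluxdiv K) auto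
    moreover have "\<bar>real k * (flux N t / t ^ Suc k) * \<alpha> t\<bar> \<le> real k * (?C * L) * K"
      unfolding abs_mult[of _ "\<alpha> t"] abs_mult[of "real k"] using t C k L_nonneg by (intro mult_mono fluxdiv K) auto
    moreover have "1 * \<bar>w t\<bar> * ?C * K = ?C * K * \<bar>w t\<bar>" by simp
    ultimately show ?thesis unfolding F_def by linarith
  qed
  have lim: "(\<lambda>n. \<integral>t. indicator {inverse (real (Suc n))..1} t * F t \<partial>lborel) \<longlonglongrightarrow> (\<integral>t. indicator {0<..<1} t * F t \<partial>lborel)"
  proof (rule integral_dominated_convergence[where w = "\<lambda>t. ?C * K * \<bar>w t\<bar> + indicator {0..1} t * (?C * L * K' + real k * (?C * L) * K)"])
    show "integrable lborel (\<lambda>t. ?C * K * \<bar>w t\<bar> + indicator {0..1} t * (?C * L * K' + real k * (?C * L) * K))"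
      using w_integrable by auto
    show "AE t in lborel. norm (indicator {inverse (real (Suc i))..1} t * F t)
       \<le> ?C * K * \<bar>w t\<bar> + indicator {0..1} t * (?C * L * K' + real k * (?C * L) * K)" for i
    proof (rule AE_I2)
      fix t :: real
      show "norm (indicator {inverse (real (Suc i))..1} t * F t)
         \<le> ?C * K * \<bar>w t\<bar> + indicator {0..1} t * (?C * L * K' + real k * (?C * L) * K)"
      proof (cases "t \<in> {inverse (real (Suc i))..1}")
        case True
        moreover have "inverse (real (Suc i)) > 0" by simp
        ultimately have "t \<in> {0<..1}" by (meson atLeastAtMost_iff greaterThanAtMost_iff less_le_trans)
        then show ?thesis using F_bound[of t] True by (auto simp: indicator_def)
      next
        case False
        then show ?thesis using C Kpos L_nonneg by (auto simp: indicator_def)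
      qed
    qed
    show "AE t in lborel. (\<lambda>i. indicator {inverse (real (Suc i))..1} t * F t) \<longlonglongrightarrow> indicator {0<..<1} t * F t"
      using AE_lborel_singleton[of 1]
    proof eventually_elim
      fix t :: real assume t: "t \<noteq> 1"
      have "eventually (\<lambda>i. indicator {inverse (real (Suc i))..1} t = (indicator {0<..<1} t :: real)) sequentially"
      proof (cases "t > 0")
        case True
        have "eventually (\<lambda>i. inverse (real (Suc i)) < t) sequentially"
          using order_tendstoD(2)[OF LIMSEQ_inverse_real_of_nat True] .
        then show ?thesis using True t by (auto elim!: eventually_mono simp: indicator_def of_bool_def simp del: of_nat_Suc)
      next
        case False
        then have "\<not> inverse (real (Suc i)) \<le> t" for i
          by (smt (verit) inverse_positive_iff_positive of_nat_0_less_iff zero_less_Suc)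
        then show ?thesis using False by (auto simp: indicator_def simp del: of_nat_Suc)
      qed
      then show "(\<lambda>i. indicator {inverse (real (Suc i))..1} t * F t) \<longlonglongrightarrow> indicator {0<..<1} t * F t"
        by (intro tendsto_eventually) (auto elim: eventually_mono)
    qed
  qed measurable
  have val: "(\<integral>t. indicator {inverse (real (Suc n))..1} t * F t \<partial>lborel)
      = \<alpha> 1 * flux N 1 - \<alpha> (inverse (real (Suc n))) / inverse (real (Suc n)) ^ k * flux N (inverse (real (Suc n)))" for n
    using flux_integration_by_parts[OF N less_imp_le[OF k] \<alpha>, of "inverse (real (Suc n))" 1]
    by (simp add: F_def has_bochner_integral_iff inverse_le_1_iff)
  have "(\<lambda>n. \<alpha> (inverse (real (Suc n))) / inverse (real (Suc n)) ^ k * flux N (inverse (real (Suc n)))) \<longlonglongrightarrow> 0"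
  proof (rule Lim_null_comparison)
    show "(\<lambda>n. K * (?C * L) * inverse (real (Suc n))) \<longlonglongrightarrow> 0"
      using tendsto_mult[OF tendsto_const LIMSEQ_inverse_real_of_nat] by force
    show "\<forall>\<^sub>F n in sequentially. norm (\<alpha> (inverse (real (Suc n))) / inverse (real (Suc n)) ^ k * flux N (inverse (real (Suc n))))
       \<le> K * (?C * L) * inverse (real (Suc n))"
    proof (intro always_eventually allI)
      fix n
      define t where "t = inverse (real (Suc n))"
      have t: "t \<in> {0<..1}" by (simp add: t_def inverse_le_1_iff)
      have "\<bar>\<alpha> t / t ^ k * flux N t\<bar> = \<bar>\<alpha> t\<bar> * \<bar>flux N t / t ^ Suc k\<bar> * t"
        using t by (simp add: abs_mult field_simps)
      also have "\<dots> \<le> K * (?C * L) * t"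
        using t k Kpos by (intro mult_right_mono mult_mono K fluxdiv) auto
      finally show "norm (\<alpha> (inverse (real (Suc n))) / inverse (real (Suc n)) ^ k * flux N (inverse (real (Suc n))))
       \<le> K * (?C * L) * inverse (real (Suc n))" by (simp add: t_def)
    qed
  qed
  then have "(\<lambda>n. \<integral>t. indicator {inverse (real (Suc n))..1} t * F t \<partial>lborel) \<longlonglongrightarrow> \<alpha> 1 * flux N 1 - 0"
    unfolding val by (intro tendsto_intros)
  from LIMSEQ_unique[OF lim this] show ?thesis by (simp add: F_def)
qed

text \<open>
  The function \<open>r\<^sup>k c(r)\<close> solves the radial equation of degree \<open>k\<close> in dimension \<open>d = e + 2\<close>, in the integrated
  form that is used for Caratheodory solutions.
\<close>

lemma radial_equation:
  assumes N: "L < real (2 * k + e)" and k: "k \<ge> 1" and r: "0 < r" "r \<le> 1"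
  defines "N \<equiv> 2 * k + e"
  shows "((\<lambda>r. r ^ k * jost N r) has_real_derivative (real k * r ^ (k - 1) * jost N r + flux N r / r ^ (k + e + 1))) (at r)"
    and "has_bochner_integral lborel
      (\<lambda>t. indicator {r..1} t * (t ^ (e + 1) * (real k * (real k + real e) / t\<^sup>2 + w t / t) * (t ^ k * jost N t)))
      ((real k * jost N 1 + flux N 1) - r ^ (e + 1) * (real k * r ^ (k - 1) * jost N r + flux N r / r ^ (k + e + 1)))"
proof -
  have N': "L < real N" using N by (simp add: N_def)
  have split: "t ^ Suc N = t ^ k * t ^ (k + e + 1)" for t :: real by (simp add: N_def flip: power_add power_Suc) (simp add: mult_2 add.assoc)
  show "((\<lambda>r. r ^ k * jost N r) has_real_derivative (real k * r ^ (k - 1) * jost N r + flux N r / r ^ (k + e + 1))) (at r)"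
    using r jost_deriv[OF N' r(1)] 
    by (auto intro!: derivative_eq_intros simp: split[of r] simp del: power_Suc)
  have fluxeq: "t ^ (k + e) * (flux N t / t ^ Suc N) = flux N t / t ^ Suc k" if "t > 0" for t
  proof -
    have "t ^ Suc N = t ^ (k + e) * t ^ Suc k"
      by (simp add: N_def mult_2 add_ac flip: power_add power_Suc)
    then show ?thesis using that by simp
  qed
  have 1: "has_bochner_integral lborel
     (\<lambda>t. indicator {r..1} t * (t ^ (N - k) * w t * jost N t - real k * (flux N t / t ^ Suc k)))
     (flux N 1 - flux N r / r ^ k)"
    using flux_integration_by_parts[OF N', of k "\<lambda>_. 1" "\<lambda>_. 0" r 1] r by (simp add: N_def)
  have "has_bochner_integral lborel (\<lambda>t. (real k * (real (k + e) * t ^ (k + e - 1) * jost N t + flux N t / t ^ Suc k)) * indicator {r..1} t)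
     (real k * (1 ^ (k + e) * jost N 1) - real k * (r ^ (k + e) * jost N r))"
  proof (rule has_bochner_integral_FTC_Icc_real)
    fix t assume "r \<le> t" "t \<le> 1"
    then have t: "t > 0" using r by simp
    have "((\<lambda>t. t ^ (k + e) * jost N t) has_real_derivative (real (k + e) * t ^ (k + e - 1) * jost N t + t ^ (k + e) * (flux N t / t ^ Suc N))) (at t)"
      using jost_deriv[OF N' t] by (auto intro!: derivative_eq_intros simp del: power_Suc)
    from DERIV_cmult[OF this[unfolded fluxeq[OF t]], of "real k"]
    show "((\<lambda>t. real k * (t ^ (k + e) * jost N t)) has_real_derivative real k * (real (k + e) * t ^ (k + e - 1) * jost N t + flux N t / t ^ Suc k)) (at t)" .
    have "isCont (jost N) t" using jost_deriv[OF N' t] by (rule DERIV_isCont)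
    then show "isCont (\<lambda>t. real k * (real (k + e) * t ^ (k + e - 1) * jost N t + flux N t / t ^ Suc k)) t"
      using t by (intro continuous_intros flux_isCont N') auto
  qed (use r in auto)
  from has_bochner_integral_add[OF 1 this]
  have 2: "has_bochner_integral lborel
     (\<lambda>t. indicator {r..1} t * (t ^ (N - k) * w t * jost N t - real k * (flux N t / t ^ Suc k))
       + (real k * (real (k + e) * t ^ (k + e - 1) * jost N t + flux N t / t ^ Suc k)) * indicator {r..1} t)
     ((flux N 1 - flux N r / r ^ k) + (real k * jost N 1 - real k * (r ^ (k + e) * jost N r)))" by simp
  have 3: "indicator {r..1} t * (t ^ (N - k) * w t * jost N t - real k * (flux N t / t ^ Suc k))
       + (real k * (real (k + e) * t ^ (k + e - 1) * jost N t + flux N t / t ^ Suc k)) * indicator {r..1} t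
       = indicator {r..1} t * (t ^ (e + 1) * (real k * (real k + real e) / t\<^sup>2 + w t / t) * (t ^ k * jost N t))" for t
  proof (cases "t \<in> {r..1}")
    case True
    then have t: "t > 0" using r by simp
    obtain j where j: "k = Suc j" using k by (cases k) auto
    have Nk: "N - k = k + e" by (simp add: N_def)
    have "t ^ (e + 1) * (real k * (real k + real e) / t\<^sup>2 + w t / t) * (t ^ k * jost N t)
       = real k * (real k + real e) * (t ^ (e + 1) * t ^ k / t\<^sup>2) * jost N t + (t ^ (e + 1) * t ^ k / t) * w t * jost N t"
      by (simp add: algebra_simps)
    also have "t ^ (e + 1) * t ^ k / t\<^sup>2 = t ^ (k + e - 1)" using t j by (simp add: power_add power2_eq_square)
    also have "t ^ (e + 1) * t ^ k / t = t ^ (k + e)" using t by (simp add: power_add)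
    finally show ?thesis using True Nk by (simp add: algebra_simps)
  qed simp
  have 4: "(flux N 1 - flux N r / r ^ k) + (real k * jost N 1 - real k * (r ^ (k + e) * jost N r))
      = (real k * jost N 1 + flux N 1) - r ^ (e + 1) * (real k * r ^ (k - 1) * jost N r + flux N r / r ^ (k + e + 1))"
  proof -
    obtain j where j: "k = Suc j" using k by (cases k) auto
    have "r ^ (e + 1) * (real k * r ^ (k - 1) * jost N r + flux N r / r ^ (k + e + 1))
       = real k * (r ^ (e + 1) * r ^ (k - 1)) * jost N r + flux N r * (r ^ (e + 1) / r ^ (k + e + 1))"
      by (simp add: algebra_simps)
    also have "r ^ (e + 1) * r ^ (k - 1) = r ^ (k + e)" by (simp add: j flip: power_add power_Suc) (simp add: algebra_simps)
    also have "r ^ (e + 1) / r ^ (k + e + 1) = 1 / r ^ k" using r by (simp add: power_add)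
    finally show ?thesis by (simp add: algebra_simps)
  qed
  show "has_bochner_integral lborel
      (\<lambda>t. indicator {r..1} t * (t ^ (e + 1) * (real k * (real k + real e) / t\<^sup>2 + w t / t) * (t ^ k * jost N t)))
      ((real k * jost N 1 + flux N 1) - r ^ (e + 1) * (real k * r ^ (k - 1) * jost N r + flux N r / r ^ (k + e + 1)))"
    using 2 unfolding 3 4 .
qed

end


section \<open>Polar coordinates\<close>

definition radial_measure :: "nat \<Rightarrow> real measure" where
  "radial_measure d = density lborel (\<lambda>r. ennreal (indicator {0<..<1} r * r ^ (d - 1)))"

text \<open>Borel measure on the ball, without the origin, where the direction \<open>x/|x|\<close> makes no sense.\<close>

abbreviation punctured_ball :: "'a::euclidean_space measure" where
  "punctured_ball \<equiv> restrict_space lborel (ball 0 1 - {0})"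

lemma space_sphere_measure [simp]: "space (sphere_measure :: 'a::euclidean_space measure) = sphere 0 1"
  by (simp add: sphere_measure_def space_scale_measure space_restrict_space)

lemma sets_sphere_measure [measurable_cong, simp]:
  "sets (sphere_measure :: 'a::euclidean_space measure) = sets (restrict_space borel (sphere 0 1))"
  by (simp add: sphere_measure_def)

lemma borel_measurable_sphere_measure:
  "f \<in> borel_measurable borel \<Longrightarrow> f \<in> borel_measurable (sphere_measure :: 'a::euclidean_space measure)"
  by (metis measurable_cong_sets measurable_restrict_space1 sets_sphere_measure)

lemma normalize_measurable:
  "(\<lambda>x::'a::euclidean_space. x /\<^sub>R norm x) \<in> punctured_ball \<rightarrow>\<^sub>M restrict_space borel (sphere 0 1)"
proof (rule measurable_restrict_space2)
  show "(\<lambda>x::'a. x /\<^sub>R norm x) \<in> space punctured_ball \<rightarrow> sphere 0 1"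
    by (auto simp: space_restrict_space)
  have "(\<lambda>x::'a. x /\<^sub>R norm x) \<in> borel_measurable borel" by measurable
  then show "(\<lambda>x::'a. x /\<^sub>R norm x) \<in> borel_measurable punctured_ball"
    by (intro measurable_restrict_space1) simp
qed

lemma normalize_measurable_lebesgue:
  "(\<lambda>x::'a::euclidean_space. x /\<^sub>R norm x) \<in> lebesgue_on (ball 0 1 - {0}) \<rightarrow>\<^sub>M restrict_space borel (sphere 0 1)"
proof (rule measurable_restrict_space2)
  show "(\<lambda>x::'a. x /\<^sub>R norm x) \<in> space (lebesgue_on (ball 0 1 - {0})) \<rightarrow> sphere 0 1" by auto
  have "(\<lambda>x::'a. x /\<^sub>R norm x) \<in> borel_measurable borel" by measurable
  then have "(\<lambda>x::'a. x /\<^sub>R norm x) \<in> borel_measurable lebesgue"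
    by (intro measurable_completion) simp
  then show "(\<lambda>x::'a. x /\<^sub>R norm x) \<in> borel_measurable (lebesgue_on (ball 0 1 - {0}))"
    by (rule measurable_restrict_space1)
qed

lemma cone_sets:
  assumes "B \<in> sets (restrict_space borel (sphere (0::'a::euclidean_space) 1))"
  shows "{x::'a. x \<noteq> 0 \<and> x /\<^sub>R norm x \<in> B} \<in> sets borel"
proof -
  have B: "B \<in> sets borel" "B \<subseteq> sphere 0 1"
    using assms by (auto simp: sets_restrict_space_iff)
  note B(1)[measurable]
  show ?thesis by measurable
qed

text \<open>The surface measure of \<open>B\<close> is \<open>d\<close> times the volume of the cone over \<open>B\<close>.\<close>

lemma emeasure_sphere_measure:
  assumes B: "B \<in> sets (restrict_space borel (sphere (0::'a::euclidean_space) 1))"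
  shows "emeasure sphere_measure B = of_nat DIM('a) * emeasure lborel {x::'a. 0 < norm x \<and> norm x < 1 \<and> x /\<^sub>R norm x \<in> B}"
proof -
  note cone_sets[OF B, measurable]
  have "{x::'a. 0 < norm x \<and> norm x < 1 \<and> x /\<^sub>R norm x \<in> B} = {x. x \<noteq> 0 \<and> x /\<^sub>R norm x \<in> B} \<inter> ball 0 1" by auto
  then have S: "{x::'a. 0 < norm x \<and> norm x < 1 \<and> x /\<^sub>R norm x \<in> B} \<in> sets borel" by simp
  have "emeasure sphere_measure B = of_nat DIM('a) *
     emeasure (lebesgue_on (ball 0 1 - {0})) ((\<lambda>x::'a. x /\<^sub>R norm x) -` B \<inter> (ball 0 1 - {0}))"
    unfolding sphere_measure_def using B
    by (simp add: emeasure_distr[OF normalize_measurable_lebesgue])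
  also have "(\<lambda>x::'a. x /\<^sub>R norm x) -` B \<inter> (ball 0 1 - {0}) = {x. 0 < norm x \<and> norm x < 1 \<and> x /\<^sub>R norm x \<in> B}"
    by auto
  also have "emeasure (lebesgue_on (ball 0 1 - {0})) {x::'a. 0 < norm x \<and> norm x < 1 \<and> x /\<^sub>R norm x \<in> B}
     = emeasure lebesgue {x. 0 < norm x \<and> norm x < 1 \<and> x /\<^sub>R norm x \<in> B}"
    by (subst emeasure_restrict_space) auto
  also have "\<dots> = emeasure lborel {x. 0 < norm x \<and> norm x < 1 \<and> x /\<^sub>R norm x \<in> B}"
    using S by simp
  finally show ?thesis .
qed

lemma finite_sphere_measure: "finite_measure (sphere_measure :: 'a::euclidean_space measure)"
proof (rule finite_measureI)
  have S: "sphere 0 1 \<in> sets (restrict_space borel (sphere (0::'a) 1))"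
    by (simp add: sets_restrict_space_iff)
  have "emeasure lborel {x::'a. 0 < norm x \<and> norm x < 1 \<and> x /\<^sub>R norm x \<in> sphere 0 1} \<le> emeasure lborel (ball (0::'a) 1)"
    by (intro emeasure_mono) auto
  also have "\<dots> < \<infinity>" by (rule emeasure_lborel_ball_finite)
  finally show "emeasure (sphere_measure :: 'a measure) (space sphere_measure) \<noteq> \<infinity>"
    unfolding space_sphere_measure emeasure_sphere_measure[OF S]
    by (simp add: ennreal_mult_eq_top_iff)
qed

lemma emeasure_lborel_scaled:
  fixes A :: "'a::euclidean_space set"
  assumes A: "A \<in> sets borel" and c: "c > 0"
  shows "emeasure lborel A = ennreal (c ^ DIM('a)) * emeasure lborel ((\<lambda>x. c *\<^sub>R x) -` A)"
proof -
  have "emeasure lborel A = emeasure (density (distr lborel borel (\<lambda>x::'a. 0 + c *\<^sub>R x)) (\<lambda>_. \<bar>c\<bar> ^ DIM('a))) A"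
    using lborel_affine[of c "0::'a"] c by simp
  also have "\<dots> = ennreal (c ^ DIM('a)) * emeasure lborel ((\<lambda>x. c *\<^sub>R x) -` A)"
    using A c by (simp add: emeasure_density nn_integral_cmult emeasure_distr ennreal_power)
  finally show ?thesis .
qed

text \<open>By scaling, after removing the sphere of radius \<open>1\<close>, which is a null set.\<close>

lemma emeasure_truncated_cone:
  assumes B: "B \<in> sets (restrict_space borel (sphere (0::'a::euclidean_space) 1))" and \<rho>: "0 \<le> \<rho>"
  shows "emeasure lborel {x::'a. 0 < norm x \<and> norm x \<le> \<rho> \<and> x /\<^sub>R norm x \<in> B}
      = ennreal (\<rho> ^ DIM('a)) * emeasure lborel {x::'a. 0 < norm x \<and> norm x < 1 \<and> x /\<^sub>R norm x \<in> B}"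
proof (cases "\<rho> = 0")
  case True
  then have "{x::'a. 0 < norm x \<and> norm x \<le> \<rho> \<and> x /\<^sub>R norm x \<in> B} = {}" by auto
  then show ?thesis using True by (simp del: Collect_empty_eq)
next
  case False
  note cone_sets[OF B, measurable]
  define E where "E = {x::'a. 0 < norm x \<and> norm x < 1 \<and> x /\<^sub>R norm x \<in> B}"
  define F where "F \<rho> = {x::'a. 0 < norm x \<and> norm x \<le> \<rho> \<and> x /\<^sub>R norm x \<in> B}" for \<rho>
  have "E = {x. x \<noteq> 0 \<and> x /\<^sub>R norm x \<in> B} \<inter> ball 0 1" "F r = {x. x \<noteq> 0 \<and> x /\<^sub>R norm x \<in> B} \<inter> cball 0 r" for r
    by (auto simp: E_def F_def)
  then have sets: "E \<in> sets borel" "F r \<in> sets borel" for r by simp_all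
  have "emeasure lborel (F \<rho>) = ennreal (\<rho> ^ DIM('a)) * emeasure lborel ((\<lambda>x. \<rho> *\<^sub>R x) -` F \<rho>)"
    using False \<rho> by (intro emeasure_lborel_scaled sets) simp
  also have "(\<lambda>x. \<rho> *\<^sub>R x) -` F \<rho> = F 1"
    using False \<rho> by (auto simp: F_def field_simps)
  also have "emeasure lborel (F 1) = emeasure lborel E"
  proof (rule emeasure_eq_AE)
    have "sphere (0::'a) 1 \<in> null_sets lborel"
      using negligible_sphere[of "0::'a" 1]
      by (auto simp: null_sets_completion_iff negligible_iff_null_sets)
    then have "AE x in lborel. x \<notin> sphere (0::'a) 1" by (rule AE_not_in)
    then show "AE x in lborel. (x \<in> F 1) = (x \<in> E)" by eventually_elim (auto simp: E_def F_def)
  qed (use sets in auto)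
  finally show ?thesis by (simp add: E_def F_def)
qed

lemma finite_radial_measure: "finite_measure (radial_measure d)"
proof (rule finite_measureI)
  have "emeasure (radial_measure d) (space (radial_measure d)) = (\<integral>\<^sup>+r. ennreal (indicator {0<..<1} r * r ^ (d - 1)) \<partial>lborel)"
    by (simp add: radial_measure_def emeasure_density)
  also have "\<dots> \<le> (\<integral>\<^sup>+r. indicator {0<..<1::real} r \<partial>lborel)"
    by (intro nn_integral_mono) (auto simp: indicator_def power_le_one)
  also have "\<dots> < \<infinity>" by simp
  finally show "emeasure (radial_measure d) (space (radial_measure d)) \<noteq> \<infinity>" by simp
qed

lemma sets_radial_measure [simp, measurable_cong]: "sets (radial_measure d) = sets borel"
  by (simp add: radial_measure_def)

text \<open>
  It suffices to compare the measures of \<open>{x<..} \<times> B\<close>. The preimage of this set is the difference of two cones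
  over \<open>B\<close>, so its volume is known by scaling.
\<close>

lemma polar_distr:
  "radial_measure DIM('a) \<Otimes>\<^sub>M sphere_measure =
     distr punctured_ball (borel \<Otimes>\<^sub>M restrict_space borel (sphere 0 1)) (\<lambda>x::'a::euclidean_space. (norm x, x /\<^sub>R norm x))"
proof (rule pair_measure_eqI)
  let ?d = "DIM('a)"
  interpret S: finite_measure "sphere_measure :: 'a measure" by (rule finite_sphere_measure)
  show "sigma_finite_measure (sphere_measure :: 'a measure)" by unfold_locales
  interpret R: finite_measure "radial_measure ?d" by (rule finite_radial_measure)
  show "sigma_finite_measure (radial_measure ?d)" by unfold_locales
  have T: "(\<lambda>x::'a. (norm x, x /\<^sub>R norm x)) \<in> punctured_ball \<rightarrow>\<^sub>M borel \<Otimes>\<^sub>M restrict_space borel (sphere 0 1)"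
    by (intro measurable_Pair normalize_measurable measurable_restrict_space1) simp
  show "sets (radial_measure ?d \<Otimes>\<^sub>M (sphere_measure :: 'a measure)) =
     sets (distr punctured_ball (borel \<Otimes>\<^sub>M restrict_space borel (sphere 0 1)) (\<lambda>x::'a. (norm x, x /\<^sub>R norm x)))"
    unfolding sets_distr by (intro sets_pair_measure_cong) (simp_all add: radial_measure_def)
  fix A :: "real set" and B :: "'a set"
  assume A: "A \<in> sets (radial_measure ?d)" and B': "B \<in> sets sphere_measure"
  have B: "B \<in> sets (restrict_space borel (sphere 0 1))" using B' by simp
  have A': "A \<in> sets borel" using A by (simp add: radial_measure_def)
  note cone_sets[OF B, measurable]
  define C where "C = {x::'a. x \<noteq> 0 \<and> x /\<^sub>R norm x \<in> B} \<inter> ball 0 1"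
  have C_sets[measurable]: "C \<in> sets borel" unfolding C_def by simp
  have C_eq: "C = {x::'a. 0 < norm x \<and> norm x < 1 \<and> x /\<^sub>R norm x \<in> B}" by (auto simp: C_def)
  have C_fin: "emeasure lborel C < \<infinity>"
  proof -
    have "emeasure lborel C \<le> emeasure lborel (ball (0::'a) 1)" by (intro emeasure_mono) (auto simp: C_def)
    also have "\<dots> < \<infinity>" by (rule emeasure_lborel_ball_finite)
    finally show ?thesis .
  qed
  \<comment> \<open>For fixed \<open>B\<close>, both sides as measures of the radial set; they agree on half-lines.\<close>
  define M where "M = distr (density lborel (indicator C)) borel (norm :: 'a \<Rightarrow> real)"
  define N where "N = scale_measure (emeasure sphere_measure B) (radial_measure ?d)"
  have M_em: "emeasure M X = emeasure lborel {x\<in>C. norm x \<in> X}" if "X \<in> sets borel" for X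
  proof -
    have "emeasure M X = emeasure (density lborel (indicator C)) (norm -` X)"
      using that by (simp add: M_def emeasure_distr)
    also have "\<dots> = emeasure lborel (C \<inter> norm -` X)"
    proof (rule emeasure_restricted)
      have "(norm :: 'a \<Rightarrow> real) \<in> borel_measurable borel" by measurable
      from measurable_sets_borel[OF this that] show "(norm :: 'a \<Rightarrow> real) -` X \<in> sets lborel" by simp
    qed simp
    also have "C \<inter> norm -` X = {x\<in>C. norm x \<in> X}" by auto
    finally show ?thesis .
  qed
  have "M = N"
  proof (rule measure_eqI_lessThan)
    show "sets M = sets borel" "sets N = sets borel" by (simp_all add: M_def N_def radial_measure_def)
    have "emeasure M {x<..} \<le> emeasure lborel C" for x by (subst M_em) (auto intro!: emeasure_mono)
    then show "emeasure M {x<..} < \<infinity>" for x using C_fin by (rule le_less_trans)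
    fix x :: real
    have N_em: "emeasure N {x<..} = of_nat ?d * emeasure lborel C * (\<integral>\<^sup>+r. ennreal (indicator {max 0 x<..<1} r * r ^ (?d - 1)) \<partial>lborel)"
    proof -
      have "emeasure (radial_measure ?d) {x<..} = (\<integral>\<^sup>+r. ennreal (indicator {0<..<1} r * r ^ (?d - 1)) * indicator {x<..} r \<partial>lborel)"
        by (simp add: radial_measure_def emeasure_density)
      also have "\<dots> = (\<integral>\<^sup>+r. ennreal (indicator {max 0 x<..<1} r * r ^ (?d - 1)) \<partial>lborel)"
        by (intro nn_integral_cong) (auto simp: indicator_def)
      finally show ?thesis by (simp add: N_def emeasure_sphere_measure[OF B] C_eq mult.assoc)
    qed
    show "emeasure M {x<..} = emeasure N {x<..}"
    proof (cases "x < 1")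
      case False
      then have "{y\<in>C. norm y \<in> {x<..}} = {}" by (auto simp: C_def)
      moreover have "(\<lambda>r. ennreal (indicator {max 0 x<..<1} r * r ^ (?d - 1))) = (\<lambda>_. 0)" using False by (auto simp: indicator_def)
      ultimately show ?thesis unfolding N_em by (subst M_em) (simp_all del: Collect_empty_eq)
    next
      case True
      define \<rho> where "\<rho> = max 0 x"
      have \<rho>: "0 \<le> \<rho>" "\<rho> < 1" using True by (auto simp: \<rho>_def)
      have 1: "(\<integral>\<^sup>+r. ennreal (indicator {\<rho><..<1} r * r ^ (?d - 1)) \<partial>lborel) = ennreal ((1 - \<rho> ^ ?d) / real ?d)"
      proof -
        have "(\<integral>\<^sup>+r. ennreal (indicator {\<rho><..<1} r * r ^ (?d - 1)) \<partial>lborel)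
           = (\<integral>\<^sup>+r. ennreal (r ^ (?d - 1)) * indicator {\<rho>..1} r \<partial>lborel)"
        proof (rule nn_integral_cong_AE)
          show "AE r in lborel. ennreal (indicator {\<rho><..<1} r * r ^ (?d - 1)) = ennreal (r ^ (?d - 1)) * indicator {\<rho>..1} r"
            using AE_lborel_singleton[of \<rho>] AE_lborel_singleton[of 1] by eventually_elim (auto simp: indicator_def)
        qed
        also have "\<dots> = ennreal (1 ^ ?d / real ?d - \<rho> ^ ?d / real ?d)"
        proof (rule nn_integral_FTC_Icc)
          show "((\<lambda>r. r ^ ?d / real ?d) has_real_derivative r ^ (?d - 1)) (at r)" for r :: real
            by (auto intro!: derivative_eq_intros)
        qed (use \<rho> in auto)
        finally show ?thesis by (simp add: diff_divide_distrib)
      qed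
      have "{y\<in>C. norm y \<in> {x<..}} = C - {y. 0 < norm y \<and> norm y \<le> \<rho> \<and> y /\<^sub>R norm y \<in> B}"
        by (auto simp: C_eq \<rho>_def max_def intro: less_le_trans[OF _ norm_ge_zero])
      then have "emeasure M {x<..} = emeasure lborel (C - {y. 0 < norm y \<and> norm y \<le> \<rho> \<and> y /\<^sub>R norm y \<in> B})"
        by (subst M_em) simp_all
      also have "\<dots> = emeasure lborel C - emeasure lborel {y. 0 < norm y \<and> norm y \<le> \<rho> \<and> y /\<^sub>R norm y \<in> B}"
      proof (rule emeasure_Diff)
        have "{y::'a. 0 < norm y \<and> norm y \<le> \<rho> \<and> y /\<^sub>R norm y \<in> B} = {x. x \<noteq> 0 \<and> x /\<^sub>R norm x \<in> B} \<inter> cball 0 \<rho>" by auto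
        then show "{y::'a. 0 < norm y \<and> norm y \<le> \<rho> \<and> y /\<^sub>R norm y \<in> B} \<in> sets lborel" by simp
        show sub: "{y::'a. 0 < norm y \<and> norm y \<le> \<rho> \<and> y /\<^sub>R norm y \<in> B} \<subseteq> C" using \<rho> by (auto simp: C_eq)
        have "emeasure lborel {y::'a. 0 < norm y \<and> norm y \<le> \<rho> \<and> y /\<^sub>R norm y \<in> B} \<le> emeasure lborel C"
          by (intro emeasure_mono sub) simp
        then show "emeasure lborel {y::'a. 0 < norm y \<and> norm y \<le> \<rho> \<and> y /\<^sub>R norm y \<in> B} \<noteq> \<infinity>"
          using C_fin by auto
      qed simp
      also have "\<dots> = emeasure lborel C - ennreal (\<rho> ^ ?d) * emeasure lborel C"
        by (subst emeasure_truncated_cone[OF B \<rho>(1)]) (simp add: C_eq)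
      also have "\<dots> = ennreal (1 - \<rho> ^ ?d) * emeasure lborel C"
      proof -
        obtain c where c: "emeasure lborel C = ennreal c" "c \<ge> 0" using C_fin by (cases "emeasure lborel C") auto
        have "\<rho> ^ ?d \<le> 1" using \<rho> by (intro power_le_one) auto
        then show ?thesis using c \<rho> by (simp add: ennreal_mult[symmetric] ennreal_minus left_diff_distrib)
      qed
      also have "\<dots> = of_nat ?d * emeasure lborel C * ennreal ((1 - \<rho> ^ ?d) / real ?d)"
      proof -
        obtain c where c: "emeasure lborel C = ennreal c" "c \<ge> 0" using C_fin by (cases "emeasure lborel C") auto
        have "\<rho> ^ ?d \<le> 1" using \<rho> by (intro power_le_one) auto
        then show ?thesis using c \<rho> by (simp add: ennreal_mult[symmetric] ennreal_of_nat_eq_real_of_nat mult_ac)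
      qed
      finally show ?thesis unfolding N_em using 1 by (simp add: \<rho>_def)
    qed
  qed
  then have "emeasure N A = emeasure M A" by simp
  also have "\<dots> = emeasure lborel {x\<in>C. norm x \<in> A}" by (rule M_em[OF A'])
  also have "\<dots> = emeasure punctured_ball {x\<in>C. norm x \<in> A}"
    using A' by (subst emeasure_restrict_space) (auto simp: C_def)
  also have "{x\<in>C. norm x \<in> A} = (\<lambda>x::'a. (norm x, x /\<^sub>R norm x)) -` (A \<times> B) \<inter> space punctured_ball"
    by (auto simp: C_def space_restrict_space)
  also have "emeasure punctured_ball \<dots> = emeasure (distr punctured_ball (borel \<Otimes>\<^sub>M restrict_space borel (sphere 0 1)) (\<lambda>x::'a. (norm x, x /\<^sub>R norm x))) (A \<times> B)"
    using A' B by (subst emeasure_distr[OF T]) auto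
  finally show "emeasure (radial_measure ?d) A * emeasure sphere_measure B =
       emeasure (distr punctured_ball (borel \<Otimes>\<^sub>M restrict_space borel (sphere 0 1)) (\<lambda>x::'a. (norm x, x /\<^sub>R norm x))) (A \<times> B)"
    by (simp add: N_def mult.commute)
qed

lemma pair_sigma_finite_polar: "pair_sigma_finite (radial_measure d) (sphere_measure :: 'a::euclidean_space measure)"
proof -
  interpret R: finite_measure "radial_measure d" by (rule finite_radial_measure)
  interpret S: finite_measure "sphere_measure :: 'a measure" by (rule finite_sphere_measure)
  show ?thesis by unfold_locales
qed

lemma polar_map_measurable:
  "(\<lambda>x::'a::euclidean_space. (norm x, x /\<^sub>R norm x)) \<in> punctured_ball \<rightarrow>\<^sub>M borel \<Otimes>\<^sub>M restrict_space borel (sphere 0 1)"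
  by (intro measurable_Pair normalize_measurable measurable_restrict_space1) simp

lemma polar_scale_measurable:
  "(\<lambda>p. fst p *\<^sub>R (snd p :: 'a::euclidean_space)) \<in> borel \<Otimes>\<^sub>M restrict_space borel (sphere 0 1) \<rightarrow>\<^sub>M borel"
proof -
  have "snd \<in> borel_measurable ((borel :: real measure) \<Otimes>\<^sub>M restrict_space borel (sphere (0::'a) 1))"
    using measurable_compose[OF measurable_snd measurable_restrict_space1[OF measurable_ident]] by simp
  then show ?thesis by (intro borel_measurable_scaleR measurable_fst) simp_all
qed

lemma polar_nn_integral:
  fixes f :: "'a::euclidean_space \<Rightarrow> ennreal"
  assumes f: "f \<in> borel_measurable borel"
  shows "(\<integral>\<^sup>+x. f x \<partial>punctured_ball) = (\<integral>\<^sup>+\<omega>. (\<integral>\<^sup>+r. f (r *\<^sub>R \<omega>) \<partial>radial_measure DIM('a)) \<partial>sphere_measure)"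
proof -
  interpret P: pair_sigma_finite "radial_measure DIM('a)" "sphere_measure :: 'a measure" by (rule pair_sigma_finite_polar)
  have g: "(\<lambda>p. f (fst p *\<^sub>R snd p)) \<in> borel_measurable (borel \<Otimes>\<^sub>M restrict_space borel (sphere 0 1))"
    by (rule measurable_compose[OF polar_scale_measurable f])
  then have g': "(\<lambda>(r, \<omega>). f (r *\<^sub>R \<omega>)) \<in> borel_measurable (radial_measure DIM('a) \<Otimes>\<^sub>M sphere_measure)"
    unfolding polar_distr by (simp add: case_prod_beta')
  have "(\<integral>\<^sup>+\<omega>. (\<integral>\<^sup>+r. f (r *\<^sub>R \<omega>) \<partial>radial_measure DIM('a)) \<partial>sphere_measure)
     = (\<integral>\<^sup>+p. f (fst p *\<^sub>R snd p) \<partial>(radial_measure DIM('a) \<Otimes>\<^sub>M sphere_measure))"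
    using P.nn_integral_snd[OF g'] by (simp add: case_prod_beta')
  also have "\<dots> = (\<integral>\<^sup>+x. f (norm x *\<^sub>R (x /\<^sub>R norm x)) \<partial>punctured_ball)"
    unfolding polar_distr by (subst nn_integral_distr[OF polar_map_measurable]) (use g in simp_all)
  also have "\<dots> = (\<integral>\<^sup>+x. f x \<partial>punctured_ball)"
    by (intro nn_integral_cong) (auto simp: space_restrict_space)
  finally show ?thesis ..
qed

lemma integral_radial_measure:
  fixes f :: "real \<Rightarrow> real" assumes [measurable]: "f \<in> borel_measurable borel"
  shows "(\<integral>r. f r \<partial>radial_measure d) = (\<integral>r. indicator {0<..<1} r * (r ^ (d - 1) * f r) \<partial>lborel)"
  unfolding radial_measure_def
  by (subst integral_density) (auto simp: mult_ac indicator_def intro!: Bochner_Integration.integral_cong)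

lemma punctured_ball_integral:
  fixes f :: "'a::euclidean_space \<Rightarrow> real"
  assumes [measurable]: "f \<in> borel_measurable borel"
  shows "integrable ball_measure f \<longleftrightarrow> integrable punctured_ball f"
    and "(\<integral>x. f x \<partial>ball_measure) = (\<integral>x. f x \<partial>punctured_ball)"
proof -
  have [measurable]: "ball (0::'a) 1 \<in> sets borel" by simp
  have AE: "AE x in lborel. indicator (ball 0 1) x *\<^sub>R f x = indicator (ball 0 1 - {0}) x *\<^sub>R f x"
    using AE_lborel_singleton[of "0::'a"] by eventually_elim (auto simp: indicator_def)
  show "integrable ball_measure f \<longleftrightarrow> integrable punctured_ball f"
  proof -
    have "integrable ball_measure f \<longleftrightarrow> integrable lborel (\<lambda>x. indicator (ball 0 1) x *\<^sub>R f x)"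
      by (subst integrable_restrict_space, simp, rule integrable_completion, measurable)
    also have "\<dots> \<longleftrightarrow> integrable lborel (\<lambda>x. indicator (ball 0 1 - {0}) x *\<^sub>R f x)"
      by (rule integrable_cong_AE[OF _ _ AE]) simp_all
    also have "\<dots> \<longleftrightarrow> integrable punctured_ball f"
      by (subst integrable_restrict_space) simp_all
    finally show ?thesis .
  qed
  show "(\<integral>x. f x \<partial>ball_measure) = (\<integral>x. f x \<partial>punctured_ball)"
  proof -
    have "(\<integral>x. f x \<partial>ball_measure) = (\<integral>x. indicator (ball 0 1) x *\<^sub>R f x \<partial>lborel)"
      by (subst integral_restrict_space, simp, rule integral_completion, measurable)
    also have "\<dots> = (\<integral>x. indicator (ball 0 1 - {0}) x *\<^sub>R f x \<partial>lborel)"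
      by (rule integral_cong_AE[OF _ _ AE]) simp_all
    also have "\<dots> = (\<integral>x. f x \<partial>punctured_ball)"
      by (subst integral_restrict_space) simp_all
    finally show ?thesis .
  qed
qed

lemma polar_integral:
  fixes f :: "'a::euclidean_space \<Rightarrow> real"
  assumes f: "f \<in> borel_measurable borel" and int: "integrable ball_measure f"
  shows "(\<integral>x. f x \<partial>ball_measure) = (\<integral>\<omega>. (\<integral>r. indicator {0<..<1} r * (r ^ (DIM('a) - 1) * f (r *\<^sub>R \<omega>)) \<partial>lborel) \<partial>sphere_measure)"
proof -
  interpret P: pair_sigma_finite "radial_measure DIM('a)" "sphere_measure :: 'a measure" by (rule pair_sigma_finite_polar)
  have int': "integrable punctured_ball f" using int punctured_ball_integral(1)[OF f] by simp
  have g: "(\<lambda>p. f (fst p *\<^sub>R snd p)) \<in> borel_measurable (borel \<Otimes>\<^sub>M restrict_space borel (sphere 0 1))"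
    by (rule measurable_compose[OF polar_scale_measurable f])
  have eq: "f (norm x *\<^sub>R (x /\<^sub>R norm x)) = f x" if "x \<in> space punctured_ball" for x
    using that by (auto simp: space_restrict_space)
  have "integrable (radial_measure DIM('a) \<Otimes>\<^sub>M sphere_measure) (\<lambda>p. f (fst p *\<^sub>R snd p))"
    unfolding polar_distr
  proof -
    have "integrable punctured_ball (\<lambda>x. f (norm x *\<^sub>R (x /\<^sub>R norm x))) \<longleftrightarrow> integrable punctured_ball f"
      by (rule Bochner_Integration.integrable_cong[OF refl]) (rule eq)
    then show "integrable (distr punctured_ball (borel \<Otimes>\<^sub>M restrict_space borel (sphere 0 1)) (\<lambda>x::'a. (norm x, x /\<^sub>R norm x))) (\<lambda>p. f (fst p *\<^sub>R snd p))"
      using int' by (simp only: integrable_distr_eq[OF polar_map_measurable g] fst_conv snd_conv)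
  qed
  then have gint: "integrable (radial_measure DIM('a) \<Otimes>\<^sub>M sphere_measure) (\<lambda>(r, \<omega>). f (r *\<^sub>R \<omega>))"
    by (simp add: case_prod_beta')
  have "(\<integral>\<omega>. (\<integral>r. f (r *\<^sub>R \<omega>) \<partial>radial_measure DIM('a)) \<partial>sphere_measure)
     = (\<integral>p. f (fst p *\<^sub>R snd p) \<partial>(radial_measure DIM('a) \<Otimes>\<^sub>M sphere_measure))"
    using P.integral_snd[OF gint] by (simp add: case_prod_beta')
  also have "\<dots> = (\<integral>x. f (norm x *\<^sub>R (x /\<^sub>R norm x)) \<partial>punctured_ball)"
    unfolding polar_distr by (subst integral_distr[OF polar_map_measurable]) (use g in simp_all)
  also have "\<dots> = (\<integral>x. f x \<partial>punctured_ball)"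
    by (intro Bochner_Integration.integral_cong refl eq)
  also have "\<dots> = (\<integral>x. f x \<partial>ball_measure)" using punctured_ball_integral(2)[OF f] by simp
  also have "(\<integral>\<omega>. (\<integral>r. f (r *\<^sub>R \<omega>) \<partial>radial_measure DIM('a)) \<partial>sphere_measure)
     = (\<integral>\<omega>. (\<integral>r. indicator {0<..<1} r * (r ^ (DIM('a) - 1) * f (r *\<^sub>R \<omega>)) \<partial>lborel) \<partial>sphere_measure)"
  proof (rule Bochner_Integration.integral_cong[OF refl], rule integral_radial_measure)
    fix \<omega> :: 'a
    show "(\<lambda>r. f (r *\<^sub>R \<omega>)) \<in> borel_measurable borel"
      by (rule measurable_compose[OF _ f]) measurable
  qed
  finally show ?thesis ..
qed

lemma AE_radial_measure:
  assumes [measurable]: "N \<in> sets borel"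
  shows "emeasure (radial_measure d) N = 0 \<longleftrightarrow> (AE r in lborel. r \<in> {0<..<1} \<longrightarrow> r \<notin> N)"
proof -
  have "emeasure (radial_measure d) N = (\<integral>\<^sup>+r. ennreal (indicator {0<..<1} r * r ^ (d - 1)) * indicator N r \<partial>lborel)"
    by (simp add: radial_measure_def emeasure_density)
  also have "\<dots> = 0 \<longleftrightarrow> (AE r in lborel. ennreal (indicator {0<..<1} r * r ^ (d - 1)) * indicator N r = 0)"
    by (rule nn_integral_0_iff_AE) measurable
  also have "\<dots> \<longleftrightarrow> (AE r in lborel. r \<in> {0<..<1} \<longrightarrow> r \<notin> N)"
    by (intro AE_cong) (auto simp: indicator_def)
  finally show ?thesis .
qed

text \<open>
  Lebesgue and Borel measure on the ball have the same null properties, so measurability in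
  polar coordinates only has to be considered for Borel sets.
\<close>

lemma AE_ball_measure_iff:
  "(AE x in ball_measure. P x) \<longleftrightarrow> (AE x in lborel. x \<in> ball (0::'a::euclidean_space) 1 \<longrightarrow> P x)"
  by (subst AE_restrict_space_iff) (auto simp: AE_completion_iff)

text \<open>
  Fubini's theorem for null sets in polar coordinates. The exceptional set is enclosed in a Borel
  null set, since it need not be Borel itself.
\<close>

lemma AE_polar:
  fixes P :: "'a::euclidean_space \<Rightarrow> bool"
  assumes "AE x in ball_measure. P x"
  shows "AE \<omega> in sphere_measure. AE r in lborel. r \<in> {0<..<1} \<longrightarrow> P (r *\<^sub>R \<omega>)"
proof -
  obtain N where N: "{x \<in> space lborel. \<not> (x \<in> ball (0::'a) 1 \<longrightarrow> P x)} \<subseteq> N" "emeasure lborel N = 0" "N \<in> sets lborel"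
    using assms unfolding AE_ball_measure_iff by (rule AE_E)
  have [measurable]: "N \<in> sets borel" using N by simp
  have "(\<integral>\<^sup>+\<omega>. (\<integral>\<^sup>+r. indicator N (r *\<^sub>R \<omega>) \<partial>radial_measure DIM('a)) \<partial>sphere_measure) = (\<integral>\<^sup>+x. indicator N x \<partial>punctured_ball)"
    by (rule polar_nn_integral[symmetric]) measurable
  also have "\<dots> = (\<integral>\<^sup>+x. indicator N x * indicator (ball 0 1 - {0}) x \<partial>lborel)"
    by (subst nn_integral_restrict_space) auto
  also have "\<dots> \<le> (\<integral>\<^sup>+x. indicator N x \<partial>lborel)"
    by (intro nn_integral_mono) (auto simp: indicator_def)
  also have "\<dots> = 0" using N by simp
  finally have z: "(\<integral>\<^sup>+\<omega>. (\<integral>\<^sup>+r. indicator N (r *\<^sub>R \<omega>) \<partial>radial_measure DIM('a)) \<partial>sphere_measure) = 0" by simp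
  interpret Q: pair_sigma_finite "sphere_measure :: 'a measure" "radial_measure DIM('a)"
    using pair_sigma_finite_polar[of "DIM('a)", where 'a='a] by (simp add: pair_sigma_finite_def)
  have meas: "(\<lambda>(\<omega>, r). indicator N (r *\<^sub>R \<omega>) :: ennreal) \<in> borel_measurable (sphere_measure \<Otimes>\<^sub>M radial_measure DIM('a))"
  proof -
    have "(\<lambda>p. snd p *\<^sub>R (fst p :: 'a)) \<in> borel_measurable (restrict_space borel (sphere 0 1) \<Otimes>\<^sub>M (borel :: real measure))"
      using measurable_compose[OF measurable_fst measurable_restrict_space1[OF measurable_ident]]
      by (intro borel_measurable_scaleR measurable_snd) simp_all
    then have "(\<lambda>p. indicator N (snd p *\<^sub>R (fst p :: 'a)) :: ennreal) \<in> borel_measurable (restrict_space borel (sphere 0 1) \<Otimes>\<^sub>M (borel :: real measure))"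
      by (rule measurable_compose) measurable
    moreover have "sets ((sphere_measure :: 'a measure) \<Otimes>\<^sub>M radial_measure DIM('a)) = sets (restrict_space borel (sphere 0 1) \<Otimes>\<^sub>M borel)"
      by (intro sets_pair_measure_cong) simp_all
    ultimately show ?thesis by (simp add: case_prod_beta' cong: measurable_cong_sets)
  qed
  have "(\<lambda>\<omega>::'a. \<integral>\<^sup>+r. indicator N (r *\<^sub>R \<omega>) \<partial>radial_measure DIM('a)) \<in> borel_measurable sphere_measure"
    using Q.M2.borel_measurable_nn_integral_fst[OF meas] by simp
  from nn_integral_0_iff_AE[OF this] z
  have "AE \<omega> in sphere_measure. (\<integral>\<^sup>+r. indicator N (r *\<^sub>R \<omega>) \<partial>radial_measure DIM('a)) = 0" by simp
  with AE_space[of "sphere_measure :: 'a measure"] show ?thesis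
  proof eventually_elim
    fix \<omega> :: 'a
    define N' where "N' = (\<lambda>r. r *\<^sub>R \<omega>) -` N"
    have "(\<lambda>r. r *\<^sub>R \<omega>) \<in> borel_measurable borel" by measurable
    from measurable_sets_borel[OF this, of N] have N'[measurable]: "N' \<in> sets borel" by (simp add: N'_def)
    assume \<omega>: "\<omega> \<in> space sphere_measure"
    assume "(\<integral>\<^sup>+r. indicator N (r *\<^sub>R \<omega>) \<partial>radial_measure DIM('a)) = 0"
    moreover have "(\<integral>\<^sup>+r. indicator N (r *\<^sub>R \<omega>) \<partial>radial_measure DIM('a)) = (\<integral>\<^sup>+r. indicator N' r \<partial>radial_measure DIM('a))"
      by (intro nn_integral_cong) (simp add: N'_def indicator_def)
    ultimately have "emeasure (radial_measure DIM('a)) N' = 0" using N' by simp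
    then have AEr: "AE r in lborel. r \<in> {0<..<1} \<longrightarrow> r \<notin> N'" by (simp add: AE_radial_measure)
    show "AE r in lborel. r \<in> {0<..<1} \<longrightarrow> P (r *\<^sub>R \<omega>)"
      using AEr
    proof eventually_elim
      fix r :: real assume "r \<in> {0<..<1} \<longrightarrow> r \<notin> N'"
      then show "r \<in> {0<..<1} \<longrightarrow> P (r *\<^sub>R \<omega>)" using N(1)[THEN subsetD, of "r *\<^sub>R \<omega>"] \<omega> by (fastforce simp: N'_def)
    qed
  qed
qed

lemma AE_radial:
  assumes "AE r in lborel. r \<in> {0<..<1} \<longrightarrow> Q r"
  shows "AE x in ball_measure. x \<noteq> (0::'a::euclidean_space) \<longrightarrow> Q (norm x)"
proof -
  obtain N where N: "{r \<in> space lborel. \<not> (r \<in> {0<..<1} \<longrightarrow> Q r)} \<subseteq> N" "emeasure lborel N = 0" "N \<in> sets lborel"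
    using assms by (rule AE_E)
  have [measurable]: "N \<in> sets borel" using N by simp
  define N' where "N' = (norm :: 'a \<Rightarrow> real) -` N"
  have "(norm :: 'a \<Rightarrow> real) \<in> borel_measurable borel" by measurable
  from measurable_sets_borel[OF this, of N] have [measurable]: "N' \<in> sets borel" by (simp add: N'_def)
  have [measurable]: "ball 0 1 - {0::'a} \<in> sets borel" by simp
  have z: "emeasure (radial_measure DIM('a)) N = 0"
    unfolding AE_radial_measure[OF \<open>N \<in> sets borel\<close>]
  proof -
    have "AE r in lborel. r \<notin> N" using N by (intro AE_not_in null_setsI)
    then show "AE r in lborel. r \<in> {0<..<1} \<longrightarrow> r \<notin> N" by eventually_elim simp
  qed
  have "(\<integral>\<^sup>+x. indicator N' x * indicator (ball 0 1 - {0}) x \<partial>lborel) = (\<integral>\<^sup>+x. indicator N' x \<partial>punctured_ball)"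
    by (subst nn_integral_restrict_space) auto
  also have "\<dots> = (\<integral>\<^sup>+\<omega>. (\<integral>\<^sup>+r. indicator N' (r *\<^sub>R \<omega>) \<partial>radial_measure DIM('a)) \<partial>(sphere_measure :: 'a measure))"
    by (rule polar_nn_integral) measurable
  also have "\<dots> = (\<integral>\<^sup>+\<omega>. 0 \<partial>(sphere_measure :: 'a measure))"
  proof (rule nn_integral_cong)
    fix \<omega> :: 'a assume "\<omega> \<in> space sphere_measure"
    then have \<omega>: "norm \<omega> = 1" by simp
    have "(\<integral>\<^sup>+r. indicator N' (r *\<^sub>R \<omega>) \<partial>radial_measure DIM('a)) = (\<integral>\<^sup>+r. indicator N r \<partial>radial_measure DIM('a))"
    proof (rule nn_integral_cong_AE)
      have "AE r in radial_measure DIM('a). r > 0"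
        unfolding radial_measure_def by (subst AE_density) (auto simp: indicator_def)
      then show "AE r in radial_measure DIM('a). indicator N' (r *\<^sub>R \<omega>) = (indicator N r :: ennreal)"
        by eventually_elim (simp add: N'_def \<omega> indicator_def)
    qed
    then show "(\<integral>\<^sup>+r. indicator N' (r *\<^sub>R \<omega>) \<partial>radial_measure DIM('a)) = 0" using z by simp
  qed
  finally have "(\<integral>\<^sup>+x. indicator N' x * indicator (ball 0 1 - {0}) x \<partial>lborel) = 0" by simp
  then have "AE x in lborel. indicator N' x * indicator (ball 0 1 - {0}) x = (0 :: ennreal)"
    by (subst (asm) nn_integral_0_iff_AE) measurable
  then have "AE x in lborel. x \<in> ball (0::'a) 1 \<longrightarrow> x \<noteq> 0 \<longrightarrow> Q (norm x)"
  proof eventually_elim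
    fix x :: 'a assume x: "indicator N' x * indicator (ball 0 1 - {0}) x = (0 :: ennreal)"
    show "x \<in> ball (0::'a) 1 \<longrightarrow> x \<noteq> 0 \<longrightarrow> Q (norm x)"
    proof (intro impI)
      assume "x \<in> ball 0 1" "x \<noteq> 0"
      then have "norm x \<notin> N" using x by (auto simp: N'_def indicator_def split: if_splits)
      then show "Q (norm x)" using N(1)[THEN subsetD, of "norm x"] \<open>x \<in> ball 0 1\<close> \<open>x \<noteq> 0\<close> by auto
    qed
  qed
  then show ?thesis unfolding AE_ball_measure_iff .
qed


section \<open>From a radial potential to a weight on the unit interval\<close>

lemma sphere_measure_pos: "emeasure (sphere_measure :: 'a::euclidean_space measure) (sphere 0 1) > 0"
proof -
  have S: "sphere 0 1 \<in> sets (restrict_space borel (sphere (0::'a) 1))"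
    by (simp add: sets_restrict_space_iff)
  have "{x::'a. 0 < norm x \<and> norm x < 1 \<and> x /\<^sub>R norm x \<in> sphere 0 1} = ball 0 1 - {0}" by auto
  moreover have "emeasure lborel (ball (0::'a) 1 - {0}) = emeasure lborel (ball (0::'a) 1)"
    by (intro emeasure_Diff_null_set) (simp_all add: null_sets_def)
  moreover have "emeasure lborel (ball (0::'a) 1) > 0"
    using emeasure_ball[of 1 "0::'a"] by simp
  ultimately show ?thesis
    unfolding emeasure_sphere_measure[OF S] by (simp add: ennreal_zero_less_mult_iff)
qed

lemma measure_sphere_pos: "measure (sphere_measure :: 'a::euclidean_space measure) (sphere 0 1) > 0"
proof -
  interpret S: finite_measure "sphere_measure :: 'a measure" by (rule finite_sphere_measure)
  show ?thesis using sphere_measure_pos[where 'a='a] unfolding S.emeasure_eq_measure by simp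
qed

lemma AE_sphere_ex:
  assumes "AE \<omega> in (sphere_measure :: 'a::euclidean_space measure). P \<omega>"
  obtains \<omega> where "norm \<omega> = 1" "P \<omega>"
proof -
  have "ae_filter (sphere_measure :: 'a measure) \<noteq> bot"
    unfolding trivial_limit_def[symmetric] using sphere_measure_pos[where 'a='a] by (simp add: ae_filter_eq_bot_iff)
  moreover have "AE \<omega> in (sphere_measure :: 'a measure). norm \<omega> = 1 \<and> P \<omega>"
    using AE_space assms by eventually_elim simp
  ultimately show ?thesis using eventually_happens' that by blast
qed

text \<open>
  The restriction of a Lebesgue measurable function to a ray need not be measurable; that of a Borel
  function is.
\<close>

lemma Borel_representative:
  fixes V :: "'a::euclidean_space \<Rightarrow> real"
  assumes "V \<in> borel_measurable ball_measure"
  obtains V' where "V' \<in> borel_measurable borel" "AE x in ball_measure. V x = V' x"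
proof -
  have "(\<lambda>x. if x \<in> ball 0 1 then V x else 0) \<in> borel_measurable lebesgue"
    using assms by (rule borel_measurable_if_I) simp
  then obtain V' where V': "V' \<in> borel_measurable lborel"
      "AE x in lborel. (if x \<in> ball 0 1 then V x else 0) = V' x"
    using completion_ex_borel_measurable_real by blast
  show ?thesis
  proof (rule that)
    show "V' \<in> borel_measurable borel" using V'(1) by simp
    show "AE x in ball_measure. V x = V' x"
      unfolding AE_ball_measure_iff using V'(2) by eventually_elim auto
  qed
qed

text \<open>
  Young's inequality for the factorization of \<open>t y\<close> into \<open>t\<^sup>(\<^sup>d\<^sup>-\<^sup>1\<^sup>)\<^sup>/\<^sup>p y\<close> and a power of \<open>t\<close>. The second
  term on the right is integrable at \<open>0\<close> if and only if its exponent exceeds \<open>-1\<close>, that is, if \<open>p > d/2\<close>.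
\<close>

lemma weight_le_Young:
  fixes t y p :: real
  assumes p: "p > 1" and t: "0 < t" and d: "d \<ge> 1"
  shows "\<bar>t * y\<bar> \<le> t ^ (d - 1) * \<bar>y\<bar> powr p + t powr ((p - real d + 1) / (p - 1))"
proof -
  define a where "a = \<bar>y\<bar> * t powr (real (d - 1) / p)"
  define b where "b = t powr (1 - real (d - 1) / p)"
  define q where "q = p / (p - 1)"
  have q: "q > 1" "1 / p + 1 / q = 1" using p by (auto simp: q_def field_simps)
  have "\<bar>t * y\<bar> = \<bar>y\<bar> * t powr (real (d - 1) / p + (1 - real (d - 1) / p))"
    using t by (simp add: abs_mult mult.commute)
  also have "\<dots> = a * b" unfolding a_def b_def powr_add by (simp add: mult.assoc)
  also have "\<dots> \<le> a powr p / p + b powr q / q"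
    using p q by (intro Youngs_inequality) (auto simp: a_def b_def)
  also have "\<dots> \<le> a powr p + b powr q"
    using p q by (intro add_mono) (auto simp: divide_le_eq mult_le_cancel_left1)
  also have "a powr p = t ^ (d - 1) * \<bar>y\<bar> powr p"
    using p t by (simp add: a_def powr_mult powr_powr powr_realpow mult.commute)
  also have "b powr q = t powr ((p - real d + 1) / (p - 1))"
  proof -
    have "(1 - real (d - 1) / p) * q = (p - real d + 1) / (p - 1)"
      using p d by (simp add: q_def field_simps of_nat_diff)
    then show ?thesis by (simp add: b_def powr_powr)
  qed
  finally show ?thesis .
qed

lemma integral_powr_unit_interval:
  fixes e :: real
  assumes e: "e > -1"
  shows "integrable lborel (\<lambda>t. indicator {0<..<1} t * t powr e)"
    and "(\<integral>t. indicator {0<..<1} t * t powr e \<partial>lborel) = 1 / (e + 1)"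
proof -
  have "((\<lambda>t. t powr e) has_integral 1 powr (e + 1) / (e + 1)) {0..1}"
    using e by (intro has_integral_powr_from_0) auto
  then have "((\<lambda>t. if t \<in> {0..1} then t powr e else 0) has_integral 1 / (e + 1)) UNIV"
    by (subst has_integral_restrict_UNIV) simp
  moreover have "(\<lambda>t. if t \<in> {0..1} then t powr e else 0) \<in> borel_measurable borel" by measurable
  ultimately have nn: "(\<integral>\<^sup>+t. ennreal (if t \<in> {0..1} then t powr e else 0) \<partial>lborel) = ennreal (1 / (e + 1))"
    by (intro nn_integral_has_integral_lborel) auto
  have "has_bochner_integral lborel (\<lambda>t. indicator {0<..<1} t * t powr e) (1 / (e + 1))"
  proof (rule has_bochner_integral_nn_integral)
    have "(\<integral>\<^sup>+t. ennreal (indicator {0<..<1} t * t powr e) \<partial>lborel) = (\<integral>\<^sup>+t. ennreal (if t \<in> {0..1} then t powr e else 0) \<partial>lborel)"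
    proof (rule nn_integral_cong_AE)
      show "AE t in lborel. ennreal (indicator {0<..<1} t * t powr e) = ennreal (if t \<in> {0..1} then t powr e else 0)"
        using AE_lborel_singleton[of "0::real"] AE_lborel_singleton[of "1::real"]
        by eventually_elim (auto simp: indicator_def)
    qed
    then show "(\<integral>\<^sup>+t. ennreal (indicator {0<..<1} t * t powr e) \<partial>lborel) = ennreal (1 / (e + 1))" using nn by simp
  qed (use e in auto)
  then show "integrable lborel (\<lambda>t. indicator {0<..<1} t * t powr e)"
    "(\<integral>t. indicator {0<..<1} t * t powr e \<partial>lborel) = 1 / (e + 1)"
    by (auto simp: has_bochner_integral_iff)
qed

lemma radial_integral:
  fixes f :: "real \<Rightarrow> real"
  assumes [measurable]: "f \<in> borel_measurable borel" and nonneg: "\<And>r. f r \<ge> 0"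
    and int: "integrable ball_measure (\<lambda>x::'a::euclidean_space. f (norm x))"
  shows "integrable lborel (\<lambda>r. indicator {0<..<1} r * (r ^ (DIM('a) - 1) * f r))"
    and "(\<integral>x. f (norm (x::'a)) \<partial>ball_measure)
      = measure (sphere_measure :: 'a measure) (sphere 0 1) * (\<integral>r. indicator {0<..<1} r * (r ^ (DIM('a) - 1) * f r) \<partial>lborel)"
proof -
  let ?d = "DIM('a)"
  interpret S: finite_measure "sphere_measure :: 'a measure" by (rule finite_sphere_measure)
  have m: "(\<lambda>x::'a. f (norm x)) \<in> borel_measurable borel" by measurable
  have int': "integrable punctured_ball (\<lambda>x::'a. f (norm x))"
    using int punctured_ball_integral(1)[OF m] by simp
  define I where "I = (\<integral>\<^sup>+r. ennreal (indicator {0<..<1} r * (r ^ (?d - 1) * f r)) \<partial>lborel)"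
  have "(\<integral>\<^sup>+x. ennreal (f (norm (x::'a))) \<partial>punctured_ball) = (\<integral>\<^sup>+\<omega>. (\<integral>\<^sup>+r. ennreal (f (norm (r *\<^sub>R \<omega>))) \<partial>radial_measure ?d) \<partial>(sphere_measure :: 'a measure))"
    by (rule polar_nn_integral) measurable
  also have "\<dots> = (\<integral>\<^sup>+\<omega>. I \<partial>(sphere_measure :: 'a measure))"
  proof (rule nn_integral_cong)
    fix \<omega> :: 'a assume "\<omega> \<in> space sphere_measure"
    then have \<omega>: "norm \<omega> = 1" by simp
    have "(\<integral>\<^sup>+r. ennreal (f (norm (r *\<^sub>R \<omega>))) \<partial>radial_measure ?d)
       = (\<integral>\<^sup>+r. ennreal (indicator {0<..<1} r * r ^ (?d - 1)) * ennreal (f \<bar>r\<bar>) \<partial>lborel)"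
      unfolding radial_measure_def by (subst nn_integral_density) (auto simp: \<omega>)
    also have "\<dots> = I" unfolding I_def
      by (intro nn_integral_cong) (auto simp: indicator_def ennreal_mult' nonneg)
    finally show "(\<integral>\<^sup>+r. ennreal (f (norm (r *\<^sub>R \<omega>))) \<partial>radial_measure ?d) = I" .
  qed
  also have "\<dots> = I * emeasure (sphere_measure :: 'a measure) (sphere 0 1)" by simp
  finally have nn: "(\<integral>\<^sup>+x. ennreal (f (norm (x::'a))) \<partial>punctured_ball) = I * emeasure (sphere_measure :: 'a measure) (sphere 0 1)" .
  have "(\<integral>\<^sup>+x. ennreal (f (norm (x::'a))) \<partial>punctured_ball) < \<infinity>"
    using int' nonneg by (simp add: integrable_iff_bounded)
  then have "I < \<infinity>"
    unfolding nn using sphere_measure_pos[where 'a='a] by (auto simp: ennreal_mult_less_top)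
  then show I: "integrable lborel (\<lambda>r. indicator {0<..<1} r * (r ^ (?d - 1) * f r))"
    unfolding I_def by (intro integrableI_nonneg) (auto simp: nonneg indicator_def)
  have I_eq: "I = ennreal (\<integral>r. indicator {0<..<1} r * (r ^ (?d - 1) * f r) \<partial>lborel)"
    unfolding I_def by (rule nn_integral_eq_integral[OF I]) (auto simp: nonneg indicator_def)
  have I0: "(\<integral>r. indicator {0<..<1} r * (r ^ (?d - 1) * f r) \<partial>lborel) \<ge> 0"
    by (intro Bochner_Integration.integral_nonneg) (auto simp: nonneg indicator_def)
  have "ennreal (\<integral>x. f (norm (x::'a)) \<partial>punctured_ball) = I * emeasure (sphere_measure :: 'a measure) (sphere 0 1)"
    unfolding nn[symmetric] by (rule nn_integral_eq_integral[OF int', symmetric]) (simp add: nonneg)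
  also have "\<dots> = ennreal (measure (sphere_measure :: 'a measure) (sphere 0 1) * (\<integral>r. indicator {0<..<1} r * (r ^ (?d - 1) * f r) \<partial>lborel))"
    unfolding I_eq S.emeasure_eq_measure using I0 by (simp add: ennreal_mult mult.commute)
  finally have "(\<integral>x. f (norm (x::'a)) \<partial>punctured_ball) = measure (sphere_measure :: 'a measure) (sphere 0 1) * (\<integral>r. indicator {0<..<1} r * (r ^ (?d - 1) * f r) \<partial>lborel)"
    using I0 by (subst (asm) ennreal_inj) (auto intro!: Bochner_Integration.integral_nonneg nonneg)
  then show "(\<integral>x. f (norm (x::'a)) \<partial>ball_measure)
      = measure (sphere_measure :: 'a measure) (sphere 0 1) * (\<integral>r. indicator {0<..<1} r * (r ^ (?d - 1) * f r) \<partial>lborel)"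
    using punctured_ball_integral(2)[OF m] by simp
qed

text \<open>
  The profile of \<open>V\<close> is determined up to null sets only and need not be Borel. A
  Borel weight \<open>w\<close> is obtained by restricting a Borel version of \<open>V\<close> to a ray on which it agrees with the
  profile almost everywhere; almost every ray has this property. That \<open>Lf\<close> does not depend on \<open>V\<close> is the reason why \<open>k\<^sub>0\<close> depends on
  the norm of \<open>V\<close> only.
\<close>

theorem radial_reduction:
  assumes d: "DIM('a::euclidean_space) \<ge> 2" and p: "real DIM('a) / 2 < p"
  obtains Lf :: "real \<Rightarrow> real" where
    "\<And>V :: 'a \<Rightarrow> real. V \<in> Lp_rad p \<Longrightarrow> \<exists>w. radial_potential w (Lf (Lp_norm ball_measure p V))
       \<and> (AE t in lborel. t \<in> {0<..<1} \<longrightarrow> w t = t * profile V t)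
       \<and> (AE x in ball_measure. x \<noteq> 0 \<longrightarrow> V x = w (norm x) / norm x)
       \<and> integrable lborel (\<lambda>r. indicator {0<..<1} r * (r ^ (DIM('a) - 1) * \<bar>w r / r\<bar> powr p))"
proof -
  let ?d = "DIM('a)"
  let ?S = "measure (sphere_measure :: 'a measure) (sphere 0 1)"
  have p1: "p > 1" using d p by linarith
  \<comment> \<open>The exponent that is left over in Young's inequality; \<open>e > -1\<close> is the condition \<open>p > d/2\<close>.\<close>
  define e where "e = (p - real ?d + 1) / (p - 1)"
  have e: "e > -1" using p p1 by (simp add: e_def field_simps)
  define Lf where "Lf x = x powr p / ?S + 1 / (e + 1)" for x
  show ?thesis
  proof (rule that[of Lf])
    fix V :: "'a \<Rightarrow> real" assume V: "V \<in> Lp_rad p"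
    define q where "q = profile V"
    have Vm: "V \<in> borel_measurable ball_measure" and Vp: "integrable ball_measure (\<lambda>x. \<bar>V x\<bar> powr p)"
      using V unfolding Lp_rad_def Lp_space_def by simp_all
    have q: "AE x in ball_measure. V x = q (norm x)"
    proof -
      have "\<exists>q. radial_profile V q" using V by (simp add: Lp_rad_def)
      then have "radial_profile V (profile V)" unfolding profile_def by (rule someI_ex)
      then show ?thesis by (simp add: radial_profile_def q_def)
    qed
    obtain V' where V': "V' \<in> borel_measurable borel" "AE x in ball_measure. V x = V' x"
      using Borel_representative[OF Vm] .
    have "AE x in ball_measure. V' x = q (norm x)" using q V'(2) by eventually_elim simp
    from AE_polar[OF this] obtain \<omega> :: 'a where \<omega>: "norm \<omega> = 1"
        "AE r in lborel. r \<in> {0<..<1} \<longrightarrow> V' (r *\<^sub>R \<omega>) = q (norm (r *\<^sub>R \<omega>))"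
      by (rule AE_sphere_ex)
    define w where "w t = indicator {0<..<1} t * (t * V' (t *\<^sub>R \<omega>))" for t
    have [measurable]: "w \<in> borel_measurable borel"
    proof -
      have "(\<lambda>t. V' (t *\<^sub>R \<omega>)) \<in> borel_measurable borel"
        by (rule measurable_compose[OF _ V'(1)]) measurable
      then show ?thesis unfolding w_def by measurable
    qed
    have wq: "AE t in lborel. t \<in> {0<..<1} \<longrightarrow> w t = t * q t"
      using \<omega>(2) by eventually_elim (simp add: w_def \<omega>(1))
    have "AE x in ball_measure. x \<noteq> (0::'a) \<longrightarrow> w (norm x) = norm x * q (norm x)"
      by (rule AE_radial[OF wq])
    then have Vw: "AE x in ball_measure. x \<noteq> (0::'a) \<longrightarrow> V x = w (norm x) / norm x"
      using q by eventually_elim auto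
    have AE0: "AE x in ball_measure. x \<noteq> (0::'a)"
      unfolding AE_ball_measure_iff using AE_lborel_singleton[of "0::'a"] by eventually_elim simp
    define f where "f r = \<bar>w r / r\<bar> powr p" for r
    have [measurable]: "f \<in> borel_measurable borel" unfolding f_def by measurable
    have fm: "(\<lambda>x::'a. f (norm x)) \<in> borel_measurable ball_measure"
      by (intro measurable_restrict_space1 measurable_completion) measurable
    have AEf: "AE x in ball_measure. \<bar>V x\<bar> powr p = f (norm (x::'a))"
      using Vw AE0 by eventually_elim (simp add: f_def)
    have fint: "integrable ball_measure (\<lambda>x::'a. f (norm x))"
      using integrable_cong_AE[OF borel_measurable_integrable[OF Vp] fm AEf] Vp by simp
    have feq: "(\<integral>x. f (norm (x::'a)) \<partial>ball_measure) = (\<integral>x. \<bar>V x\<bar> powr p \<partial>ball_measure)"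
      using integral_cong_AE[OF borel_measurable_integrable[OF Vp] fm AEf] by simp
    have f0: "f r \<ge> 0" for r by (simp add: f_def)
    note R = radial_integral[OF \<open>f \<in> borel_measurable borel\<close> f0 fint]
    let ?I = "\<integral>r. indicator {0<..<1} r * (r ^ (?d - 1) * f r) \<partial>lborel"
    have norm_p: "Lp_norm ball_measure p V powr p = ?S * ?I"
      unfolding R(2)[symmetric] feq Lp_norm_def using p1 by (simp add: powr_powr)
    have bound: "\<bar>w t\<bar> \<le> indicator {0<..<1} t * (t ^ (?d - 1) * f t) + indicator {0<..<1} t * t powr e" for t
    proof (cases "t \<in> {0<..<1}")
      case True
      then show ?thesis
        using weight_le_Young[OF p1, of t ?d "w t / t"] d by (simp add: f_def e_def abs_divide)
    qed (simp add: w_def)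
    have int_bound: "integrable lborel (\<lambda>t. indicator {0<..<1} t * (t ^ (?d - 1) * f t) + indicator {0<..<1} t * t powr e)"
      by (intro Bochner_Integration.integrable_add R(1) integral_powr_unit_interval e)
    have w_int: "integrable lborel w"
      by (rule Bochner_Integration.integrable_bound[OF int_bound]) (use bound in \<open>auto intro!: AE_I2 intro: order_trans[OF bound]\<close>)
    have "(\<integral>t. \<bar>w t\<bar> \<partial>lborel) \<le> (\<integral>t. indicator {0<..<1} t * (t ^ (?d - 1) * f t) + indicator {0<..<1} t * t powr e \<partial>lborel)"
      using w_int bound by (intro integral_mono int_bound) auto
    also have "\<dots> = ?I + 1 / (e + 1)"
      using R(1) integral_powr_unit_interval[OF e] by simp
    also have "?I = Lp_norm ball_measure p V powr p / ?S"
      unfolding norm_p using measure_sphere_pos[where 'a='a] by simp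
    finally have "(\<integral>t. \<bar>w t\<bar> \<partial>lborel) \<le> Lf (Lp_norm ball_measure p V)" by (simp add: Lf_def)
    then have "radial_potential w (Lf (Lp_norm ball_measure p V))"
      using w_int by unfold_locales (auto simp: w_def)
    then show "\<exists>w. radial_potential w (Lf (Lp_norm ball_measure p V))
       \<and> (AE t in lborel. t \<in> {0<..<1} \<longrightarrow> w t = t * profile V t)
       \<and> (AE x in ball_measure. x \<noteq> 0 \<longrightarrow> V x = w (norm x) / norm x)
       \<and> integrable lborel (\<lambda>r. indicator {0<..<1} r * (r ^ (DIM('a) - 1) * \<bar>w r / r\<bar> powr p))"
      using wq Vw R(1) by (intro exI[of _ w]) (simp add: f_def q_def)
  qed
qed


section \<open>The divergence theorem in the unit ball\<close>

lemma C1_continuous: "C1_function \<phi> \<Phi> \<Longrightarrow> continuous_on UNIV \<phi>"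
  unfolding C1_function_def gderiv_def
  using has_derivative_continuous continuous_at_imp_continuous_on[of UNIV \<phi>] by blast

lemma C1_gradient_continuous: "C1_function \<phi> \<Phi> \<Longrightarrow> continuous_on UNIV \<Phi>"
  by (simp add: C1_function_def)

lemma C1_mult:
  assumes "C1_function \<phi> \<Phi>" "C1_function \<psi> \<Psi>"
  shows "C1_function (\<lambda>x. \<phi> x * \<psi> x) (\<lambda>x. \<phi> x *\<^sub>R \<Psi> x + \<psi> x *\<^sub>R \<Phi> x)"
  unfolding C1_function_def
proof (intro conjI allI)
  show "GDERIV (\<lambda>x. \<phi> x * \<psi> x) x :> \<phi> x *\<^sub>R \<Psi> x + \<psi> x *\<^sub>R \<Phi> x" for x
    using assms unfolding C1_function_def by (intro GDERIV_mult) simp_all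
  show "continuous_on UNIV (\<lambda>x. \<phi> x *\<^sub>R \<Psi> x + \<psi> x *\<^sub>R \<Phi> x)"
    using assms by (intro continuous_on_add continuous_on_scaleR) (auto intro: C1_continuous C1_gradient_continuous)
qed

lemma C1_deriv_line:
  fixes \<phi> :: "'a::euclidean_space \<Rightarrow> real"
  assumes "C1_function \<phi> \<Phi>"
  shows "((\<lambda>t. \<phi> (x + t *\<^sub>R v)) has_real_derivative \<Phi> (x + t *\<^sub>R v) \<bullet> v) (at t)"
proof -
  have "((\<lambda>t. x + t *\<^sub>R v) has_derivative (\<lambda>h. h *\<^sub>R v)) (at t)"
    by (auto intro!: derivative_eq_intros)
  moreover have "(\<phi> has_derivative (\<lambda>h. h \<bullet> \<Phi> (x + t *\<^sub>R v))) (at (x + t *\<^sub>R v))"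
    using assms by (simp add: C1_function_def gderiv_def)
  ultimately have "((\<lambda>t. \<phi> (x + t *\<^sub>R v)) has_derivative (\<lambda>h. (h *\<^sub>R v) \<bullet> \<Phi> (x + t *\<^sub>R v))) (at t)"
    by (rule has_derivative_compose[where f = "\<lambda>t. x + t *\<^sub>R v"])
  moreover have "(\<lambda>h. (h *\<^sub>R v) \<bullet> \<Phi> (x + t *\<^sub>R v)) = (*) (\<Phi> (x + t *\<^sub>R v) \<bullet> v)"
    by (rule ext) (simp only: inner_scaleR_left inner_commute[of v] mult.commute)
  ultimately show ?thesis by (simp only: has_field_derivative_def)
qed

lemma continuous_bounded_cball:
  fixes f :: "'a::euclidean_space \<Rightarrow> 'b::real_normed_vector"
  assumes "continuous_on UNIV f"
  obtains C where "C > 0" "\<And>x. norm x \<le> R \<Longrightarrow> norm (f x) \<le> C"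
proof -
  have "compact (f ` cball 0 R)"
    by (intro compact_continuous_image continuous_on_subset[OF assms]) auto
  then have "bounded (f ` cball 0 R)" by (rule compact_imp_bounded)
  then obtain C where C: "C > 0" "\<forall>y\<in>f ` cball 0 R. norm y \<le> C" unfolding bounded_pos by blast
  show ?thesis
  proof (rule that[OF C(1)])
    fix x :: 'a assume "norm x \<le> R"
    then have "f x \<in> f ` cball 0 R" by (intro imageI) simp
    then show "norm (f x) \<le> C" using C(2) by blast
  qed
qed

lemma finite_ball_measure: "finite_measure (ball_measure :: 'a::euclidean_space measure)"
  by (intro finite_measure_lebesgue_on) simp

lemma borel_measurable_ball_measure:
  "f \<in> borel_measurable borel \<Longrightarrow> f \<in> borel_measurable (ball_measure :: 'a::euclidean_space measure)"
  by (intro measurable_restrict_space1 measurable_completion) simp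

lemma continuous_measurable_ball:
  "continuous_on UNIV f \<Longrightarrow> f \<in> borel_measurable (ball_measure :: 'a::euclidean_space measure)"
  by (intro borel_measurable_ball_measure borel_measurable_continuous_onI)

lemma continuous_integrable_ball:
  fixes f :: "'a::euclidean_space \<Rightarrow> 'b::euclidean_space"
  assumes "continuous_on UNIV f"
  shows "integrable ball_measure f"
proof -
  interpret finite_measure "ball_measure :: 'a measure" by (rule finite_ball_measure)
  obtain C where "C > 0" "\<And>x. norm x \<le> 1 \<Longrightarrow> norm (f x) \<le> C" using continuous_bounded_cball[OF assms] by blast
  then show ?thesis
    by (intro integrable_const_bound[of _ C] AE_I2 continuous_measurable_ball assms) simp
qed

lemma continuous_integrable_sphere:
  fixes f :: "'a::euclidean_space \<Rightarrow> 'b::euclidean_space"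
  assumes "continuous_on UNIV f"
  shows "integrable sphere_measure f"
proof -
  interpret finite_measure "sphere_measure :: 'a measure" by (rule finite_sphere_measure)
  obtain C where "C > 0" "\<And>x. norm x \<le> 1 \<Longrightarrow> norm (f x) \<le> C" using continuous_bounded_cball[OF assms] by blast
  then show ?thesis
    by (intro integrable_const_bound[of _ C] AE_I2 borel_measurable_sphere_measure borel_measurable_continuous_onI assms) simp
qed

text \<open>
  By translation invariance the difference quotients of \<open>\<psi>\<close> have integral zero. They converge to the
  partial derivative and are bounded, uniformly supported in a ball.
\<close>

lemma integral_partial_zero:
  fixes \<psi> :: "'a::euclidean_space \<Rightarrow> real"
  assumes C1: "C1_function \<psi> \<Psi>" and supp: "\<And>x. norm x > R \<Longrightarrow> \<psi> x = 0" and i: "i \<in> Basis"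
  shows "(\<integral>x. \<Psi> x \<bullet> i \<partial>lborel) = 0"
proof -
  have c: "continuous_on UNIV \<psi>" "continuous_on UNIV \<Psi>"
    using C1_continuous[OF C1] C1_gradient_continuous[OF C1] .
  then have [measurable]: "\<psi> \<in> borel_measurable borel" "\<Psi> \<in> borel_measurable borel"
    by (auto intro: borel_measurable_continuous_onI)
  obtain C where C: "C > 0" "\<And>x. norm x \<le> R + 2 \<Longrightarrow> norm (\<Psi> x) \<le> C" using continuous_bounded_cball[OF c(2)] by blast
  have \<psi>_int: "integrable lborel \<psi>"
  proof -
    have "integrable lborel (\<lambda>x. indicator (cball 0 R) x *\<^sub>R \<psi> x)"
      by (intro borel_integrable_compact continuous_on_subset[OF c(1)]) auto
    moreover have "(\<lambda>x. indicator (cball 0 R) x *\<^sub>R \<psi> x) = \<psi>"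
    proof
      fix x show "indicator (cball 0 R) x *\<^sub>R \<psi> x = \<psi> x"
        using supp[of x] by (cases "norm x \<le> R") auto
    qed
    ultimately show ?thesis by (simp only:)
  qed
  define h where "h n = inverse (real (Suc n))" for n
  have h: "0 < h n" "h n \<le> 1" for n by (auto simp: h_def inverse_le_1_iff)
  have h0: "h \<longlonglongrightarrow> 0" unfolding h_def by (rule LIMSEQ_inverse_real_of_nat)
  define f where "f n x = (\<psi> (x + h n *\<^sub>R i) - \<psi> x) / h n" for n x
  have zero: "(\<integral>x. f n x \<partial>lborel) = 0" for n
  proof -
    have d: "distr lborel borel (\<lambda>x. x + h n *\<^sub>R i) = (lborel :: 'a measure)"
    proof -
      have "(\<lambda>x. x + h n *\<^sub>R i) = (+) (h n *\<^sub>R i)" by (auto simp: add.commute)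
      then show ?thesis by (simp only: lborel_distr_plus)
    qed
    have "integrable (distr lborel borel (\<lambda>x. x + h n *\<^sub>R i)) \<psi>" unfolding d by (rule \<psi>_int)
    then have 1: "integrable lborel (\<lambda>x. \<psi> (x + h n *\<^sub>R i))" by (subst (asm) integrable_distr_eq) auto
    have "(\<integral>x. \<psi> x \<partial>distr lborel borel (\<lambda>x. x + h n *\<^sub>R i)) = (\<integral>x. \<psi> (x + h n *\<^sub>R i) \<partial>lborel)"
      by (subst integral_distr) auto
    then have "(\<integral>x. \<psi> x \<partial>lborel) = (\<integral>x. \<psi> (x + h n *\<^sub>R i) \<partial>lborel)" unfolding d .
    then show ?thesis unfolding f_def using 1 \<psi>_int by simp
  qed
  have bound: "\<bar>f n x\<bar> \<le> indicator (cball 0 (R + 1)) x * C" for n x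
  proof (cases "norm x \<le> R + 1")
    case True
    have "\<exists>z>0. z < h n \<and> \<psi> (x + h n *\<^sub>R i) - \<psi> (x + 0 *\<^sub>R i) = (h n - 0) * (\<Psi> (x + z *\<^sub>R i) \<bullet> i)"
      using h by (intro MVT2 C1_deriv_line[OF C1]) auto
    then obtain z where z: "0 < z" "z < h n" "\<psi> (x + h n *\<^sub>R i) - \<psi> x = h n * (\<Psi> (x + z *\<^sub>R i) \<bullet> i)" by auto
    have "f n x = \<Psi> (x + z *\<^sub>R i) \<bullet> i" using z(3) h(1)[of n] by (simp add: f_def)
    also have "\<bar>\<dots>\<bar> \<le> norm (\<Psi> (x + z *\<^sub>R i)) * norm i" by (rule Cauchy_Schwarz_ineq2)
    also have "\<dots> \<le> C"
    proof -
      have "norm (x + z *\<^sub>R i) \<le> norm x + norm (z *\<^sub>R i)" by (rule norm_triangle_ineq)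
      also have "\<dots> \<le> R + 2" using True z h(2)[of n] i by simp
      finally show ?thesis using C(2) i by simp
    qed
    finally show ?thesis using True by simp
  next
    case False
    have "norm x - norm (h n *\<^sub>R i) \<le> norm (x + h n *\<^sub>R i)" by (rule norm_diff_ineq)
    moreover have "norm (h n *\<^sub>R i) \<le> 1" using i h[of n] by simp
    ultimately have "norm (x + h n *\<^sub>R i) > R" using False by linarith
    then show ?thesis using supp[of x] supp[of "x + h n *\<^sub>R i"] False by (simp add: f_def)
  qed
  have "(\<lambda>n. \<integral>x. f n x \<partial>lborel) \<longlonglongrightarrow> (\<integral>x. \<Psi> x \<bullet> i \<partial>lborel)"
  proof (rule integral_dominated_convergence[where w = "\<lambda>x. indicator (cball 0 (R + 1)) x * C"])
    show "AE x in lborel. (\<lambda>n. f n x) \<longlonglongrightarrow> \<Psi> x \<bullet> i"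
    proof (rule AE_I2)
      fix x
      have "((\<lambda>t. (\<psi> (x + t *\<^sub>R i) - \<psi> (x + 0 *\<^sub>R i)) / (t - 0)) \<longlongrightarrow> \<Psi> (x + 0 *\<^sub>R i) \<bullet> i) (at 0)"
        using C1_deriv_line[OF C1, of x i 0] by (simp add: has_field_derivative_iff)
      then have "((\<lambda>t. (\<psi> (x + t *\<^sub>R i) - \<psi> x) / t) \<longlongrightarrow> \<Psi> x \<bullet> i) (at 0)" by simp
      moreover have "filterlim h (at 0) sequentially"
      proof -
        have "h n \<noteq> 0" for n using h(1)[of n] by simp
        then show ?thesis using h0 by (simp add: filterlim_at)
      qed
      ultimately show "(\<lambda>n. f n x) \<longlonglongrightarrow> \<Psi> x \<bullet> i"
        unfolding f_def by (rule filterlim_compose)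
    qed
    show "integrable lborel (\<lambda>x. indicator (cball 0 (R + 1)) x * C)"
      by (intro integrable_mult_left integrable_real_indicator) (simp_all add: emeasure_lborel_cball_finite[unfolded infinity_ennreal_def])
  qed (use bound in \<open>auto simp: f_def\<close>)
  then show ?thesis unfolding zero by (simp add: LIMSEQ_const_iff)
qed

text \<open>
  As a function of \<open>y = |x|\<^sup>2\<close>, a \<open>C\<^sup>1\<close> cutoff: the square makes the positive part differentiable, the power \<open>n\<close> makes
  the functions converge to \<open>1\<close> on \<open>[0,1)\<close>, and the dilation factor puts the support inside the open unit interval.
\<close>

definition radial_cutoff :: "nat \<Rightarrow> real \<Rightarrow> real" where
  "radial_cutoff n y = (max 0 (1 - ((1 + inverse (real (Suc n))) * y) ^ n))\<^sup>2"

definition radial_cutoff' :: "nat \<Rightarrow> real \<Rightarrow> real" where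
  "radial_cutoff' n y = 2 * max 0 (1 - ((1 + inverse (real (Suc n))) * y) ^ n)
     * - (real n * ((1 + inverse (real (Suc n))) * y) ^ (n - 1) * (1 + inverse (real (Suc n))))"

lemma DERIV_max_0_square: "((\<lambda>z::real. (max 0 z)\<^sup>2) has_real_derivative 2 * max 0 z) (at z)"
proof -
  consider "z > 0" | "z < 0" | "z = 0" by linarith
  then show ?thesis
  proof cases
    case 1
    have "((\<lambda>z::real. z\<^sup>2) has_real_derivative 2 * max 0 z) (at z)"
      using 1 by (auto intro!: derivative_eq_intros)
    then show ?thesis
      by (rule DERIV_cong_ev[THEN iffD1, rotated -1])
         (use 1 in \<open>auto intro!: eventually_mono[OF eventually_nhds_in_open[of "{0<..}"]]\<close>)
  next
    case 2
    have "((\<lambda>z::real. 0) has_real_derivative 2 * max 0 z) (at z)" using 2 by simp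
    then show ?thesis
      by (rule DERIV_cong_ev[THEN iffD1, rotated -1])
         (use 2 in \<open>auto intro!: eventually_mono[OF eventually_nhds_in_open[of "{..<0}"]]\<close>)
  next
    case 3
    have "((\<lambda>h::real. (max 0 h)\<^sup>2 / h) \<longlongrightarrow> 0) (at 0)"
    proof (rule Lim_null_comparison)
      show "\<forall>\<^sub>F h in at (0::real). norm ((max 0 h)\<^sup>2 / h) \<le> \<bar>h\<bar>"
        by (intro always_eventually) (auto simp: max_def power2_eq_square)
      show "((\<lambda>h::real. \<bar>h\<bar>) \<longlongrightarrow> 0) (at 0)" by (rule tendsto_eq_intros) (auto intro!: tendsto_eq_intros)
    qed
    then show ?thesis using 3 by (simp add: has_field_derivative_iff)
  qed
qed

lemma radial_cutoff_deriv: "(radial_cutoff n has_real_derivative radial_cutoff' n y) (at y)"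
  unfolding radial_cutoff_def[abs_def] radial_cutoff'_def
proof (rule DERIV_chain2[OF DERIV_max_0_square])
  let ?a = "1 + inverse (real (Suc n))"
  show "((\<lambda>y. 1 - (?a * y) ^ n) has_real_derivative - (real n * (?a * y) ^ (n - 1) * ?a)) (at y)"
    by (auto intro!: derivative_eq_intros)
qed

lemma radial_cutoff'_continuous: "continuous_on UNIV (radial_cutoff' n)"
  unfolding radial_cutoff'_def[abs_def] by (intro continuous_intros)

lemma radial_cutoff_range:
  assumes "y \<ge> 0" shows "0 \<le> radial_cutoff n y" "radial_cutoff n y \<le> 1"
proof -
  have "max 0 (1 - ((1 + inverse (real (Suc n))) * y) ^ n) \<le> 1" using assms by simp
  then show "radial_cutoff n y \<le> 1" unfolding radial_cutoff_def by (intro power_le_one) auto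
qed (simp add: radial_cutoff_def)

lemma radial_cutoff_zero:
  assumes "(1 + inverse (real (Suc n))) * y \<ge> 1"
  shows "radial_cutoff n y = 0" "radial_cutoff' n y = 0"
proof -
  have "((1 + inverse (real (Suc n))) * y) ^ n \<ge> 1" using assms by (rule one_le_power)
  then show "radial_cutoff n y = 0" "radial_cutoff' n y = 0"
    by (simp_all add: radial_cutoff_def radial_cutoff'_def)
qed

text \<open>The dilation factor does no harm, as \<open>(1 + 1/(n+1))\<^sup>n \<le> exp 1\<close>.\<close>

lemma radial_cutoff_tendsto:
  assumes y: "0 \<le> y" "y < 1"
  shows "(\<lambda>n. radial_cutoff n y) \<longlonglongrightarrow> 1"
proof -
  have "(\<lambda>n. ((1 + inverse (real (Suc n))) * y) ^ n) \<longlonglongrightarrow> 0"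
  proof (rule Lim_null_comparison)
    show "\<forall>\<^sub>F n in sequentially. norm (((1 + inverse (real (Suc n))) * y) ^ n) \<le> exp 1 * y ^ n"
    proof (intro always_eventually allI)
      fix n
      have "(1 + inverse (real (Suc n))) ^ n \<le> exp (inverse (real (Suc n))) ^ n"
        by (intro power_mono) auto
      also have "\<dots> = exp (real n * inverse (real (Suc n)))" by (simp add: exp_of_nat_mult)
      also have "\<dots> \<le> exp 1" by (simp add: field_simps)
      finally have "(1 + inverse (real (Suc n))) ^ n * y ^ n \<le> exp 1 * y ^ n"
        using y by (intro mult_right_mono) auto
      then show "norm (((1 + inverse (real (Suc n))) * y) ^ n) \<le> exp 1 * y ^ n"
        using y by (simp add: power_mult_distrib abs_mult)
    qed
    show "(\<lambda>n. exp 1 * y ^ n) \<longlonglongrightarrow> 0"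
      using y by (intro tendsto_mult_right_zero LIMSEQ_realpow_zero) auto
  qed
  then have "(\<lambda>n. (max 0 (1 - ((1 + inverse (real (Suc n))) * y) ^ n))\<^sup>2) \<longlonglongrightarrow> (max 0 (1 - 0))\<^sup>2"
    by (intro tendsto_intros)
  then show ?thesis by (simp add: radial_cutoff_def)
qed

abbreviation cutoff :: "nat \<Rightarrow> 'a::euclidean_space \<Rightarrow> real" where
  "cutoff n x \<equiv> radial_cutoff n (x \<bullet> x)"

abbreviation cutoff_gradient :: "nat \<Rightarrow> 'a::euclidean_space \<Rightarrow> 'a" where
  "cutoff_gradient n x \<equiv> radial_cutoff' n (x \<bullet> x) *\<^sub>R (2 *\<^sub>R x)"

lemma cutoff_C1: "C1_function (cutoff n :: 'a::euclidean_space \<Rightarrow> real) (cutoff_gradient n)"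
  unfolding C1_function_def
proof (intro conjI allI)
  fix x :: 'a
  have "GDERIV (\<lambda>x::'a. x \<bullet> x) x :> 2 *\<^sub>R x"
    unfolding gderiv_def by (auto intro!: derivative_eq_intros simp: inner_commute)
  then show "GDERIV (cutoff n) x :> cutoff_gradient n x"
    by (rule GDERIV_DERIV_compose) (rule radial_cutoff_deriv)
  have "continuous_on UNIV (\<lambda>x::'a. radial_cutoff' n (x \<bullet> x))"
    by (rule continuous_on_compose2[OF radial_cutoff'_continuous]) (auto intro!: continuous_intros)
  then show "continuous_on UNIV (cutoff_gradient n :: 'a \<Rightarrow> 'a)" by (intro continuous_intros)
qed

lemma cutoff_C1_compact_support:
  assumes \<psi>: "C1_function \<psi> \<Psi>"
  shows "C1_compact_support (\<lambda>x::'a::euclidean_space. cutoff n x * \<psi> x) (\<lambda>x. cutoff n x *\<^sub>R \<Psi> x + \<psi> x *\<^sub>R cutoff_gradient n x)"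
  unfolding C1_compact_support_def
proof
  show "C1_function (\<lambda>x. cutoff n x * \<psi> x) (\<lambda>x. cutoff n x *\<^sub>R \<Psi> x + \<psi> x *\<^sub>R cutoff_gradient n x)"
    by (rule C1_mult[OF cutoff_C1 \<psi>])
  let ?a = "1 + inverse (real (Suc n))"
  have "{x. cutoff n x * \<psi> x \<noteq> 0} \<subseteq> {x. ?a * (x \<bullet> x) \<le> 1}"
  proof
    fix x assume "x \<in> {x. cutoff n x * \<psi> x \<noteq> 0}"
    then have "cutoff n x \<noteq> 0" by simp
    then show "x \<in> {x. ?a * (x \<bullet> x) \<le> 1}" using radial_cutoff_zero(1)[of n "x \<bullet> x"] by fastforce
  qed
  moreover have "closed {x::'a. ?a * (x \<bullet> x) \<le> 1}"
    by (intro closed_Collect_le continuous_intros)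
  ultimately have "closure {x. cutoff n x * \<psi> x \<noteq> 0} \<subseteq> {x. ?a * (x \<bullet> x) \<le> 1}"
    by (rule closure_minimal)
  also have "\<dots> \<subseteq> ball 0 1"
  proof
    fix x :: 'a assume "x \<in> {x. ?a * (x \<bullet> x) \<le> 1}"
    then have 1: "?a * (x \<bullet> x) \<le> 1" by simp
    have "x \<bullet> x < 1"
    proof (rule ccontr)
      assume "\<not> x \<bullet> x < 1"
      then have "?a * 1 \<le> ?a * (x \<bullet> x)" by (intro mult_left_mono) (auto simp: add_nonneg_nonneg)
      from order_trans[OF this 1] have "inverse (real (Suc n)) \<le> 0" by simp
      then show False by simp
    qed
    then have "(norm x)\<^sup>2 < 1" by (simp add: power2_norm_eq_inner)
    then have "norm x < 1" by (simp add: power2_less_imp_less[of _ 1])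
    then show "x \<in> ball 0 1" by simp
  qed
  finally show "closure {x. cutoff n x * \<psi> x \<noteq> 0} \<subseteq> ball 0 1" .
qed

lemma C1_compact_support_zero:
  assumes "C1_compact_support \<phi> \<Phi>" "norm x \<ge> 1"
  shows "\<phi> x = 0"
proof (rule ccontr)
  assume "\<phi> x \<noteq> 0"
  then have "x \<in> {x. \<phi> x \<noteq> 0}" by simp
  then have "x \<in> closure {x. \<phi> x \<noteq> 0}" by (rule subsetD[OF closure_subset])
  moreover have "closure {x. \<phi> x \<noteq> 0} \<subseteq> ball 0 1" using assms(1) unfolding C1_compact_support_def by (rule conjunct2)
  ultimately have "x \<in> ball 0 1" by (rule rev_subsetD)
  then show False using assms(2) by simp
qed

text \<open>
  Let \<open>\<chi>\<close> be the cutoff. The integral of the derivative of \<open>\<chi> \<psi>\<close> vanishes, so that the integral of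
  \<open>\<chi> \<partial>\<^sub>i\<psi>\<close>, which tends to the left-hand side, equals that of \<open>- \<psi> \<partial>\<^sub>i\<chi>\<close>. The latter is computed in polar coordinates: on each ray \<open>- \<chi>'\<close> is
  moved to \<open>r\<^sup>d\<^sup>-\<^sup>1 \<psi>\<close> by parts. The limit is the integral of the derivative of \<open>r\<^sup>d\<^sup>-\<^sup>1 \<psi>\<close> over \<open>(0,1)\<close>, that is, the value
  of \<open>\<psi>\<close> at the end of the ray.
\<close>

theorem divergence_theorem_ball:
  fixes \<psi> :: "'a::euclidean_space \<Rightarrow> real"
  assumes C1: "C1_function \<psi> \<Psi>" and i: "i \<in> Basis" and d: "DIM('a) \<ge> 2"
  shows "(\<integral>x. \<Psi> x \<bullet> i \<partial>ball_measure) = (\<integral>\<omega>. \<psi> \<omega> * (\<omega> \<bullet> i) \<partial>sphere_measure)"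
proof -
  let ?d = "DIM('a)"
  interpret S: finite_measure "sphere_measure :: 'a measure" by (rule finite_sphere_measure)
  note c = C1_continuous[OF C1] C1_gradient_continuous[OF C1]
  have [measurable]: "\<psi> \<in> borel_measurable borel" "\<Psi> \<in> borel_measurable borel"
    using borel_measurable_continuous_onI[OF c(1)] borel_measurable_continuous_onI[OF c(2)] .
  have cut_cont: "continuous_on UNIV (radial_cutoff n)" for n
    by (intro continuous_at_imp_continuous_on ballI DERIV_isCont[OF radial_cutoff_deriv])
  have [measurable]: "radial_cutoff n \<in> borel_measurable borel" "radial_cutoff' n \<in> borel_measurable borel" for n
    using cut_cont radial_cutoff'_continuous by (auto intro: borel_measurable_continuous_onI)
  have cut: "continuous_on UNIV (cutoff n :: 'a \<Rightarrow> real)" "continuous_on UNIV (cutoff_gradient n :: 'a \<Rightarrow> 'a)" for n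
    using C1_continuous[OF cutoff_C1] C1_gradient_continuous[OF cutoff_C1] by auto
  define A where "A n = (\<integral>x. cutoff n x * (\<Psi> x \<bullet> i) \<partial>ball_measure)" for n
  define B where "B n = (\<integral>x. \<psi> x * (cutoff_gradient n x \<bullet> i) \<partial>ball_measure)" for n
  have AB: "A n = - B n" for n
  proof -
    let ?G = "\<lambda>x. cutoff n x *\<^sub>R \<Psi> x + \<psi> x *\<^sub>R cutoff_gradient n x"
    note cs = cutoff_C1_compact_support[OF C1, of n]
    have z: "(\<integral>x. ?G x \<bullet> i \<partial>lborel) = 0"
    proof (rule integral_partial_zero[where R=1])
      show "C1_function (\<lambda>x. cutoff n x * \<psi> x) ?G" using cs by (simp add: C1_compact_support_def)
      show "cutoff n x * \<psi> x = 0" if "norm x > 1" for x using C1_compact_support_zero[OF cs, of x] that by simp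
    qed (rule i)
    have Gz: "?G x = 0" if "x \<notin> ball 0 1" for x :: 'a
    proof -
      have "norm x ^ 2 \<ge> 1" using that by simp
      then have "x \<bullet> x \<ge> 1" by (simp add: power2_norm_eq_inner)
      then have "(1 + inverse (real (Suc n))) * (x \<bullet> x) \<ge> 1 * 1" by (intro mult_mono) auto
      then show ?thesis using radial_cutoff_zero[of n "x \<bullet> x"] by simp
    qed
    have "A n + B n = (\<integral>x. cutoff n x * (\<Psi> x \<bullet> i) + \<psi> x * (cutoff_gradient n x \<bullet> i) \<partial>ball_measure)"
      unfolding A_def B_def
      by (rule Bochner_Integration.integral_add[symmetric])
         (intro continuous_integrable_ball continuous_on_mult continuous_on_inner continuous_on_const cut c)+
    also have "\<dots> = (\<integral>x. ?G x \<bullet> i \<partial>ball_measure)"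
      by (simp only: inner_add_left inner_scaleR_left)
    also have "\<dots> = (\<integral>x. indicator (ball 0 1) x *\<^sub>R (?G x \<bullet> i) \<partial>lebesgue)"
      by (subst integral_restrict_space) auto
    also have "\<dots> = (\<integral>x. ?G x \<bullet> i \<partial>lebesgue)"
    proof (rule Bochner_Integration.integral_cong[OF refl])
      fix x show "indicator (ball 0 1) x *\<^sub>R (?G x \<bullet> i) = ?G x \<bullet> i"
      proof (cases "x \<in> ball 0 1")
        case False
        then show ?thesis by (simp only: Gz[OF False] inner_zero_left scaleR_zero_right)
      qed simp
    qed
    also have "\<dots> = (\<integral>x. ?G x \<bullet> i \<partial>lborel)"
    proof (rule integral_completion)
      have "continuous_on UNIV (\<lambda>x. ?G x \<bullet> i)"
        by (intro continuous_on_inner continuous_on_add continuous_on_scaleR continuous_on_const cut c)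
      then show "(\<lambda>x. ?G x \<bullet> i) \<in> borel_measurable lborel"
        using borel_measurable_continuous_onI by simp
    qed
    finally show ?thesis using z by simp
  qed
  have A_lim: "A \<longlonglongrightarrow> (\<integral>x. \<Psi> x \<bullet> i \<partial>ball_measure)"
    unfolding A_def
  proof (rule integral_dominated_convergence[where w = "\<lambda>x. \<bar>\<Psi> x \<bullet> i\<bar>"])
    show "integrable ball_measure (\<lambda>x. \<bar>\<Psi> x \<bullet> i\<bar>)"
      by (intro continuous_integrable_ball continuous_intros c)
    show "AE x in ball_measure. (\<lambda>n. cutoff n x * (\<Psi> x \<bullet> i)) \<longlonglongrightarrow> \<Psi> x \<bullet> i"
    proof (rule AE_I2)
      fix x :: 'a assume "x \<in> space ball_measure"
      then have "(norm x)\<^sup>2 < 1" by (simp add: power_less_one_iff abs_square_less_1)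
      then have "x \<bullet> x < 1" by (simp add: power2_norm_eq_inner)
      then have "(\<lambda>n. cutoff n x * (\<Psi> x \<bullet> i)) \<longlonglongrightarrow> 1 * (\<Psi> x \<bullet> i)"
        by (intro tendsto_intros radial_cutoff_tendsto) auto
      then show "(\<lambda>n. cutoff n x * (\<Psi> x \<bullet> i)) \<longlonglongrightarrow> \<Psi> x \<bullet> i" by simp
    qed
    show "AE x in ball_measure. norm (cutoff n x * (\<Psi> x \<bullet> i)) \<le> \<bar>\<Psi> x \<bullet> i\<bar>" for n
    proof (rule AE_I2)
      fix x :: 'a
      have "\<bar>cutoff n x\<bar> \<le> 1" using radial_cutoff_range[of "x \<bullet> x" n] by simp
      then show "norm (cutoff n x * (\<Psi> x \<bullet> i)) \<le> \<bar>\<Psi> x \<bullet> i\<bar>"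
        by (simp add: abs_mult mult_left_le_one_le)
    qed
  qed (intro continuous_measurable_ball continuous_on_mult continuous_on_inner continuous_on_const cut c)+
  define h' where "h' \<omega> r = real (?d - 1) * r ^ (?d - 1 - 1) * \<psi> (r *\<^sub>R \<omega>) + r ^ (?d - 1) * (\<Psi> (r *\<^sub>R \<omega>) \<bullet> \<omega>)" for \<omega> r
  have h': "((\<lambda>r. r ^ (?d - 1) * \<psi> (r *\<^sub>R \<omega>)) has_real_derivative h' \<omega> r) (at r)" for \<omega> r
    unfolding h'_def using C1_deriv_line[OF C1, of 0 \<omega> r] by (auto intro!: derivative_eq_intros)
  have h'_cont: "continuous_on UNIV (h' \<omega>)" for \<omega>
    unfolding h'_def
    by (intro continuous_intros continuous_on_compose2[OF c(1)] continuous_on_compose2[OF c(2)]) auto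
  obtain C1' where C1': "C1' > 0" "\<And>x. norm x \<le> 1 \<Longrightarrow> norm (\<psi> x) \<le> C1'" using continuous_bounded_cball[OF c(1)] by blast
  obtain C2 where C2: "C2 > 0" "\<And>x. norm x \<le> 1 \<Longrightarrow> norm (\<Psi> x) \<le> C2" using continuous_bounded_cball[OF c(2)] by blast
  define K where "K = real (?d - 1) * C1' + C2"
  have h'_bound: "\<bar>h' \<omega> r\<bar> \<le> K" if "norm \<omega> = 1" "0 \<le> r" "r \<le> 1" for \<omega> r
  proof -
    have "\<bar>real (?d - 1) * r ^ (?d - 1 - 1) * \<psi> (r *\<^sub>R \<omega>)\<bar> \<le> real (?d - 1) * 1 * C1'"
      unfolding abs_mult using that C1' by (intro mult_mono) (auto intro: power_le_one)
    moreover have "\<bar>\<Psi> (r *\<^sub>R \<omega>) \<bullet> \<omega>\<bar> \<le> C2"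
      using Cauchy_Schwarz_ineq2[of "\<Psi> (r *\<^sub>R \<omega>)" \<omega>] C2(2)[of "r *\<^sub>R \<omega>"] that by simp
    then have "\<bar>r ^ (?d - 1) * (\<Psi> (r *\<^sub>R \<omega>) \<bullet> \<omega>)\<bar> \<le> 1 * C2"
      unfolding abs_mult using that by (intro mult_mono) (auto intro: power_le_one)
    ultimately show ?thesis unfolding h'_def K_def by linarith
  qed
  have [measurable]: "(\<lambda>(\<omega>, r). h' \<omega> r) \<in> borel_measurable (borel \<Otimes>\<^sub>M borel)" unfolding h'_def by measurable
  have [measurable]: "h' \<omega> \<in> borel_measurable borel" for \<omega> by (rule borel_measurable_continuous_onI[OF h'_cont])
  \<comment> \<open>The radial integral after integration by parts; it tends to \<open>\<psi> \<omega>\<close>.\<close>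
  define J where "J n \<omega> = (\<integral>r. indicator {0..1} r * (radial_cutoff n (r\<^sup>2) * h' \<omega> r) \<partial>lborel)" for n \<omega>
  have [measurable]: "J n \<in> borel_measurable borel" for n unfolding J_def by measurable
  have B_cont: "continuous_on UNIV (\<lambda>x. \<psi> x * (cutoff_gradient n x \<bullet> i))" for n
    by (intro continuous_on_mult continuous_on_inner continuous_on_const cut c)
  have meas: "(\<lambda>r. indicator A r * f r) \<in> borel_measurable lborel" if "continuous_on UNIV f" "A \<in> sets borel" for f :: "real \<Rightarrow> real" and A
    using borel_measurable_continuous_onI[OF that(1)] that(2) by simp
  have B_eq: "B n = - (\<integral>\<omega>. (\<omega> \<bullet> i) * J n \<omega> \<partial>sphere_measure)" for n
  proof -
    have "B n = (\<integral>\<omega>. (\<integral>r. indicator {0<..<1} r * (r ^ (?d - 1) * (\<psi> (r *\<^sub>R \<omega>) * (cutoff_gradient n (r *\<^sub>R \<omega>) \<bullet> i))) \<partial>lborel) \<partial>sphere_measure)"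
      unfolding B_def
    proof (rule polar_integral)
      show "(\<lambda>x. \<psi> x * (cutoff_gradient n x \<bullet> i)) \<in> borel_measurable borel"
        "integrable ball_measure (\<lambda>x. \<psi> x * (cutoff_gradient n x \<bullet> i))"
        using B_cont by (rule borel_measurable_continuous_onI, rule continuous_integrable_ball)
    qed
    also have "\<dots> = (\<integral>\<omega>. - ((\<omega> \<bullet> i) * J n \<omega>) \<partial>sphere_measure)"
    proof (rule Bochner_Integration.integral_cong[OF refl])
      fix \<omega> :: 'a assume "\<omega> \<in> space sphere_measure"
      then have \<omega>: "norm \<omega> = 1" by simp
      then have \<omega>2: "\<omega> \<bullet> \<omega> = 1" by (simp add: power2_norm_eq_inner[symmetric])
      let ?g = "\<lambda>r. radial_cutoff n (r\<^sup>2)" and ?g' = "\<lambda>r. radial_cutoff' n (r\<^sup>2) * (2 * r)"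
      let ?h = "\<lambda>r. r ^ (?d - 1) * \<psi> (r *\<^sub>R \<omega>)"
      have g': "(?g has_real_derivative ?g' r) (at r)" for r
        by (rule DERIV_chain2[OF radial_cutoff_deriv]) (auto intro!: derivative_eq_intros)
      have sq: "continuous_on UNIV (\<lambda>r::real. r\<^sup>2)" "continuous_on UNIV (\<lambda>r::real. 2 * r)" by (intro continuous_intros)+
      have g_cont: "continuous_on UNIV ?g" "continuous_on UNIV ?g'"
        using continuous_on_compose2[OF cut_cont sq(1)]
          continuous_on_mult[OF continuous_on_compose2[OF radial_cutoff'_continuous sq(1)] sq(2)] by simp_all
      have h_cont: "continuous_on UNIV ?h"
        by (rule continuous_on_mult[OF continuous_on_power[OF continuous_on_id] continuous_on_compose2[OF c(1)]])
          (auto intro!: continuous_intros)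
      have gh_cont: "continuous_on UNIV (\<lambda>r. ?g' r * ?h r)" "continuous_on UNIV (\<lambda>r. ?g r * h' \<omega> r)"
        by (rule continuous_on_mult[OF g_cont(2) h_cont], rule continuous_on_mult[OF g_cont(1) h'_cont])
      have "(\<integral>r. (?g' r * ?h r + ?g r * h' \<omega> r) * indicator {0..1} r \<partial>lborel) = ?g 1 * ?h 1 - ?g 0 * ?h 0"
      proof (rule integral_FTC_Icc_real)
        fix r :: real
        show "((\<lambda>r. ?g r * ?h r) has_real_derivative ?g' r * ?h r + ?g r * h' \<omega> r) (at r)"
          by (rule DERIV_cong[OF DERIV_mult[OF g' h']]) (simp add: algebra_simps)
        show "isCont (\<lambda>r. ?g' r * ?h r + ?g r * h' \<omega> r) r"
          by (rule continuous_on_interior[OF continuous_on_add[OF gh_cont]]) simp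
      qed simp
      also have "?g 1 = 0" by (rule radial_cutoff_zero) simp
      also have "?h 0 = 0" using d by simp
      finally have sum0: "(\<integral>r. (?g' r * ?h r + ?g r * h' \<omega> r) * indicator {0..1} r \<partial>lborel) = 0" by simp
      have int: "integrable lborel (\<lambda>r. indicator {0..1} r * f r)" if "continuous_on UNIV f" for f :: "real \<Rightarrow> real"
        using borel_integrable_compact[of "{0..1::real}" f] continuous_on_subset[OF that] by simp
      have "(\<integral>r. (?g' r * ?h r + ?g r * h' \<omega> r) * indicator {0..1} r \<partial>lborel)
         = (\<integral>r. indicator {0..1} r * (?g' r * ?h r) \<partial>lborel) + J n \<omega>"
        unfolding J_def
        by (subst Bochner_Integration.integral_add[symmetric, OF int[OF gh_cont(1)] int[OF gh_cont(2)]])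
           (rule Bochner_Integration.integral_cong[OF refl], simp add: distrib_left mult_ac)
      then have IJ: "(\<integral>r. indicator {0..1} r * (?g' r * ?h r) \<partial>lborel) = - J n \<omega>" using sum0 by simp
      have "(\<integral>r. indicator {0<..<1} r * (r ^ (?d - 1) * (\<psi> (r *\<^sub>R \<omega>) * (cutoff_gradient n (r *\<^sub>R \<omega>) \<bullet> i))) \<partial>lborel)
         = (\<integral>r. (\<omega> \<bullet> i) * (indicator {0..1} r * (?g' r * ?h r)) \<partial>lborel)"
      proof (rule integral_cong_AE)
        show "AE r in lborel. indicator {0<..<1} r * (r ^ (?d - 1) * (\<psi> (r *\<^sub>R \<omega>) * (cutoff_gradient n (r *\<^sub>R \<omega>) \<bullet> i)))
           = (\<omega> \<bullet> i) * (indicator {0..1} r * (?g' r * ?h r))"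
          using AE_lborel_singleton[of "0::real"] AE_lborel_singleton[of "1::real"]
        proof eventually_elim
          fix r :: real assume "r \<noteq> 0" "r \<noteq> 1"
          then show "indicator {0<..<1} r * (r ^ (?d - 1) * (\<psi> (r *\<^sub>R \<omega>) * (cutoff_gradient n (r *\<^sub>R \<omega>) \<bullet> i)))
            = (\<omega> \<bullet> i) * (indicator {0..1} r * (?g' r * ?h r))"
            by (cases "r \<in> {0<..<1}") (auto simp: \<omega>2 power2_eq_square mult_ac)
        qed
        have "continuous_on UNIV (\<lambda>r. r *\<^sub>R \<omega>)" by (intro continuous_intros)
        then have "continuous_on UNIV (\<lambda>r. r ^ (?d - 1) * (\<psi> (r *\<^sub>R \<omega>) * (cutoff_gradient n (r *\<^sub>R \<omega>) \<bullet> i)))"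
          by (intro continuous_on_mult continuous_on_power continuous_on_id continuous_on_compose2[OF B_cont[of n]]) auto
        then show "(\<lambda>r. indicator {0<..<1} r * (r ^ (?d - 1) * (\<psi> (r *\<^sub>R \<omega>) * (cutoff_gradient n (r *\<^sub>R \<omega>) \<bullet> i)))) \<in> borel_measurable lborel"
          by (intro meas) simp_all
        show "(\<lambda>r. (\<omega> \<bullet> i) * (indicator {0..1} r * (?g' r * ?h r))) \<in> borel_measurable lborel"
          by (intro borel_measurable_times borel_measurable_const meas gh_cont(1)) simp
      qed
      also have "\<dots> = - ((\<omega> \<bullet> i) * J n \<omega>)" using IJ by simp
      finally show "(\<integral>r. indicator {0<..<1} r * (r ^ (?d - 1) * (\<psi> (r *\<^sub>R \<omega>) * (cutoff_gradient n (r *\<^sub>R \<omega>) \<bullet> i))) \<partial>lborel)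
         = - ((\<omega> \<bullet> i) * J n \<omega>)" .
    qed
    finally show ?thesis by simp
  qed
  have J_lim: "(\<lambda>n. J n \<omega>) \<longlonglongrightarrow> \<psi> \<omega>" if \<omega>: "norm \<omega> = 1" for \<omega>
  proof -
    have "(\<lambda>n. J n \<omega>) \<longlonglongrightarrow> (\<integral>r. h' \<omega> r * indicator {0..1} r \<partial>lborel)"
      unfolding J_def
    proof (rule integral_dominated_convergence[where w = "\<lambda>r. indicator {0..1} r * K"])
      show "AE r in lborel. (\<lambda>n. indicator {0..1} r * (radial_cutoff n (r\<^sup>2) * h' \<omega> r)) \<longlonglongrightarrow> h' \<omega> r * indicator {0..1} r"
        using AE_lborel_singleton[of "1::real"]
      proof eventually_elim
        fix r :: real assume r: "r \<noteq> 1"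
        show "(\<lambda>n. indicator {0..1} r * (radial_cutoff n (r\<^sup>2) * h' \<omega> r)) \<longlonglongrightarrow> h' \<omega> r * indicator {0..1} r"
        proof (cases "r \<in> {0..1}")
          case True
          then have "(\<lambda>n. radial_cutoff n (r\<^sup>2) * h' \<omega> r) \<longlonglongrightarrow> 1 * h' \<omega> r"
            using r by (intro tendsto_intros radial_cutoff_tendsto) (auto simp: power_less_one_iff abs_square_less_1)
          then show ?thesis using True by simp
        qed simp
      qed
      show "AE r in lborel. norm (indicator {0..1} r * (radial_cutoff n (r\<^sup>2) * h' \<omega> r)) \<le> indicator {0..1} r * K" for n
      proof (rule AE_I2)
        fix r :: real
        show "norm (indicator {0..1} r * (radial_cutoff n (r\<^sup>2) * h' \<omega> r)) \<le> indicator {0..1} r * K"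
        proof (cases "r \<in> {0..1}")
          case True
          then have "\<bar>radial_cutoff n (r\<^sup>2)\<bar> * \<bar>h' \<omega> r\<bar> \<le> 1 * K"
            using radial_cutoff_range[of "r\<^sup>2" n] h'_bound[OF \<omega>, of r] by (intro mult_mono) auto
          then show ?thesis using True by (simp add: abs_mult)
        qed simp
      qed
      show "(\<lambda>r. h' \<omega> r * indicator {0..1} r) \<in> borel_measurable lborel"
        using meas[OF h'_cont[of \<omega>], of "{0..1}"] by (simp add: mult.commute)
      show "(\<lambda>r. indicator {0..1} r * (radial_cutoff n (r\<^sup>2) * h' \<omega> r)) \<in> borel_measurable lborel" for n
        by (intro meas continuous_on_mult h'_cont continuous_on_compose2[OF cut_cont continuous_on_power[OF continuous_on_id]]) auto
      show "integrable lborel (\<lambda>r. indicator {0..1::real} r * K)" by simp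
    qed
    also have "(\<integral>r. h' \<omega> r * indicator {0..1} r \<partial>lborel) = 1 ^ (?d - 1) * \<psi> (1 *\<^sub>R \<omega>) - 0 ^ (?d - 1) * \<psi> (0 *\<^sub>R \<omega>)"
      by (intro integral_FTC_Icc_real h' continuous_on_interior[OF h'_cont]) auto
    also have "\<dots> = \<psi> \<omega>" using d by simp
    finally show ?thesis .
  qed
  have K0: "K \<ge> 0" using C1' C2 by (simp add: K_def)
  have J_bound: "\<bar>J n \<omega>\<bar> \<le> K" if \<omega>: "norm \<omega> = 1" for n \<omega>
  proof -
    have "\<bar>J n \<omega>\<bar> \<le> (\<integral>r. \<bar>indicator {0..1} r * (radial_cutoff n (r\<^sup>2) * h' \<omega> r)\<bar> \<partial>lborel)"
      unfolding J_def by (rule integral_abs_bound)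
    also have "\<dots> \<le> (\<integral>r. indicator {0..1::real} r * K \<partial>lborel)"
    proof (rule integral_mono)
      have "continuous_on UNIV (\<lambda>r. radial_cutoff n (r\<^sup>2) * h' \<omega> r)"
        by (intro continuous_on_mult h'_cont continuous_on_compose2[OF cut_cont continuous_on_power[OF continuous_on_id]]) auto
      then have "integrable lborel (\<lambda>r. indicator {0..1} r *\<^sub>R (radial_cutoff n (r\<^sup>2) * h' \<omega> r))"
        by (intro borel_integrable_compact) (auto intro: continuous_on_subset)
      then show "integrable lborel (\<lambda>r. \<bar>indicator {0..1} r * (radial_cutoff n (r\<^sup>2) * h' \<omega> r)\<bar>)" by simp
      fix r :: real
      show "\<bar>indicator {0..1} r * (radial_cutoff n (r\<^sup>2) * h' \<omega> r)\<bar> \<le> indicator {0..1} r * K"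
      proof (cases "r \<in> {0..1}")
        case True
        then have "\<bar>radial_cutoff n (r\<^sup>2)\<bar> * \<bar>h' \<omega> r\<bar> \<le> 1 * K"
          using radial_cutoff_range[of "r\<^sup>2" n] h'_bound[OF \<omega>, of r] by (intro mult_mono) auto
        then show ?thesis using True by (simp add: abs_mult)
      qed simp
    qed simp
    also have "\<dots> = K" by simp
    finally show ?thesis .
  qed
  have B_lim: "(\<lambda>n. \<integral>\<omega>. (\<omega> \<bullet> i) * J n \<omega> \<partial>sphere_measure) \<longlonglongrightarrow> (\<integral>\<omega>. (\<omega> \<bullet> i) * \<psi> \<omega> \<partial>sphere_measure)"
  proof (rule integral_dominated_convergence[where w = "\<lambda>\<omega>. K"])
    show "AE \<omega> in sphere_measure. (\<lambda>n. (\<omega> \<bullet> i) * J n \<omega>) \<longlonglongrightarrow> (\<omega> \<bullet> i) * \<psi> \<omega>"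
      by (intro AE_I2 tendsto_intros J_lim) simp
    show "AE \<omega> in sphere_measure. norm ((\<omega> \<bullet> i) * J n \<omega>) \<le> K" for n
    proof (rule AE_I2)
      fix \<omega> :: 'a assume "\<omega> \<in> space sphere_measure"
      then have \<omega>: "norm \<omega> = 1" by simp
      have "\<bar>\<omega> \<bullet> i\<bar> \<le> 1" using Basis_le_norm[OF i, of \<omega>] \<omega> by simp
      then have "\<bar>\<omega> \<bullet> i\<bar> * \<bar>J n \<omega>\<bar> \<le> 1 * K" using J_bound[OF \<omega>] by (intro mult_mono) auto
      then show "norm ((\<omega> \<bullet> i) * J n \<omega>) \<le> K" by (simp add: abs_mult)
    qed
    show "(\<lambda>\<omega>. (\<omega> \<bullet> i) * \<psi> \<omega>) \<in> borel_measurable sphere_measure"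
      by (rule borel_measurable_sphere_measure) measurable
    show "(\<lambda>\<omega>. (\<omega> \<bullet> i) * J n \<omega>) \<in> borel_measurable sphere_measure" for n
      by (rule borel_measurable_sphere_measure) measurable
  qed simp
  have "A \<longlonglongrightarrow> (\<integral>\<omega>. (\<omega> \<bullet> i) * \<psi> \<omega> \<partial>sphere_measure)"
    using B_lim by (simp add: AB[abs_def] B_eq)
  from LIMSEQ_unique[OF A_lim this] show ?thesis by (simp add: mult.commute)
qed


section \<open>Harmonic polynomials\<close>

lemma real_polynomial_function_gradient:
  fixes P :: "'a::euclidean_space \<Rightarrow> real"
  assumes "real_polynomial_function P"
  shows "\<exists>G. (\<forall>x. GDERIV P x :> G x) \<and> (\<forall>i\<in>Basis. real_polynomial_function (\<lambda>x. G x \<bullet> i))"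
  using assms
proof induction
  case (linear f)
  define g where "g = (\<Sum>i\<in>Basis. f i *\<^sub>R i)"
  have "f h = h \<bullet> g" for h
  proof -
    have "f h = f (\<Sum>i\<in>Basis. (h \<bullet> i) *\<^sub>R i)" by (simp add: euclidean_representation)
    also have "\<dots> = (\<Sum>i\<in>Basis. (h \<bullet> i) * f i)"
      using bounded_linear.linear[OF linear] by (simp add: linear_sum linear_scale)
    also have "\<dots> = h \<bullet> g" by (simp add: g_def inner_sum_right mult.commute)
    finally show ?thesis .
  qed
  then have "f = (\<lambda>h. h \<bullet> g)" by auto
  moreover have "(f has_derivative f) (at x)" for x by (rule bounded_linear_imp_has_derivative[OF linear])
  ultimately have "GDERIV f x :> g" for x unfolding gderiv_def by simp
  then show ?case by (intro exI[of _ "\<lambda>x. g"]) auto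
next
  case (const c)
  show ?case by (intro exI[of _ "\<lambda>x. 0"]) (auto simp: GDERIV_const)
next
  case (add f g)
  then obtain F G where FG: "\<forall>x. GDERIV f x :> F x" "\<forall>i\<in>Basis. real_polynomial_function (\<lambda>x. F x \<bullet> i)"
    "\<forall>x. GDERIV g x :> G x" "\<forall>i\<in>Basis. real_polynomial_function (\<lambda>x. G x \<bullet> i)" by auto
  show ?case
    by (intro exI[of _ "\<lambda>x. F x + G x"] conjI allI ballI GDERIV_add)
       (use FG in \<open>auto simp: inner_add_left intro: real_polynomial_function.intros(3)\<close>)
next
  case (mult f g)
  then obtain F G where FG: "\<forall>x. GDERIV f x :> F x" "\<forall>i\<in>Basis. real_polynomial_function (\<lambda>x. F x \<bullet> i)"
    "\<forall>x. GDERIV g x :> G x" "\<forall>i\<in>Basis. real_polynomial_function (\<lambda>x. G x \<bullet> i)" by auto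
  show ?case
    by (intro exI[of _ "\<lambda>x. f x *\<^sub>R G x + g x *\<^sub>R F x"] conjI allI ballI GDERIV_mult)
       (use FG mult.hyps in \<open>auto simp: inner_add_left intro!: real_polynomial_function.intros(3) real_polynomial_function.intros(4)\<close>)
qed

lemma real_polynomial_continuous: "real_polynomial_function P \<Longrightarrow> continuous_on UNIV P"
  by (intro continuous_at_imp_continuous_on ballI continuous_real_polymonial_function)

lemma real_polynomial_C1:
  fixes P :: "'a::euclidean_space \<Rightarrow> real"
  assumes "real_polynomial_function P"
  obtains G where "C1_function P G" "\<And>i. i \<in> Basis \<Longrightarrow> real_polynomial_function (\<lambda>x. G x \<bullet> i)"
proof -
  obtain G where G: "\<forall>x. GDERIV P x :> G x" "\<forall>i\<in>Basis. real_polynomial_function (\<lambda>x. G x \<bullet> i)"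
    using real_polynomial_function_gradient[OF assms] by blast
  have "continuous_on UNIV (\<lambda>x. \<Sum>i\<in>Basis. (G x \<bullet> i) *\<^sub>R i)"
    using G(2) by (intro continuous_on_sum continuous_on_scaleR real_polynomial_continuous continuous_on_const) auto
  then have "continuous_on UNIV G" by (simp add: euclidean_representation)
  then show ?thesis using G that by (auto simp: C1_function_def)
qed

text \<open>
  The vectors \<open>H i x\<close> are the rows of the Hessian, and the last property is harmonicity. This
  form replaces the iterated one-dimensional derivatives in the definition of the Laplacian by \<open>C\<^sup>1\<close>
  functions to which the divergence theorem applies.
\<close>

lemma harmonic_polynomial_gradient:
  fixes P :: "'a::euclidean_space \<Rightarrow> real"
  assumes P: "real_polynomial_function P" and hom: "\<And>c x. P (c *\<^sub>R x) = c ^ k * P x"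
    and harm: "\<And>x. laplacian P x = 0"
  obtains G H where "C1_function P G" "\<And>i. i \<in> Basis \<Longrightarrow> C1_function (\<lambda>x. G x \<bullet> i) (H i)"
    "\<And>x. (\<Sum>i\<in>Basis. H i x \<bullet> i) = 0"
proof -
  obtain G where G: "C1_function P G" "\<And>i. i \<in> Basis \<Longrightarrow> real_polynomial_function (\<lambda>x. G x \<bullet> i)"
    using real_polynomial_C1[OF P] by blast
  have "\<forall>i\<in>Basis. \<exists>H. C1_function (\<lambda>x. G x \<bullet> i) H"
    using real_polynomial_C1[OF G(2)] by blast
  from bchoice[OF this] obtain H where "\<forall>i\<in>Basis. C1_function (\<lambda>x. G x \<bullet> i) (H i)" by (rule exE)
  then have H: "\<And>i. i \<in> Basis \<Longrightarrow> C1_function (\<lambda>x. G x \<bullet> i) (H i)" by (rule bspec)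
  have "(\<Sum>i\<in>Basis. H i x \<bullet> i) = 0" for x
  proof -
    have "(deriv ^^ 2) (\<lambda>t. P (x + t *\<^sub>R i)) 0 = H i x \<bullet> i" if i: "i \<in> Basis" for i
    proof -
      have "deriv (\<lambda>t. P (x + t *\<^sub>R i)) = (\<lambda>t. G (x + t *\<^sub>R i) \<bullet> i)"
        by (intro ext DERIV_imp_deriv C1_deriv_line[OF G(1)])
      then have "(deriv ^^ 2) (\<lambda>t. P (x + t *\<^sub>R i)) 0 = deriv (\<lambda>t. G (x + t *\<^sub>R i) \<bullet> i) 0"
        by (simp add: numeral_2_eq_2)
      also have "\<dots> = H i (x + 0 *\<^sub>R i) \<bullet> i"
        by (rule DERIV_imp_deriv) (rule C1_deriv_line[OF H[OF i]])
      finally show ?thesis by simp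
    qed
    then show ?thesis using harm[of x] by (simp add: laplacian_def)
  qed
  with G(1) H show ?thesis by (rule that)
qed

text \<open>The first property is Euler's identity.\<close>

lemma homogeneous_gradient:
  fixes P :: "'a::euclidean_space \<Rightarrow> real"
  assumes C1: "C1_function P G" and hom: "\<And>c x. P (c *\<^sub>R x) = c ^ k * P x"
  shows "G x \<bullet> x = real k * P x"
    and "c \<noteq> 0 \<Longrightarrow> k \<ge> 1 \<Longrightarrow> G (c *\<^sub>R x) = c ^ (k - 1) *\<^sub>R G x"
    and "k \<ge> 2 \<Longrightarrow> G 0 = 0"
proof -
  have "((\<lambda>t. P (t *\<^sub>R x)) has_real_derivative G x \<bullet> x) (at 1)"
    using C1_deriv_line[OF C1, of 0 x 1] by simp
  moreover have "((\<lambda>t. P (t *\<^sub>R x)) has_real_derivative real k * P x) (at 1)"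
    unfolding hom by (auto intro!: derivative_eq_intros)
  ultimately show "G x \<bullet> x = real k * P x" by (rule DERIV_unique)
next
  assume c: "c \<noteq> 0" and k: "k \<ge> 1"
  have "G (c *\<^sub>R x) \<bullet> i = (c ^ (k - 1) *\<^sub>R G x) \<bullet> i" if "i \<in> Basis" for i
  proof -
    have eq: "P (c *\<^sub>R (x + t *\<^sub>R i)) = P (c *\<^sub>R x + t *\<^sub>R (c *\<^sub>R i))" for t
      by (simp add: scaleR_add_right mult.commute)
    have "((\<lambda>t. P (c *\<^sub>R x + t *\<^sub>R (c *\<^sub>R i))) has_real_derivative G (c *\<^sub>R x) \<bullet> (c *\<^sub>R i)) (at 0)"
      using C1_deriv_line[OF C1, of "c *\<^sub>R x" "c *\<^sub>R i" 0] by simp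
    moreover have "((\<lambda>t. c ^ k * P (x + t *\<^sub>R i)) has_real_derivative c ^ k * (G x \<bullet> i)) (at 0)"
      using DERIV_cmult[OF C1_deriv_line[OF C1, of x i 0], of "c ^ k"] by simp
    ultimately have "G (c *\<^sub>R x) \<bullet> (c *\<^sub>R i) = c ^ k * (G x \<bullet> i)"
      unfolding eq[symmetric] hom by (rule DERIV_unique)
    moreover have "c ^ k = c * c ^ (k - 1)" using k by (cases k) auto
    ultimately show ?thesis using c by simp
  qed
  then show "G (c *\<^sub>R x) = c ^ (k - 1) *\<^sub>R G x" by (rule euclidean_eqI)
next
  assume k: "k \<ge> 2"
  have "G 0 \<bullet> i = 0 \<bullet> i" if "i \<in> Basis" for i
  proof -
    have "((\<lambda>t. P (t *\<^sub>R i)) has_real_derivative G 0 \<bullet> i) (at 0)"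
      using C1_deriv_line[OF C1, of 0 i 0] by simp
    moreover have "((\<lambda>t. P (t *\<^sub>R i)) has_real_derivative 0) (at 0)"
      unfolding hom using k by (auto intro!: derivative_eq_intros)
    ultimately have "G 0 \<bullet> i = 0" by (rule DERIV_unique)
    then show ?thesis by simp
  qed
  then show "G 0 = 0" by (rule euclidean_eqI)
qed

lemma homogeneous_bound:
  fixes P :: "'a::euclidean_space \<Rightarrow> 'b::real_normed_vector"
  assumes cont: "continuous_on UNIV P" and m: "m \<ge> 1"
    and hom: "\<And>c x. c > 0 \<Longrightarrow> P (c *\<^sub>R x) = c ^ m *\<^sub>R P x" and zero: "P 0 = 0"
  obtains C where "C > 0" "\<And>x. norm (P x) \<le> C * norm x ^ m"
proof -
  obtain C where C: "C > 0" "\<And>x. norm x \<le> 1 \<Longrightarrow> norm (P x) \<le> C"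
    using continuous_bounded_cball[OF cont] by blast
  show ?thesis
  proof (rule that[OF C(1)])
    fix x :: 'a
    show "norm (P x) \<le> C * norm x ^ m"
    proof (cases "x = 0")
      case True then show ?thesis using zero C(1) by simp
    next
      case False
      have "P x = norm x ^ m *\<^sub>R P (x /\<^sub>R norm x)"
        using hom[of "norm x" "x /\<^sub>R norm x"] False by simp
      then have "norm (P x) = norm x ^ m * norm (P (x /\<^sub>R norm x))" by simp
      also have "\<dots> \<le> norm x ^ m * C" by (intro mult_left_mono C(2)) (use False in auto)
      finally show ?thesis by (simp add: mult.commute)
    qed
  qed
qed

text \<open>
  Only the origin needs care: the derivative of \<open>c\<close> may blow up like \<open>1/r\<close> there, but \<open>P\<close> vanishes to the second
  order.
\<close>

lemma radial_times_homogeneous_C1: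
  fixes P :: "'a::euclidean_space \<Rightarrow> real" and c c' :: "real \<Rightarrow> real"
  assumes c: "\<And>r. r > 0 \<Longrightarrow> (c has_real_derivative c' r) (at r)" "continuous_on {0<..} c'"
    and bounds: "\<And>r. r > 0 \<Longrightarrow> \<bar>c r\<bar> \<le> A" "\<And>r. r > 0 \<Longrightarrow> \<bar>c' r\<bar> * r \<le> B"
    and C1: "C1_function P G" and hom: "\<And>c x. P (c *\<^sub>R x) = c ^ m * P x" and m: "m \<ge> 2"
  shows "C1_function (\<lambda>x. c (norm x) * P x) (\<lambda>x. c (norm x) *\<^sub>R G x + (c' (norm x) * P x / norm x) *\<^sub>R x)"
proof -
  let ?\<Phi> = "\<lambda>x. c (norm x) *\<^sub>R G x + (c' (norm x) * P x / norm x) *\<^sub>R x"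
  have P0: "P 0 = 0" using hom[of 0 0] m by (auto simp: power_0_left split: if_splits)
  have G0: "G 0 = 0" using homogeneous_gradient(3)[OF C1 hom m] .
  obtain CP where CP: "CP > 0" "\<And>x. norm (P x) \<le> CP * norm x ^ m"
    using homogeneous_bound[OF C1_continuous[OF C1], of m] hom m P0 by auto
  obtain CG where CG: "CG > 0" "\<And>x. norm (G x) \<le> CG * norm x ^ (m - 1)"
  proof (rule homogeneous_bound[OF C1_gradient_continuous[OF C1], of "m - 1"])
    show "1 \<le> m - 1" using m by simp
    show "G (c *\<^sub>R x) = c ^ (m - 1) *\<^sub>R G x" if "c > 0" for c x
      using that m by (intro homogeneous_gradient(2)[OF C1 hom]) auto
  qed (use G0 in auto)
  have Psq: "norm (P x) \<le> CP * norm x ^ 2" if "norm x \<le> 1" for x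
    using CP(1) m that by (intro order_trans[OF CP(2)] mult_left_mono power_decreasing) auto
  have Gsq: "norm (G x) \<le> CG * norm x" if "norm x \<le> 1" for x
  proof -
    have "norm (G x) \<le> CG * norm x ^ 1"
      using CG(1) m that by (intro order_trans[OF CG(2)] mult_left_mono power_decreasing) auto
    then show ?thesis by simp
  qed
  have A0: "A \<ge> 0" using bounds(1)[of 1] by simp
  have B0: "B \<ge> 0" using bounds(2)[of 1] by simp
  have near0: "\<forall>\<^sub>F x in at (0::'a). x \<noteq> 0 \<and> norm x \<le> 1"
    unfolding eventually_at by (intro exI[of _ 1]) auto
  have \<Phi>0: "?\<Phi> 0 = 0" using G0 by simp
  have norm0: "((\<lambda>x. K * norm x) \<longlongrightarrow> 0) (at (0::'a))" for K :: real
    by (rule tendsto_mult_right_zero[OF tendsto_norm_zero[OF tendsto_ident_at]])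
  have der: "GDERIV (\<lambda>x. c (norm x) * P x) x :> ?\<Phi> x" for x
  proof (cases "x = 0")
    case False
    have "GDERIV (\<lambda>x. c (norm x)) x :> c' (norm x) *\<^sub>R sgn x"
      by (rule GDERIV_DERIV_compose[OF GDERIV_norm[OF False] c(1)]) (use False in simp)
    moreover have "GDERIV P x :> G x" using C1 by (simp add: C1_function_def)
    ultimately have "GDERIV (\<lambda>x. c (norm x) * P x) x :> c (norm x) *\<^sub>R G x + P x *\<^sub>R (c' (norm x) *\<^sub>R sgn x)"
      by (rule GDERIV_mult)
    then show ?thesis by (simp add: sgn_div_norm divide_inverse mult_ac)
  next
    case True
    have "((\<lambda>x. c (norm x) * P x) has_derivative (\<lambda>h. 0)) (at 0)"
      unfolding has_derivative_at
    proof (intro conjI)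
      have "((\<lambda>h. norm (c (norm h) * P h) / norm h) \<longlongrightarrow> 0) (at (0::'a))"
      proof (rule Lim_null_comparison[OF _ norm0[of "A * CP"]])
        show "\<forall>\<^sub>F x in at (0::'a). norm (norm (c (norm x) * P x) / norm x) \<le> A * CP * norm x"
          using near0
        proof eventually_elim
          fix x :: 'a assume x: "x \<noteq> 0 \<and> norm x \<le> 1"
          have "norm (P x) \<le> CP * norm x ^ 2" using x by (intro Psq) simp
          then have "\<bar>c (norm x)\<bar> * \<bar>P x\<bar> \<le> A * (CP * norm x ^ 2)"
            using bounds(1)[of "norm x"] x A0 by (intro mult_mono) auto
          then show "norm (norm (c (norm x) * P x) / norm x) \<le> A * CP * norm x"
            using x by (simp add: abs_mult divide_le_eq power2_eq_square mult_ac)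
        qed
      qed
      then show "(\<lambda>h. norm (c (norm (0 + h)) * P (0 + h) - c (norm 0) * P 0 - 0) / norm h) \<midarrow>0\<rightarrow> 0"
        using P0 by simp
    qed simp
    then have "GDERIV (\<lambda>x. c (norm x) * P x) 0 :> 0" by (simp add: gderiv_def)
    then show ?thesis unfolding True \<Phi>0 .
  qed
  have "continuous (at x) ?\<Phi>" for x
  proof (cases "x = 0")
    case False
    have cc: "isCont c (norm x)" using c(1)[of "norm x"] False by (intro DERIV_isCont) auto
    have cc': "isCont c' (norm x)" using c(2) False by (simp add: continuous_on_eq_continuous_at)
    have "isCont P x" "isCont G x"
      using C1_continuous[OF C1] C1_gradient_continuous[OF C1] by (simp_all add: continuous_on_eq_continuous_at)
    moreover have "isCont (\<lambda>x. c (norm x)) x" "isCont (\<lambda>x. c' (norm x)) x"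
      using isCont_o2[OF isCont_norm[OF continuous_ident] cc] isCont_o2[OF isCont_norm[OF continuous_ident] cc'] by simp_all
    ultimately show ?thesis using False by (intro continuous_intros) auto
  next
    case True
    have "(?\<Phi> \<longlongrightarrow> 0) (at 0)"
    proof (rule Lim_null_comparison[OF _ norm0[of "A * CG + B * CP"]])
      show "\<forall>\<^sub>F x in at (0::'a). norm (?\<Phi> x) \<le> (A * CG + B * CP) * norm x"
        using near0
      proof eventually_elim
        fix x :: 'a assume x: "x \<noteq> 0 \<and> norm x \<le> 1"
        have P: "norm (P x) \<le> CP * norm x ^ 2" using x by (intro Psq) simp
        have G: "norm (G x) \<le> CG * norm x" using x by (intro Gsq) simp
        have "norm (?\<Phi> x) \<le> \<bar>c (norm x)\<bar> * norm (G x) + \<bar>c' (norm x)\<bar> * \<bar>P x\<bar>"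
          using x by (intro order_trans[OF norm_triangle_ineq]) (simp add: abs_mult)
        also have "\<dots> \<le> A * (CG * norm x) + \<bar>c' (norm x)\<bar> * (CP * norm x ^ 2)"
          using bounds(1)[of "norm x"] x A0 G P by (intro add_mono mult_mono) auto
        also have "\<bar>c' (norm x)\<bar> * (CP * norm x ^ 2) = (\<bar>c' (norm x)\<bar> * norm x) * (CP * norm x)"
          by (simp add: power2_eq_square)
        also have "\<dots> \<le> B * (CP * norm x)"
          using bounds(2)[of "norm x"] x CP(1) by (intro mult_right_mono) auto
        finally show "norm (?\<Phi> x) \<le> (A * CG + B * CP) * norm x" by (simp add: algebra_simps)
      qed
    qed
    then show ?thesis unfolding continuous_within True \<Phi>0 .
  qed
  then show ?thesis unfolding C1_function_def using der by (auto intro: continuous_at_imp_continuous_on)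
qed

text \<open>
  The real part of \<open>(x\<^sub>1 + i x\<^sub>2)\<^sup>k\<close>. Its nontriviality is what makes eigenvalues and radial solutions
  unique, since these are defined by conditions on all spherical harmonics of degree \<open>k\<close>.
\<close>

lemma planar_harmonic_exists:
  assumes d: "DIM('a::euclidean_space) \<ge> 2"
  obtains P :: "'a::euclidean_space \<Rightarrow> real" and e where
    "real_polynomial_function P" "\<And>c x. P (c *\<^sub>R x) = c ^ k * P x" "\<And>x. laplacian P x = 0"
    "norm e = 1" "P e = 1"
proof -
  obtain e1 e2 :: 'a where e: "e1 \<in> Basis" "e2 \<in> Basis" "e1 \<noteq> e2"
  proof -
    obtain T where T: "T \<subseteq> (Basis :: 'a set)" "card T = 2" using obtain_subset_with_card_n[OF d] .
    from T(2) obtain x y where "T = {x, y}" "x \<noteq> y" unfolding card_2_iff by blast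
    then show ?thesis using that[of x y] T(1) by simp
  qed
  define z where "z x = Complex (x \<bullet> e1) (x \<bullet> e2)" for x :: 'a
  define P where "P x = Re (z x ^ k)" for x
  have poly: "real_polynomial_function (\<lambda>x. Re (z x ^ n)) \<and> real_polynomial_function (\<lambda>x. Im (z x ^ n))" for n
  proof (induction n)
    case (Suc n)
    have lin: "real_polynomial_function (\<lambda>x. x \<bullet> v)" for v :: 'a
      by (intro real_polynomial_function.intros(1) bounded_linear_inner_left)
    show ?case using Suc lin
      by (auto simp: z_def intro!: real_polynomial_function.intros(3) real_polynomial_function.intros(4) real_polynomial_function_diff)
  qed auto
  have hom: "P (c *\<^sub>R x) = c ^ k * P x" for c x
  proof -
    have "z (c *\<^sub>R x) = of_real c * z x" by (simp add: z_def complex_eq_iff)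
    then have "z (c *\<^sub>R x) ^ k = of_real (c ^ k) * z x ^ k" by (simp add: power_mult_distrib)
    then show ?thesis by (simp add: P_def)
  qed
  have lap: "laplacian P x = 0" for x
  proof -
    define \<alpha> where "\<alpha> i = Complex (i \<bullet> e1) (i \<bullet> e2)" for i :: 'a
    have line: "z (x + t *\<^sub>R i) = z x + of_real t * \<alpha> i" for t i
      by (simp add: z_def \<alpha>_def complex_eq_iff inner_add_left)
    have D: "((\<lambda>t. Re (\<beta> * (z x + of_real t * \<alpha> i) ^ n)) has_real_derivative Re (\<beta> * (of_nat n * (z x + of_real t * \<alpha> i) ^ (n - 1) * \<alpha> i))) (at t)" for \<beta> n i t
    proof (rule has_field_derivative_Re, rule has_vector_derivative_real_field[where f="\<lambda>w. \<beta> * (z x + w * \<alpha> i) ^ n"])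
      show "((\<lambda>w. \<beta> * (z x + w * \<alpha> i) ^ n) has_field_derivative \<beta> * (of_nat n * (z x + of_real t * \<alpha> i) ^ (n - 1) * \<alpha> i)) (at (of_real t))"
        by (auto intro!: derivative_eq_intros)
    qed
    have "(deriv ^^ 2) (\<lambda>t. P (x + t *\<^sub>R i)) 0 = Re (of_nat k * of_nat (k - 1) * z x ^ (k - 2) * (\<alpha> i)\<^sup>2)" for i
    proof -
      have "deriv (\<lambda>t. P (x + t *\<^sub>R i)) = (\<lambda>t. Re ((of_nat k * \<alpha> i) * (z x + of_real t * \<alpha> i) ^ (k - 1)))"
      proof
        fix t
        have "((\<lambda>t. P (x + t *\<^sub>R i)) has_real_derivative Re ((of_nat k * \<alpha> i) * (z x + of_real t * \<alpha> i) ^ (k - 1))) (at t)"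
          using D[of 1 i k t] by (simp add: P_def line mult_ac)
        then show "deriv (\<lambda>t. P (x + t *\<^sub>R i)) t = Re ((of_nat k * \<alpha> i) * (z x + of_real t * \<alpha> i) ^ (k - 1))"
          by (rule DERIV_imp_deriv)
      qed
      then have "(deriv ^^ 2) (\<lambda>t. P (x + t *\<^sub>R i)) 0 = deriv (\<lambda>t. Re ((of_nat k * \<alpha> i) * (z x + of_real t * \<alpha> i) ^ (k - 1))) 0"
        by (simp add: numeral_2_eq_2)
      also have "\<dots> = Re ((of_nat k * \<alpha> i) * (of_nat (k - 1) * (z x + of_real 0 * \<alpha> i) ^ (k - 1 - 1) * \<alpha> i))"
        by (rule DERIV_imp_deriv) (rule D)
      also have "(of_nat k * \<alpha> i) * (of_nat (k - 1) * (z x + of_real 0 * \<alpha> i) ^ (k - 1 - 1) * \<alpha> i)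
         = of_nat k * of_nat (k - 1) * z x ^ (k - 2) * (\<alpha> i)\<^sup>2"
        by (simp add: power2_eq_square mult_ac numeral_2_eq_2)
      finally show ?thesis .
    qed
    then have "laplacian P x = Re (of_nat k * of_nat (k - 1) * z x ^ (k - 2) * (\<Sum>i\<in>Basis. (\<alpha> i)\<^sup>2))"
      by (simp add: laplacian_def sum_distrib_left)
    also have "(\<Sum>i\<in>Basis. (\<alpha> i)\<^sup>2) = (\<Sum>i\<in>Basis. (if i = e1 then 1 else 0) + (if i = e2 then -1 else 0))"
    proof (rule sum.cong[OF refl])
      fix i :: 'a assume "i \<in> Basis"
      then show "(\<alpha> i)\<^sup>2 = (if i = e1 then 1 else 0) + (if i = e2 then -1 else 0)"
        using e by (auto simp: \<alpha>_def inner_Basis complex_eq_iff power2_eq_square)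
    qed
    also have "\<dots> = 0" using e by (simp add: sum.distrib sum.delta)
    finally show ?thesis by simp
  qed
  have "z e1 = 1" using e by (simp add: z_def inner_Basis complex_eq_iff)
  then have "P e1 = 1" by (simp add: P_def)
  moreover have "norm e1 = 1" using e by simp
  moreover have "real_polynomial_function P" using poly[of k] by (simp add: P_def[abs_def])
  ultimately show ?thesis using that[of P e1, OF _ hom lap] by simp
qed


section \<open>Spherical harmonics as eigenfunctions of the Dirichlet-to-Neumann map\<close>

lemma continuous_measurable_borel:
  fixes f :: "'a::topological_space \<Rightarrow> 'b::topological_space"
  assumes "continuous_on UNIV f" shows "f \<in> borel_measurable borel"
  using assms by (rule borel_measurable_continuous_onI)

lemma integrable_mult_continuous:
  fixes V f :: "'a::euclidean_space \<Rightarrow> real"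
  assumes V: "integrable ball_measure V" and f: "continuous_on UNIV f"
  shows "integrable ball_measure (\<lambda>x. V x * f x)"
proof -
  obtain C where C: "C > 0" "\<And>x. norm x \<le> 1 \<Longrightarrow> norm (f x) \<le> C" using continuous_bounded_cball[OF f] by blast
  have "integrable ball_measure (\<lambda>x. C * V x)" using V by simp
  then show ?thesis
  proof (rule Bochner_Integration.integrable_bound)
    show "(\<lambda>x. V x * f x) \<in> borel_measurable ball_measure"
      by (intro borel_measurable_times borel_measurable_integrable[OF V] continuous_measurable_ball f)
    show "AE x in ball_measure. norm (V x * f x) \<le> norm (C * V x)"
    proof (rule AE_I2)
      fix x :: 'a assume "x \<in> space ball_measure"
      then have "\<bar>f x\<bar> \<le> C" using C(2)[of x] by simp
      then have "\<bar>f x\<bar> * \<bar>V x\<bar> \<le> C * \<bar>V x\<bar>" by (rule mult_right_mono) simp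
      then show "norm (V x * f x) \<le> norm (C * V x)" using C(1) by (simp add: abs_mult mult.commute)
    qed
  qed
qed

context radial_potential begin

lemma jost_radial_C1:
  fixes Q :: "'a::euclidean_space \<Rightarrow> real"
  assumes N: "L < real N" and C1: "C1_function Q G" and hom: "\<And>c x. Q (c *\<^sub>R x) = c ^ m * Q x" and m: "m \<ge> 2"
  shows "C1_function (\<lambda>x. jost N (norm x) * Q x)
    (\<lambda>x. jost N (norm x) *\<^sub>R G x + (flux N (norm x) / norm x ^ Suc N * Q x / norm x) *\<^sub>R x)"
proof (rule radial_times_homogeneous_C1[OF _ _ _ _ C1 hom m])
  show "(jost N has_real_derivative flux N r / r ^ Suc N) (at r)" if "r > 0" for r by (rule jost_deriv[OF N that])
  have "continuous_on {0<..} (flux N)"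
    by (intro continuous_at_imp_continuous_on ballI flux_isCont N)
  then show "continuous_on {0<..} (\<lambda>r. flux N r / r ^ Suc N)" by (intro continuous_intros) auto
  show "\<bar>jost N r\<bar> \<le> jost_bd N" for r by (rule jost_abs_bound[OF N])
  show "\<bar>flux N r / r ^ Suc N\<bar> * r \<le> jost_bd N * L" if "r > 0" for r
    using flux_bound_L[OF N that] that by (simp add: field_simps)
qed

text \<open>
  The vector field \<open>\<phi> c \<nabla>P\<close> is \<open>C\<^sup>1\<close>, and the divergence theorem gives the part \<open>k c(1) \<integral>P \<phi>\<close> of the boundary term, by
  Euler's identity and the harmonicity of \<open>P\<close>. In the remaining terms, which contain \<open>\<nabla>c\<close> and \<open>V\<close>, only derivatives of \<open>\<phi>\<close> in the radial direction
  occur, and \<open>radial_Green\<close> on each ray gives the part \<open>flux N 1 \<integral>P \<phi>\<close>. The field \<open>\<nabla>u\<close> itself need not be \<open>C\<^sup>1\<close>, which is why the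
  divergence theorem is applied to \<open>\<phi> c \<nabla>P\<close> instead. The condition \<open>k \<ge> 3\<close> makes \<open>c \<nabla>P\<close> of class \<open>C\<^sup>1\<close> at the origin.
\<close>

theorem harmonic_Green:
  fixes P V :: "'a::euclidean_space \<Rightarrow> real"
  assumes d: "DIM('a) \<ge> 2" and k: "k \<ge> 3" and N: "N = 2 * k + (DIM('a) - 2)" "L < real N"
    and P: "real_polynomial_function P" "\<And>c x. P (c *\<^sub>R x) = c ^ k * P x" "\<And>x. laplacian P x = 0"
    and V: "integrable ball_measure V" "AE x in ball_measure. x \<noteq> 0 \<longrightarrow> V x = w (norm x) / norm x"
  obtains U where "C1_function (\<lambda>x. jost N (norm x) * P x) U"
    "\<And>\<phi> \<Phi>. C1_function \<phi> \<Phi> \<Longrightarrow>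
       (\<integral>x. U x \<bullet> \<Phi> x + V x * (jost N (norm x) * P x) * \<phi> x \<partial>ball_measure)
        = (real k * jost N 1 + flux N 1) * (\<integral>\<omega>. P \<omega> * \<phi> \<omega> \<partial>sphere_measure)"
proof -
  obtain G H where G: "C1_function P G" and H: "\<And>i. i \<in> Basis \<Longrightarrow> C1_function (\<lambda>x. G x \<bullet> i) (H i)"
    and div0: "\<And>x. (\<Sum>i\<in>Basis. H i x \<bullet> i) = 0"
  proof (rule harmonic_polynomial_gradient[OF P])
    fix G H
    assume "C1_function P G" "\<And>i. i \<in> Basis \<Longrightarrow> C1_function (\<lambda>x. G x \<bullet> i) (H i)"
      "\<And>x. (\<Sum>i\<in>Basis. H i x \<bullet> i) = 0"
    then show thesis by (rule that)
  qed
  have G0: "G 0 = 0" using homogeneous_gradient(3)[OF G P(2)] k by simp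
  have G_hom: "G (c *\<^sub>R x) \<bullet> i = c ^ (k - 1) * (G x \<bullet> i)" for c x i
  proof (cases "c = 0")
    case True then show ?thesis using G0 k by (simp add: power_0_left)
  next
    case False then show ?thesis using homogeneous_gradient(2)[OF G P(2) False] k by simp
  qed
  let ?c = "\<lambda>x::'a. jost N (norm x)" and ?c' = "\<lambda>x::'a. flux N (norm x) / norm x ^ Suc N"
  define u where "u x = ?c x * P x" for x
  define U where "U x = ?c x *\<^sub>R G x + (?c' x * P x / norm x) *\<^sub>R x" for x
  have u_C1: "C1_function u U"
    unfolding u_def U_def by (rule jost_radial_C1[OF N(2) G P(2)]) (use k in simp)
  define v where "v i x = ?c x * (G x \<bullet> i)" for i x
  \<comment> \<open>The gradients of the components \<open>v i\<close> of the field \<open>c \<nabla>P\<close>.\<close>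
  define W where "W i x = ?c x *\<^sub>R H i x + (?c' x * (G x \<bullet> i) / norm x) *\<^sub>R x" for i x
  have v_C1: "C1_function (v i) (W i)" if "i \<in> Basis" for i
    unfolding v_def W_def by (rule jost_radial_C1[OF N(2) H[OF that] G_hom]) (use k in simp)
  show ?thesis
  proof (rule that)
    show "C1_function (\<lambda>x. jost N (norm x) * P x) U" using u_C1 by (simp add: u_def[abs_def])
    fix \<phi> :: "'a \<Rightarrow> real" and \<Phi> assume \<phi>: "C1_function \<phi> \<Phi>"
    note cont = C1_continuous[OF \<phi>] C1_gradient_continuous[OF \<phi>] C1_continuous[OF u_C1] C1_gradient_continuous[OF u_C1]
      C1_continuous[OF G] C1_gradient_continuous[OF G]
    have [measurable]: "\<phi> \<in> borel_measurable borel" "\<Phi> \<in> borel_measurable borel" "P \<in> borel_measurable borel"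
      using cont by (auto intro: continuous_measurable_borel)
    \<comment> \<open>The divergence of \<open>\<phi> c \<nabla>P\<close>.\<close>
    define D where "D x = (\<Sum>i\<in>Basis. (\<phi> x *\<^sub>R W i x + v i x *\<^sub>R \<Phi> x) \<bullet> i)" for x
    have D_C1: "C1_function (\<lambda>x. \<phi> x * v i x) (\<lambda>x. \<phi> x *\<^sub>R W i x + v i x *\<^sub>R \<Phi> x)" if "i \<in> Basis" for i
      by (rule C1_mult[OF \<phi> v_C1[OF that]])
    have D_cont1: "continuous_on UNIV (\<lambda>x. (\<phi> x *\<^sub>R W i x + v i x *\<^sub>R \<Phi> x) \<bullet> i)" if "i \<in> Basis" for i
      by (intro continuous_on_inner C1_gradient_continuous[OF D_C1[OF that]] continuous_on_const)
    have D_cont: "continuous_on UNIV D"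
      unfolding D_def by (intro continuous_on_sum D_cont1)
    have D_eq: "D x = \<phi> x * (?c' x * (G x \<bullet> x) / norm x) + ?c x * (G x \<bullet> \<Phi> x)" for x
    proof -
      have GG: "(\<Sum>i\<in>Basis. (G x \<bullet> i) * (y \<bullet> i)) = G x \<bullet> y" for y by (rule euclidean_inner[symmetric])
      have "D x = (\<Sum>i\<in>Basis. \<phi> x * ?c x * (H i x \<bullet> i) + \<phi> x * (?c' x / norm x) * ((G x \<bullet> i) * (x \<bullet> i)) + ?c x * ((G x \<bullet> i) * (\<Phi> x \<bullet> i)))"
        unfolding D_def by (rule sum.cong[OF refl]) (simp add: W_def v_def inner_add_left algebra_simps)
      also have "\<dots> = \<phi> x * ?c x * (\<Sum>i\<in>Basis. H i x \<bullet> i) + \<phi> x * (?c' x / norm x) * (\<Sum>i\<in>Basis. (G x \<bullet> i) * (x \<bullet> i)) + ?c x * (\<Sum>i\<in>Basis. (G x \<bullet> i) * (\<Phi> x \<bullet> i))"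
        by (simp only: sum.distrib sum_distrib_left)
      finally show ?thesis unfolding div0 GG by simp
    qed
    have "(\<integral>x. D x \<partial>ball_measure) = (\<Sum>i\<in>Basis. \<integral>x. (\<phi> x *\<^sub>R W i x + v i x *\<^sub>R \<Phi> x) \<bullet> i \<partial>ball_measure)"
      unfolding D_def by (rule Bochner_Integration.integral_sum) (intro continuous_integrable_ball D_cont1)
    also have "\<dots> = (\<Sum>i\<in>Basis. \<integral>\<omega>. \<phi> \<omega> * v i \<omega> * (\<omega> \<bullet> i) \<partial>sphere_measure)"
      by (rule sum.cong[OF refl]) (rule divergence_theorem_ball[OF D_C1 _ d])
    also have "\<dots> = (\<integral>\<omega>. (\<Sum>i\<in>Basis. \<phi> \<omega> * v i \<omega> * (\<omega> \<bullet> i)) \<partial>sphere_measure)"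
    proof (rule Bochner_Integration.integral_sum[symmetric])
      fix i :: 'a assume "i \<in> Basis"
      then show "integrable sphere_measure (\<lambda>\<omega>. \<phi> \<omega> * v i \<omega> * (\<omega> \<bullet> i))"
        by (intro continuous_integrable_sphere continuous_on_mult cont C1_continuous[OF v_C1] continuous_on_inner continuous_on_id continuous_on_const)
    qed
    also have "\<dots> = (\<integral>\<omega>. real k * jost N 1 * (P \<omega> * \<phi> \<omega>) \<partial>sphere_measure)"
    proof (rule Bochner_Integration.integral_cong[OF refl])
      fix \<omega> :: 'a assume "\<omega> \<in> space sphere_measure"
      then have \<omega>: "norm \<omega> = 1" by simp
      have "(\<Sum>i\<in>Basis. \<phi> \<omega> * v i \<omega> * (\<omega> \<bullet> i)) = \<phi> \<omega> * jost N 1 * (\<Sum>i\<in>Basis. (G \<omega> \<bullet> i) * (\<omega> \<bullet> i))"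
        by (simp add: v_def \<omega> sum_distrib_left mult_ac)
      also have "(\<Sum>i\<in>Basis. (G \<omega> \<bullet> i) * (\<omega> \<bullet> i)) = G \<omega> \<bullet> \<omega>" by (rule euclidean_inner[symmetric])
      also have "\<dots> = real k * P \<omega>" by (rule homogeneous_gradient(1)[OF G P(2)])
      finally show "(\<Sum>i\<in>Basis. \<phi> \<omega> * v i \<omega> * (\<omega> \<bullet> i)) = real k * jost N 1 * (P \<omega> * \<phi> \<omega>)" by simp
    qed
    finally have D_int: "(\<integral>x. D x \<partial>ball_measure) = real k * jost N 1 * (\<integral>\<omega>. P \<omega> * \<phi> \<omega> \<partial>sphere_measure)" by simp
    \<comment> \<open>What is left of the integrand; Borel, unlike \<open>V\<close>, so that polar coordinates apply.\<close>
    define F where "F x = ?c' x * P x / norm x * (x \<bullet> \<Phi> x) - \<phi> x * (?c' x * (real k * P x) / norm x)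
        + w (norm x) / norm x * (?c x * P x) * \<phi> x" for x
    have F_meas: "F \<in> borel_measurable borel" unfolding F_def by measurable
    define E where "E x = U x \<bullet> \<Phi> x + V x * u x * \<phi> x" for x
    have E_int: "integrable ball_measure E"
    proof -
      have "integrable ball_measure (\<lambda>x. V x * (u x * \<phi> x))"
        by (intro integrable_mult_continuous V(1) continuous_on_mult cont)
      then have "integrable ball_measure (\<lambda>x. V x * u x * \<phi> x)" by (simp only: mult.assoc)
      moreover have "integrable ball_measure (\<lambda>x. U x \<bullet> \<Phi> x)"
        by (intro continuous_integrable_ball continuous_on_inner cont)
      ultimately show ?thesis unfolding E_def by (intro Bochner_Integration.integrable_add)
    qed
    have AE0: "AE x in ball_measure. x \<noteq> (0::'a)"
      unfolding AE_ball_measure_iff using AE_lborel_singleton[of "0::'a"] by eventually_elim simp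
    have EF: "AE x in ball_measure. E x - D x = F x"
      using V(2) AE0
    proof eventually_elim
      fix x :: 'a assume "x \<noteq> 0 \<longrightarrow> V x = w (norm x) / norm x" "x \<noteq> 0"
      then have Vx: "V x = w (norm x) / norm x" by simp
      have Euler: "G x \<bullet> x = real k * P x" by (rule homogeneous_gradient(1)[OF G P(2)])
      show "E x - D x = F x"
        unfolding E_def D_eq F_def Vx Euler U_def u_def by (simp add: inner_add_left)
    qed
    have ED_int: "integrable ball_measure (\<lambda>x. E x - D x)"
      by (intro Bochner_Integration.integrable_diff E_int continuous_integrable_ball D_cont)
    have F_int: "integrable ball_measure F"
      using integrable_cong_AE[OF borel_measurable_integrable[OF ED_int] borel_measurable_ball_measure[OF F_meas] EF] ED_int by simp
    have "(\<integral>x. E x \<partial>ball_measure) = (\<integral>x. D x \<partial>ball_measure) + (\<integral>x. E x - D x \<partial>ball_measure)"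
      using E_int continuous_integrable_ball[OF D_cont] by simp
    also have "(\<integral>x. E x - D x \<partial>ball_measure) = (\<integral>x. F x \<partial>ball_measure)"
      by (rule integral_cong_AE[OF borel_measurable_integrable[OF ED_int] borel_measurable_ball_measure[OF F_meas] EF])
    also have "\<dots> = (\<integral>\<omega>. (\<integral>r. indicator {0<..<1} r * (r ^ (DIM('a) - 1) * F (r *\<^sub>R \<omega>)) \<partial>lborel) \<partial>sphere_measure)"
      by (rule polar_integral[OF F_meas F_int])
    also have "\<dots> = (\<integral>\<omega>. flux N 1 * (P \<omega> * \<phi> \<omega>) \<partial>sphere_measure)"
    proof (rule Bochner_Integration.integral_cong[OF refl])
      fix \<omega> :: 'a assume "\<omega> \<in> space sphere_measure"
      then have \<omega>: "norm \<omega> = 1" by simp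
      define \<alpha> where "\<alpha> r = \<phi> (r *\<^sub>R \<omega>)" for r
      define \<alpha>' where "\<alpha>' r = \<Phi> (r *\<^sub>R \<omega>) \<bullet> \<omega>" for r
      have \<alpha>: "(\<alpha> has_real_derivative \<alpha>' r) (at r)" for r
        using C1_deriv_line[OF \<phi>, of 0 \<omega> r] by (simp add: \<alpha>_def[abs_def] \<alpha>'_def)
      have \<alpha>'_cont: "continuous_on UNIV \<alpha>'"
        unfolding \<alpha>'_def
        by (intro continuous_on_inner continuous_on_compose2[OF cont(2)] continuous_on_scaleR continuous_on_id continuous_on_const) auto
      have kN: "k < N" using N k by simp
      have eqr: "indicator {0<..<1} r * (r ^ (DIM('a) - 1) * F (r *\<^sub>R \<omega>))
        = P \<omega> * (indicator {0<..<1} r * (r ^ (N - k) * w r * jost N r * \<alpha> r + (flux N r / r ^ k * \<alpha>' r - real k * (flux N r / r ^ Suc k) * \<alpha> r)))" for r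
      proof (cases "r \<in> {0<..<1}")
        case True
        then have r: "r > 0" by simp
        define e where "e = DIM('a) - 2"
        have e: "DIM('a) = Suc (Suc e)" using d by (simp add: e_def)
        have 1: "r ^ Suc e * (flux N r / r ^ Suc N * (r ^ k * P \<omega>) / r * (r * \<alpha>' r)) = P \<omega> * (flux N r / r ^ k * \<alpha>' r)"
        proof -
          have "r ^ Suc N = r ^ k * (r ^ k * r ^ Suc e)" unfolding N(1) by (simp add: e flip: power_add) (simp add: mult_2 add_ac)
          then show ?thesis using r by simp
        qed
        have 2: "r ^ Suc e * (\<alpha> r * (flux N r / r ^ Suc N * (real k * (r ^ k * P \<omega>)) / r)) = P \<omega> * (real k * (flux N r / r ^ Suc k) * \<alpha> r)"
        proof -
          have "r ^ Suc N = r ^ k * (r ^ k * r ^ Suc e)" unfolding N(1) by (simp add: e flip: power_add) (simp add: mult_2 add_ac)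
          then show ?thesis using r by (simp add: mult_ac)
        qed
        have 3: "r ^ Suc e * (w r / r * (jost N r * (r ^ k * P \<omega>)) * \<alpha> r) = P \<omega> * (r ^ (N - k) * w r * jost N r * \<alpha> r)"
        proof -
          have "N - k = e + k" unfolding N(1) by (simp add: e)
          then show ?thesis using r by (simp add: power_add)
        qed
        have "r ^ (DIM('a) - 1) * F (r *\<^sub>R \<omega>) = r ^ Suc e * (flux N r / r ^ Suc N * (r ^ k * P \<omega>) / r * (r * \<alpha>' r))
            - r ^ Suc e * (\<alpha> r * (flux N r / r ^ Suc N * (real k * (r ^ k * P \<omega>)) / r))
            + r ^ Suc e * (w r / r * (jost N r * (r ^ k * P \<omega>)) * \<alpha> r)"
          unfolding F_def using r by (simp add: e P(2) \<omega> \<alpha>_def \<alpha>'_def inner_commute[of \<omega>] distrib_left right_diff_distrib del: power_Suc)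
        then show ?thesis unfolding 1 2 3 using True by (simp add: algebra_simps)
      qed simp
      have "(\<integral>r. indicator {0<..<1} r * (r ^ (DIM('a) - 1) * F (r *\<^sub>R \<omega>)) \<partial>lborel) = P \<omega> * (\<alpha> 1 * flux N 1)"
        unfolding eqr integral_mult_right_zero radial_Green[OF N(2) kN \<alpha> \<alpha>'_cont] ..
      then show "(\<integral>r. indicator {0<..<1} r * (r ^ (DIM('a) - 1) * F (r *\<^sub>R \<omega>)) \<partial>lborel) = flux N 1 * (P \<omega> * \<phi> \<omega>)"
        by (simp add: \<alpha>_def)
    qed
    finally have "(\<integral>x. E x \<partial>ball_measure) = (real k * jost N 1 + flux N 1) * (\<integral>\<omega>. P \<omega> * \<phi> \<omega> \<partial>sphere_measure)"
      unfolding D_int by (simp add: distrib_right)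
    then show "(\<integral>x. U x \<bullet> \<Phi> x + V x * (jost N (norm x) * P x) * \<phi> x \<partial>ball_measure)
        = (real k * jost N 1 + flux N 1) * (\<integral>\<omega>. P \<omega> * \<phi> \<omega> \<partial>sphere_measure)"
      by (simp add: E_def u_def)
  qed
qed

end

lemma Lp_norm_zero: "(\<And>x. x \<in> space M \<Longrightarrow> f x = 0) \<Longrightarrow> Lp_norm M 2 f = 0"
  unfolding Lp_norm_def by (subst Bochner_Integration.integral_cong[OF refl, of M _ "\<lambda>_. 0"]) auto

lemma norm_powr_2: "norm (x::'b::real_normed_vector) powr 2 = norm x ^ 2"
  by (cases "x = 0") (simp_all add: powr_numeral)

lemma continuous_Lp_ball:
  fixes f :: "'a::euclidean_space \<Rightarrow> 'b::euclidean_space"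
  assumes "continuous_on UNIV f" shows "f \<in> Lp_space ball_measure 2"
  unfolding Lp_space_def norm_powr_2
  using assms by (auto intro!: continuous_measurable_ball continuous_integrable_ball continuous_intros)

lemma Lp_sphere_cong:
  fixes f g :: "'a::euclidean_space \<Rightarrow> real"
  assumes "continuous_on UNIV g" "\<And>x. x \<in> sphere 0 1 \<Longrightarrow> f x = g x"
  shows "f \<in> Lp_space sphere_measure 2"
proof -
  have "g \<in> borel_measurable sphere_measure" "integrable sphere_measure (\<lambda>x. norm (g x) ^ 2)"
    using assms(1) by (auto intro!: borel_measurable_sphere_measure continuous_measurable_borel continuous_integrable_sphere continuous_intros)
  moreover have "f \<in> borel_measurable sphere_measure \<longleftrightarrow> g \<in> borel_measurable sphere_measure"
    by (rule measurable_cong) (simp add: assms(2))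
  moreover have "integrable sphere_measure (\<lambda>x. norm (f x) ^ 2) \<longleftrightarrow> integrable sphere_measure (\<lambda>x. norm (g x) ^ 2)"
    by (rule Bochner_Integration.integrable_cong) (simp_all add: assms(2))
  ultimately show ?thesis unfolding Lp_space_def norm_powr_2 by simp
qed

lemma C1_has_trace:
  assumes u: "C1_function u U" and f: "\<And>x. x \<in> sphere 0 1 \<Longrightarrow> f x = u x"
  shows "has_trace u U f"
  unfolding has_trace_def
proof (intro conjI exI[of _ "\<lambda>n. u"] exI[of _ "\<lambda>n. U"] allI)
  show "f \<in> Lp_space sphere_measure 2" by (rule Lp_sphere_cong[OF C1_continuous[OF u] f])
  show "C1_function u U" by (rule u)
  show "(\<lambda>n. Lp_norm ball_measure 2 (\<lambda>x. u x - u x)) \<longlonglongrightarrow> 0" "(\<lambda>n. Lp_norm ball_measure 2 (\<lambda>x. U x - U x)) \<longlonglongrightarrow> 0"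
    by (simp_all add: Lp_norm_zero)
  have "Lp_norm sphere_measure 2 (\<lambda>x. u x - f x) = 0" by (rule Lp_norm_zero) (simp add: f)
  then show "(\<lambda>n. Lp_norm sphere_measure 2 (\<lambda>x. u x - f x)) \<longlonglongrightarrow> 0" by simp
qed

lemma C1_H1_function:
  fixes u :: "'a::euclidean_space \<Rightarrow> real"
  assumes u: "C1_function u U" and d: "DIM('a) \<ge> 2"
  shows "H1_function u U"
  unfolding H1_function_def
proof (intro conjI allI impI ballI)
  show "u \<in> Lp_space ball_measure 2" "U \<in> Lp_space ball_measure 2"
    by (intro continuous_Lp_ball C1_continuous[OF u] C1_gradient_continuous[OF u])+
  fix \<phi> :: "'a \<Rightarrow> real" and \<Phi> and i :: 'a
  assume \<phi>: "C1_compact_support \<phi> \<Phi>" and i: "i \<in> Basis"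
  have \<phi>C: "C1_function \<phi> \<Phi>" using \<phi> by (simp add: C1_compact_support_def)
  note cont = C1_continuous[OF \<phi>C] C1_gradient_continuous[OF \<phi>C] C1_continuous[OF u] C1_gradient_continuous[OF u]
  have "(\<integral>x. (u x *\<^sub>R \<Phi> x + \<phi> x *\<^sub>R U x) \<bullet> i \<partial>ball_measure) = (\<integral>\<omega>. u \<omega> * \<phi> \<omega> * (\<omega> \<bullet> i) \<partial>sphere_measure)"
    by (rule divergence_theorem_ball[OF C1_mult[OF u \<phi>C] i d])
  also have "\<dots> = (\<integral>\<omega>. 0 \<partial>(sphere_measure :: 'a measure))"
    by (rule Bochner_Integration.integral_cong[OF refl]) (simp add: C1_compact_support_zero[OF \<phi>])
  finally have "(\<integral>x. (u x *\<^sub>R \<Phi> x + \<phi> x *\<^sub>R U x) \<bullet> i \<partial>ball_measure) = 0" by simp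
  moreover have "(\<integral>x. (u x *\<^sub>R \<Phi> x + \<phi> x *\<^sub>R U x) \<bullet> i \<partial>ball_measure)
     = (\<integral>x. u x * (\<Phi> x \<bullet> i) \<partial>ball_measure) + (\<integral>x. (U x \<bullet> i) * \<phi> x \<partial>ball_measure)"
  proof (subst Bochner_Integration.integral_add[symmetric])
    show "integrable ball_measure (\<lambda>x. u x * (\<Phi> x \<bullet> i))" "integrable ball_measure (\<lambda>x. (U x \<bullet> i) * \<phi> x)"
      by (intro continuous_integrable_ball continuous_on_mult continuous_on_inner continuous_on_const cont)+
  qed (simp add: inner_add_left mult.commute)
  ultimately show "(\<integral>x. u x * (\<Phi> x \<bullet> i) \<partial>ball_measure) = - (\<integral>x. (U x \<bullet> i) * \<phi> x \<partial>ball_measure)" by simp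
qed

text \<open>The solution with boundary values \<open>Y\<close> is \<open>c(|x|) P(x) / c(1)\<close>.\<close>

theorem (in radial_potential) DN_map_spherical_harmonic:
  fixes V Y :: "'a::euclidean_space \<Rightarrow> real"
  assumes d: "DIM('a) \<ge> 2" and k: "k \<ge> 3" and N: "N = 2 * k + (DIM('a) - 2)" "2 * L < real N"
    and V: "integrable ball_measure V" "AE x in ball_measure. x \<noteq> 0 \<longrightarrow> V x = w (norm x) / norm x"
    and Y: "spherical_harmonic k Y"
  shows "DN_map V Y (\<lambda>x. (real k + flux N 1 / jost N 1) * Y x)"
proof -
  obtain P where P: "real_polynomial_function P" "\<And>c x. P (c *\<^sub>R x) = c ^ k * P x" "\<And>x. laplacian P x = 0"
    and YP: "\<And>x. x \<in> sphere 0 1 \<Longrightarrow> Y x = P x"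
    using Y unfolding spherical_harmonic_def by blast
  have LN: "L < real N" using N(2) L_nonneg by linarith
  obtain U where U: "C1_function (\<lambda>x. jost N (norm x) * P x) U"
    and Green: "\<And>\<phi> \<Phi>. C1_function \<phi> \<Phi> \<Longrightarrow>
       (\<integral>x. U x \<bullet> \<Phi> x + V x * (jost N (norm x) * P x) * \<phi> x \<partial>ball_measure)
        = (real k * jost N 1 + flux N 1) * (\<integral>\<omega>. P \<omega> * \<phi> \<omega> \<partial>sphere_measure)"
  proof (rule harmonic_Green[OF d k N(1) LN P V])
    fix U
    assume "C1_function (\<lambda>x. jost N (norm x) * P x) U"
      "\<And>\<phi> \<Phi>. C1_function \<phi> \<Phi> \<Longrightarrow>
       (\<integral>x. U x \<bullet> \<Phi> x + V x * (jost N (norm x) * P x) * \<phi> x \<partial>ball_measure)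
        = (real k * jost N 1 + flux N 1) * (\<integral>\<omega>. P \<omega> * \<phi> \<omega> \<partial>sphere_measure)"
    then show thesis by (rule that)
  qed
  define c where "c = jost N 1"
  have c: "c > 0" unfolding c_def by (rule jost_pos[OF N(2)])
  define u where "u x = (1 / c) * (jost N (norm x) * P x)" for x
  define U' where "U' x = (1 / c) *\<^sub>R U x" for x
  have u: "C1_function u U'"
  proof -
    have "C1_function (\<lambda>x. 1 / c) (\<lambda>x. 0 :: 'a)"
      by (simp add: C1_function_def GDERIV_const)
    from C1_mult[OF this U] show ?thesis by (simp add: u_def[abs_def] U'_def[abs_def])
  qed
  let ?l = "real k + flux N 1 / jost N 1"
  have Green': "(\<integral>x. U' x \<bullet> \<Phi> x + V x * u x * \<phi> x \<partial>ball_measure) = ?l * (\<integral>\<omega>. P \<omega> * \<phi> \<omega> \<partial>sphere_measure)"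
    if \<phi>: "C1_function \<phi> \<Phi>" for \<phi> \<Phi>
  proof -
    have "(\<integral>x. U' x \<bullet> \<Phi> x + V x * u x * \<phi> x \<partial>ball_measure)
      = (\<integral>x. (1 / c) * (U x \<bullet> \<Phi> x + V x * (jost N (norm x) * P x) * \<phi> x) \<partial>ball_measure)"
      by (simp add: U'_def u_def algebra_simps)
    also have "\<dots> = (1 / c) * ((real k * jost N 1 + flux N 1) * (\<integral>\<omega>. P \<omega> * \<phi> \<omega> \<partial>sphere_measure))"
      unfolding integral_mult_right_zero Green[OF \<phi>] ..
    also have "\<dots> = ?l * (\<integral>\<omega>. P \<omega> * \<phi> \<omega> \<partial>sphere_measure)"
      using c by (simp add: c_def[symmetric] field_simps)
    finally show ?thesis .
  qed
  have weak: "weak_solution V u U'"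
    unfolding weak_solution_def
  proof (intro conjI allI impI)
    show "H1_function u U'" by (rule C1_H1_function[OF u d])
    show "integrable ball_measure (\<lambda>x. V x * u x)" by (rule integrable_mult_continuous[OF V(1) C1_continuous[OF u]])
    fix \<phi> :: "'a \<Rightarrow> real" and \<Phi> assume \<phi>: "C1_compact_support \<phi> \<Phi>"
    have "(\<integral>\<omega>. P \<omega> * \<phi> \<omega> \<partial>sphere_measure) = (\<integral>\<omega>. 0 \<partial>(sphere_measure :: 'a measure))"
      by (rule Bochner_Integration.integral_cong[OF refl]) (simp add: C1_compact_support_zero[OF \<phi>])
    then show "(\<integral>x. U' x \<bullet> \<Phi> x + V x * u x * \<phi> x \<partial>ball_measure) = 0"
      using Green'[of \<phi> \<Phi>] \<phi> by (simp add: C1_compact_support_def)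
  qed
  have trace: "has_trace u U' Y"
    using c by (intro C1_has_trace[OF u]) (simp add: u_def YP c_def)
  have P_cont: "continuous_on UNIV P" by (rule real_polynomial_continuous[OF P(1)])
  have "continuous_on UNIV (\<lambda>x. ?l * P x)" by (intro continuous_on_mult continuous_on_const P_cont)
  then have lY: "(\<lambda>x. ?l * Y x) \<in> Lp_space sphere_measure 2"
    by (rule Lp_sphere_cong) (simp add: YP)
  show ?thesis
    unfolding DN_map_def
  proof (intro conjI lY exI[of _ u] exI[of _ U'] weak trace allI impI)
    fix \<phi> :: "'a \<Rightarrow> real" and \<Phi> assume \<phi>: "C1_function \<phi> \<Phi>"
    have "(\<integral>x. ?l * Y x * \<phi> x \<partial>sphere_measure) = (\<integral>x. ?l * (P x * \<phi> x) \<partial>sphere_measure)"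
      by (rule Bochner_Integration.integral_cong[OF refl]) (simp add: YP)
    then show "(\<integral>x. U' x \<bullet> \<Phi> x + V x * u x * \<phi> x \<partial>ball_measure) = (\<integral>x. ?l * Y x * \<phi> x \<partial>sphere_measure)"
      unfolding Green'[OF \<phi>] by simp
  qed
qed


section \<open>Uniqueness of the eigenvalue\<close>

lemma Lp2_ball_integrable:
  fixes f :: "'a::euclidean_space \<Rightarrow> real"
  assumes "f \<in> Lp_space ball_measure 2" shows "integrable ball_measure f"
proof -
  interpret finite_measure "ball_measure :: 'a measure" by (rule finite_ball_measure)
  have f: "f \<in> borel_measurable ball_measure" "integrable ball_measure (\<lambda>x. norm (f x) ^ 2)"
    using assms unfolding Lp_space_def norm_powr_2 by auto
  have "integrable ball_measure (\<lambda>x. 1 + norm (f x) ^ 2)" using f(2) by simp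
  then show ?thesis
  proof (rule Bochner_Integration.integrable_bound[OF _ f(1)])
    show "AE x in ball_measure. norm (f x) \<le> norm (1 + norm (f x) ^ 2)"
    proof (rule AE_I2)
      fix x
      have "0 \<le> (\<bar>f x\<bar> - 1)\<^sup>2" by simp
      then have "2 * \<bar>f x\<bar> \<le> 1 + \<bar>f x\<bar>\<^sup>2" by (simp add: power2_diff)
      then show "norm (f x) \<le> norm (1 + norm (f x) ^ 2)" by simp
    qed
  qed
qed

lemma norm_diff_square_le: "norm (a - b) ^ 2 \<le> 2 * norm a ^ 2 + 2 * norm (b::'b::real_normed_vector) ^ 2"
proof -
  have "norm (a - b) ^ 2 \<le> (norm a + norm b) ^ 2" by (intro power_mono norm_triangle_ineq4) simp
  also have "\<dots> \<le> 2 * norm a ^ 2 + 2 * norm b ^ 2"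
    using zero_le_power2[of "norm a - norm b"] by (simp add: power2_sum power2_diff)
  finally show ?thesis .
qed

lemma Lp2_diff:
  fixes f g :: "'b \<Rightarrow> 'c::euclidean_space"
  assumes f: "f \<in> Lp_space M 2" and g: "g \<in> Lp_space M 2"
  shows "(\<lambda>x. f x - g x) \<in> Lp_space M 2"
proof -
  have m: "f \<in> borel_measurable M" "g \<in> borel_measurable M"
    and i: "integrable M (\<lambda>x. norm (f x) ^ 2)" "integrable M (\<lambda>x. norm (g x) ^ 2)"
    using assms unfolding Lp_space_def norm_powr_2 by auto
  have "integrable M (\<lambda>x. 2 * norm (f x) ^ 2 + 2 * norm (g x) ^ 2)" using i by simp
  then have "integrable M (\<lambda>x. norm (f x - g x) ^ 2)"
    by (rule Bochner_Integration.integrable_bound) (use m norm_diff_square_le[of "f x" "g x" for x] in auto)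
  then show ?thesis unfolding Lp_space_def norm_powr_2 using m by simp
qed

lemma Lp_norm_2_sq: "(Lp_norm M 2 f)\<^sup>2 = (\<integral>x. norm (f x) ^ 2 \<partial>M)"
proof -
  have "(\<integral>x. norm (f x) ^ 2 \<partial>M) \<ge> 0" by (intro Bochner_Integration.integral_nonneg) simp
  then show ?thesis by (simp add: Lp_norm_def norm_powr_2 powr_half_sqrt)
qed

lemma Lp_norm_nonneg: "Lp_norm M p f \<ge> 0" by (simp add: Lp_norm_def)

lemma Lp_norm_2_diff_tendsto:
  fixes a b :: "nat \<Rightarrow> 'b \<Rightarrow> 'c::euclidean_space"
  assumes a: "\<And>n. a n \<in> Lp_space M 2" "(\<lambda>n. Lp_norm M 2 (a n)) \<longlonglongrightarrow> 0"
    and b: "\<And>n. b n \<in> Lp_space M 2" "(\<lambda>n. Lp_norm M 2 (b n)) \<longlonglongrightarrow> 0"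
  shows "(\<lambda>n. Lp_norm M 2 (\<lambda>x. a n x - b n x)) \<longlonglongrightarrow> 0"
proof (rule Lim_null_comparison)
  have i: "integrable M (\<lambda>x. norm (a n x) ^ 2)" "integrable M (\<lambda>x. norm (b n x) ^ 2)"
     "integrable M (\<lambda>x. norm (a n x - b n x) ^ 2)" for n
    using a(1)[of n] b(1)[of n] Lp2_diff[OF a(1)[of n] b(1)[of n]] unfolding Lp_space_def norm_powr_2 by auto
  show "\<forall>\<^sub>F n in sequentially. norm (Lp_norm M 2 (\<lambda>x. a n x - b n x))
     \<le> sqrt (2 * (Lp_norm M 2 (a n))\<^sup>2 + 2 * (Lp_norm M 2 (b n))\<^sup>2)"
  proof (intro always_eventually allI)
    fix n
    have "(Lp_norm M 2 (\<lambda>x. a n x - b n x))\<^sup>2 \<le> (\<integral>x. 2 * norm (a n x) ^ 2 + 2 * norm (b n x) ^ 2 \<partial>M)"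
      unfolding Lp_norm_2_sq using i[of n] by (intro integral_mono norm_diff_square_le) auto
    also have "\<dots> = 2 * (Lp_norm M 2 (a n))\<^sup>2 + 2 * (Lp_norm M 2 (b n))\<^sup>2"
      unfolding Lp_norm_2_sq using i[of n] by simp
    finally show "norm (Lp_norm M 2 (\<lambda>x. a n x - b n x)) \<le> sqrt (2 * (Lp_norm M 2 (a n))\<^sup>2 + 2 * (Lp_norm M 2 (b n))\<^sup>2)"
      using Lp_norm_nonneg[of M 2 "\<lambda>x. a n x - b n x"] by (simp add: real_le_rsqrt)
  qed
  have "(\<lambda>n. sqrt (2 * (Lp_norm M 2 (a n))\<^sup>2 + 2 * (Lp_norm M 2 (b n))\<^sup>2)) \<longlonglongrightarrow> sqrt (2 * 0\<^sup>2 + 2 * 0\<^sup>2)"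
    by (intro tendsto_intros a b)
  then show "(\<lambda>n. sqrt (2 * (Lp_norm M 2 (a n))\<^sup>2 + 2 * (Lp_norm M 2 (b n))\<^sup>2)) \<longlonglongrightarrow> 0" by simp
qed

lemma C1_diff:
  assumes "C1_function \<phi> \<Phi>" "C1_function \<psi> \<Psi>"
  shows "C1_function (\<lambda>x. \<phi> x - \<psi> x) (\<lambda>x. \<Phi> x - \<Psi> x)"
  using assms unfolding C1_function_def by (simp add: GDERIV_diff continuous_on_diff)

lemma has_trace_diff:
  assumes H1: "H1_function u G" "H1_function u' G'" and tr: "has_trace u G f" "has_trace u' G' f"
  shows "has_trace (\<lambda>x. u x - u' x) (\<lambda>x. G x - G' x) (\<lambda>_. 0)"
proof -
  obtain \<phi> \<Phi> where \<phi>: "\<And>n::nat. C1_function (\<phi> n) (\<Phi> n)"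
      "(\<lambda>n. Lp_norm ball_measure 2 (\<lambda>x. \<phi> n x - u x)) \<longlonglongrightarrow> 0"
      "(\<lambda>n. Lp_norm ball_measure 2 (\<lambda>x. \<Phi> n x - G x)) \<longlonglongrightarrow> 0"
      "(\<lambda>n. Lp_norm sphere_measure 2 (\<lambda>x. \<phi> n x - f x)) \<longlonglongrightarrow> 0"
    and f: "f \<in> Lp_space sphere_measure 2"
    using tr(1) unfolding has_trace_def by blast
  obtain \<psi> \<Psi> where \<psi>: "\<And>n::nat. C1_function (\<psi> n) (\<Psi> n)"
      "(\<lambda>n. Lp_norm ball_measure 2 (\<lambda>x. \<psi> n x - u' x)) \<longlonglongrightarrow> 0"
      "(\<lambda>n. Lp_norm ball_measure 2 (\<lambda>x. \<Psi> n x - G' x)) \<longlonglongrightarrow> 0"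
      "(\<lambda>n. Lp_norm sphere_measure 2 (\<lambda>x. \<psi> n x - f x)) \<longlonglongrightarrow> 0"
    using tr(2) unfolding has_trace_def by blast
  have L: "u \<in> Lp_space ball_measure 2" "G \<in> Lp_space ball_measure 2" "u' \<in> Lp_space ball_measure 2" "G' \<in> Lp_space ball_measure 2"
    using H1 unfolding H1_function_def by auto
  note ball = Lp2_diff[OF continuous_Lp_ball]
  have sphere: "(\<lambda>x. \<xi> x - f x) \<in> Lp_space sphere_measure 2" if "continuous_on UNIV \<xi>" for \<xi>
    by (rule Lp2_diff[OF Lp_sphere_cong[OF that refl] f])
  have 1: "(\<lambda>n. Lp_norm ball_measure 2 (\<lambda>x. (\<phi> n x - u x) - (\<psi> n x - u' x))) \<longlonglongrightarrow> 0"
    by (intro Lp_norm_2_diff_tendsto ball C1_continuous[OF \<phi>(1)] C1_continuous[OF \<psi>(1)] L \<phi> \<psi>)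
  have 2: "(\<lambda>n. Lp_norm ball_measure 2 (\<lambda>x. (\<Phi> n x - G x) - (\<Psi> n x - G' x))) \<longlonglongrightarrow> 0"
    by (intro Lp_norm_2_diff_tendsto ball C1_gradient_continuous[OF \<phi>(1)] C1_gradient_continuous[OF \<psi>(1)] L \<phi> \<psi>)
  have 3: "(\<lambda>n. Lp_norm sphere_measure 2 (\<lambda>x. (\<phi> n x - f x) - (\<psi> n x - f x))) \<longlonglongrightarrow> 0"
    by (intro Lp_norm_2_diff_tendsto sphere C1_continuous[OF \<phi>(1)] C1_continuous[OF \<psi>(1)] \<phi> \<psi>)
  show ?thesis
    unfolding has_trace_def
  proof (intro conjI exI[of _ "\<lambda>n x. \<phi> n x - \<psi> n x"] exI[of _ "\<lambda>n x. \<Phi> n x - \<Psi> n x"] allI)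
    show "(\<lambda>_. 0) \<in> Lp_space sphere_measure 2" by (simp add: Lp_space_def)
    show "C1_function (\<lambda>x. \<phi> n x - \<psi> n x) (\<lambda>x. \<Phi> n x - \<Psi> n x)" for n by (rule C1_diff[OF \<phi>(1) \<psi>(1)])
    show "(\<lambda>n. Lp_norm ball_measure 2 (\<lambda>x. \<phi> n x - \<psi> n x - (u x - u' x))) \<longlonglongrightarrow> 0"
      using 1 by (simp add: algebra_simps)
    show "(\<lambda>n. Lp_norm ball_measure 2 (\<lambda>x. \<Phi> n x - \<Psi> n x - (G x - G' x))) \<longlonglongrightarrow> 0"
      using 2 by (simp add: algebra_simps)
    show "(\<lambda>n. Lp_norm sphere_measure 2 (\<lambda>x. \<phi> n x - \<psi> n x - 0)) \<longlonglongrightarrow> 0"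
      using 3 by simp
  qed
qed

lemma Lp2_inner_integrable:
  fixes G :: "'a::euclidean_space \<Rightarrow> 'a"
  assumes "G \<in> Lp_space ball_measure 2" "i \<in> Basis"
  shows "integrable ball_measure (\<lambda>x. G x \<bullet> i)"
proof (rule Lp2_ball_integrable)
  have G: "G \<in> borel_measurable ball_measure" "integrable ball_measure (\<lambda>x. norm (G x) ^ 2)"
    using assms(1) unfolding Lp_space_def norm_powr_2 by auto
  have m: "(\<lambda>x. G x \<bullet> i) \<in> borel_measurable ball_measure" using G(1) by simp
  have "\<bar>y \<bullet> i\<bar>\<^sup>2 \<le> norm y ^ 2" for y by (intro power_mono Basis_le_norm assms) simp
  then have "integrable ball_measure (\<lambda>x. norm (G x \<bullet> i) ^ 2)"
    by (intro Bochner_Integration.integrable_bound[OF G(2)]) (use m in auto)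
  then show "(\<lambda>x. G x \<bullet> i) \<in> Lp_space ball_measure 2" unfolding Lp_space_def norm_powr_2 using m by simp
qed

lemma H1_diff:
  fixes u :: "'a::euclidean_space \<Rightarrow> real"
  assumes "H1_function u G" "H1_function u' G'"
  shows "H1_function (\<lambda>x. u x - u' x) (\<lambda>x. G x - G' x)"
proof -
  have L: "u \<in> Lp_space ball_measure 2" "G \<in> Lp_space ball_measure 2" "u' \<in> Lp_space ball_measure 2" "G' \<in> Lp_space ball_measure 2"
    using assms unfolding H1_function_def by auto
  show ?thesis
    unfolding H1_function_def
  proof (intro conjI Lp2_diff L allI impI ballI)
    fix \<phi> :: "'a \<Rightarrow> real" and \<Phi> and i :: 'a
    assume \<phi>: "C1_compact_support \<phi> \<Phi>" and i: "i \<in> Basis"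
    have C: "C1_function \<phi> \<Phi>" using \<phi> by (simp add: C1_compact_support_def)
    have c: "continuous_on UNIV \<phi>" "continuous_on UNIV (\<lambda>x. \<Phi> x \<bullet> i)"
      by (intro C1_continuous[OF C] continuous_on_inner C1_gradient_continuous[OF C] continuous_on_const)+
    note int = integrable_mult_continuous[OF Lp2_ball_integrable[OF L(1)] c(2)] integrable_mult_continuous[OF Lp2_ball_integrable[OF L(3)] c(2)]
      integrable_mult_continuous[OF Lp2_inner_integrable[OF L(2) i] c(1)] integrable_mult_continuous[OF Lp2_inner_integrable[OF L(4) i] c(1)]
    have "(\<integral>x. u x * (\<Phi> x \<bullet> i) \<partial>ball_measure) = - (\<integral>x. (G x \<bullet> i) * \<phi> x \<partial>ball_measure)"
      "(\<integral>x. u' x * (\<Phi> x \<bullet> i) \<partial>ball_measure) = - (\<integral>x. (G' x \<bullet> i) * \<phi> x \<partial>ball_measure)"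
      using assms \<phi> i unfolding H1_function_def by blast+
    then show "(\<integral>x. (u x - u' x) * (\<Phi> x \<bullet> i) \<partial>ball_measure) = - (\<integral>x. ((G x - G' x) \<bullet> i) * \<phi> x \<partial>ball_measure)"
      using int by (simp add: left_diff_distrib inner_diff_left)
  qed
qed

lemma integrable_inner_C1:
  fixes G :: "'a::euclidean_space \<Rightarrow> 'a"
  assumes "G \<in> Lp_space ball_measure 2" "continuous_on UNIV \<Phi>"
  shows "integrable ball_measure (\<lambda>x. G x \<bullet> \<Phi> x)"
proof -
  have "integrable ball_measure (\<lambda>x. \<Sum>i\<in>Basis. (G x \<bullet> i) * (\<Phi> x \<bullet> i))"
    by (intro Bochner_Integration.integrable_sum integrable_mult_continuous Lp2_inner_integrable assms
        continuous_on_inner continuous_on_const)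
  then show ?thesis by (simp add: euclidean_inner[symmetric])
qed

lemma weak_form_diff:
  fixes V u :: "'a::euclidean_space \<Rightarrow> real"
  assumes w: "weak_solution V u G" "weak_solution V u' G'" and \<phi>: "C1_function \<phi> \<Phi>"
  shows "(\<integral>x. (G x - G' x) \<bullet> \<Phi> x + V x * (u x - u' x) * \<phi> x \<partial>ball_measure)
    = (\<integral>x. G x \<bullet> \<Phi> x + V x * u x * \<phi> x \<partial>ball_measure) - (\<integral>x. G' x \<bullet> \<Phi> x + V x * u' x * \<phi> x \<partial>ball_measure)"
proof -
  note c = C1_continuous[OF \<phi>] C1_gradient_continuous[OF \<phi>]
  have L: "G \<in> Lp_space ball_measure 2" "G' \<in> Lp_space ball_measure 2" "integrable ball_measure (\<lambda>x. V x * u x)" "integrable ball_measure (\<lambda>x. V x * u' x)"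
    using w unfolding weak_solution_def H1_function_def by auto
  note int = integrable_inner_C1[OF L(1) c(2)] integrable_inner_C1[OF L(2) c(2)]
    integrable_mult_continuous[OF L(3) c(1)] integrable_mult_continuous[OF L(4) c(1)]
  show ?thesis
    using int by (simp add: inner_diff_left left_diff_distrib right_diff_distrib)
qed

lemma weak_solution_diff:
  fixes V u :: "'a::euclidean_space \<Rightarrow> real"
  assumes w: "weak_solution V u G" "weak_solution V u' G'"
  shows "weak_solution V (\<lambda>x. u x - u' x) (\<lambda>x. G x - G' x)"
  unfolding weak_solution_def
proof (intro conjI allI impI)
  show "H1_function (\<lambda>x. u x - u' x) (\<lambda>x. G x - G' x)"
    using w by (intro H1_diff) (simp_all add: weak_solution_def)
  have "integrable ball_measure (\<lambda>x. V x * u x - V x * u' x)" using w by (simp add: weak_solution_def)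
  then show "integrable ball_measure (\<lambda>x. V x * (u x - u' x))" by (simp add: right_diff_distrib)
  fix \<phi> :: "'a \<Rightarrow> real" and \<Phi> assume \<phi>: "C1_compact_support \<phi> \<Phi>"
  then have C: "C1_function \<phi> \<Phi>" by (simp add: C1_compact_support_def)
  have "(\<integral>x. G x \<bullet> \<Phi> x + V x * u x * \<phi> x \<partial>ball_measure) = 0" "(\<integral>x. G' x \<bullet> \<Phi> x + V x * u' x * \<phi> x \<partial>ball_measure) = 0"
    using w \<phi> unfolding weak_solution_def by blast+
  then show "(\<integral>x. (G x - G' x) \<bullet> \<Phi> x + V x * (u x - u' x) * \<phi> x \<partial>ball_measure) = 0"
    unfolding weak_form_diff[OF w C] by simp
qed

text \<open>
  Test functions in the definition of a weak gradient have compact support; the cutoffs extend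
  the conclusion to all \<open>C\<^sup>1\<close> functions.
\<close>

lemma weak_gradient_of_null:
  fixes v :: "'a::euclidean_space \<Rightarrow> real"
  assumes H1: "H1_function v H" and null: "AE x in ball_measure. v x = 0"
    and \<psi>: "C1_function \<psi> \<Psi>" and i: "i \<in> Basis"
  shows "(\<integral>x. (H x \<bullet> i) * \<psi> x \<partial>ball_measure) = 0"
proof -
  have H: "H \<in> Lp_space ball_measure 2" and v: "v \<in> Lp_space ball_measure 2" using H1 unfolding H1_function_def by auto
  have zero: "(\<integral>x. (H x \<bullet> i) * (cutoff n x * \<psi> x) \<partial>ball_measure) = 0" for n
  proof -
    let ?\<Phi> = "\<lambda>x. cutoff n x *\<^sub>R \<Psi> x + \<psi> x *\<^sub>R cutoff_gradient n x"
    have "(\<integral>x. v x * (?\<Phi> x \<bullet> i) \<partial>ball_measure) = - (\<integral>x. (H x \<bullet> i) * (cutoff n x * \<psi> x) \<partial>ball_measure)"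
      using H1 cutoff_C1_compact_support[OF \<psi>, of n] i unfolding H1_function_def by blast
    moreover have "(\<integral>x. v x * (?\<Phi> x \<bullet> i) \<partial>ball_measure) = 0"
    proof (rule integral_eq_zero_AE)
      show "AE x in ball_measure. v x * (?\<Phi> x \<bullet> i) = 0" using null by eventually_elim simp
    qed
    ultimately show ?thesis by simp
  qed
  note int = integrable_mult_continuous[OF Lp2_inner_integrable[OF H i] C1_continuous[OF \<psi>]]
  have "(\<lambda>n. \<integral>x. (H x \<bullet> i) * (cutoff n x * \<psi> x) \<partial>ball_measure) \<longlonglongrightarrow> (\<integral>x. (H x \<bullet> i) * \<psi> x \<partial>ball_measure)"
  proof (rule integral_dominated_convergence[where w = "\<lambda>x. \<bar>(H x \<bullet> i) * \<psi> x\<bar>"])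
    show "integrable ball_measure (\<lambda>x. \<bar>(H x \<bullet> i) * \<psi> x\<bar>)" using int by (rule integrable_abs)
    show "(\<lambda>x. (H x \<bullet> i) * \<psi> x) \<in> borel_measurable ball_measure" by (rule borel_measurable_integrable[OF int])
    show "(\<lambda>x. (H x \<bullet> i) * (cutoff n x * \<psi> x)) \<in> borel_measurable ball_measure" for n
      by (intro borel_measurable_integrable integrable_mult_continuous Lp2_inner_integrable[OF H i] continuous_on_mult
          C1_continuous[OF cutoff_C1] C1_continuous[OF \<psi>])
    show "AE x in ball_measure. (\<lambda>n. (H x \<bullet> i) * (cutoff n x * \<psi> x)) \<longlonglongrightarrow> (H x \<bullet> i) * \<psi> x"
    proof (rule AE_I2)
      fix x :: 'a assume "x \<in> space ball_measure"
      then have "(norm x)\<^sup>2 < 1" by (simp add: power_less_one_iff abs_square_less_1)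
      then have "x \<bullet> x < 1" by (simp add: power2_norm_eq_inner)
      then have "(\<lambda>n. (H x \<bullet> i) * (cutoff n x * \<psi> x)) \<longlonglongrightarrow> (H x \<bullet> i) * (1 * \<psi> x)"
        by (intro tendsto_intros radial_cutoff_tendsto) auto
      then show "(\<lambda>n. (H x \<bullet> i) * (cutoff n x * \<psi> x)) \<longlonglongrightarrow> (H x \<bullet> i) * \<psi> x" by simp
    qed
    show "AE x in ball_measure. norm ((H x \<bullet> i) * (cutoff n x * \<psi> x)) \<le> \<bar>(H x \<bullet> i) * \<psi> x\<bar>" for n
    proof (rule AE_I2)
      fix x :: 'a
      have "\<bar>cutoff n x\<bar> \<le> 1" using radial_cutoff_range[of "x \<bullet> x" n] by simp
      then have "\<bar>H x \<bullet> i\<bar> * \<bar>\<psi> x\<bar> * \<bar>cutoff n x\<bar> \<le> \<bar>H x \<bullet> i\<bar> * \<bar>\<psi> x\<bar>" by (simp add: mult_left_le)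
      then show "norm ((H x \<bullet> i) * (cutoff n x * \<psi> x)) \<le> \<bar>(H x \<bullet> i) * \<psi> x\<bar>" by (simp add: abs_mult mult_ac)
    qed
  qed
  then show ?thesis unfolding zero by (simp add: LIMSEQ_const_iff)
qed

text \<open>
  The difference of the two solutions is a weak solution with zero trace, hence vanishes almost
  everywhere. Then its weak gradient pairs to zero with \<open>C\<^sup>1\<close> vector fields, so the test function
  has to have a \<open>C\<^sup>1\<close> gradient.
\<close>

lemma DN_map_unique_pairing:
  fixes V f :: "'a::euclidean_space \<Rightarrow> real"
  assumes nz: "\<not> zero_Dirichlet_eigenvalue V" and DN: "DN_map V f g" "DN_map V f g'"
    and \<phi>: "C1_function \<phi> \<Phi>" "\<And>i. i \<in> Basis \<Longrightarrow> C1_function (\<lambda>x. \<Phi> x \<bullet> i) (\<Psi> i)"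
  shows "(\<integral>x. g x * \<phi> x \<partial>sphere_measure) = (\<integral>x. g' x * \<phi> x \<partial>sphere_measure)"
proof -
  obtain u G where u: "weak_solution V u G" "has_trace u G f"
    and g: "(\<integral>x. G x \<bullet> \<Phi> x + V x * u x * \<phi> x \<partial>ball_measure) = (\<integral>x. g x * \<phi> x \<partial>sphere_measure)"
    using DN(1) \<phi>(1) unfolding DN_map_def by blast
  obtain u' G' where u': "weak_solution V u' G'" "has_trace u' G' f"
    and g': "(\<integral>x. G' x \<bullet> \<Phi> x + V x * u' x * \<phi> x \<partial>ball_measure) = (\<integral>x. g' x * \<phi> x \<partial>sphere_measure)"
    using DN(2) \<phi>(1) unfolding DN_map_def by blast
  have H1: "H1_function u G" "H1_function u' G'" using u(1) u'(1) by (simp_all add: weak_solution_def)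
  define v where "v x = u x - u' x" for x
  define H where "H x = G x - G' x" for x
  have v: "weak_solution V v H" "has_trace v H (\<lambda>_. 0)"
    unfolding v_def H_def by (rule weak_solution_diff[OF u(1) u'(1)], rule has_trace_diff[OF H1 u(2) u'(2)])
  then have null: "AE x in ball_measure. v x = 0"
    using nz unfolding zero_Dirichlet_eigenvalue_def by blast
  have vH1: "H1_function v H" using v(1) by (simp add: weak_solution_def)
  have HL: "H \<in> Lp_space ball_measure 2" using vH1 by (simp add: H1_function_def)
  have int: "integrable ball_measure (\<lambda>x. (H x \<bullet> i) * (\<Phi> x \<bullet> i))" if "i \<in> Basis" for i
    by (rule integrable_mult_continuous[OF Lp2_inner_integrable[OF HL that] C1_continuous[OF \<phi>(2)[OF that]]])
  have "(\<integral>x. H x \<bullet> \<Phi> x + V x * v x * \<phi> x \<partial>ball_measure) = (\<integral>x. H x \<bullet> \<Phi> x \<partial>ball_measure)"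
  proof (rule integral_cong_AE)
    show "AE x in ball_measure. H x \<bullet> \<Phi> x + V x * v x * \<phi> x = H x \<bullet> \<Phi> x" using null by eventually_elim simp
    have i1: "integrable ball_measure (\<lambda>x. H x \<bullet> \<Phi> x)" by (rule integrable_inner_C1[OF HL C1_gradient_continuous[OF \<phi>(1)]])
    have i2: "integrable ball_measure (\<lambda>x. V x * v x * \<phi> x)"
    proof (rule integrable_mult_continuous[OF _ C1_continuous[OF \<phi>(1)]])
      show "integrable ball_measure (\<lambda>x. V x * v x)" using v(1) unfolding weak_solution_def by blast
    qed
    show "(\<lambda>x. H x \<bullet> \<Phi> x) \<in> borel_measurable ball_measure" "(\<lambda>x. H x \<bullet> \<Phi> x + V x * v x * \<phi> x) \<in> borel_measurable ball_measure"
      by (rule borel_measurable_integrable[OF i1], rule borel_measurable_integrable[OF Bochner_Integration.integrable_add[OF i1 i2]])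
  qed
  also have "\<dots> = (\<integral>x. (\<Sum>i\<in>Basis. (H x \<bullet> i) * (\<Phi> x \<bullet> i)) \<partial>ball_measure)" by (simp only: euclidean_inner[symmetric])
  also have "\<dots> = (\<Sum>i\<in>Basis. \<integral>x. (H x \<bullet> i) * (\<Phi> x \<bullet> i) \<partial>ball_measure)"
    by (rule Bochner_Integration.integral_sum) (rule int)
  also have "\<dots> = 0"
    by (rule sum.neutral) (auto intro!: weak_gradient_of_null[OF vH1 null \<phi>(2)])
  finally show ?thesis
    unfolding v_def H_def weak_form_diff[OF u(1) u'(1) \<phi>(1)] g g' by simp
qed

text \<open>
  Otherwise \<open>P\<close> vanishes almost everywhere on the sphere, hence by homogeneity almost everywhere in
  the ball, which contradicts continuity.
\<close>

lemma integral_sphere_square_pos: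
  fixes P :: "'a::euclidean_space \<Rightarrow> real"
  assumes cont: "continuous_on UNIV P" and hom: "\<And>c x. P (c *\<^sub>R x) = c ^ k * P x"
    and e: "norm e = 1" "P e \<noteq> 0"
  shows "(\<integral>\<omega>. P \<omega> * P \<omega> \<partial>sphere_measure) > 0"
proof (rule ccontr)
  have int: "integrable sphere_measure (\<lambda>\<omega>. P \<omega> * P \<omega>)"
    by (intro continuous_integrable_sphere continuous_on_mult cont)
  assume "\<not> (\<integral>\<omega>. P \<omega> * P \<omega> \<partial>sphere_measure) > 0"
  moreover have "(\<integral>\<omega>. P \<omega> * P \<omega> \<partial>sphere_measure) \<ge> 0" by (intro Bochner_Integration.integral_nonneg) simp
  ultimately have "(\<integral>\<omega>. P \<omega> * P \<omega> \<partial>sphere_measure) = 0" by simp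
  then have "AE \<omega> in sphere_measure. P \<omega> * P \<omega> = 0"
    using integral_nonneg_eq_0_iff_AE[OF int] by simp
  then have AE: "AE \<omega> in sphere_measure. \<not> (P \<omega> \<noteq> 0)" by eventually_elim simp
  have [measurable]: "P \<in> borel_measurable borel" by (rule continuous_measurable_borel[OF cont])
  let ?B = "{\<omega> \<in> sphere 0 1. P \<omega> \<noteq> 0}"
  have B: "?B \<in> sets (restrict_space borel (sphere (0::'a) 1))"
  proof -
    have "{x. P x \<noteq> 0} \<in> sets borel" by measurable
    moreover have "?B = sphere 0 1 \<inter> {x. P x \<noteq> 0}" by auto
    ultimately show ?thesis by (simp add: sets_restrict_space)
  qed
  have "emeasure sphere_measure ?B = 0"
    using AE_iff_measurable[of ?B sphere_measure "\<lambda>\<omega>. \<not> (P \<omega> \<noteq> 0)"] B AE by auto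
  then have z: "emeasure lborel {x::'a. 0 < norm x \<and> norm x < 1 \<and> x /\<^sub>R norm x \<in> ?B} = 0"
    unfolding emeasure_sphere_measure[OF B] by simp
  define W where "W = {x. P x \<noteq> 0} \<inter> (ball 0 1 - {0})"
  have eq: "{x::'a. 0 < norm x \<and> norm x < 1 \<and> x /\<^sub>R norm x \<in> ?B} = W"
  proof -
    have "P (x /\<^sub>R norm x) \<noteq> 0 \<longleftrightarrow> P x \<noteq> 0" if "x \<noteq> 0" for x :: 'a using that hom[of "inverse (norm x)" x] by simp
    then show ?thesis by (auto simp: W_def)
  qed
  have "open {x. P x \<noteq> 0}" using cont by (intro open_Collect_neq continuous_on_const)
  then have "open W" unfolding W_def by (intro open_Int open_delete) auto
  moreover have "(1/2) *\<^sub>R e \<in> W" using e hom[of "1/2" e] by (auto simp: W_def)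
  ultimately have "\<not> negligible W" by (intro open_not_negligible) auto
  moreover have "W \<in> null_sets lborel" using z \<open>open W\<close> unfolding eq by (auto simp: null_sets_def)
  then have "negligible W" by (simp add: negligible_iff_null_sets null_sets_completionI)
  ultimately show False by simp
qed

text \<open>
  The eigenvalue is unique because two of them, tested with the same harmonic polynomial \<open>P\<close>, give the
  same multiple of \<open>\<integral>P\<^sup>2\<close> over the sphere.
\<close>

theorem (in radial_potential) DN_eigenvalue_regular:
  fixes V :: "'a::euclidean_space \<Rightarrow> real"
  assumes d: "DIM('a) \<ge> 2" and k: "k \<ge> 3" and N: "N = 2 * k + (DIM('a) - 2)" "2 * L < real N"
    and V: "integrable ball_measure V" "AE x in ball_measure. x \<noteq> 0 \<longrightarrow> V x = w (norm x) / norm x"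
    and nz: "\<not> zero_Dirichlet_eigenvalue V"
  shows "DN_eigenvalue V k = real k + flux N 1 / jost N 1"
proof -
  let ?l = "real k + flux N 1 / jost N 1"
  have ex: "\<forall>Y. spherical_harmonic k Y \<longrightarrow> DN_map V Y (\<lambda>x. ?l * Y x)"
    using DN_map_spherical_harmonic[OF d k N V] by blast
  obtain P :: "'a \<Rightarrow> real" and e where P: "real_polynomial_function P" "\<And>c x. P (c *\<^sub>R x) = c ^ k * P x" "\<And>x. laplacian P x = 0"
    and e: "norm e = 1" "P e = 1"
    using planar_harmonic_exists[OF d] by blast
  have sph: "spherical_harmonic k P" unfolding spherical_harmonic_def using P by blast
  obtain G H where G: "C1_function P G" and H: "\<And>i. i \<in> Basis \<Longrightarrow> C1_function (\<lambda>x. G x \<bullet> i) (H i)"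
  proof (rule harmonic_polynomial_gradient[OF P])
    fix G H
    assume "C1_function P G" "\<And>i. i \<in> Basis \<Longrightarrow> C1_function (\<lambda>x. G x \<bullet> i) (H i)"
    then show thesis by (rule that)
  qed
  have pos: "(\<integral>\<omega>. P \<omega> * P \<omega> \<partial>sphere_measure) > 0"
    by (rule integral_sphere_square_pos[OF C1_continuous[OF G] P(2) e(1)]) (simp add: e)
  have "(THE l. \<forall>Y. spherical_harmonic k Y \<longrightarrow> DN_map V Y (\<lambda>x. l * Y x)) = ?l"
  proof (rule the_equality[where P = "\<lambda>l. \<forall>Y. spherical_harmonic k Y \<longrightarrow> DN_map V Y (\<lambda>x. l * Y x)", OF ex])
    fix l assume "\<forall>Y. spherical_harmonic k Y \<longrightarrow> DN_map V Y (\<lambda>x. l * Y x)"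
    then have "DN_map V P (\<lambda>x. l * P x)" "DN_map V P (\<lambda>x. ?l * P x)" using sph ex by blast+
    from DN_map_unique_pairing[OF nz this G H]
    have "(\<integral>x. l * P x * P x \<partial>sphere_measure) = (\<integral>x. ?l * P x * P x \<partial>sphere_measure)" .
    then have "l * (\<integral>x. P x * P x \<partial>sphere_measure) = ?l * (\<integral>x. P x * P x \<partial>sphere_measure)"
      by (simp only: mult.assoc integral_mult_right_zero)
    then show "l = ?l" using pos by simp
  qed
  then show ?thesis using nz unfolding DN_eigenvalue_def by (simp only: if_False)
qed


section \<open>Caratheodory solutions and their Wronskian\<close>

definition radial_coefficient :: "nat \<Rightarrow> (real \<Rightarrow> real) \<Rightarrow> nat \<Rightarrow> real \<Rightarrow> real" where
  "radial_coefficient d q k t = t ^ (d - 1) * (real k * (real k + real d - 2) / t\<^sup>2 + q t)"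

text \<open>The body of \<open>radial_solution\<close> with the derivative as an explicit argument, which the Wronskian needs.\<close>

definition radial_derivative :: "nat \<Rightarrow> (real \<Rightarrow> real) \<Rightarrow> nat \<Rightarrow> (real \<Rightarrow> real) \<Rightarrow> (real \<Rightarrow> real) \<Rightarrow> bool" where
  "radial_derivative d q k b b' \<longleftrightarrow> (\<forall>r\<in>{0<..1}.
        (b has_real_derivative b' r) (at r within {0<..1}) \<and>
        set_integrable lebesgue {r..1} (\<lambda>t. radial_coefficient d q k t * b t) \<and>
        b' 1 - r ^ (d - 1) * b' r = set_lebesgue_integral lebesgue {r..1} (\<lambda>t. radial_coefficient d q k t * b t))"

lemma radial_solution_iff: "radial_solution d q k b \<longleftrightarrow> (\<exists>b'. radial_derivative d q k b b')"
  unfolding radial_solution_def radial_derivative_def radial_coefficient_def by (rule refl)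

lemma radial_derivative_interior:
  assumes "radial_derivative d q k b b'" "0 < r" "r < 1"
  shows "(b has_real_derivative b' r) (at r)"
proof -
  have "(b has_real_derivative b' r) (at r within {0<..1})" using assms by (simp add: radial_derivative_def)
  then have "(b has_real_derivative b' r) (at r within {0<..<1})" by (rule DERIV_subset) auto
  moreover have "at r within {0<..<1} = at r" using assms by (intro at_within_open) auto
  ultimately show ?thesis by simp
qed

lemma radial_flux_increment:
  assumes b: "radial_derivative d q k b b'" and r: "0 < r" "r \<le> s" "s \<le> 1"
  shows "s ^ (d - 1) * b' s - r ^ (d - 1) * b' r = (\<integral>t. indicator {r..<s} t * (radial_coefficient d q k t * b t) \<partial>lebesgue)"
proof -
  let ?f = "\<lambda>t. radial_coefficient d q k t * b t"
  have i: "integrable lebesgue (\<lambda>t. indicator {r..1} t * ?f t)" "integrable lebesgue (\<lambda>t. indicator {s..1} t * ?f t)"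
    and e: "b' 1 - r ^ (d - 1) * b' r = (\<integral>t. indicator {r..1} t * ?f t \<partial>lebesgue)"
      "b' 1 - s ^ (d - 1) * b' s = (\<integral>t. indicator {s..1} t * ?f t \<partial>lebesgue)"
    using b r by (auto simp: radial_derivative_def set_integrable_def set_lebesgue_integral_def)
  have "indicator {r..<s} t * ?f t = indicator {r..1} t * ?f t - indicator {s..1} t * ?f t" for t
    using r by (auto simp: indicator_def)
  then have "(\<integral>t. indicator {r..<s} t * ?f t \<partial>lebesgue) = (\<integral>t. indicator {r..1} t * ?f t \<partial>lebesgue) - (\<integral>t. indicator {s..1} t * ?f t \<partial>lebesgue)"
    using i by simp
  then show ?thesis using e by simp
qed

text \<open>
  The flux \<open>r\<^sup>d\<^sup>-\<^sup>1 b'\<close> is an indefinite integral. A Borel version \<open>g\<close> of the integrand is needed because the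
  profile is only Lebesgue measurable.
\<close>

lemma radial_derivative_continuous:
  assumes b: "radial_derivative d q k b b'"
  shows "continuous_on {0<..<1} b'"
proof (intro continuous_at_imp_continuous_on ballI)
  fix x :: real assume x: "x \<in> {0<..<1}"
  let ?f = "\<lambda>t. radial_coefficient d q k t * b t"
  define r where "r = x / 2"
  have r: "0 < r" "r < x" "r \<le> 1" using x by (auto simp: r_def)
  have "integrable lebesgue (\<lambda>t. indicator {r..1} t * ?f t)"
    using b r by (auto simp: radial_derivative_def set_integrable_def)
  then obtain g where g: "g \<in> borel_measurable lborel" "AE t in lborel. indicator {r..1} t * ?f t = g t"
    and gi: "integrable lborel g"
  proof -
    assume i: "integrable lebesgue (\<lambda>t. indicator {r..1} t * ?f t)"
      and that: "\<And>g. g \<in> borel_measurable lborel \<Longrightarrow> AE t in lborel. indicator {r..1} t * ?f t = g t \<Longrightarrow> integrable lborel g \<Longrightarrow> thesis"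
    obtain g where g: "g \<in> borel_measurable lborel" "AE t in lborel. indicator {r..1} t * ?f t = g t"
      using completion_ex_borel_measurable_real[OF borel_measurable_integrable[OF i]] by blast
    have "integrable lebesgue g"
      using integrable_cong_AE[OF borel_measurable_integrable[OF i] measurable_completion[OF g(1)] AE_completion[OF g(2)]] i by simp
    then have "integrable lborel g" using integrable_completion[OF g(1)] by simp
    with g show thesis by (rule that)
  qed
  have eq: "b' s = (r ^ (d - 1) * b' r + (\<integral>t. indicator {..<s} t * g t \<partial>lborel)) / s ^ (d - 1)" if s: "s \<in> {r<..<1}" for s
  proof -
    have [measurable]: "g \<in> borel_measurable borel" using g(1) by simp
    have "(\<integral>t. indicator {r..<s} t * ?f t \<partial>lebesgue) = (\<integral>t. indicator {..<s} t * g t \<partial>lebesgue)"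
    proof (rule integral_cong_AE)
      show "AE t in lebesgue. indicator {r..<s} t * ?f t = indicator {..<s} t * g t"
        using AE_completion[OF g(2)]
      proof eventually_elim
        fix t assume t: "indicator {r..1} t * ?f t = g t"
        show "indicator {r..<s} t * ?f t = indicator {..<s} t * g t"
          unfolding t[symmetric] using s by (auto simp: indicator_def)
      qed
      then have "AE t in lebesgue. indicator {..<s} t * g t = indicator {r..<s} t * ?f t" by eventually_elim simp
      moreover show m: "(\<lambda>t. indicator {..<s} t * g t) \<in> borel_measurable lebesgue"
        by (intro measurable_completion) measurable
      ultimately show "(\<lambda>t. indicator {r..<s} t * ?f t) \<in> borel_measurable lebesgue"
        by (rule borel_measurable_AE[rotated])
    qed
    also have "\<dots> = (\<integral>t. indicator {..<s} t * g t \<partial>lborel)" by (rule integral_completion) measurable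
    finally show ?thesis
      using radial_flux_increment[OF b r(1), of s] s r by (simp add: field_simps)
  qed
  have "isCont (\<lambda>s. (r ^ (d - 1) * b' r + (\<integral>t. indicator {..<s} t * g t \<partial>lborel)) / s ^ (d - 1)) x"
    using x by (intro continuous_intros isCont_indefinite_integral[OF gi]) auto
  moreover have "\<forall>\<^sub>F s in nhds x. b' s = (r ^ (d - 1) * b' r + (\<integral>t. indicator {..<s} t * g t \<partial>lborel)) / s ^ (d - 1)"
  proof (rule eventually_mono)
    show "\<forall>\<^sub>F s in nhds x. s \<in> {r<..<1}" using x r by (intro eventually_nhds_in_open) auto
  qed (rule eq)
  ultimately show "isCont b' x" by (subst isCont_cong)
qed

text \<open>
  Integration by parts of \<open>b\<^sub>1 (r\<^sup>d\<^sup>-\<^sup>1 b\<^sub>2')\<close>. The right-hand side is symmetric in the two solutions, which is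
  why their Wronskian is constant.
\<close>

lemma radial_product:
  assumes b1: "radial_derivative d q k b1 b1'" and b2: "radial_derivative d q k b2 b2'"
    and r: "0 < r" "r \<le> s" "s < 1"
  shows "b1 s * (s ^ (d - 1) * b2' s) - b1 r * (r ^ (d - 1) * b2' r)
    = (\<integral>t. indicator {r..s} t * (radial_coefficient d q k t * b1 t * b2 t + t ^ (d - 1) * b1' t * b2' t) \<partial>lebesgue)"
proof -
  let ?f = "\<lambda>t. radial_coefficient d q k t * b2 t"
  have i: "integrable lebesgue (\<lambda>t. indicator {r..1} t * ?f t)"
    using b2 r by (auto simp: radial_derivative_def set_integrable_def)
  have i: "integrable lebesgue (\<lambda>t. indicator {r..s} t * ?f t)"
  proof -
    have "integrable lebesgue (\<lambda>t. indicator {r..s} t *\<^sub>R (indicator {r..1} t * ?f t))"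
      by (rule integrable_mult_indicator[OF _ i]) simp
    moreover have "(\<lambda>t. indicator {r..s} t *\<^sub>R (indicator {r..1} t * ?f t)) = (\<lambda>t. indicator {r..s} t * ?f t)"
      using r by (auto simp: indicator_def)
    ultimately show ?thesis by (simp only:)
  qed
  obtain g0 where g0: "g0 \<in> borel_measurable lborel" "AE t in lborel. indicator {r..s} t * ?f t = g0 t"
    using completion_ex_borel_measurable_real[OF borel_measurable_integrable[OF i]] by blast
  define g where "g t = indicator {r..s} t * g0 t" for t
  have g: "g \<in> borel_measurable lborel" "AE t in lborel. indicator {r..s} t * ?f t = g t"
  proof -
    have [measurable]: "g0 \<in> borel_measurable borel" using g0(1) by simp
    show "g \<in> borel_measurable lborel" unfolding g_def by measurable
    show "AE t in lborel. indicator {r..s} t * ?f t = g t"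
      using g0(2)
    proof eventually_elim
      fix t assume t: "indicator {r..s} t * ?f t = g0 t"
      show "indicator {r..s} t * ?f t = g t" unfolding g_def t[symmetric] by (auto simp: indicator_def)
    qed
  qed
  have [measurable]: "g \<in> borel_measurable borel" using g(1) by simp
  have "integrable lebesgue g"
    using integrable_cong_AE[OF borel_measurable_integrable[OF i] measurable_completion[OF g(1)] AE_completion[OF g(2)]] i by simp
  then have gi: "integrable lborel g" using integrable_completion[OF g(1)] by simp
  have b1_cont: "continuous_on {r..s} b1"
    by (intro continuous_at_imp_continuous_on ballI DERIV_isCont[OF radial_derivative_interior[OF b1]]) (use r in auto)
  have b1g: "integrable lborel (\<lambda>t. b1 t * g t)"
  proof -
    have "compact (b1 ` {r..s})" by (intro compact_continuous_image b1_cont) simp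
    then have "bounded (b1 ` {r..s})" by (rule compact_imp_bounded)
    then obtain K where K: "\<forall>y\<in>b1 ` {r..s}. norm y \<le> K" unfolding bounded_iff by blast
    have m: "(\<lambda>t. indicator {r..s} t *\<^sub>R b1 t) \<in> borel_measurable borel"
      using borel_measurable_continuous_on_indicator[OF _ b1_cont] by simp
    have "integrable lborel (\<lambda>t. (indicator {r..s} t *\<^sub>R b1 t) * g t)"
    proof (rule Bochner_Integration.integrable_bound)
      show "integrable lborel (\<lambda>t. K * g t)" using gi by simp
      show "(\<lambda>t. (indicator {r..s} t *\<^sub>R b1 t) * g t) \<in> borel_measurable lborel" using m by simp
      show "AE t in lborel. norm ((indicator {r..s} t *\<^sub>R b1 t) * g t) \<le> norm (K * g t)"
      proof (rule AE_I2)
        fix t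
        show "norm ((indicator {r..s} t *\<^sub>R b1 t) * g t) \<le> norm (K * g t)"
        proof (cases "t \<in> {r..s}")
          case True
          then have "\<bar>b1 t\<bar> \<le> \<bar>K\<bar>" using K by force
          then show ?thesis using True by (simp add: abs_mult mult_right_mono)
        qed (simp add: g_def)
      qed
    qed
    moreover have "(\<lambda>t. (indicator {r..s} t *\<^sub>R b1 t) * g t) = (\<lambda>t. b1 t * g t)"
      by (auto simp: g_def indicator_def)
    ultimately show ?thesis by (simp only:)
  qed
  define G where "G x = (\<integral>t. indicator {..<x} t * g t \<partial>lborel)" for x
  have G_eq: "G x = x ^ (d - 1) * b2' x - r ^ (d - 1) * b2' r" if x: "x \<in> {r..s}" for x
  proof -
    have "(\<integral>t. indicator {r..<x} t * ?f t \<partial>lebesgue) = (\<integral>t. indicator {..<x} t * g t \<partial>lebesgue)"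
    proof (rule integral_cong_AE)
      show "AE t in lebesgue. indicator {r..<x} t * ?f t = indicator {..<x} t * g t"
        using AE_completion[OF g(2)]
      proof eventually_elim
        fix t assume t: "indicator {r..s} t * ?f t = g t"
        show "indicator {r..<x} t * ?f t = indicator {..<x} t * g t"
          unfolding t[symmetric] using x by (auto simp: indicator_def)
      qed
      then have "AE t in lebesgue. indicator {..<x} t * g t = indicator {r..<x} t * ?f t" by eventually_elim simp
      moreover show m: "(\<lambda>t. indicator {..<x} t * g t) \<in> borel_measurable lebesgue"
        by (intro measurable_completion) measurable
      ultimately show "(\<lambda>t. indicator {r..<x} t * ?f t) \<in> borel_measurable lebesgue"
        by (rule borel_measurable_AE[rotated])
    qed
    also have "\<dots> = (\<integral>t. indicator {..<x} t * g t \<partial>lborel)" by (rule integral_completion) measurable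
    finally show ?thesis using radial_flux_increment[OF b2 r(1), of x] x r by (simp add: G_def)
  qed
  have parts: "has_bochner_integral lborel (\<lambda>t. indicator {r..s} t * (b1 t * g t + b1' t * G t)) (b1 s * G s - b1 r * G r)"
    by (rule weighted_integration_by_parts[OF gi b1g radial_derivative_interior[OF b1] radial_derivative_continuous[OF b1] G_def r])
  have b1': "has_bochner_integral lborel (\<lambda>t. b1' t * indicator {r..s} t) (b1 s - b1 r)"
  proof (rule has_bochner_integral_FTC_Icc_real[OF r(2)])
    fix t assume "r \<le> t" "t \<le> s"
    then show "(b1 has_real_derivative b1' t) (at t)" "isCont b1' t"
      using r radial_derivative_continuous[OF b1]
      by (auto intro: radial_derivative_interior[OF b1] simp: continuous_on_eq_continuous_at)
  qed
  let ?c = "r ^ (d - 1) * b2' r"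
  have "has_bochner_integral lborel (\<lambda>t. indicator {r..s} t * (b1 t * g t + b1' t * G t) + ?c * (b1' t * indicator {r..s} t))
      ((b1 s * G s - b1 r * G r) + ?c * (b1 s - b1 r))"
    by (intro has_bochner_integral_add parts has_bochner_integral_mult_right b1')
  moreover have "(b1 s * G s - b1 r * G r) + ?c * (b1 s - b1 r) = b1 s * (s ^ (d - 1) * b2' s) - b1 r * (r ^ (d - 1) * b2' r)"
    using r by (simp add: G_eq algebra_simps)
  moreover have "indicator {r..s} t * (b1 t * g t + b1' t * G t) + ?c * (b1' t * indicator {r..s} t)
     = indicator {r..s} t * (b1 t * g t + t ^ (d - 1) * b1' t * b2' t)" for t
  proof (cases "t \<in> {r..s}")
    case True
    show ?thesis unfolding G_eq[OF True] using True by (simp add: algebra_simps)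
  qed simp
  ultimately have hb: "has_bochner_integral lborel (\<lambda>t. indicator {r..s} t * (b1 t * g t + t ^ (d - 1) * b1' t * b2' t))
      (b1 s * (s ^ (d - 1) * b2' s) - b1 r * (r ^ (d - 1) * b2' r))" by simp
  let ?h = "\<lambda>t. indicator {r..s} t * (b1 t * g t + t ^ (d - 1) * b1' t * b2' t)"
  have hi: "integrable lborel ?h" "integral\<^sup>L lborel ?h = b1 s * (s ^ (d - 1) * b2' s) - b1 r * (r ^ (d - 1) * b2' r)"
    using hb by (simp_all add: has_bochner_integral_iff)
  have hm: "?h \<in> borel_measurable lebesgue" by (rule measurable_completion[OF borel_measurable_integrable[OF hi(1)]])
  have AE: "AE t in lebesgue. ?h t = indicator {r..s} t * (radial_coefficient d q k t * b1 t * b2 t + t ^ (d - 1) * b1' t * b2' t)"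
    using AE_completion[OF g(2)]
  proof eventually_elim
    fix t assume t: "indicator {r..s} t * ?f t = g t"
    show "?h t = indicator {r..s} t * (radial_coefficient d q k t * b1 t * b2 t + t ^ (d - 1) * b1' t * b2' t)"
      unfolding t[symmetric] by (auto simp: indicator_def)
  qed
  have "integral\<^sup>L lborel ?h = integral\<^sup>L lebesgue ?h"
    by (rule integral_completion[symmetric, OF borel_measurable_integrable[OF hi(1)]])
  also have "\<dots> = (\<integral>t. indicator {r..s} t * (radial_coefficient d q k t * b1 t * b2 t + t ^ (d - 1) * b1' t * b2' t) \<partial>lebesgue)"
    by (rule integral_cong_AE[OF hm borel_measurable_AE[OF hm AE] AE])
  finally show ?thesis using hi(2) by simp
qed

lemma Wronskian_constant:
  assumes b1: "radial_derivative d q k b1 b1'" and b2: "radial_derivative d q k b2 b2'"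
    and r: "0 < r" "r \<le> s" "s < 1"
  shows "s ^ (d - 1) * (b1 s * b2' s - b2 s * b1' s) = r ^ (d - 1) * (b1 r * b2' r - b2 r * b1' r)"
  using radial_product[OF b1 b2 r] radial_product[OF b2 b1 r] by (simp add: algebra_simps)

text \<open>Over \<open>[\<epsilon>, 2\<epsilon>]\<close> alone the integral is at least \<open>c/(4\<epsilon>)\<close>, which is unbounded.\<close>

lemma inverse_square_lower_bound_not_integrable:
  fixes f :: "real \<Rightarrow> real"
  assumes f[measurable]: "f \<in> borel_measurable borel" and fin: "(\<integral>\<^sup>+t. ennreal (indicator {0<..<1} t * f t) \<partial>lborel) < \<infinity>"
    and c: "c > 0" "0 < r" "r < 1" and low: "\<And>t. 0 < t \<Longrightarrow> t < r \<Longrightarrow> f t \<ge> c / t ^ 2"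
  shows False
proof -
  obtain T where T: "(\<integral>\<^sup>+t. ennreal (indicator {0<..<1} t * f t) \<partial>lborel) = ennreal T" "T \<ge> 0"
    using fin by (cases "\<integral>\<^sup>+t. ennreal (indicator {0<..<1} t * f t) \<partial>lborel") auto
  have bound: "c / (4 * \<epsilon>) \<le> T" if \<epsilon>: "0 < \<epsilon>" "2 * \<epsilon> < r" for \<epsilon>
  proof -
    have "ennreal (c / (4 * \<epsilon>)) = (\<integral>\<^sup>+t. ennreal (c / (4 * \<epsilon>\<^sup>2)) * indicator {\<epsilon>..2 * \<epsilon>} t \<partial>lborel)"
      using \<epsilon> c by (subst nn_integral_cmult_indicator) (auto simp: ennreal_mult[symmetric] power2_eq_square)
    also have "\<dots> \<le> (\<integral>\<^sup>+t. ennreal (indicator {0<..<1} t * f t) \<partial>lborel)"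
    proof (rule nn_integral_mono)
      fix t :: real
      show "ennreal (c / (4 * \<epsilon>\<^sup>2)) * indicator {\<epsilon>..2 * \<epsilon>} t \<le> ennreal (indicator {0<..<1} t * f t)"
      proof (cases "t \<in> {\<epsilon>..2 * \<epsilon>}")
        case True
        then have t: "0 < t" "t < r" "t < 1" using \<epsilon> c by auto
        have "t\<^sup>2 \<le> (2 * \<epsilon>)\<^sup>2" using True t by (intro power_mono) auto
        then have "c / (4 * \<epsilon>\<^sup>2) \<le> c / t\<^sup>2" using c t \<epsilon> by (intro divide_left_mono) (auto simp: power_mult_distrib)
        also have "\<dots> \<le> f t" by (rule low[OF t(1,2)])
        finally show ?thesis using True t by (simp add: ennreal_leI)
      qed simp
    qed
    finally show ?thesis unfolding T(1) using T(2) by simp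
  qed
  \<comment> \<open>Small enough for \<open>c / (4 \<epsilon>) > T\<close>.\<close>
  define \<epsilon> where "\<epsilon> = min (r / 3) (c / (8 * (T + 1)))"
  have \<epsilon>: "0 < \<epsilon>" "2 * \<epsilon> < r" using c T by (auto simp: \<epsilon>_def min_def)
  have "\<epsilon> \<le> c / (8 * (T + 1))" by (simp add: \<epsilon>_def)
  then have "8 * (T + 1) * \<epsilon> \<le> c" using T by (simp add: field_simps)
  moreover have "c \<le> 4 * \<epsilon> * T" using bound[OF \<epsilon>] \<epsilon> by (simp add: field_simps)
  ultimately have "8 * (T + 1) * \<epsilon> \<le> 4 * T * \<epsilon>" by (simp add: mult_ac)
  then have "8 * (T + 1) \<le> 4 * T" using \<epsilon> by simp
  then show False using T by simp
qed


section \<open>The eigenvalue given by the radial equation\<close>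

context radial_potential begin

lemma jost_radial_derivative:
  assumes k: "k \<ge> 1" and N: "L < real (2 * k + e)"
    and q: "AE t in lborel. t \<in> {0<..<1} \<longrightarrow> w t = t * q t"
    and b: "\<And>r. r \<in> {0<..1} \<Longrightarrow> b r = C * (r ^ k * jost (2 * k + e) r)"
  shows "radial_derivative (e + 2) q k b
    (\<lambda>r. C * (real k * r ^ (k - 1) * jost (2 * k + e) r + flux (2 * k + e) r / r ^ (k + e + 1)))"
  unfolding radial_derivative_def
proof (intro ballI conjI)
  let ?N = "2 * k + e"
  fix r :: real assume r: "r \<in> {0<..1}"
  then have r': "0 < r" "r \<le> 1" by auto
  note eqn = radial_equation[OF N k r']
  have "((\<lambda>r. C * (r ^ k * jost ?N r)) has_real_derivative C * (real k * r ^ (k - 1) * jost ?N r + flux ?N r / r ^ (k + e + 1))) (at r within {0<..1})"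
    by (rule has_field_derivative_at_within[OF DERIV_cmult[OF eqn(1)]])
  then show "(b has_real_derivative C * (real k * r ^ (k - 1) * jost ?N r + flux ?N r / r ^ (k + e + 1))) (at r within {0<..1})"
    unfolding has_field_derivative_def by (rule has_derivative_transform[OF r b, rotated])
  let ?h = "\<lambda>t. indicator {r..1} t * (t ^ (e + 1) * (real k * (real k + real e) / t\<^sup>2 + w t / t) * (t ^ k * jost ?N t))"
  let ?g = "\<lambda>t. indicator {r..1} t * (radial_coefficient (e + 2) q k t * b t)"
  have hb: "has_bochner_integral lborel (\<lambda>t. C * ?h t)
     (C * ((real k * jost ?N 1 + flux ?N 1) - r ^ (e + 1) * (real k * r ^ (k - 1) * jost ?N r + flux ?N r / r ^ (k + e + 1))))"
    by (rule has_bochner_integral_mult_right) (use eqn(2) in auto)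
  have AE: "AE t in lborel. C * ?h t = ?g t"
    using q AE_lborel_singleton[of "1::real"]
  proof eventually_elim
    fix t :: real assume t: "t \<in> {0<..<1} \<longrightarrow> w t = t * q t" "t \<noteq> 1"
    show "C * ?h t = ?g t"
    proof (cases "t \<in> {r..1}")
      case True
      then have t': "t \<in> {0<..<1}" "t \<in> {0<..1}" using t(2) r' by auto
      then have "w t / t = q t" using t(1) by simp
      then show ?thesis by (simp add: b[OF t'(2)] radial_coefficient_def mult_ac)
    qed simp
  qed
  have hm: "(\<lambda>t. C * ?h t) \<in> borel_measurable lborel" using hb by (auto simp: has_bochner_integral_iff)
  have gm: "?g \<in> borel_measurable lebesgue"
    by (rule borel_measurable_AE[OF measurable_completion[OF hm] AE_completion[OF AE]])
  have "integrable lebesgue (\<lambda>t. C * ?h t)" using hb integrable_completion[OF hm] by (simp add: has_bochner_integral_iff)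
  then have gi: "integrable lebesgue ?g"
    using integrable_cong_AE[OF measurable_completion[OF hm] gm AE_completion[OF AE]] by simp
  then show "set_integrable lebesgue {r..1} (\<lambda>t. radial_coefficient (e + 2) q k t * b t)"
    by (simp add: set_integrable_def)
  have "(\<integral>t. ?g t \<partial>lebesgue) = (\<integral>t. C * ?h t \<partial>lebesgue)"
    by (rule integral_cong_AE[OF measurable_completion[OF hm] gm AE_completion[OF AE], symmetric])
  also have "\<dots> = (\<integral>t. C * ?h t \<partial>lborel)" by (rule integral_completion[OF hm])
  also have "\<dots> = C * ((real k * jost ?N 1 + flux ?N 1) - r ^ (e + 1) * (real k * r ^ (k - 1) * jost ?N r + flux ?N r / r ^ (k + e + 1)))"
    using hb by (simp only: has_bochner_integral_iff)
  finally have I: "(\<integral>t. ?g t \<partial>lebesgue)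
    = C * ((real k * jost ?N 1 + flux ?N 1) - r ^ (e + 1) * (real k * r ^ (k - 1) * jost ?N r + flux ?N r / r ^ (k + e + 1)))" .
  have "e + 2 - 1 = e + 1" by simp
  then show "C * (real k * 1 ^ (k - 1) * jost ?N 1 + flux ?N 1 / 1 ^ (k + e + 1))
      - r ^ (e + 2 - 1) * (C * (real k * r ^ (k - 1) * jost ?N r + flux ?N r / r ^ (k + e + 1)))
      = set_lebesgue_integral lebesgue {r..1} (\<lambda>t. radial_coefficient (e + 2) q k t * b t)"
    using I by (simp only: set_lebesgue_integral_def real_scaleR_def power_one div_by_1 mult_1_right right_diff_distrib mult.left_commute[of C])
qed

text \<open>
  Reduction of order with the regular solution \<open>b\<^sub>0 = r\<^sup>k c(r) > 0\<close>: the quotient \<open>y = b/b\<^sub>0\<close> has the derivative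
  \<open>W\<^sub>0 / (r\<^sup>d\<^sup>-\<^sup>1 b\<^sub>0\<^sup>2)\<close> with the constant Wronskian \<open>W\<^sub>0\<close>. If \<open>W\<^sub>0 \<noteq> 0\<close>, then \<open>|y|\<close> grows at least like \<open>r\<^sup>-\<^sup>N\<close> at the origin, so
  that \<open>r\<^sup>d\<^sup>-\<^sup>3 b\<^sup>2\<close> is at least of the order \<open>r\<^sup>-\<^sup>N\<^sup>-\<^sup>1\<close> and not integrable.
\<close>

lemma square_integrable_solution_unique:
  assumes k: "k \<ge> 1" and N: "N = 2 * k + e" "2 * L < real N"
    and q: "AE t in lborel. t \<in> {0<..<1} \<longrightarrow> w t = t * q t"
    and b: "radial_derivative (e + 2) q k b b'"
    and L2: "(\<integral>\<^sup>+t. ennreal (indicator {0<..<1} t * (t ^ (e + 1) / t\<^sup>2 * (indicator {0<..1} t * b t)\<^sup>2)) \<partial>lborel) < \<infinity>"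
  obtains C where "\<And>r. r \<in> {0<..<1} \<Longrightarrow> b r = C * (r ^ k * jost N r)"
proof -
  have LN: "L < real N" using N(2) L_nonneg by linarith
  define b0 where "b0 r = r ^ k * jost N r" for r
  define b0' where "b0' r = 1 * (real k * r ^ (k - 1) * jost (2 * k + e) r + flux (2 * k + e) r / r ^ (k + e + 1))" for r
  have rd0: "radial_derivative (e + 2) q k b0 b0'"
    unfolding b0'_def using LN N(1) by (intro jost_radial_derivative[OF k _ q]) (auto simp: b0_def)
  have b0_pos: "b0 r > 0" if "r > 0" for r using jost_pos[OF N(2)] that by (simp add: b0_def)
  define Wr where "Wr r = r ^ (e + 1) * (b0 r * b' r - b r * b0' r)" for r
  have Wr_const: "Wr s = Wr r" if "0 < r" "r \<le> s" "s < 1" for r s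
    using Wronskian_constant[OF rd0 b that] by (simp add: Wr_def)
  define W0 where "W0 = Wr (1/2)"
  have Wr: "Wr r = W0" if "r \<in> {0<..<1}" for r
    using Wr_const[of r "1/2"] Wr_const[of "1/2" r] that by (cases "r \<le> 1/2") (auto simp: W0_def)
  define y where "y r = b r / b0 r" for r
  have y: "(y has_real_derivative W0 / (r ^ (e + 1) * (b0 r)\<^sup>2)) (at r)" if r: "r \<in> {0<..<1}" for r
  proof -
    have "(b has_real_derivative b' r) (at r)" "(b0 has_real_derivative b0' r) (at r)"
      using radial_derivative_interior[OF b] radial_derivative_interior[OF rd0] r by auto
    then have "(y has_real_derivative (b' r * b0 r - b r * b0' r) / (b0 r * b0 r)) (at r)"
      unfolding y_def[abs_def] using b0_pos[of r] r by (intro DERIV_divide) auto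
    moreover have "(b' r * b0 r - b r * b0' r) / (b0 r * b0 r) = W0 / (r ^ (e + 1) * (b0 r)\<^sup>2)"
      unfolding Wr[OF r, symmetric] Wr_def using r b0_pos[of r] by (simp add: power2_eq_square mult.commute)
    ultimately show ?thesis by simp
  qed
  have "W0 = 0"
  proof (rule ccontr)
    assume "W0 \<noteq> 0"
    have N1: "N \<ge> 1" using k N(1) by simp
    define M where "M = jost_bd N"
    have M: "M > 0" "\<And>r. jost N r \<le> M"
      using jost_bd_pos[OF LN] jost_abs_bound[OF LN] by (auto simp: M_def intro: order_trans[OF abs_ge_self])
    define m where "m = 1 - L / (real N - L)"
    have m: "m > 0" "\<And>r. m \<le> jost N r"
    proof -
      show "m > 0" using N(2) L_nonneg by (simp add: m_def field_simps)
      show "m \<le> jost N r" for r using jost_bound[OF LN, of r] by (simp add: m_def)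
    qed
    define A where "A = \<bar>W0\<bar> / (M\<^sup>2 * real N)"
    have A: "A > 0" using \<open>W0 \<noteq> 0\<close> M(1) N1 by (simp add: A_def)
    \<comment> \<open>A lower bound on \<open>|y'|\<close> in the form of a monotone function, which avoids integrating \<open>y'\<close>.\<close>
    define z where "z r = sgn W0 * y r + A / r ^ N" for r
    have z_mono: "z r \<le> z (1/2)" if r: "0 < r" "r \<le> 1/2" for r
    proof (rule DERIV_nonneg_imp_nondecreasing[OF r(2)])
      fix t assume t: "r \<le> t" "t \<le> 1/2"
      then have t0: "t \<in> {0<..<1}" "t > 0" using r by auto
      have "((\<lambda>t. A / t ^ N) has_real_derivative - (A * real N / t ^ Suc N)) (at t)"
      proof (rule DERIV_cong[OF DERIV_divide[OF DERIV_const DERIV_power[OF DERIV_ident]]])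
        obtain n where "N = Suc n" using N1 by (cases N) auto
        then show "(0 * t ^ N - A * (real N * (1 * t ^ (N - Suc 0)))) / (t ^ N * t ^ N) = - (A * real N / t ^ Suc N)"
          using t0 by simp
      qed (use t0 in simp)
      from DERIV_add[OF DERIV_cmult[OF y[OF t0(1)], of "sgn W0"] this]
      have "(z has_real_derivative sgn W0 * (W0 / (t ^ (e + 1) * (b0 t)\<^sup>2)) - A * real N / t ^ Suc N) (at t)"
        unfolding z_def[abs_def] by simp
      moreover have "sgn W0 * (W0 / (t ^ (e + 1) * (b0 t)\<^sup>2)) - A * real N / t ^ Suc N \<ge> 0"
      proof -
        have "t ^ (e + 1) * (b0 t)\<^sup>2 = t ^ Suc N * (jost N t)\<^sup>2"
          by (simp add: b0_def N(1) power_mult_distrib flip: power_mult power_add) (simp add: power_add mult_2 mult.commute)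
        also have "\<dots> \<le> t ^ Suc N * M\<^sup>2"
          using t0 M(2)[of t] jost_pos[OF N(2), of t] by (intro mult_left_mono power_mono) auto
        finally have le: "t ^ (e + 1) * (b0 t)\<^sup>2 \<le> t ^ Suc N * M\<^sup>2" .
        have "A * real N / t ^ Suc N = \<bar>W0\<bar> / (t ^ Suc N * M\<^sup>2)" using N1 by (simp add: A_def)
        also have "\<dots> \<le> \<bar>W0\<bar> / (t ^ (e + 1) * (b0 t)\<^sup>2)"
          using le t0 M(1) b0_pos[of t] by (intro divide_left_mono) auto
        also have "\<dots> = sgn W0 * (W0 / (t ^ (e + 1) * (b0 t)\<^sup>2))" by (simp add: abs_sgn mult.commute)
        finally show ?thesis by simp
      qed
      ultimately show "\<exists>y. (z has_real_derivative y) (at t) \<and> 0 \<le> y" by blast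
    qed
    define Z where "Z = \<bar>z (1/2)\<bar> + 1"
    have Z: "Z > 0" by (simp add: Z_def)
    define r1 where "r1 = min (1/2) (A / (2 * Z))"
    have r1: "0 < r1" "r1 < 1" using A Z by (auto simp: r1_def)
    define f where "f t = t ^ (e + 1) / t\<^sup>2 * (indicator {0<..1} t * b t)\<^sup>2" for t
    have "continuous_on {0<..1} b"
      using b unfolding radial_derivative_def by (intro continuous_on_eq_continuous_within[THEN iffD2] ballI) (auto intro: DERIV_continuous)
    then have [measurable]: "(\<lambda>t. indicator {0<..1} t * b t) \<in> borel_measurable borel"
      using borel_measurable_continuous_on_indicator[of "{0<..1}" b] by simp
    have fm: "f \<in> borel_measurable borel" unfolding f_def by measurable
    have low: "f t \<ge> (A / 2 * m)\<^sup>2 / t ^ 2" if t: "0 < t" "t < r1" for t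
    proof -
      have t1: "t < 1" "t \<le> 1/2" "t \<le> A / (2 * Z)" using t r1 by (auto simp: r1_def)
      have tN: "t ^ N \<le> t" using power_decreasing[of 1 N t] N1 t t1 by simp
      have "t ^ N * (2 * Z) \<le> A"
      proof -
        have "t ^ N * (2 * Z) \<le> t * (2 * Z)" using tN Z by (intro mult_right_mono) auto
        also have "\<dots> \<le> A" using t1(3) Z by (simp add: field_simps)
        finally show ?thesis .
      qed
      then have AZ: "2 * Z \<le> A / t ^ N" using t by (simp add: field_simps)
      have "sgn W0 * y t + A / t ^ N \<le> Z" using z_mono[OF t(1) t1(2)] by (simp add: z_def Z_def)
      moreover have "X / 2 \<le> - Y" if "Y + X \<le> Z" "2 * Z \<le> X" for X Y using that by linarith
      ultimately have "A / t ^ N / 2 \<le> - (sgn W0 * y t)" using AZ by blast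
      also have "\<dots> \<le> \<bar>y t\<bar>" using \<open>W0 \<noteq> 0\<close> by (cases "W0 > 0") auto
      finally have yt: "A / 2 / t ^ N \<le> \<bar>y t\<bar>" by simp
      have "A / 2 / t ^ N * (t ^ k * m) \<le> \<bar>y t\<bar> * b0 t"
        using yt m(2)[of t] t A m(1) unfolding b0_def by (intro mult_mono) auto
      also have "\<dots> = \<bar>b t\<bar>" using b0_pos[OF t(1)] by (simp add: y_def abs_divide)
      finally have bt: "A / 2 / t ^ N * (t ^ k * m) \<le> \<bar>b t\<bar>" .
      have sq: "(A / 2 / t ^ N * (t ^ k * m))\<^sup>2 \<le> (b t)\<^sup>2"
      proof -
        have "(A / 2 / t ^ N * (t ^ k * m))\<^sup>2 \<le> \<bar>b t\<bar>\<^sup>2" using A m(1) t by (intro power_mono bt) auto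
        then show ?thesis by simp
      qed
      have "(A / 2 * m)\<^sup>2 / t ^ 2 \<le> (A / 2 * m)\<^sup>2 / t ^ (N + 1)"
        using t t1 N1 by (intro divide_left_mono power_decreasing) auto
      also have "\<dots> = t ^ (e + 1) / t\<^sup>2 * (A / 2 / t ^ N * (t ^ k * m))\<^sup>2"
      proof -
        have "t ^ (e + 1) * (t ^ k)\<^sup>2 * t ^ (N + 1) = t\<^sup>2 * (t ^ N)\<^sup>2"
          by (simp add: N(1) flip: power_add power_mult) (simp add: power_add power2_eq_square mult_ac mult_2)
        then have "t ^ (e + 1) * (t ^ k)\<^sup>2 / (t\<^sup>2 * (t ^ N)\<^sup>2) = 1 / t ^ (N + 1)" using t by (simp add: divide_simps)
        moreover have "t ^ (e + 1) / t\<^sup>2 * (A / 2 / t ^ N * (t ^ k * m))\<^sup>2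
          = (A / 2 * m)\<^sup>2 * (t ^ (e + 1) * (t ^ k)\<^sup>2 / (t\<^sup>2 * (t ^ N)\<^sup>2))"
          by (simp add: power_mult_distrib power_divide mult_ac)
        ultimately show ?thesis by simp
      qed
      also have "\<dots> \<le> t ^ (e + 1) / t\<^sup>2 * (b t)\<^sup>2" using sq t by (intro mult_left_mono) auto
      also have "\<dots> = f t" using t t1 by (simp add: f_def)
      finally show ?thesis .
    qed
    show False
      by (rule inverse_square_lower_bound_not_integrable[OF fm _ _ r1 low]) (use L2 A m in \<open>auto simp: f_def\<close>)
  qed
  show ?thesis
  proof (rule that[of "y (1/2)"])
    fix r :: real assume r: "r \<in> {0<..<1}"
    have "y r = y (1/2)"
    proof (rule DERIV_isconst3[of 0 1 r "1/2" y])
      fix x :: real assume "x \<in> {0<..<1}"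
      then show "(y has_real_derivative 0) (at x)" using y[of x] \<open>W0 = 0\<close> by simp
    qed (use r in auto)
    then show "b r = y (1/2) * (r ^ k * jost N r)"
      using b0_pos[of r] r by (simp add: y_def b0_def[symmetric] field_simps)
  qed
qed

end

text \<open>
  In polar coordinates the integral over the ball factors into the radial integral and the
  integral of \<open>P\<^sup>2\<close> over the sphere, which is positive for a suitable \<open>P\<close>.
\<close>

lemma admissible_radial_L2:
  fixes V :: "'a::euclidean_space \<Rightarrow> real"
  assumes d: "DIM('a) \<ge> 2" and adm: "admissible_solution V k b" and cont: "continuous_on {0<..1} b"
  shows "(\<integral>\<^sup>+t. ennreal (indicator {0<..<1} t * (t ^ (DIM('a) - 1) / t\<^sup>2 * (indicator {0<..1} t * b t)\<^sup>2)) \<partial>lborel) < \<infinity>"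
proof -
  obtain P :: "'a \<Rightarrow> real" and e where P: "real_polynomial_function P" "\<And>c x. P (c *\<^sub>R x) = c ^ k * P x" "\<And>x. laplacian P x = 0"
    and e: "norm e = 1" "P e = 1"
    using planar_harmonic_exists[OF d] by blast
  have P_cont: "continuous_on UNIV P" by (rule real_polynomial_continuous[OF P(1)])
  have [measurable]: "P \<in> borel_measurable borel" by (rule continuous_measurable_borel[OF P_cont])
  have bm[measurable]: "(\<lambda>t. indicator {0<..1} t * b t) \<in> borel_measurable borel"
    using borel_measurable_continuous_on_indicator[of "{0<..1}" b] cont by simp
  define \<beta> where "\<beta> t = indicator {0<..1} t * b t" for t
  have [measurable]: "\<beta> \<in> borel_measurable borel" unfolding \<beta>_def by (rule bm)
  define \<rho> where "\<rho> x = ennreal (1 / (norm x)\<^sup>2)" for x :: 'a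
  have [measurable]: "\<rho> \<in> borel_measurable borel" unfolding \<rho>_def by measurable
  have \<rho>m: "\<rho> \<in> borel_measurable ball_measure" by (rule borel_measurable_ball_measure) measurable
  define h where "h x = b (norm x) * P (x /\<^sub>R norm x)" for x
  have sph: "spherical_harmonic k P" unfolding spherical_harmonic_def using P by blast
  have "h \<in> Lp_space (density ball_measure \<rho>) 2"
    using adm sph unfolding admissible_solution_def h_def \<rho>_def by blast
  then have h: "h \<in> borel_measurable ball_measure" "integrable (density ball_measure \<rho>) (\<lambda>x. (h x)\<^sup>2)"
    unfolding Lp_space_def norm_powr_2 by simp_all
  define F where "F x = ennreal (1 / (norm x)\<^sup>2) * ennreal ((\<beta> (norm x) * P (x /\<^sub>R norm x))\<^sup>2)" for x :: 'a
  have Fm[measurable]: "F \<in> borel_measurable borel" unfolding F_def by measurable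
  have [measurable]: "ball 0 1 - {0::'a} \<in> sets borel" "ball (0::'a) 1 \<in> sets borel" by simp_all
  have "(\<integral>\<^sup>+x. F x \<partial>punctured_ball) = (\<integral>\<^sup>+x. F x * indicator (ball 0 1 - {0}) x \<partial>lborel)"
    by (subst nn_integral_restrict_space) auto
  also have "\<dots> = (\<integral>\<^sup>+x. F x * indicator (ball 0 1 - {0}) x \<partial>lebesgue)"
    by (simp add: nn_integral_completion)
  also have "\<dots> \<le> (\<integral>\<^sup>+x. \<rho> x * ennreal ((h x)\<^sup>2) * indicator (ball 0 1) x \<partial>lebesgue)"
  proof (rule nn_integral_mono)
    fix x :: 'a
    show "F x * indicator (ball 0 1 - {0}) x \<le> \<rho> x * ennreal ((h x)\<^sup>2) * indicator (ball 0 1) x"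
      by (cases "x \<in> ball 0 1 - {0}") (auto simp: F_def \<rho>_def h_def \<beta>_def)
  qed
  also have "\<dots> = (\<integral>\<^sup>+x. \<rho> x * ennreal ((h x)\<^sup>2) \<partial>ball_measure)"
    by (subst nn_integral_restrict_space) auto
  also have "\<dots> = (\<integral>\<^sup>+x. ennreal ((h x)\<^sup>2) \<partial>density ball_measure \<rho>)"
    by (rule nn_integral_density[symmetric, OF \<rho>m]) (use h(1) in simp)
  also have "\<dots> < \<infinity>" using h(2) by (simp add: integrable_iff_bounded)
  finally have fin: "(\<integral>\<^sup>+x. F x \<partial>punctured_ball) < \<infinity>" .
  define I where "I = (\<integral>\<^sup>+t. ennreal (indicator {0<..<1} t * (t ^ (DIM('a) - 1) / t\<^sup>2 * (\<beta> t)\<^sup>2)) \<partial>lborel)"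
  have "(\<integral>\<^sup>+x. F x \<partial>punctured_ball) = (\<integral>\<^sup>+\<omega>. (\<integral>\<^sup>+r. F (r *\<^sub>R \<omega>) \<partial>radial_measure DIM('a)) \<partial>sphere_measure)"
    by (rule polar_nn_integral[OF Fm])
  also have "\<dots> = (\<integral>\<^sup>+\<omega>. I * ennreal (P \<omega> * P \<omega>) \<partial>sphere_measure)"
  proof (rule nn_integral_cong)
    fix \<omega> :: 'a assume "\<omega> \<in> space sphere_measure"
    then have \<omega>: "norm \<omega> = 1" by simp
    have [measurable]: "(\<lambda>r. F (r *\<^sub>R \<omega>)) \<in> borel_measurable borel"
      by (rule measurable_compose[OF _ Fm]) measurable
    have "(\<integral>\<^sup>+r. F (r *\<^sub>R \<omega>) \<partial>radial_measure DIM('a))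
       = (\<integral>\<^sup>+r. ennreal (indicator {0<..<1} r * r ^ (DIM('a) - 1)) * F (r *\<^sub>R \<omega>) \<partial>lborel)"
      unfolding radial_measure_def by (rule nn_integral_density) measurable
    also have "\<dots> = (\<integral>\<^sup>+r. ennreal (indicator {0<..<1} r * (r ^ (DIM('a) - 1) / r\<^sup>2 * (\<beta> r)\<^sup>2)) * ennreal (P \<omega> * P \<omega>) \<partial>lborel)"
    proof (rule nn_integral_cong)
      fix r :: real
      show "ennreal (indicator {0<..<1} r * r ^ (DIM('a) - 1)) * F (r *\<^sub>R \<omega>)
         = ennreal (indicator {0<..<1} r * (r ^ (DIM('a) - 1) / r\<^sup>2 * (\<beta> r)\<^sup>2)) * ennreal (P \<omega> * P \<omega>)"
      proof (cases "r \<in> {0<..<1}")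
        case True
        then have Fr: "F (r *\<^sub>R \<omega>) = ennreal (1 / r\<^sup>2 * (\<beta> r * P \<omega>)\<^sup>2)"
          by (simp add: F_def \<omega> ennreal_mult[symmetric])
        have "ennreal (indicator {0<..<1} r * r ^ (DIM('a) - 1)) * F (r *\<^sub>R \<omega>)
            = ennreal (indicator {0<..<1} r * r ^ (DIM('a) - 1) * (1 / r\<^sup>2 * (\<beta> r * P \<omega>)\<^sup>2))"
          unfolding Fr by (rule ennreal_mult[symmetric]) (use True in auto)
        also have "indicator {0<..<1} r * r ^ (DIM('a) - 1) * (1 / r\<^sup>2 * (\<beta> r * P \<omega>)\<^sup>2)
            = indicator {0<..<1} r * (r ^ (DIM('a) - 1) / r\<^sup>2 * (\<beta> r)\<^sup>2) * (P \<omega> * P \<omega>)"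
          by (simp add: power_mult_distrib power2_eq_square)
        also have "ennreal \<dots> = ennreal (indicator {0<..<1} r * (r ^ (DIM('a) - 1) / r\<^sup>2 * (\<beta> r)\<^sup>2)) * ennreal (P \<omega> * P \<omega>)"
          by (rule ennreal_mult) (use True in auto)
        finally show ?thesis .
      qed simp
    qed
    also have "\<dots> = I * ennreal (P \<omega> * P \<omega>)" unfolding I_def by (rule nn_integral_multc) measurable
    finally show "(\<integral>\<^sup>+r. F (r *\<^sub>R \<omega>) \<partial>radial_measure DIM('a)) = I * ennreal (P \<omega> * P \<omega>)" .
  qed
  also have "\<dots> = I * (\<integral>\<^sup>+\<omega>. ennreal (P \<omega> * P \<omega>) \<partial>sphere_measure)"
    by (rule nn_integral_cmult) (rule borel_measurable_sphere_measure, measurable)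
  also have "(\<integral>\<^sup>+\<omega>. ennreal (P \<omega> * P \<omega>) \<partial>sphere_measure) = ennreal (\<integral>\<omega>. P \<omega> * P \<omega> \<partial>sphere_measure)"
    by (rule nn_integral_eq_integral) (auto intro!: continuous_integrable_sphere continuous_on_mult P_cont)
  finally have "I * ennreal (\<integral>\<omega>. P \<omega> * P \<omega> \<partial>sphere_measure) < \<infinity>" using fin by simp
  moreover have "(\<integral>\<omega>. P \<omega> * P \<omega> \<partial>sphere_measure) > 0"
    by (rule integral_sphere_square_pos[OF P_cont P(2) e(1)]) (simp add: e)
  ultimately have "I < \<infinity>" by (auto simp: ennreal_mult_less_top)
  then show ?thesis by (simp add: I_def \<beta>_def)
qed

text \<open>The singularity of the density is compensated because the function is bounded by a multiple of \<open>|x|\<^sup>k\<close>.\<close>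

lemma (in radial_potential) jost_admissible_Lp:
  fixes Y :: "'a::euclidean_space \<Rightarrow> real"
  assumes d: "DIM('a) \<ge> 2" and k: "k \<ge> 3" and N: "L < real N" and Y: "spherical_harmonic k Y"
    and b: "\<And>r. r \<in> {0<..1} \<Longrightarrow> b r = C * (r ^ k * jost N r)"
  shows "(\<lambda>x::'a. b (norm x) * Y (x /\<^sub>R norm x)) \<in> Lp_space (density ball_measure (\<lambda>x. ennreal (1 / (norm x)\<^sup>2))) 2"
proof -
  obtain P where P: "real_polynomial_function P" "\<And>c x. P (c *\<^sub>R x) = c ^ k * P x"
    and YP: "\<And>x. x \<in> sphere 0 1 \<Longrightarrow> Y x = P x"
    using Y unfolding spherical_harmonic_def by blast
  have P_cont: "continuous_on UNIV P" by (rule real_polynomial_continuous[OF P(1)])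
  have [measurable]: "P \<in> borel_measurable borel" by (rule continuous_measurable_borel[OF P_cont])
  have P0: "P 0 = 0" using P(2)[of 0 0] k by (auto simp: power_0_left split: if_splits)
  define h where "h x = b (norm x) * Y (x /\<^sub>R norm x)" for x :: 'a
  define g where "g x = C * (jost N (norm x) * P x)" for x
  have hg: "h x = g x" if "x \<noteq> 0" "norm x < 1" for x
  proof -
    have "P x = norm x ^ k * P (x /\<^sub>R norm x)" using P(2)[of "norm x" "x /\<^sub>R norm x"] that by simp
    then show ?thesis using that by (simp add: h_def g_def b YP)
  qed
  have gm: "g \<in> borel_measurable borel" unfolding g_def by measurable
  have hm: "h \<in> borel_measurable ball_measure"
  proof -
    have "(\<lambda>x. if x = 0 then h 0 else g x) \<in> borel_measurable ball_measure"
      by (rule borel_measurable_ball_measure) (use gm in measurable)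
    moreover have "(\<lambda>x. if x = 0 then h 0 else g x) \<in> borel_measurable ball_measure \<longleftrightarrow> h \<in> borel_measurable ball_measure"
      by (rule measurable_cong) (simp add: hg)
    ultimately show ?thesis by simp
  qed
  obtain CP where CP: "CP > 0" "\<And>x. norm (P x) \<le> CP * norm x ^ k"
    using homogeneous_bound[OF P_cont, of k] P(2) P0 k by auto
  interpret finite_measure "ball_measure :: 'a measure" by (rule finite_ball_measure)
  define K where "K = (\<bar>C\<bar> * (jost_bd N * CP))\<^sup>2"
  have bound: "1 / (norm x)\<^sup>2 * (h x)\<^sup>2 \<le> K" if "norm x < 1" for x
  proof (cases "x = 0")
    case True
    then show ?thesis by (simp add: K_def)
  next
    case False
    have "\<bar>g x\<bar> \<le> \<bar>C\<bar> * (jost_bd N * (CP * norm x ^ k))"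
      unfolding g_def abs_mult using CP jost_abs_bound[OF N] jost_bd_pos[OF N]
      by (intro mult_mono) (auto simp: real_norm_def[symmetric] simp del: real_norm_def)
    also have "\<dots> \<le> \<bar>C\<bar> * (jost_bd N * (CP * norm x ^ 1))"
      using CP(1) jost_bd_pos[OF N] k that by (intro mult_left_mono power_decreasing) auto
    finally have "\<bar>h x\<bar> \<le> \<bar>C\<bar> * (jost_bd N * CP) * norm x" using hg[OF False that] by (simp add: mult_ac)
    then have "\<bar>h x\<bar>\<^sup>2 \<le> (\<bar>C\<bar> * (jost_bd N * CP) * norm x)\<^sup>2" by (intro power_mono) auto
    then show ?thesis using False by (simp add: K_def power_mult_distrib divide_le_eq)
  qed
  have int: "integrable ball_measure (\<lambda>x. 1 / (norm x)\<^sup>2 * (h x)\<^sup>2)"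
  proof (rule integrable_const_bound[of _ K])
    show "AE x in ball_measure. norm (1 / (norm x)\<^sup>2 * (h x)\<^sup>2) \<le> K"
      using bound by (intro AE_I2) simp
    have "(\<lambda>x::'a. 1 / (norm x)\<^sup>2) \<in> borel_measurable ball_measure" by (rule borel_measurable_ball_measure) measurable
    then show "(\<lambda>x. 1 / (norm x)\<^sup>2 * (h x)\<^sup>2) \<in> borel_measurable ball_measure"
      using hm by (intro borel_measurable_times borel_measurable_power)
  qed
  have "(\<lambda>x::'a. 1 / (norm x)\<^sup>2) \<in> borel_measurable ball_measure" by (rule borel_measurable_ball_measure) measurable
  then have "integrable (density ball_measure (\<lambda>x. ennreal (1 / (norm x)\<^sup>2))) (\<lambda>x. (h x)\<^sup>2)"
    using hm int by (subst integrable_density) auto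
  then have "h \<in> Lp_space (density ball_measure (\<lambda>x. ennreal (1 / (norm x)\<^sup>2))) 2"
    unfolding Lp_space_def norm_powr_2 using hm by simp
  then show ?thesis by (simp only: h_def[abs_def])
qed

text \<open>
  The normalized regular solution is admissible, and any admissible solution is a multiple of it in \<open>(0,1)\<close>; the
  factor is fixed by continuity at \<open>1\<close>.
\<close>

theorem (in radial_potential) radial_eigenvalue_eq:
  fixes V :: "'a::euclidean_space \<Rightarrow> real"
  assumes d: "DIM('a) \<ge> 2" and k: "k \<ge> 3" and N: "N = 2 * k + (DIM('a) - 2)" "2 * L < real N"
    and q: "AE t in lborel. t \<in> {0<..<1} \<longrightarrow> w t = t * profile V t"
  shows "radial_eigenvalue V k = real k + flux N 1 / jost N 1"
proof -
  define e where "e = DIM('a) - 2"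
  have De: "DIM('a) = e + 2" "DIM('a) - 1 = e + 1" using d by (simp_all add: e_def)
  have Ne: "N = 2 * k + e" using N(1) by (simp add: e_def)
  have LN: "L < real N" using N(2) L_nonneg by linarith
  have k1: "k \<ge> 1" using k by simp
  define c where "c = jost N 1"
  have c: "c > 0" unfolding c_def by (rule jost_pos[OF N(2)])
  define b where "b = restrict (\<lambda>r. 1 / c * (r ^ k * jost N r)) {0<..1}"
  define b' where "b' r = 1 / c * (real k * r ^ (k - 1) * jost (2 * k + e) r + flux (2 * k + e) r / r ^ (k + e + 1))" for r
  have b_eq: "b r = 1 / c * (r ^ k * jost N r)" if "r \<in> {0<..1}" for r using that by (simp add: b_def)
  have rd: "radial_derivative (e + 2) (profile V) k b b'"
    unfolding b'_def by (rule jost_radial_derivative[OF k1 _ q]) (use LN Ne b_eq in auto)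
  have adm: "admissible_solution V k b"
    unfolding admissible_solution_def
  proof (intro conjI allI impI)
    show "b \<in> extensional {0<..1}" by (simp add: b_def)
    show "radial_solution DIM('a) (profile V) k b" using rd unfolding radial_solution_iff De(1) by blast
    show "b 1 = 1" using c by (simp add: b_def c_def)
    show "(\<lambda>x::'a. b (norm x) * Y (x /\<^sub>R norm x)) \<in> Lp_space (density ball_measure (\<lambda>x. ennreal (1 / (norm x)\<^sup>2))) 2"
      if "spherical_harmonic k Y" for Y :: "'a \<Rightarrow> real"
      by (rule jost_admissible_Lp[OF d k LN that b_eq])
  qed
  have unique: "b2 = b" if adm2: "admissible_solution V k b2" for b2
  proof -
    have ext: "b2 \<in> extensional {0<..1}" and one: "b2 1 = 1" and "radial_solution DIM('a) (profile V) k b2"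
      using adm2 unfolding admissible_solution_def by blast+
    then obtain b2' where rd2: "radial_derivative (e + 2) (profile V) k b2 b2'"
      unfolding radial_solution_iff De(1) by blast
    have cont2: "continuous_on {0<..1} b2"
      using rd2 unfolding radial_derivative_def by (intro continuous_on_eq_continuous_within[THEN iffD2] ballI) (auto intro: DERIV_continuous)
    have cont: "continuous_on {0<..1} b"
      using rd unfolding radial_derivative_def by (intro continuous_on_eq_continuous_within[THEN iffD2] ballI) (auto intro: DERIV_continuous)
    obtain C where C: "\<And>r. r \<in> {0<..<1} \<Longrightarrow> b2 r = C * (r ^ k * jost N r)"
    proof (rule square_integrable_solution_unique[OF k1 Ne N(2) q rd2])
      show "(\<integral>\<^sup>+t. ennreal (indicator {0<..<1} t * (t ^ (e + 1) / t\<^sup>2 * (indicator {0<..1} t * b2 t)\<^sup>2)) \<partial>lborel) < \<infinity>"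
        using admissible_radial_L2[OF d adm2 cont2] by (simp only: De(2))
    qed blast
    have Cb: "b2 r = C * c * b r" if "r \<in> {0<..<1}" for r
      using C[OF that] b_eq[of r] that c by simp
    have bot: "at (1::real) within {0<..<1} \<noteq> bot"
      by (simp add: trivial_limit_within islimpt_greaterThanLessThan2)
    have "(b2 \<longlongrightarrow> b2 1) (at 1 within {0<..1})" "(b \<longlongrightarrow> b 1) (at 1 within {0<..1})"
      using cont2 cont by (simp_all add: continuous_on_def)
    then have lim: "(b2 \<longlongrightarrow> b2 1) (at 1 within {0<..<1})" "(b \<longlongrightarrow> b 1) (at 1 within {0<..<1})"
      by (auto elim!: tendsto_within_subset)
    have "((\<lambda>r. C * c * b r) \<longlongrightarrow> b2 1) (at 1 within {0<..<1})"
      using lim(1) by (rule Lim_transform_eventually) (auto simp: eventually_at_filter Cb)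
    moreover have "((\<lambda>r. C * c * b r) \<longlongrightarrow> C * c * b 1) (at 1 within {0<..<1})"
      by (intro tendsto_intros lim)
    ultimately have "b2 1 = C * c * b 1" using tendsto_unique[OF bot] by blast
    moreover have "b 1 = 1" using c by (simp add: b_def c_def)
    ultimately have Cc: "C * c = 1" using one by simp
    show "b2 = b"
    proof (rule extensionalityI[OF ext])
      show "b \<in> extensional {0<..1}" by (simp add: b_def)
      fix r :: real assume "r \<in> {0<..1}"
      then show "b2 r = b r" using Cb[of r] Cc one \<open>b 1 = 1\<close> by (cases "r = 1") auto
    qed
  qed
  have ex1: "\<exists>!b. admissible_solution V k b" using adm unique by blast
  have the: "(THE b. admissible_solution V k b) = b" using adm unique by (rule the_equality)
  have "(b has_real_derivative b' 1) (at 1 within {0<..1})" using rd by (simp add: radial_derivative_def)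
  then have "(b has_vector_derivative b' 1) (at 1 within {0<..1})"
    by (simp add: has_real_derivative_iff_has_vector_derivative)
  moreover have "at (1::real) within {0<..1} \<noteq> bot"
  proof -
    have "(1::real) islimpt {0<..<1}" by (simp add: islimpt_greaterThanLessThan2)
    then have "(1::real) islimpt {0<..1}" by (rule islimpt_subset) auto
    then show ?thesis by (simp add: trivial_limit_within)
  qed
  ultimately have "vector_derivative b (at 1 within {0<..1}) = b' 1" by (intro vector_derivative_within)
  also have "b' 1 = real k + flux N 1 / jost N 1"
    using c by (simp add: b'_def Ne[symmetric] c_def add_divide_distrib)
  finally show ?thesis unfolding radial_eigenvalue_def the using ex1 by simp
qed


section \<open>The eigenvalues as perturbed moments\<close>

lemma Lp_space_ball_integrable:
  fixes V :: "'a::euclidean_space \<Rightarrow> real"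
  assumes V: "V \<in> Lp_space ball_measure p" and p: "p \<ge> 1"
  shows "integrable ball_measure V"
proof (rule Bochner_Integration.integrable_bound)
  show "integrable ball_measure (\<lambda>x. 1 + norm (V x) powr p)"
    using V finite_measure.integrable_const[OF finite_ball_measure]
    by (intro Bochner_Integration.integrable_add) (auto simp: Lp_space_def)
  show "V \<in> borel_measurable ball_measure" using V by (simp add: Lp_space_def)
  have "norm (V x) \<le> norm (1 + norm (V x) powr p)" for x
  proof (cases "\<bar>V x\<bar> \<le> 1")
    case False
    then have "\<bar>V x\<bar> powr 1 \<le> \<bar>V x\<bar> powr p" using p by (intro powr_mono) auto
    then show ?thesis using False by simp
  qed (smt (verit) powr_ge_zero real_norm_def)
  then show "AE x in ball_measure. norm (V x) \<le> norm (1 + norm (V x) powr p)" by simp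
qed

lemma (in radial_potential) DN_eigenvalue_eq:
  fixes V :: "'a::euclidean_space \<Rightarrow> real"
  assumes "DIM('a) \<ge> 2" "k \<ge> 3" "N = 2 * k + (DIM('a) - 2)" "2 * L < real N"
    and "integrable ball_measure V"
    and "AE x in ball_measure. x \<noteq> 0 \<longrightarrow> V x = w (norm x) / norm x"
    and "AE t in lborel. t \<in> {0<..<1} \<longrightarrow> w t = t * profile V t"
  shows "DN_eigenvalue V k = real k + flux N 1 / jost N 1"
proof (cases "zero_Dirichlet_eigenvalue V")
  case True
  then have "DN_eigenvalue V k = radial_eigenvalue V k" by (simp add: DN_eigenvalue_def)
  then show ?thesis using radial_eigenvalue_eq[OF assms(1-4,7)] by simp
qed (rule DN_eigenvalue_regular[OF assms(1-6)])

text \<open>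
  The distribution of the square root of a uniform variable, so that \<open>r\<^sup>2\<close> is uniformly distributed
  on \<open>[0,1]\<close>.
\<close>

definition sqrt_uniform_measure :: "real measure" where
  "sqrt_uniform_measure = density lborel (\<lambda>r. ennreal (indicator {0<..<1} r * (2 * r)))"

lemma integral_sqrt_uniform_measure:
  assumes [measurable]: "f \<in> borel_measurable borel"
  shows "integrable sqrt_uniform_measure f \<longleftrightarrow> integrable lborel (\<lambda>r. indicator {0<..<1} r * (2 * r) * f r)"
    and "(\<integral>r. f r \<partial>sqrt_uniform_measure) = (\<integral>r. indicator {0<..<1} r * (2 * r) * f r \<partial>lborel)"
proof -
  have nn: "AE r in lborel. 0 \<le> indicator {0<..<1} r * (2 * r :: real)" by (auto simp: indicator_def)
  have [measurable]: "{0<..<1::real} \<in> sets borel" by simp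
  have m: "(\<lambda>r. indicator {0<..<1} r * (2 * r :: real)) \<in> borel_measurable lborel" by measurable
  have fm: "f \<in> borel_measurable lborel" by measurable
  show "integrable sqrt_uniform_measure f \<longleftrightarrow> integrable lborel (\<lambda>r. indicator {0<..<1} r * (2 * r) * f r)"
    unfolding sqrt_uniform_measure_def by (subst integrable_density[OF fm m nn]) simp
  show "(\<integral>r. f r \<partial>sqrt_uniform_measure) = (\<integral>r. indicator {0<..<1} r * (2 * r) * f r \<partial>lborel)"
    unfolding sqrt_uniform_measure_def by (subst integral_density[OF fm m nn]) simp
qed

text \<open>
  Outside the unit interval, which is a null set, the variable is set to \<open>0\<close>, so that its values
  lie in \<open>[0,1]\<close> everywhere.
\<close>

lemma moments_sqrt_uniform_measure:
  "integrable sqrt_uniform_measure (\<lambda>r. (indicator {0..1} r * r\<^sup>2) ^ n)"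
  "(\<integral>r. (indicator {0..1} r * r\<^sup>2) ^ n \<partial>sqrt_uniform_measure) = 1 / (real n + 1)"
proof -
  have [measurable]: "{0..1::real} \<in> sets borel" by simp
  have m: "(\<lambda>r. (indicator {0..1} r * r\<^sup>2 :: real) ^ n) \<in> borel_measurable borel" by measurable
  have eq: "(\<lambda>r. indicator {0<..<1} r * (2 * r) * (indicator {0..1} r * r\<^sup>2) ^ n)
      = (\<lambda>r::real. 2 * (indicator {0<..<1} r * r powr (2 * real n + 1)))"
  proof
    fix r :: real
    have "r powr (2 * real n + 1) = r * (r\<^sup>2) ^ n" if "r > 0"
      using that powr_realpow[OF that, of "2 * n + 1"] by (simp add: power_mult add.commute)
    then show "indicator {0<..<1} r * (2 * r) * (indicator {0..1} r * r\<^sup>2) ^ n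
      = 2 * (indicator {0<..<1} r * r powr (2 * real n + 1))"
      by (cases "r \<in> {0<..<1}") auto
  qed
  note u = integral_powr_unit_interval[of "2 * real n + 1"]
  show "integrable sqrt_uniform_measure (\<lambda>r. (indicator {0..1} r * r\<^sup>2) ^ n)"
    unfolding integral_sqrt_uniform_measure(1)[OF m] eq using u(1) by simp
  show "(\<integral>r. (indicator {0..1} r * r\<^sup>2) ^ n \<partial>sqrt_uniform_measure) = 1 / (real n + 1)"
    unfolding integral_sqrt_uniform_measure(2)[OF m] eq using u(2) by (simp add: field_simps)
qed

lemma finite_sqrt_uniform_measure: "finite_measure sqrt_uniform_measure"
proof
  have "integrable sqrt_uniform_measure (\<lambda>r. 1::real)" using moments_sqrt_uniform_measure(1)[of 0] by simp
  then show "emeasure sqrt_uniform_measure (space sqrt_uniform_measure) \<noteq> \<infinity>"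
    by (simp add: integrable_iff_bounded less_top)
qed

text \<open>
  The density of the main term is \<open>h r = r\<^sup>a\<^sup>-\<^sup>1 w(r) / 2\<close> with respect to the measure \<open>2 r dr\<close>. Its \<open>p\<close>-th power
  is integrable because \<open>2 r |h|\<^sup>p \<le> r\<^sup>a\<^sup>+\<^sup>1 |w/r|\<^sup>p\<close> and \<open>d \<le> a\<close>.
\<close>

lemma (in radial_potential) shifted_eigenvalue_bound:
  fixes \<mu> :: "nat \<Rightarrow> real"
  assumes p: "p > 1" and d: "d \<le> a" and a: "2 * L + 2 \<le> real a"
    and wp: "integrable lborel (\<lambda>r. indicator {0<..<1} r * (r ^ d * \<bar>w r / r\<bar> powr p))"
    and \<mu>: "\<And>n. \<mu> n = flux (2 * n + a) 1 / jost (2 * n + a) 1"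
  obtains B where "\<And>k. real (k + 1) powr (p - 1) * (\<Sum>m\<le>k. \<bar>real (k choose m) * fdiff (k - m) \<mu> m\<bar> powr p) \<le> B"
proof -
  obtain \<nu> where \<nu>: "dominated \<nu> (\<lambda>n. L\<^sup>2 * (1 / (real n + 1)))"
    and fr: "\<And>n. flux (2 * n + a) 1 / jost (2 * n + a) 1 = (\<integral>t. t ^ (2 * n + a) * w t \<partial>lborel) + \<nu> n"
    using flux_ratio[OF a] by blast
  define T where "T r = indicator {0..1} r * r\<^sup>2" for r :: real
  define h where "h r = r ^ a * w r / (2 * r)" for r
  have [measurable]: "w \<in> borel_measurable borel" using borel_measurable_integrable[OF w_integrable] by simp
  have [measurable]: "{0..1::real} \<in> sets borel" "{0<..<1::real} \<in> sets borel" by simp_all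
  have Tm[measurable]: "T \<in> borel_measurable borel" unfolding T_def by measurable
  have hm[measurable]: "h \<in> borel_measurable borel" unfolding h_def by measurable
  have "indicator {0<..<1} r * (2 * r) * (T r ^ n * h r) = r ^ (2 * n + a) * w r" for r n
    by (cases "r \<in> {0<..<1}") (auto simp: T_def h_def w_support power_add power_mult)
  then have eq: "(\<lambda>r. indicator {0<..<1} r * (2 * r) * (T r ^ n * h r)) = (\<lambda>r. r ^ (2 * n + a) * w r)" for n by blast
  have moment: "(\<integral>r. T r ^ n * h r \<partial>sqrt_uniform_measure) = (\<integral>t. t ^ (2 * n + a) * w t \<partial>lborel)" for n
    by (subst integral_sqrt_uniform_measure(2)) (simp_all add: eq)
  have h_int: "integrable sqrt_uniform_measure h"
  proof -
    have "integrable lborel (\<lambda>r. r ^ a * w r)"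
    proof (rule Bochner_Integration.integrable_bound[OF w_integrable])
      have "norm (r ^ a * w r) \<le> norm (w r)" for r
        by (cases "r \<in> {0<..<1}") (auto simp: w_support abs_mult power_le_one mult_left_le_one_le)
      then show "AE r in lborel. norm (r ^ a * w r) \<le> norm (w r)" by simp
    qed measurable
    then show ?thesis using eq[of 0] by (simp add: integral_sqrt_uniform_measure(1))
  qed
  have hp_int: "integrable sqrt_uniform_measure (\<lambda>r. \<bar>h r\<bar> powr p)"
  proof -
    have "integrable lborel (\<lambda>r. indicator {0<..<1} r * (2 * r) * \<bar>h r\<bar> powr p)"
    proof (rule Bochner_Integration.integrable_bound[OF wp])
      have "norm (indicator {0<..<1} r * (2 * r) * \<bar>h r\<bar> powr p) \<le> norm (indicator {0<..<1} r * (r ^ d * \<bar>w r / r\<bar> powr p))" for r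
      proof (cases "r \<in> {0<..<1}")
        case True
        then have r: "0 < r" "r < 1" by auto
        have ra: "0 < r ^ a / 2" "r ^ a / 2 \<le> 1" using r power_le_one[of r a] by auto
        have "(r ^ a / 2) powr p \<le> (r ^ a / 2) powr 1" using ra p by (intro powr_mono') auto
        then have "(r ^ a / 2) powr p \<le> r ^ a / 2" using ra by simp
        then have "2 * r * (r ^ a / 2) powr p \<le> 2 * r * (r ^ a / 2)" using r by (intro mult_left_mono) auto
        also have "\<dots> = r ^ Suc a" by simp
        also have "\<dots> \<le> r ^ d" using r d by (intro power_decreasing) auto
        finally have le: "2 * r * (r ^ a / 2) powr p \<le> r ^ d" .
        have "\<bar>h r\<bar> = r ^ a / 2 * \<bar>w r / r\<bar>" using r by (simp add: h_def abs_mult)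
        then have "2 * r * \<bar>h r\<bar> powr p = 2 * r * (r ^ a / 2) powr p * \<bar>w r / r\<bar> powr p"
          using r by (simp only: powr_mult)
        also have "\<dots> \<le> r ^ d * \<bar>w r / r\<bar> powr p" using le by (rule mult_right_mono) simp
        finally show ?thesis using True r by simp
      qed simp
      then show "AE r in lborel. norm (indicator {0<..<1} r * (2 * r) * \<bar>h r\<bar> powr p)
          \<le> norm (indicator {0<..<1} r * (r ^ d * \<bar>w r / r\<bar> powr p))" by simp
    qed measurable
    then show ?thesis by (simp add: integral_sqrt_uniform_measure(1))
  qed
  have Tm': "T \<in> borel_measurable sqrt_uniform_measure" unfolding sqrt_uniform_measure_def by measurable
  have T01: "0 \<le> T r \<and> T r \<le> 1" for r
    by (auto simp: T_def indicator_def power_le_one)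
  have uniform: "(\<integral>r. T r ^ n \<partial>sqrt_uniform_measure) = 1 / (real n + 1)" for n
    unfolding T_def by (rule moments_sqrt_uniform_measure)
  have \<mu>': "\<mu> n = (\<integral>r. T r ^ n * h r \<partial>sqrt_uniform_measure) + \<nu> n" for n
    unfolding \<mu> fr moment ..
  show ?thesis
    by (rule that, rule Hausdorff_bound_perturbed[OF p Tm' T01 finite_sqrt_uniform_measure uniform h_int hp_int \<nu> \<mu>'])
qed

theorem theorem7p1:
  fixes p :: real
  assumes "DIM('a::euclidean_space) \<ge> 2"
    and "real DIM('a) / 2 < p"
  shows "\<exists>k0 :: real \<Rightarrow> nat. \<forall>V :: 'a \<Rightarrow> real. V \<in> Lp_rad p \<longrightarrow>
    (SUP k. ereal (real (k + 1) powr (p - 1) *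
       (\<Sum>m\<le>k. \<bar>real (k choose m) *
          fdiff (k - m) (\<lambda>n. DN_eigenvalue V n - real n) (m + k0 (Lp_norm ball_measure p V))\<bar> powr p))) < \<infinity>"
proof -
  have p: "p > 1" using assms by linarith
  obtain Lf :: "real \<Rightarrow> real" where Lf: "\<forall>V :: 'a \<Rightarrow> real. V \<in> Lp_rad p \<longrightarrow> (\<exists>w. radial_potential w (Lf (Lp_norm ball_measure p V)) \<and>
       (AE t in lborel. t \<in> {0<..<1} \<longrightarrow> w t = t * profile V t) \<and>
       (AE x in ball_measure. x \<noteq> 0 \<longrightarrow> V x = w (norm x) / norm x) \<and>
       integrable lborel (\<lambda>r. indicator {0<..<1} r * (r ^ (DIM('a) - 1) * \<bar>w r / r\<bar> powr p)))"
    using radial_reduction[OF assms] by blast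
  \<comment> \<open>Large enough for \<open>C\<^sup>1\<close> solutions (\<open>k \<ge> 3\<close>) and for the convergence of the series for \<open>1/c\<close> in all degrees \<open>k \<ge> k0\<close>.\<close>
  define k0 where "k0 x = nat \<lceil>Lf x\<rceil> + 3" for x
  show ?thesis
  proof (rule exI[of _ k0], intro allI impI)
    fix V :: "'a \<Rightarrow> real" assume V: "V \<in> Lp_rad p"
    define L where "L = Lf (Lp_norm ball_measure p V)"
    define K where "K = k0 (Lp_norm ball_measure p V)"
    \<comment> \<open>The value of \<open>N\<close> for the first degree \<open>K\<close>; degree \<open>n + K\<close> has \<open>N = 2 n + a\<close>.\<close>
    define a where "a = 2 * K + (DIM('a) - 2)"
    have K: "K \<ge> 3" "L + 3 \<le> real K" unfolding K_def L_def k0_def by linarith+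
    obtain w where w: "radial_potential w L"
      and wq: "AE t in lborel. t \<in> {0<..<1} \<longrightarrow> w t = t * profile V t"
      and wV: "AE x in ball_measure. x \<noteq> 0 \<longrightarrow> V x = w (norm x) / norm x"
      and wp: "integrable lborel (\<lambda>r. indicator {0<..<1} r * (r ^ (DIM('a) - 1) * \<bar>w r / r\<bar> powr p))"
      using Lf V unfolding L_def by blast
    interpret radial_potential w L by (rule w)
    have Vi: "integrable ball_measure V"
      using V p by (intro Lp_space_ball_integrable[of V p]) (auto simp: Lp_rad_def)
    have da: "DIM('a) - 1 \<le> a" using K(1) by (simp add: a_def)
    have aL: "2 * L + 2 \<le> real a" using K(2) by (simp add: a_def)
    define \<mu> where "\<mu> n = DN_eigenvalue V (n + K) - real (n + K)" for n
    have \<mu>: "\<mu> n = flux (2 * n + a) 1 / jost (2 * n + a) 1" for n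
    proof -
      have "DN_eigenvalue V (n + K) = real (n + K) + flux (2 * n + a) 1 / jost (2 * n + a) 1"
        using K aL by (intro DN_eigenvalue_eq[OF assms(1) _ _ _ Vi wV wq]) (auto simp: a_def)
      then show ?thesis by (simp add: \<mu>_def)
    qed
    obtain B where B: "\<And>k. real (k + 1) powr (p - 1) * (\<Sum>m\<le>k. \<bar>real (k choose m) * fdiff (k - m) \<mu> m\<bar> powr p) \<le> B"
      using shifted_eigenvalue_bound[OF p da aL wp \<mu>] by blast
    have shift: "fdiff j (\<lambda>n. DN_eigenvalue V n - real n) (m + K) = fdiff j \<mu> m" for j m
      unfolding fdiff_def \<mu>_def by (intro sum.cong refl arg_cong2[of _ _ _ _ "(*)"]) (simp add: add.commute add.left_commute)
    have "(SUP k. ereal (real (k + 1) powr (p - 1) *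
       (\<Sum>m\<le>k. \<bar>real (k choose m) * fdiff (k - m) (\<lambda>n. DN_eigenvalue V n - real n) (m + K)\<bar> powr p))) \<le> ereal B"
      unfolding shift using B by (intro SUP_least) simp
    also have "\<dots> < \<infinity>" by simp
    finally show "(SUP k. ereal (real (k + 1) powr (p - 1) *
       (\<Sum>m\<le>k. \<bar>real (k choose m) *
          fdiff (k - m) (\<lambda>n. DN_eigenvalue V n - real n) (m + k0 (Lp_norm ball_measure p V))\<bar> powr p))) < \<infinity>"
      unfolding K_def .
  qed
qed


end
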